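(* Let $(\Omega,\Sigma,\mu)$ be a complete $\sigma$-finite measure space, let $p:\Omega\to[1,+\infty]$ be a measurable function, and let $\Omega_f=\{t\in\Omega: p(t)<+\infty\}$. The following conditions are all equivalent: 1) $L^{p(\cdot)}(\Omega)$ has weak normal structure. 2) $L^{p(\cdot)}(\Omega)$ satisfies the weak fixed point property ($w$-FPP). 3) $L^{p(\cdot)}(\Omega)$ does not contain an isometric copy of $L^1[0,1]$. 4) $p_+(\Omega_f)<+\infty$, $p^{-1}(\{+\infty\})$ contains at most finitely many atoms, and every measurable atomless subset of $p^{-1}(\{1,+\infty\})$ is negligible (i.e. $\mu$-null).
   Context: Variable Lebesgue space: for a measurable $p:\Omega\to[1,+\infty]$ put $\Omega_f=\{t: p(t)<+\infty\}$ and, for measurable $g:\Omega\to\mathbb{R}$ (functions equal a.e. are identified), define the modular $\rho(g)=\int_{\Omega_f}|g(t)|^{p(t)}\,d\mu+\operatorname{ess\,sup}_{t\in p^{-1}(\{+\infty\})}|g(t)|$ (the last term is $0$ if $p^{-1}(\{+\infty\})$ is null). $L^{p(\cdot)}(\Omega)$ is the space of those $g$ with $\rho(g/\lambda)<\infty$ for some $\lambda>0$, with the Luxemburg norm $\|g\|=\inf\{\alpha>0:\rho(g/\alpha)\le 1\}$; it is a real Banach space. For measurable $E\subset\Omega$, $p_+(E)=\operatorname{ess\,sup}_{t\in E}p(t)$; the condition $p_+(E)<+\infty$ is regarded as satisfied when $E$ is null. An atom is a measurable set $A$ with $\mu(A)>0$ such that each measurable subset of $A$ has measure $0$ or $\mu(A)$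 (atoms are counted up to null sets); a measurable set is atomless if it contains no atom. A Banach space $X$ has the $w$-FPP if for every nonempty convex weakly compact $C\subset X$, every nonexpansive $T:C\to C$ (i.e. $\|Tx-Ty\|\le\|x-y\|$ for all $x,y\in C$) has a fixed point. $X$ has weak normal structure if for every convex weakly compact $C\subset X$ with $\operatorname{diam}(C)>0$ there is $x_0\in C$ with $\sup\{\|x_0-y\|:y\in C\}<\operatorname{diam}(C)$. $X$ contains an isometric copy of $Y$ if there is a linear isometric embedding $Y\to X$. *)

theory Defs
  imports "HOL-Analysis.Analysis" "HOL-Probability.Essential_Supremum"
begin

section \<open>Normed spaces given by a carrier\<close>

text \<open>
  The variable Lebesgue space depends on a measure and on an exponent function, so it is not
  an instance of the normed-space type classes. The geometric notions are therefore stated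
  for a real normed space with explicit carrier and operations.
\<close>

record 'v normed_sp =
  pts :: "'v set"
  vzero :: 'v
  vadd :: "'v \<Rightarrow> 'v \<Rightarrow> 'v"
  vscale :: "real \<Rightarrow> 'v \<Rightarrow> 'v"
  vnorm :: "'v \<Rightarrow> real"

definition vdist :: "'v normed_sp \<Rightarrow> 'v \<Rightarrow> 'v \<Rightarrow> real" where
  "vdist X x y = vnorm X (vadd X x (vscale X (-1) y))"

definition linear_between :: "'v normed_sp \<Rightarrow> 'w normed_sp \<Rightarrow> ('v \<Rightarrow> 'w) \<Rightarrow> bool" where
  "linear_between Y X J \<longleftrightarrow>
     (\<forall>y\<in>pts Y. J y \<in> pts X) \<and>
     (\<forall>y\<in>pts Y. \<forall>z\<in>pts Y. J (vadd Y y z) = vadd X (J y) (J z)) \<and>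
     (\<forall>c. \<forall>y\<in>pts Y. J (vscale Y c y) = vscale X c (J y))"

definition contains_isometric_copy :: "'v normed_sp \<Rightarrow> 'w normed_sp \<Rightarrow> bool" where
  "contains_isometric_copy X Y \<longleftrightarrow>
     (\<exists>J. linear_between Y X J \<and> (\<forall>y\<in>pts Y. vnorm X (J y) = vnorm Y y))"

definition dual_space :: "'v normed_sp \<Rightarrow> ('v \<Rightarrow> real) set" where
  "dual_space X = {f.
     (\<forall>x\<in>pts X. \<forall>y\<in>pts X. f (vadd X x y) = f x + f y) \<and>
     (\<forall>c. \<forall>x\<in>pts X. f (vscale X c x) = c * f x) \<and>
     (\<exists>K. \<forall>x\<in>pts X. \<bar>f x\<bar> \<le> K * vnorm X x)}"

definition weak_topology :: "'v normed_sp \<Rightarrow> 'v topology" where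
  "weak_topology X =
     topology_generated_by {{x \<in> pts X. f x \<in> U} | f U. f \<in> dual_space X \<and> open U}"

definition convex_in :: "'v normed_sp \<Rightarrow> 'v set \<Rightarrow> bool" where
  "convex_in X C \<longleftrightarrow> C \<subseteq> pts X \<and>
     (\<forall>x\<in>C. \<forall>y\<in>C. \<forall>t\<in>{0..1}. vadd X (vscale X (1 - t) x) (vscale X t y) \<in> C)"

text \<open>Suprema of distances are taken in \<^typ>\<open>ennreal\<close>, so that unbounded sets have
  infinite diameter and the empty set has diameter 0.\<close>

definition radius_from :: "'v normed_sp \<Rightarrow> 'v \<Rightarrow> 'v set \<Rightarrow> ennreal" where
  "radius_from X x C = (SUP y\<in>C. ennreal (vdist X x y))"

definition diam :: "'v normed_sp \<Rightarrow> 'v set \<Rightarrow> ennreal" where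
  "diam X C = (SUP x\<in>C. SUP y\<in>C. ennreal (vdist X x y))"

definition weak_normal_structure :: "'v normed_sp \<Rightarrow> bool" where
  "weak_normal_structure X \<longleftrightarrow>
     (\<forall>C. convex_in X C \<and> compactin (weak_topology X) C \<and> diam X C > 0 \<longrightarrow>
        (\<exists>x\<^sub>0\<in>C. radius_from X x\<^sub>0 C < diam X C))"

definition nonexpansive_on :: "'v normed_sp \<Rightarrow> 'v set \<Rightarrow> ('v \<Rightarrow> 'v) \<Rightarrow> bool" where
  "nonexpansive_on X C T \<longleftrightarrow> (\<forall>x\<in>C. \<forall>y\<in>C. vdist X (T x) (T y) \<le> vdist X x y)"

definition weak_FPP :: "'v normed_sp \<Rightarrow> bool" where
  "weak_FPP X \<longleftrightarrow>
     (\<forall>C T. C \<noteq> {} \<and> convex_in X C \<and> compactin (weak_topology X) C \<and>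
        T ` C \<subseteq> C \<and> nonexpansive_on X C T \<longrightarrow> (\<exists>x\<in>C. T x = x))"


section \<open>Function spaces modulo equality almost everywhere\<close>

definition ae_eq :: "'a measure \<Rightarrow> (('a \<Rightarrow> real) \<times> ('a \<Rightarrow> real)) set" where
  "ae_eq M = {(f, g). f \<in> borel_measurable M \<and> g \<in> borel_measurable M \<and> (AE t in M. f t = g t)}"

definition ae_class :: "'a measure \<Rightarrow> ('a \<Rightarrow> real) \<Rightarrow> ('a \<Rightarrow> real) set" where
  "ae_class M f = ae_eq M `` {f}"

definition ae_rep :: "('a \<Rightarrow> real) set \<Rightarrow> 'a \<Rightarrow> real" where
  "ae_rep A = (SOME f. f \<in> A)"

text \<open>
  The points are the a.e.-classes of the functions in \<open>V\<close>; the operations are computed on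
  representatives. \<open>N\<close> is meant to be invariant under a.e. equality.
\<close>

definition function_space ::
  "'a measure \<Rightarrow> ('a \<Rightarrow> real) set \<Rightarrow> (('a \<Rightarrow> real) \<Rightarrow> real) \<Rightarrow> ('a \<Rightarrow> real) set normed_sp" where
  "function_space M V N =
     \<lparr> pts = V // ae_eq M,
       vzero = ae_class M (\<lambda>_. 0),
       vadd = (\<lambda>A B. ae_class M (\<lambda>t. ae_rep A t + ae_rep B t)),
       vscale = (\<lambda>c A. ae_class M (\<lambda>t. c * ae_rep A t)),
       vnorm = (\<lambda>A. N (ae_rep A)) \<rparr>"


section \<open>Variable Lebesgue spaces\<close>

text \<open>Note that \<open>esssup\<close> on \<^typ>\<open>ennreal\<close> over a null set is 0.\<close>

definition esssup_on :: "'a measure \<Rightarrow> 'a set \<Rightarrow> ('a \<Rightarrow> ennreal) \<Rightarrow> ennreal" where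
  "esssup_on M E f = esssup (restrict_space M E) f"

definition finite_part :: "'a measure \<Rightarrow> ('a \<Rightarrow> ennreal) \<Rightarrow> 'a set" where
  "finite_part M p = {t \<in> space M. p t < \<infinity>}"

definition infinite_part :: "'a measure \<Rightarrow> ('a \<Rightarrow> ennreal) \<Rightarrow> 'a set" where
  "infinite_part M p = {t \<in> space M. p t = \<infinity>}"

definition modular :: "'a measure \<Rightarrow> ('a \<Rightarrow> ennreal) \<Rightarrow> ('a \<Rightarrow> real) \<Rightarrow> ennreal" where
  "modular M p g =
     (\<integral>\<^sup>+t\<in>finite_part M p. ennreal (\<bar>g t\<bar> powr enn2real (p t)) \<partial>M)
     + esssup_on M (infinite_part M p) (\<lambda>t. ennreal \<bar>g t\<bar>)"

definition var_Lp_functions :: "'a measure \<Rightarrow> ('a \<Rightarrow> ennreal) \<Rightarrow> ('a \<Rightarrow> real) set" where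
  "var_Lp_functions M p =
     {g \<in> borel_measurable M. \<exists>l>0. modular M p (\<lambda>t. g t / l) < \<infinity>}"

definition luxemburg_norm :: "'a measure \<Rightarrow> ('a \<Rightarrow> ennreal) \<Rightarrow> ('a \<Rightarrow> real) \<Rightarrow> real" where
  "luxemburg_norm M p g = Inf {\<alpha>. \<alpha> > 0 \<and> modular M p (\<lambda>t. g t / \<alpha>) \<le> 1}"

definition var_Lp :: "'a measure \<Rightarrow> ('a \<Rightarrow> ennreal) \<Rightarrow> ('a \<Rightarrow> real) set normed_sp" where
  "var_Lp M p = function_space M (var_Lp_functions M p) (luxemburg_norm M p)"

definition L1_01 :: "(real \<Rightarrow> real) set normed_sp" where
  "L1_01 = function_space (lebesgue_on {0..1}) {f. integrable (lebesgue_on {0..1}) f}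
     (\<lambda>f. \<integral>t. \<bar>f t\<bar> \<partial>lebesgue_on {0..1})"


section \<open>Atoms\<close>

definition is_atom :: "'a measure \<Rightarrow> 'a set \<Rightarrow> bool" where
  "is_atom M A \<longleftrightarrow> A \<in> sets M \<and> emeasure M A > 0 \<and>
     (\<forall>B\<in>sets M. B \<subseteq> A \<longrightarrow> emeasure M B = 0 \<or> emeasure M B = emeasure M A)"

definition null_eq :: "'a measure \<Rightarrow> ('a set \<times> 'a set) set" where
  "null_eq M = {(A, B). A \<in> sets M \<and> B \<in> sets M \<and> sym_diff A B \<in> null_sets M}"

definition finitely_many_atoms :: "'a measure \<Rightarrow> 'a set \<Rightarrow> bool" where
  "finitely_many_atoms M E \<longleftrightarrow> finite ({A. is_atom M A \<and> A \<subseteq> E} // null_eq M)"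

definition atomless :: "'a measure \<Rightarrow> 'a set \<Rightarrow> bool" where
  "atomless M E \<longleftrightarrow> E \<in> sets M \<and> (\<forall>A. is_atom M A \<longrightarrow> \<not> A \<subseteq> E)"

end

theory Submission
  imports Defs
begin

text \<open>
  The four conditions are linked in a cycle: weak normal structure implies the weak fixed point
  property, which excludes copies of \<open>L\<^sup>1[0,1]\<close>, which forces the condition on the exponent, which in
  turn gives weak normal structure.

  The first implication is Kirk's theorem, valid in every normed space. A minimal invariant weakly
  compact convex set cannot contain a point that is not diametral, since such points would form a
  smaller invariant set (\<open>weak_normal_structure_imp_weak_FPP\<close>). It rests on the weak closedness of
  balls, that is on norming functionals.

  The second implication is Alspach's example. In \<open>L\<^sup>1[0,1]\<close> the functions with values in \<open>[0,2]\<close> and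
  integral 1 form a weakly compact convex set (\<open>weakly_compact_order_interval\<close>). Stretching a graph
  to double its height, cutting it at level 2 and putting the upper part beside the lower one is an
  isometry of this set without fixed points, because a fixed point would be twice the indicator
  function of a set of measure \<open>1/2\<close> that is invariant under the doubling map, which is ergodic
  (\<open>alspach_no_fixed_point\<close>). A linear isometric embedding carries set and map along.

  For the third implication, copies of \<open>L\<^sup>1[0,1]\<close> are built whenever the condition on the exponent
  fails. If \<open>p = 1\<close> on an atomless set of positive measure, composition with a uniformly distributed
  function on this set embeds \<open>L\<^sup>1[0,1]\<close> (\<open>distr_entry\<close>). In the other cases, namely \<open>p\<close> unbounded
  where it is finite, or infinitely many disjoint non-null sets with \<open>p = \<infinity>\<close>, there is a sequence of
  disjointly supported functions whose combinations are normed by the supremum of the coefficients.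
  So the space contains the bounded sequences, and these contain \<open>L\<^sup>1[0,1]\<close> because countably many
  sign functions norm it (\<open>countable_norming_family\<close>, \<open>blocks_imp_contains_L1\<close>).

  For the last implication, suppose that every point of a weakly compact convex set is diametral.
  Where \<open>1 < p < \<infinity>\<close>, powers are strictly convex, and boundedness of \<open>p\<close> turns this into a gap in the
  midpoint inequality for the modular. Hence all members of the set agree there
  (\<open>diametral_midpoint_imp_agree\<close>). Their differences live on the atoms with exponent 1 or \<open>\<infinity>\<close>, where
  the norm is a sum of a weighted \<open>\<ell>\<^sup>1\<close> norm and a finite-dimensional supremum norm. Take a sequence
  whose members are asymptotically at distance \<open>d\<close> from the previous ones and from the midpoints of
  these, where \<open>d\<close> is the diameter, and which converges on every atom. Then the differences from the
  limit have asymptotically disjoint masses of size \<open>d/2\<close> and a common sign, and the functional given by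
  this sign has the value \<open>d/2\<close> on them, which contradicts weak compactness
  (\<open>diametral_limit_functional\<close>).
\<close>

section \<open>Real normed spaces with explicit carrier\<close>

locale carrier_normed_space =
  fixes X :: "'v normed_sp"
  assumes zero_pts [simp, intro]: "vzero X \<in> pts X"
    and add_pts [simp, intro]: "\<And>x y. x \<in> pts X \<Longrightarrow> y \<in> pts X \<Longrightarrow> vadd X x y \<in> pts X"
    and scale_pts [simp, intro]: "\<And>c x. x \<in> pts X \<Longrightarrow> vscale X c x \<in> pts X"
    and add_assoc: "\<And>x y z. x \<in> pts X \<Longrightarrow> y \<in> pts X \<Longrightarrow> z \<in> pts X \<Longrightarrow>
          vadd X (vadd X x y) z = vadd X x (vadd X y z)"
    and add_comm: "\<And>x y. x \<in> pts X \<Longrightarrow> y \<in> pts X \<Longrightarrow> vadd X x y = vadd X y x"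
    and add_zero [simp]: "\<And>x. x \<in> pts X \<Longrightarrow> vadd X x (vzero X) = x"
    and scale_zero [simp]: "\<And>x. x \<in> pts X \<Longrightarrow> vscale X 0 x = vzero X"
    and scale_one [simp]: "\<And>x. x \<in> pts X \<Longrightarrow> vscale X 1 x = x"
    and scale_scale [simp]: "\<And>a b x. x \<in> pts X \<Longrightarrow> vscale X a (vscale X b x) = vscale X (a * b) x"
    and scale_add: "\<And>c x y. x \<in> pts X \<Longrightarrow> y \<in> pts X \<Longrightarrow>
          vscale X c (vadd X x y) = vadd X (vscale X c x) (vscale X c y)"
    and add_scale: "\<And>a b x. x \<in> pts X \<Longrightarrow>
          vscale X (a + b) x = vadd X (vscale X a x) (vscale X b x)"
    and norm_scale: "\<And>c x. x \<in> pts X \<Longrightarrow> vnorm X (vscale X c x) = \<bar>c\<bar> * vnorm X x"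
    and norm_triangle: "\<And>x y. x \<in> pts X \<Longrightarrow> y \<in> pts X \<Longrightarrow>
          vnorm X (vadd X x y) \<le> vnorm X x + vnorm X y"
    and norm_eq_zero: "\<And>x. x \<in> pts X \<Longrightarrow> vnorm X x = 0 \<Longrightarrow> x = vzero X"
begin

abbreviation plus_syntax (infixl "\<oplus>" 65) where "x \<oplus> y \<equiv> vadd X x y"
abbreviation scale_syntax (infixr "\<cdot>" 75) where "c \<cdot> x \<equiv> vscale X c x"

lemma add_left_comm:
  assumes "x \<in> pts X" "y \<in> pts X" "z \<in> pts X"
  shows "x \<oplus> (y \<oplus> z) = y \<oplus> (x \<oplus> z)"
  using assms by (metis add_assoc add_comm)

lemmas add_ac = add_assoc add_comm add_left_comm

lemma scale_zero_vector [simp]: "c \<cdot> vzero X = vzero X"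
  by (metis scale_scale scale_zero mult_zero_right zero_pts)

lemma zero_add [simp]: "x \<in> pts X \<Longrightarrow> vzero X \<oplus> x = x"
  by (simp add: add_comm)

lemma add_neg [simp]: "x \<in> pts X \<Longrightarrow> x \<oplus> (-1) \<cdot> x = vzero X"
  using add_scale[of x 1 "-1"] by simp

lemma norm_zero [simp]: "vnorm X (vzero X) = 0"
  using norm_scale[of "vzero X" 0] by simp

lemma norm_nonneg:
  assumes "x \<in> pts X" shows "0 \<le> vnorm X x"
  using norm_triangle[of x "(-1) \<cdot> x"] norm_scale[of x "-1"] assms by simp

lemma vdist_self [simp]: "x \<in> pts X \<Longrightarrow> vdist X x x = 0"
  by (simp add: vdist_def)

lemma vdist_nonneg: "x \<in> pts X \<Longrightarrow> y \<in> pts X \<Longrightarrow> 0 \<le> vdist X x y"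
  by (simp add: vdist_def norm_nonneg)

lemma diff_add_cancel:
  assumes "x \<in> pts X" "y \<in> pts X"
  shows "(x \<oplus> (-1) \<cdot> y) \<oplus> y = x"
proof -
  have "(-1) \<cdot> y \<oplus> y = vzero X"
    using assms add_comm[of "(-1) \<cdot> y" y] by simp
  then show ?thesis using assms by (simp add: add_assoc)
qed

lemma vdist_eq_zero:
  assumes "x \<in> pts X" "y \<in> pts X" "vdist X x y = 0"
  shows "x = y"
  using assms norm_eq_zero[of "x \<oplus> (-1) \<cdot> y"] diff_add_cancel[of x y] by (simp add: vdist_def)

lemma vdist_commute:
  assumes "x \<in> pts X" "y \<in> pts X"
  shows "vdist X x y = vdist X y x"
proof -
  have "(-1) \<cdot> (x \<oplus> (-1) \<cdot> y) = y \<oplus> (-1) \<cdot> x"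
    using assms by (simp add: scale_add add_comm)
  then show ?thesis
    using norm_scale[of "x \<oplus> (-1) \<cdot> y" "-1"] assms by (simp add: vdist_def)
qed

lemma dist_le_norm_add:
  assumes "x \<in> pts X" "y \<in> pts X"
  shows "vdist X x y \<le> vnorm X x + vnorm X y"
  using norm_triangle[of x "(-1) \<cdot> y"] norm_scale[of y "-1"] assms by (simp add: vdist_def)

lemma vdist_convex_combination:
  assumes "x \<in> pts X" "z \<in> pts X" "y \<in> pts X" "0 \<le> t" "t \<le> 1"
  shows "vdist X ((1 - t) \<cdot> x \<oplus> t \<cdot> z) y \<le> (1 - t) * vdist X x y + t * vdist X z y"
proof -
  have split: "((1 - t) \<cdot> x \<oplus> t \<cdot> z) \<oplus> v = (1 - t) \<cdot> (x \<oplus> v) \<oplus> t \<cdot> (z \<oplus> v)"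
    if v: "v \<in> pts X" for v
  proof -
    have v_split: "(1 - t) \<cdot> v \<oplus> t \<cdot> v = v"
      using v add_scale[of v "1 - t" t] by simp
    have "(1 - t) \<cdot> (x \<oplus> v) \<oplus> t \<cdot> (z \<oplus> v)
        = ((1 - t) \<cdot> x \<oplus> t \<cdot> z) \<oplus> ((1 - t) \<cdot> v \<oplus> t \<cdot> v)"
      using assms v by (simp add: scale_add add_ac)
    then show ?thesis by (simp add: v_split)
  qed
  have "vdist X ((1 - t) \<cdot> x \<oplus> t \<cdot> z) y
      = vnorm X ((1 - t) \<cdot> (x \<oplus> (-1) \<cdot> y) \<oplus> t \<cdot> (z \<oplus> (-1) \<cdot> y))"
    unfolding vdist_def using split[of "(-1) \<cdot> y"] assms by simp
  also have "\<dots> \<le> vnorm X ((1 - t) \<cdot> (x \<oplus> (-1) \<cdot> y)) + vnorm X (t \<cdot> (z \<oplus> (-1) \<cdot> y))"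
    using assms by (intro norm_triangle) auto
  finally show ?thesis
    using assms by (simp add: vdist_def norm_scale)
qed

subsection \<open>Norming functionals\<close>

definition sublinear :: "('v \<Rightarrow> real) \<Rightarrow> bool" where
  "sublinear q \<longleftrightarrow> (\<forall>x\<in>pts X. \<forall>y\<in>pts X. q (x \<oplus> y) \<le> q x + q y) \<and>
     (\<forall>c\<ge>0. \<forall>x\<in>pts X. q (c \<cdot> x) = c * q x)"

lemma sublinear_lower:
  assumes "sublinear q" "x \<in> pts X" "y \<in> pts X"
  shows "q x \<ge> - q ((-1) \<cdot> x)" "q (x \<oplus> y) \<ge> q y - q ((-1) \<cdot> x)"
proof -
  have 0: "q (vzero X) = 0"
    using assms(1) unfolding sublinear_def by (metis mult_zero_left order_refl scale_zero zero_pts)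
  have "q (x \<oplus> (-1) \<cdot> x) \<le> q x + q ((-1) \<cdot> x)"
    using assms unfolding sublinear_def by (meson scale_pts)
  then show "q x \<ge> - q ((-1) \<cdot> x)"
    using 0 assms by simp
  have "(x \<oplus> y) \<oplus> (-1) \<cdot> x = y"
    using assms by (metis add_assoc add_comm add_neg add_pts add_zero scale_pts)
  then have "q y \<le> q (x \<oplus> y) + q ((-1) \<cdot> x)"
    using assms unfolding sublinear_def by (metis add_pts scale_pts)
  then show "q (x \<oplus> y) \<ge> q y - q ((-1) \<cdot> x)" by simp
qed

lemma sublinearI:
  assumes "\<And>x y. x \<in> pts X \<Longrightarrow> y \<in> pts X \<Longrightarrow> q (x \<oplus> y) \<le> q x + q y"
    and le: "\<And>c x. 0 < c \<Longrightarrow> x \<in> pts X \<Longrightarrow> q (c \<cdot> x) \<le> c * q x"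
    and "q (vzero X) = 0"
  shows "sublinear q"
  unfolding sublinear_def
proof (intro conjI ballI allI impI)
  fix c :: real and x assume c: "0 \<le> c" and x: "x \<in> pts X"
  show "q (c \<cdot> x) = c * q x"
  proof (cases "c = 0")
    case True then show ?thesis using x assms(3) by simp
  next
    case False
    then have c: "c > 0" using c by simp
    have "q x \<le> 1 / c * q (c \<cdot> x)"
      using le[of "1 / c" "c \<cdot> x"] c x by simp
    then have "c * q x \<le> q (c \<cdot> x)"
      using c by (simp add: field_simps)
    then show ?thesis using le[OF c x] by simp
  qed
qed (use assms in auto)

text \<open>
  The infimum over \<open>t \<ge> 0\<close> of \<open>q (x + t a) - t q a\<close> is the largest sublinear functional below
  \<open>q\<close> that is additive on the ray through \<open>a\<close>; it turns any point into one where the functional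
  cannot be decreased further.
\<close>

lemma sublinear_shift:
  assumes q: "sublinear q" and a: "a \<in> pts X"
  shows "\<exists>r. sublinear r \<and> (\<forall>x\<in>pts X. r x \<le> q x) \<and> r ((-1) \<cdot> a) \<le> - q a \<and>
             (\<forall>x. x \<notin> pts X \<longrightarrow> r x = 0)"
proof -
  have hom: "\<And>c x. c \<ge> 0 \<Longrightarrow> x \<in> pts X \<Longrightarrow> q (c \<cdot> x) = c * q x"
    and sub: "\<And>x y. x \<in> pts X \<Longrightarrow> y \<in> pts X \<Longrightarrow> q (x \<oplus> y) \<le> q x + q y"
    using q unfolding sublinear_def by auto
  define S where "S = (\<lambda>x. (\<lambda>t. q (x \<oplus> t \<cdot> a) - t * q a) ` {0..})"
  define r where "r = (\<lambda>x. if x \<in> pts X then Inf (S x) else 0)"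
  have lower: "- q ((-1) \<cdot> x) \<le> q (x \<oplus> t \<cdot> a) - t * q a" if "x \<in> pts X" "t \<ge> 0" for x t
    using sublinear_lower(2)[OF q that(1), of "t \<cdot> a"] hom[OF that(2) a] a by simp
  have bdd: "bdd_below (S x)" if "x \<in> pts X" for x
    unfolding S_def by (rule bdd_belowI2[of _ "- q ((-1) \<cdot> x)"]) (use lower that in auto)
  have upper: "r x \<le> q (x \<oplus> t \<cdot> a) - t * q a" if "x \<in> pts X" "t \<ge> 0" for x t
    unfolding r_def S_def using that bdd[OF that(1)] by (auto intro!: cINF_lower simp: S_def)
  have greatest: "B \<le> r x" if "x \<in> pts X" "\<And>t. t \<ge> 0 \<Longrightarrow> B \<le> q (x \<oplus> t \<cdot> a) - t * q a" for x B
    unfolding r_def S_def using that by (auto intro!: cINF_greatest)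
  have 0: "q (vzero X) = 0"
    using hom[of 0 "vzero X"] by simp
  have "sublinear r"
  proof (rule sublinearI)
    fix x y assume x: "x \<in> pts X" and y: "y \<in> pts X"
    have "r (x \<oplus> y) - (q (x \<oplus> s \<cdot> a) - s * q a) \<le> q (y \<oplus> t \<cdot> a) - t * q a"
      if "s \<ge> 0" "t \<ge> 0" for s t
    proof -
      have "(x \<oplus> y) \<oplus> (s + t) \<cdot> a = (x \<oplus> s \<cdot> a) \<oplus> (y \<oplus> t \<cdot> a)"
        using x y a by (simp add: add_scale add_ac)
      moreover have "q ((x \<oplus> s \<cdot> a) \<oplus> (y \<oplus> t \<cdot> a)) \<le> q (x \<oplus> s \<cdot> a) + q (y \<oplus> t \<cdot> a)"
        using x y a by (intro sub) auto
      moreover have "r (x \<oplus> y) \<le> q ((x \<oplus> y) \<oplus> (s + t) \<cdot> a) - (s + t) * q a"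
        using x y that by (intro upper) auto
      ultimately show ?thesis by (simp add: algebra_simps)
    qed
    then have "r (x \<oplus> y) - (q (x \<oplus> s \<cdot> a) - s * q a) \<le> r y" if "s \<ge> 0" for s
      using that y by (intro greatest) auto
    then have "r (x \<oplus> y) - r y \<le> r x"
      using x by (intro greatest) (auto simp: algebra_simps)
    then show "r (x \<oplus> y) \<le> r x + r y" by simp
  next
    fix c :: real and x assume c: "0 < c" and x: "x \<in> pts X"
    have "r (c \<cdot> x) / c \<le> q (x \<oplus> t \<cdot> a) - t * q a" if "t \<ge> 0" for t
    proof -
      have "r (c \<cdot> x) \<le> q (c \<cdot> x \<oplus> (c * t) \<cdot> a) - (c * t) * q a"
        using c x that by (intro upper) auto
      also have "c \<cdot> x \<oplus> (c * t) \<cdot> a = c \<cdot> (x \<oplus> t \<cdot> a)"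
        using x a by (simp add: scale_add)
      also have "q \<dots> = c * q (x \<oplus> t \<cdot> a)"
        using hom[of c "x \<oplus> t \<cdot> a"] c x a by auto
      finally show ?thesis using c by (simp add: field_simps)
    qed
    then have "r (c \<cdot> x) / c \<le> r x"
      using x by (intro greatest) auto
    then show "r (c \<cdot> x) \<le> c * r x" using c by (simp add: field_simps)
  next
    have "r (vzero X) \<le> 0" using upper[of "vzero X" 0] a 0 by simp
    moreover have "0 \<le> r (vzero X)"
      by (rule greatest) (use a hom in auto)
    ultimately show "r (vzero X) = 0" by simp
  qed
  moreover have "r x \<le> q x" if "x \<in> pts X" for x
    using upper[OF that, of 0] a that by simp
  moreover have "r ((-1) \<cdot> a) \<le> - q a"
  proof -
    have "(-1) \<cdot> a \<oplus> 1 \<cdot> a = vzero X"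
      using a add_comm[of "(-1) \<cdot> a" a] by simp
    then show ?thesis using upper[of "(-1) \<cdot> a" 1] a 0 by simp
  qed
  moreover have "\<forall>x. x \<notin> pts X \<longrightarrow> r x = 0" by (simp add: r_def)
  ultimately show ?thesis by blast
qed

text \<open>
  A minimal sublinear functional is linear: shifting at \<open>a\<close> cannot decrease it, hence its value
  at \<open>-a\<close> is the negative of its value at \<open>a\<close>. Minimal ones exist below any given sublinear
  functional by Zorn's lemma, because the value at \<open>x\<close> is bounded from below by the value at
  \<open>-x\<close>.
\<close>

lemma linear_below_sublinear:
  assumes p: "sublinear p"
  shows "\<exists>f. (\<forall>x\<in>pts X. \<forall>y\<in>pts X. f (x \<oplus> y) = f x + f y) \<and>
             (\<forall>c. \<forall>x\<in>pts X. f (c \<cdot> x) = c * f x) \<and> (\<forall>x\<in>pts X. f x \<le> p x)"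
proof -
  define A where "A = {q. sublinear q \<and> (\<forall>x\<in>pts X. q x \<le> p x) \<and> (\<forall>x. x \<notin> pts X \<longrightarrow> q x = 0)}"
  define P where "P = (\<lambda>(q::'v \<Rightarrow> real) r. \<forall>x. r x \<le> q x)"
  have A_D: "sublinear q" "\<And>x. x \<in> pts X \<Longrightarrow> q x \<le> p x" "\<And>x. x \<notin> pts X \<Longrightarrow> q x = 0"
    if "q \<in> A" for q using that by (auto simp: A_def)
  have "\<exists>q\<in>A. \<forall>r\<in>A. P q r \<longrightarrow> r = q"
  proof (rule predicate_Zorn)
    have "r = q" if "P q r" "P r q" for q r
      using that by (auto simp: P_def fun_eq_iff intro: antisym)
    then show "partial_order_on A (relation_of P A)"
      by (auto simp: partial_order_on_def preorder_on_def refl_on_def trans_def antisym_def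
          relation_of_def P_def intro: order_trans)
  next
    fix C assume "C \<in> Chains (relation_of P A)"
    then have CA: "C \<subseteq> A" and chain: "\<And>q r. q \<in> C \<Longrightarrow> r \<in> C \<Longrightarrow> P q r \<or> P r q"
      by (auto simp: Chains_def relation_of_def)
    show "\<exists>u\<in>A. \<forall>q\<in>C. P q u"
    proof (cases "C = {}")
      case True
      have "(\<lambda>x. if x \<in> pts X then p x else 0) \<in> A"
        using p by (auto simp: A_def sublinear_def)
      then show ?thesis using True by blast
    next
      case False
      define u where "u = (\<lambda>x. INF q\<in>C. q x)"
      have bdd: "bdd_below ((\<lambda>q. q x) ` C)" for x
      proof (cases "x \<in> pts X")
        case True
        show ?thesis
        proof (rule bdd_belowI2[of _ "- p ((-1) \<cdot> x)"])
          fix q assume "q \<in> C"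
          then have "q \<in> A" using CA by auto
          then show "- p ((-1) \<cdot> x) \<le> q x"
            using sublinear_lower(1)[OF A_D(1) True True, of q] A_D(2)[of q "(-1) \<cdot> x"] True
            by fastforce
        qed
      next
        case False
        then show ?thesis using A_D(3) CA
          by (intro bdd_belowI2[of _ 0]) force
      qed
      have lower: "u x \<le> q x" if "q \<in> C" for q x
        unfolding u_def using bdd that by (intro cINF_lower)
      have greatest: "B \<le> u x" if "\<And>q. q \<in> C \<Longrightarrow> B \<le> q x" for B x
        unfolding u_def using False that by (intro cINF_greatest)
      have out: "u x = 0" if "x \<notin> pts X" for x
      proof -
        have "(\<lambda>q. q x) ` C = {0}" using False CA A_D(3)[of _ x] that by force
        then show ?thesis by (simp add: u_def)
      qed
      have "sublinear u"
      proof (rule sublinearI)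
        fix x y assume x: "x \<in> pts X" and y: "y \<in> pts X"
        have *: "u (x \<oplus> y) \<le> q x + r y" if qr: "q \<in> C" "r \<in> C" for q r
        proof -
          obtain s where s: "s \<in> C" "\<forall>z. s z \<le> q z" "\<forall>z. s z \<le> r z"
            using chain[OF qr] qr unfolding P_def by (metis order_refl)
          have "u (x \<oplus> y) \<le> s (x \<oplus> y)" using s lower by auto
          also have "\<dots> \<le> s x + s y"
            using s A_D(1) CA x y unfolding sublinear_def by blast
          also have "\<dots> \<le> q x + r y" using s by (meson add_mono)
          finally show ?thesis .
        qed
        have "u (x \<oplus> y) - q x \<le> u y" if "q \<in> C" for q
          by (rule greatest) (use *[OF that] in \<open>auto simp: algebra_simps\<close>)
        then have "u (x \<oplus> y) - u y \<le> u x"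
          by (intro greatest) (auto simp: algebra_simps)
        then show "u (x \<oplus> y) \<le> u x + u y" by simp
      next
        fix c :: real and x assume c: "0 < c" and x: "x \<in> pts X"
        have "u (c \<cdot> x) / c \<le> q x" if "q \<in> C" for q
        proof -
          have "u (c \<cdot> x) \<le> q (c \<cdot> x)" using lower that by auto
          also have "\<dots> = c * q x"
            using c x A_D(1) CA that unfolding sublinear_def by (meson less_imp_le subsetD)
          finally show ?thesis using c by (simp add: field_simps)
        qed
        then have "u (c \<cdot> x) / c \<le> u x" by (rule greatest)
        then show "u (c \<cdot> x) \<le> c * u x" using c by (simp add: field_simps)
      next
        have "q (vzero X) = 0" if "q \<in> C" for q
          using A_D(1) CA that unfolding sublinear_def
          by (metis mult_zero_left order_refl scale_zero subsetD zero_pts)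
        then have "(\<lambda>q. q (vzero X)) ` C = {0}" using False by force
        then show "u (vzero X) = 0" by (simp add: u_def)
      qed
      moreover have "u x \<le> p x" if "x \<in> pts X" for x
      proof -
        obtain q where "q \<in> C" using False by auto
        then show ?thesis using lower[of q x] A_D(2)[of q x] CA that by fastforce
      qed
      ultimately have "u \<in> A" using out by (auto simp: A_def)
      then show ?thesis using lower by (auto simp: P_def)
    qed
  qed
  then obtain f where fA: "f \<in> A" and min: "\<And>r. r \<in> A \<Longrightarrow> P f r \<Longrightarrow> r = f" by blast
  have sub: "\<And>x y. x \<in> pts X \<Longrightarrow> y \<in> pts X \<Longrightarrow> f (x \<oplus> y) \<le> f x + f y"
    and hom: "\<And>c x. c \<ge> 0 \<Longrightarrow> x \<in> pts X \<Longrightarrow> f (c \<cdot> x) = c * f x"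
    using A_D(1)[OF fA] unfolding sublinear_def by auto
  have neg: "f ((-1) \<cdot> a) = - f a" if a: "a \<in> pts X" for a
  proof -
    obtain r where r: "sublinear r" "\<forall>x\<in>pts X. r x \<le> f x" "r ((-1) \<cdot> a) \<le> - f a"
        "\<forall>x. x \<notin> pts X \<longrightarrow> r x = 0"
      using sublinear_shift[OF A_D(1)[OF fA] a] by blast
    have "r \<in> A" using r A_D(2)[OF fA] unfolding A_def by (auto intro: order_trans)
    moreover have "P f r"
      unfolding P_def using r A_D(3)[OF fA] by (metis order_refl)
    ultimately have "r = f" by (rule min)
    then show ?thesis
      using r(3) sublinear_lower(1)[OF A_D(1)[OF fA] a a] by simp
  qed
  have "f (x \<oplus> y) = f x + f y" if x: "x \<in> pts X" and y: "y \<in> pts X" for x y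
  proof -
    have "f ((-1) \<cdot> (x \<oplus> y)) \<le> f ((-1) \<cdot> x) + f ((-1) \<cdot> y)"
      using sub[of "(-1) \<cdot> x" "(-1) \<cdot> y"] x y by (simp add: scale_add)
    then have "f x + f y \<le> f (x \<oplus> y)"
      using x y by (simp add: neg)
    then show ?thesis using sub[OF x y] by simp
  qed
  moreover have "f (c \<cdot> x) = c * f x" if x: "x \<in> pts X" for c x
  proof (cases "c \<ge> 0")
    case True then show ?thesis using hom x by simp
  next
    case False
    have "f ((-1) \<cdot> ((- c) \<cdot> x)) = - (- c * f x)"
      using neg[of "(- c) \<cdot> x"] hom[of "- c" x] False x by simp
    then show ?thesis using x by simp
  qed
  ultimately show ?thesis using A_D(2)[OF fA] by blast
qed

text \<open>
  Shifting the norm along \<open>a\<close> before taking a linear minorant makes the minorant at most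
  \<open>- vnorm X a\<close> at \<open>-a\<close>, which forces its value at \<open>a\<close>.
\<close>

theorem norming_functional:
  assumes a: "a \<in> pts X"
  obtains f where "f \<in> dual_space X" "f a = vnorm X a" "\<And>x. x \<in> pts X \<Longrightarrow> \<bar>f x\<bar> \<le> vnorm X x"
proof -
  have "sublinear (vnorm X)"
    by (rule sublinearI) (auto simp: norm_triangle norm_scale)
  then obtain q where q: "sublinear q" "\<forall>x\<in>pts X. q x \<le> vnorm X x"
      "q ((-1) \<cdot> a) \<le> - vnorm X a"
    using sublinear_shift[OF _ a] by blast
  obtain f where f: "\<forall>x\<in>pts X. \<forall>y\<in>pts X. f (x \<oplus> y) = f x + f y"
      "\<forall>c. \<forall>x\<in>pts X. f (c \<cdot> x) = c * f x" "\<forall>x\<in>pts X. f x \<le> q x"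
    using linear_below_sublinear[OF q(1)] by blast
  have le: "f x \<le> vnorm X x" if "x \<in> pts X" for x
    using f(3) q(2) that by force
  have abs: "\<bar>f x\<bar> \<le> vnorm X x" if "x \<in> pts X" for x
  proof -
    have "- f x = f ((-1) \<cdot> x)" using f(2)[rule_format, OF that, of "-1"] by simp
    also have "\<dots> \<le> vnorm X ((-1) \<cdot> x)" using le that by blast
    also have "\<dots> = vnorm X x" using that by (simp add: norm_scale)
    finally show ?thesis using le[OF that] by simp
  qed
  have "- f a = f ((-1) \<cdot> a)" using f(2)[rule_format, OF a, of "-1"] by simp
  also have "\<dots> \<le> - vnorm X a" using f(3)[rule_format, of "(-1) \<cdot> a"] q(3) a by simp
  finally have "f a = vnorm X a" using le[OF a] by simp
  moreover have "f \<in> dual_space X"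
    unfolding dual_space_def using f(1,2) abs by (auto intro!: exI[of _ 1])
  ultimately show thesis using that abs by blast
qed

subsection \<open>The weak topology\<close>

lemma zero_functional [simp]: "(\<lambda>_. 0) \<in> dual_space X"
  by (auto simp: dual_space_def intro!: exI[of _ 0])

lemma topspace_weak [simp]: "topspace (weak_topology X) = pts X"
proof -
  have "pts X \<in> {{x \<in> pts X. f x \<in> U} | f U. f \<in> dual_space X \<and> open U}"
    by (rule CollectI, rule exI[of _ "\<lambda>_. 0"], rule exI[of _ UNIV]) auto
  then show ?thesis
    unfolding weak_topology_def topology_generated_by_topspace by auto
qed

lemma openin_weak_functional:
  assumes "f \<in> dual_space X" "open U"
  shows "openin (weak_topology X) {x \<in> pts X. f x \<in> U}"
  unfolding weak_topology_def using assms by (intro topology_generated_by_Basis) auto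

lemma continuous_map_functional:
  assumes "f \<in> dual_space X"
  shows "continuous_map (weak_topology X) euclideanreal f"
  using assms by (auto simp: continuous_map_def openin_weak_functional)

text \<open>
  A point outside the ball is separated from it by a functional that norms its difference from
  the centre.
\<close>

lemma closed_ball_weakly_closed:
  assumes y: "y \<in> pts X"
  shows "closedin (weak_topology X) {x \<in> pts X. vdist X x y \<le> r}"
proof -
  have "openin (weak_topology X) {x \<in> pts X. vdist X x y > r}"
  proof (subst openin_subopen, intro ballI)
    fix x assume "x \<in> {x \<in> pts X. vdist X x y > r}"
    then have x: "x \<in> pts X" and r: "r < vdist X x y" by auto
    obtain f where f: "f \<in> dual_space X" "f (x \<oplus> (-1) \<cdot> y) = vdist X x y"
        "\<And>z. z \<in> pts X \<Longrightarrow> \<bar>f z\<bar> \<le> vnorm X z"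
      using norming_functional[of "x \<oplus> (-1) \<cdot> y"] x y unfolding vdist_def by blast
    have diff: "f (z \<oplus> (-1) \<cdot> y) = f z - f y" if "z \<in> pts X" for z
      using f(1) that y unfolding dual_space_def by force
    let ?U = "{z \<in> pts X. f z \<in> {f y + r<..}}"
    have "openin (weak_topology X) ?U"
      using f(1) by (rule openin_weak_functional) simp
    moreover have "x \<in> ?U" using x f(2) diff[OF x] r by simp
    moreover have "?U \<subseteq> {x \<in> pts X. vdist X x y > r}"
    proof
      fix z assume "z \<in> ?U"
      then have z: "z \<in> pts X" "f z > f y + r" by auto
      then have "r < f (z \<oplus> (-1) \<cdot> y)" using diff by simp
      also have "\<dots> \<le> vdist X z y"
        using f(3)[of "z \<oplus> (-1) \<cdot> y"] z y unfolding vdist_def by fastforce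
      finally show "z \<in> {x \<in> pts X. vdist X x y > r}" using z by simp
    qed
    ultimately show "\<exists>T. openin (weak_topology X) T \<and> x \<in> T \<and> T \<subseteq> {x \<in> pts X. vdist X x y > r}"
      by blast
  qed
  moreover have "pts X - {x \<in> pts X. vdist X x y \<le> r} = {x \<in> pts X. vdist X x y > r}"
    by auto
  ultimately show ?thesis
    unfolding closedin_def by auto
qed

text \<open>
  Otherwise finitely many neighbourhoods, each visited only finitely often, would cover \<open>C\<close>.
\<close>

lemma weakly_compact_cluster_point:
  fixes x :: "nat \<Rightarrow> 'v"
  assumes C: "compactin (weak_topology X) C" and x: "\<And>n. x n \<in> C"
  shows "\<exists>u\<in>C. \<forall>U. openin (weak_topology X) U \<longrightarrow> u \<in> U \<longrightarrow> (\<exists>\<^sub>\<infinity>n. x n \<in> U)"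
proof (rule ccontr)
  assume "\<not> ?thesis"
  then have "\<forall>u\<in>C. \<exists>U. openin (weak_topology X) U \<and> u \<in> U \<and> \<not> (\<exists>\<^sub>\<infinity>n. x n \<in> U)"
    by blast
  then obtain V where V: "\<And>u. u \<in> C \<Longrightarrow> openin (weak_topology X) (V u)"
      "\<And>u. u \<in> C \<Longrightarrow> u \<in> V u" "\<And>u. u \<in> C \<Longrightarrow> finite {n. x n \<in> V u}"
    by (metis INFM_iff_infinite)
  obtain F where F: "finite F" "F \<subseteq> V ` C" "C \<subseteq> \<Union>F"
    using compactinD[OF C, of "V ` C"] V by blast
  have "UNIV = (\<Union>W\<in>F. {n. x n \<in> W})" using x F(3) by auto
  moreover have "finite (\<Union>W\<in>F. {n. x n \<in> W})"
    using F V(3) by auto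
  ultimately show False by simp
qed

text \<open>
  On a weakly compact set every functional is bounded. If the norm were not, choose points \<open>x n\<close>
  of rapidly growing norm with norming functionals \<open>\<phi> n\<close> and add the functionals
  \<open>\<plusminus> \<phi> n / 3 ^ n\<close>, the sign being chosen such that the partial sum is large at \<open>x n\<close>;
  the tail of the series can destroy only half of this value.
\<close>

theorem weakly_compact_bounded:
  assumes C: "compactin (weak_topology X) C"
  shows "\<exists>B. \<forall>x\<in>C. vnorm X x \<le> B"
proof (rule ccontr)
  assume "\<nexists>B. \<forall>x\<in>C. vnorm X x \<le> B"
  then have "\<forall>n::nat. \<exists>x\<in>C. vnorm X x > 2 * real n * 3 ^ n"
    by (metis not_le)
  then obtain x where xC: "\<And>n. x n \<in> C" and big: "\<And>n. vnorm X (x n) > 2 * real n * 3 ^ n"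
    by metis
  have CX: "C \<subseteq> pts X" using compactin_subset_topspace[OF C] by simp
  have xX: "x n \<in> pts X" for n using xC CX by auto
  have "\<forall>n. \<exists>f. f \<in> dual_space X \<and> f (x n) = vnorm X (x n) \<and> (\<forall>y\<in>pts X. \<bar>f y\<bar> \<le> vnorm X y)"
    using norming_functional[OF xX] by metis
  then obtain \<phi> where \<phi>: "\<And>n. \<phi> n \<in> dual_space X" "\<And>n. \<phi> n (x n) = vnorm X (x n)"
      "\<And>n y. y \<in> pts X \<Longrightarrow> \<bar>\<phi> n y\<bar> \<le> vnorm X y"
    by metis
  define sgn_of where "sgn_of = (\<lambda>n (h :: 'v \<Rightarrow> real).
      if \<bar>h (x n) + vnorm X (x n) / 3 ^ n\<bar> \<ge> vnorm X (x n) / 3 ^ n then 1 else -1 :: real)"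
  define g where "g = rec_nat (\<lambda>_. 0) (\<lambda>n h y. h y + sgn_of n h * \<phi> n y / 3 ^ n)"
  define \<sigma> where "\<sigma> n = sgn_of n (g n)" for n
  have gSuc: "g (Suc n) y = g n y + \<sigma> n * \<phi> n y / 3 ^ n" for n y
    by (simp add: g_def \<sigma>_def)
  have g_sum: "g n y = (\<Sum>k<n. \<sigma> k * \<phi> k y / 3 ^ k)" for n y
    by (induction n) (simp_all add: gSuc, simp add: g_def)
  have \<sigma>: "\<bar>\<sigma> n\<bar> = 1" for n by (simp add: \<sigma>_def sgn_of_def)
  have g_large: "\<bar>g (Suc n) (x n)\<bar> \<ge> vnorm X (x n) / 3 ^ n" for n
    unfolding gSuc \<phi>(2) \<sigma>_def sgn_of_def by (auto simp: abs_if split: if_splits)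
  have term_le: "\<bar>\<sigma> k * \<phi> k y / 3 ^ k\<bar> \<le> vnorm X y * (1 / 3) ^ k" if "y \<in> pts X" for k y
  proof -
    have "\<bar>\<sigma> k * \<phi> k y / 3 ^ k\<bar> = \<bar>\<phi> k y\<bar> / 3 ^ k" by (simp add: abs_mult \<sigma>)
    also have "\<dots> \<le> vnorm X y / 3 ^ k" using \<phi>(3)[OF that, of k] by (rule divide_right_mono) simp
    finally show ?thesis by (simp add: power_one_over)
  qed
  have geo: "summable (\<lambda>k. vnorm X y * (1 / 3) ^ k)" for y
    by (intro summable_mult summable_geometric) simp
  have summ: "summable (\<lambda>k. \<sigma> k * \<phi> k y / 3 ^ k)" if "y \<in> pts X" for y
    by (rule summable_comparison_test[OF _ geo[of y]]) (use term_le[OF that] in \<open>auto intro!: exI[of _ 0]\<close>)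
  define \<psi> where "\<psi> y = (\<Sum>k. \<sigma> k * \<phi> k y / 3 ^ k)" for y
  have tail: "\<bar>\<psi> y - g n y\<bar> \<le> vnorm X y * ((1/3)^n * (3/2))" if y: "y \<in> pts X" for y n
  proof -
    have "\<psi> y - g n y = (\<Sum>k. \<sigma> (k + n) * \<phi> (k + n) y / 3 ^ (k + n))"
      unfolding \<psi>_def g_sum using suminf_split_initial_segment[OF summ[OF y], of n] by simp
    also have "\<bar>\<dots>\<bar> \<le> (\<Sum>k. vnorm X y * (1 / 3) ^ (k + n))"
    proof -
      have s: "summable (\<lambda>k. vnorm X y * (1 / 3) ^ (k + n))"
        using summable_ignore_initial_segment[OF geo[of y], of n] .
      have abs: "summable (\<lambda>k. \<bar>\<sigma> (k + n) * \<phi> (k + n) y / 3 ^ (k + n)\<bar>)"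
        by (rule summable_comparison_test[OF _ s], rule exI[of _ 0])
          (use term_le[OF y] in simp)
      show ?thesis
        by (rule order_trans[OF summable_rabs[OF abs] suminf_le[OF _ abs s]]) (rule term_le[OF y])
    qed
    also have "\<dots> = vnorm X y * ((1/3)^n * (3/2))"
    proof -
      have "(\<lambda>k. (vnorm X y * (1/3)^n) * (1 / 3) ^ k) sums ((vnorm X y * (1/3)^n) * (1 / (1 - 1/3)))"
        by (intro sums_mult geometric_sums) simp
      then have "(\<lambda>k. vnorm X y * (1 / 3) ^ (k + n)) sums (vnorm X y * ((1/3)^n * (3/2)))"
        by (simp add: power_add mult_ac)
      then show ?thesis by (rule sums_unique[symmetric])
    qed
    finally show ?thesis .
  qed
  have "\<psi> \<in> dual_space X"
  proof -
    have "\<psi> (y \<oplus> z) = \<psi> y + \<psi> z" if "y \<in> pts X" "z \<in> pts X" for y z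
    proof -
      have "\<psi> y + \<psi> z = (\<Sum>k. \<sigma> k * \<phi> k y / 3 ^ k + \<sigma> k * \<phi> k z / 3 ^ k)"
        unfolding \<psi>_def by (rule suminf_add) (use summ that in auto)
      also have "\<dots> = \<psi> (y \<oplus> z)"
        unfolding \<psi>_def using \<phi>(1) that
        by (auto simp: dual_space_def algebra_simps add_divide_distrib)
      finally show ?thesis by simp
    qed
    moreover have "\<psi> (c \<cdot> y) = c * \<psi> y" if "y \<in> pts X" for c y
    proof -
      have "c * \<psi> y = (\<Sum>k. c * (\<sigma> k * \<phi> k y / 3 ^ k))"
        unfolding \<psi>_def by (rule suminf_mult[symmetric]) (use summ that in auto)
      also have "\<dots> = \<psi> (c \<cdot> y)"
        unfolding \<psi>_def using \<phi>(1) that by (auto simp: dual_space_def mult_ac)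
      finally show ?thesis by simp
    qed
    moreover have "\<bar>\<psi> y\<bar> \<le> 3 / 2 * vnorm X y" if "y \<in> pts X" for y
      using tail[OF that, of 0] by (simp add: g_def mult_ac)
    ultimately show ?thesis unfolding dual_space_def by blast
  qed
  then have "compactin euclideanreal (\<psi> ` C)"
    using image_compactin[OF C continuous_map_functional] by blast
  then have "bounded (\<psi> ` C)" by (simp add: compact_imp_bounded)
  then obtain B where B: "\<And>y. y \<in> C \<Longrightarrow> \<bar>\<psi> y\<bar> \<le> B"
    unfolding bounded_iff by auto
  obtain n :: nat where n: "real n > B" using reals_Archimedean2 by blast
  have "real n \<le> vnorm X (x n) / 3 ^ n / 2"
    using big[of n] by (simp add: field_simps)
  also have "\<dots> \<le> \<bar>g (Suc n) (x n)\<bar> - \<bar>\<psi> (x n) - g (Suc n) (x n)\<bar>"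
    using g_large[of n] tail[OF xX, of n "Suc n"] by (simp add: power_one_over)
  also have "\<dots> \<le> \<bar>\<psi> (x n)\<bar>" by simp
  also have "\<dots> \<le> B" using B xC by simp
  finally show False using n by simp
qed

subsection \<open>Weak normal structure yields fixed points\<close>

lemma diam_le:
  assumes "\<And>x y. x \<in> C \<Longrightarrow> y \<in> C \<Longrightarrow> vdist X x y \<le> r"
  shows "diam X C \<le> ennreal r"
  unfolding diam_def using assms by (auto intro!: SUP_least ennreal_leI)

lemma dist_le_radius:
  assumes "y \<in> C" shows "ennreal (vdist X x y) \<le> radius_from X x C"
  unfolding radius_from_def using assms by (rule SUP_upper)

lemma dist_le_diam:
  assumes "x \<in> C" "y \<in> C" shows "ennreal (vdist X x y) \<le> diam X C"
  unfolding diam_def using assms by (meson SUP_upper2 SUP_upper)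

text \<open>
  Kirk's argument. In a minimal invariant set \<open>K\<close> consider the points whose distance from all of
  \<open>K\<close> is at most \<open>r\<close>. If \<open>x\<close> is one, then the ball around \<open>T x\<close> contains \<open>T ` K\<close>, so its
  intersection with \<open>K\<close> is invariant and hence equals \<open>K\<close>; thus the set of these points is
  itself invariant, and equals \<open>K\<close> as soon as it is nonempty.
\<close>

theorem weak_normal_structure_imp_weak_FPP:
  assumes wns: "weak_normal_structure X"
  shows "weak_FPP X"
  unfolding weak_FPP_def
proof (intro allI impI, elim conjE)
  fix C T
  assume ne: "C \<noteq> {}" and conv: "convex_in X C" and comp: "compactin (weak_topology X) C"
    and TC: "T ` C \<subseteq> C" and nonexp: "nonexpansive_on X C T"
  let ?W = "subtopology (weak_topology X) C"
  have CX: "C \<subseteq> pts X" using conv by (simp add: convex_in_def)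
  have top: "topspace ?W = C" using CX by (simp add: Int_absorb1)
  have compW: "compact_space ?W" using comp by (simp add: compact_space_subtopology)
  define A where "A = {K. K \<noteq> {} \<and> convex_in X K \<and> closedin ?W K \<and> T ` K \<subseteq> K}"
  have sub: "K \<subseteq> C" if "K \<in> A" for K
    using that top closedin_subset by (fastforce simp: A_def)
  define P where "P = (\<lambda>(K::'v set) L. L \<subseteq> K)"
  have "C \<in> A" using ne conv TC top closedin_topspace[of ?W] by (simp add: A_def)
  have "\<exists>K\<in>A. \<forall>L\<in>A. P K L \<longrightarrow> L = K"
  proof (rule predicate_Zorn)
    show "partial_order_on A (relation_of P A)"
      by (auto simp: partial_order_on_def preorder_on_def refl_on_def trans_def antisym_def
          relation_of_def P_def)
  next
    fix \<C> assume "\<C> \<in> Chains (relation_of P A)"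
    then have CA: "\<C> \<subseteq> A" and chain: "\<And>K L. K \<in> \<C> \<Longrightarrow> L \<in> \<C> \<Longrightarrow> K \<subseteq> L \<or> L \<subseteq> K"
      by (auto simp: Chains_def relation_of_def P_def)
    show "\<exists>U\<in>A. \<forall>K\<in>\<C>. P K U"
    proof (cases "\<C> = {}")
      case True then show ?thesis using \<open>C \<in> A\<close> by auto
    next
      case False
      have "\<Inter>\<F> \<noteq> {}" if "finite \<F>" "\<F> \<subseteq> \<C>" for \<F>
      proof (cases "\<F> = {}")
        case False
        have "subset.chain \<C> \<F>" using that(2) chain by (auto simp: subset_chain_def)
        then have "\<Inter>\<F> \<in> \<F>" using Inter_in_chain[OF that(1) False] by blast
        then show ?thesis using that(2) CA by (auto simp: A_def)
      qed auto
      then have "\<Inter>\<C> \<noteq> {}"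
        using compW CA unfolding compact_space_fip by (auto simp: A_def)
      moreover have "convex_in X (\<Inter>\<C>)"
        using False CA unfolding convex_in_def A_def by blast
      moreover have "closedin ?W (\<Inter>\<C>)"
        using False CA by (intro closedin_Inter) (auto simp: A_def)
      moreover have "T ` \<Inter>\<C> \<subseteq> \<Inter>\<C>"
        using CA unfolding A_def by blast
      ultimately have "\<Inter>\<C> \<in> A" by (simp add: A_def)
      then show ?thesis by (auto simp: P_def)
    qed
  qed
  then obtain K where KA: "K \<in> A" and min: "\<And>L. L \<in> A \<Longrightarrow> L \<subseteq> K \<Longrightarrow> L = K"
    by (auto simp: P_def)
  have KC: "K \<subseteq> C" and KX: "K \<subseteq> pts X" using sub[OF KA] CX by auto
  have K: "K \<noteq> {}" "convex_in X K" "closedin ?W K" "T ` K \<subseteq> K" using KA by (auto simp: A_def)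
  show "\<exists>x\<in>C. T x = x"
  proof (cases "diam X K > 0")
    case False
    obtain x where x: "x \<in> K" using K by auto
    then have Tx: "T x \<in> K" using K by auto
    have "ennreal (vdist X (T x) x) \<le> 0"
      using dist_le_diam[OF Tx x] False by (simp add: not_less)
    then have "vdist X (T x) x = 0"
      using vdist_nonneg[of "T x" x] x Tx KX by (auto simp: ennreal_eq_0_iff)
    then have "T x = x" using vdist_eq_zero[of "T x" x] x Tx KX by auto
    then show ?thesis using x KC by auto
  next
    case True
    have "compactin (weak_topology X) K"
      using closedin_compact_space[OF compW K(3)] by (simp add: compactin_subtopology)
    then obtain x0 where x0: "x0 \<in> K" and rad: "radius_from X x0 K < diam X K"
      using wns K(2) True unfolding weak_normal_structure_def by blast
    define r where "r = enn2real (radius_from X x0 K)"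
    have fin: "radius_from X x0 K < top" using rad by (metis less_le_trans top_greatest)
    then have r: "radius_from X x0 K = ennreal r" by (simp add: r_def)
    have r0: "0 \<le> r" by (simp add: r_def)
    let ?ball = "\<lambda>y. {x \<in> pts X. vdist X x y \<le> r}"
    have inv_closed: "closedin ?W (K \<inter> (\<Inter>y\<in>B. ?ball y))" if "B \<subseteq> pts X" for B
    proof (cases "B = {}")
      case False
      then have "closedin (weak_topology X) (\<Inter>y\<in>B. ?ball y)"
        using that by (intro closedin_Inter) (auto intro: closed_ball_weakly_closed)
      then show ?thesis using K(3) by (simp add: closedin_subtopology_Int_closedin)
    qed (use K in simp)
    have inv_convex: "convex_in X (K \<inter> (\<Inter>y\<in>B. ?ball y))" if B: "B \<subseteq> pts X" for B
      unfolding convex_in_def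
    proof (intro conjI ballI)
      fix x z t assume x: "x \<in> K \<inter> (\<Inter>y\<in>B. ?ball y)" and z: "z \<in> K \<inter> (\<Inter>y\<in>B. ?ball y)"
        and t: "t \<in> {0..1::real}"
      let ?v = "(1 - t) \<cdot> x \<oplus> t \<cdot> z"
      have "?v \<in> K" using x z t K(2) unfolding convex_in_def by blast
      moreover have "vdist X ?v y \<le> r" if y: "y \<in> B" for y
      proof -
        have "vdist X ?v y \<le> (1 - t) * vdist X x y + t * vdist X z y"
          using x z y t B KX by (intro vdist_convex_combination) auto
        also have "\<dots> \<le> (1 - t) * r + t * r"
          using x z y t by (intro add_mono mult_left_mono) auto
        finally show ?thesis by (simp add: algebra_simps)
      qed
      ultimately show "?v \<in> K \<inter> (\<Inter>y\<in>B. ?ball y)" using KX by auto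
    qed (use KX in auto)
    let ?D = "K \<inter> (\<Inter>y\<in>K. ?ball y)"
    have "vdist X x0 y \<le> r" if "y \<in> K" for y
      using dist_le_radius[OF that, of x0] r r0 by simp
    then have "x0 \<in> ?D" using x0 KX by auto
    moreover have "T x \<in> ?D" if x: "x \<in> ?D" for x
    proof -
      have Tx: "T x \<in> K" using x K by auto
      let ?E = "K \<inter> (\<Inter>y\<in>{T x}. ?ball y)"
      have TE: "T z \<in> ?E" if z: "z \<in> K" for z
      proof -
        have "vdist X (T z) (T x) \<le> vdist X z x"
          using nonexp z x KC unfolding nonexpansive_on_def by auto
        also have "\<dots> \<le> r" using x z KX vdist_commute[of z x] by auto
        finally show ?thesis using z K KX by auto
      qed
      have "?E \<in> A"
        unfolding A_def mem_Collect_eq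
      proof (intro conjI)
        show "?E \<noteq> {}" using TE[OF x0] by blast
        show "convex_in X ?E" using inv_convex[of "{T x}"] Tx KX by blast
        show "closedin ?W ?E" using inv_closed[of "{T x}"] Tx KX by blast
        show "T ` ?E \<subseteq> ?E" using TE by blast
      qed
      then have "?E = K" using min by blast
      then have "vdist X z (T x) \<le> r" if "z \<in> K" for z using that by auto
      then have "vdist X (T x) z \<le> r" if "z \<in> K" for z
        using that vdist_commute[of z "T x"] Tx KX by (metis subsetD)
      then show ?thesis using Tx KX by auto
    qed
    ultimately have "?D \<in> A"
      unfolding A_def using inv_convex[OF KX] inv_closed[OF KX] by blast
    then have "?D = K" using min by blast
    then have "vdist X x y \<le> r" if "x \<in> K" "y \<in> K" for x y using that by auto
    then have "diam X K \<le> ennreal r" by (rule diam_le)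
    then show ?thesis using rad r by simp
  qed
qed

end

section \<open>Function spaces modulo null functions\<close>

lemma equiv_ae_eq: "equiv (borel_measurable M) (ae_eq M)"
proof (rule equivI)
  show "ae_eq M \<subseteq> borel_measurable M \<times> borel_measurable M" by (auto simp: ae_eq_def)
  show "refl_on (borel_measurable M) (ae_eq M)" by (auto simp: refl_on_def ae_eq_def)
  show "sym (ae_eq M)" by (auto simp: sym_def ae_eq_def)
  show "trans (ae_eq M)"
  proof (rule transI)
    fix f g h assume "(f, g) \<in> ae_eq M" "(g, h) \<in> ae_eq M"
    then have *: "f \<in> borel_measurable M" "h \<in> borel_measurable M"
        "AE t in M. f t = g t" "AE t in M. g t = h t" by (auto simp: ae_eq_def)
    have "AE t in M. f t = h t" using *(3,4) by eventually_elim simp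
    with * show "(f, h) \<in> ae_eq M" by (simp add: ae_eq_def)
  qed
qed

lemma ae_class_eq_iff:
  assumes "f \<in> borel_measurable M" "g \<in> borel_measurable M"
  shows "ae_class M f = ae_class M g \<longleftrightarrow> (AE t in M. f t = g t)"
  using eq_equiv_class_iff[OF equiv_ae_eq assms] assms by (simp add: ae_class_def ae_eq_def)

lemma mem_ae_class:
  "f \<in> borel_measurable M \<Longrightarrow>
    g \<in> ae_class M f \<longleftrightarrow> g \<in> borel_measurable M \<and> (AE t in M. f t = g t)"
  by (auto simp: ae_class_def ae_eq_def)

lemma ae_rep_ae_class:
  assumes "f \<in> borel_measurable M"
  shows "ae_rep (ae_class M f) \<in> borel_measurable M" "AE t in M. ae_rep (ae_class M f) t = f t"
proof -
  have "f \<in> ae_class M f" using assms by (simp add: mem_ae_class)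
  then have "ae_rep (ae_class M f) \<in> ae_class M f"
    unfolding ae_rep_def by (metis someI)
  then show "ae_rep (ae_class M f) \<in> borel_measurable M" "AE t in M. ae_rep (ae_class M f) t = f t"
    using assms by (auto simp: mem_ae_class elim: AE_mp)
qed

text \<open>
  The variable Lebesgue spaces and \<open>L\<^sup>1\<close> arise from a vector space of functions and a seminorm that
  vanishes only on null functions. The passage to classes is made once, for both of them.
\<close>

locale normed_function_space =
  fixes M :: "'a measure" and V :: "('a \<Rightarrow> real) set" and N :: "('a \<Rightarrow> real) \<Rightarrow> real"
  assumes V_measurable: "f \<in> V \<Longrightarrow> f \<in> borel_measurable M"
    and V_nonempty: "V \<noteq> {}"
    and V_add: "f \<in> V \<Longrightarrow> g \<in> V \<Longrightarrow> (\<lambda>t. f t + g t) \<in> V"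
    and V_scale: "f \<in> V \<Longrightarrow> (\<lambda>t. c * f t) \<in> V"
    and V_ae: "f \<in> V \<Longrightarrow> g \<in> borel_measurable M \<Longrightarrow> (AE t in M. f t = g t) \<Longrightarrow> g \<in> V"
    and N_ae: "f \<in> V \<Longrightarrow> g \<in> V \<Longrightarrow> (AE t in M. f t = g t) \<Longrightarrow> N f = N g"
    and N_scale: "f \<in> V \<Longrightarrow> N (\<lambda>t. c * f t) = \<bar>c\<bar> * N f"
    and N_triangle: "f \<in> V \<Longrightarrow> g \<in> V \<Longrightarrow> N (\<lambda>t. f t + g t) \<le> N f + N g"
    and N_eq_zero: "f \<in> V \<Longrightarrow> N f = 0 \<Longrightarrow> AE t in M. f t = 0"
begin

abbreviation cl where "cl \<equiv> ae_class M"
abbreviation X where "X \<equiv> function_space M V N"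

lemma V_zero: "(\<lambda>_. 0) \<in> V"
proof -
  obtain f where "f \<in> V" using V_nonempty by auto
  then show ?thesis using V_scale[of f 0] by simp
qed

lemma V_diff: "f \<in> V \<Longrightarrow> g \<in> V \<Longrightarrow> (\<lambda>t. f t - g t) \<in> V"
  using V_add[of f "\<lambda>t. (-1) * g t"] V_scale[of g "-1"] by simp

lemma pts_iff: "A \<in> pts X \<longleftrightarrow> (\<exists>f\<in>V. A = cl f)"
  by (auto simp: function_space_def quotient_def ae_class_def)

lemma cl_pts [simp, intro]: "f \<in> V \<Longrightarrow> cl f \<in> pts X"
  by (auto simp: pts_iff)

lemma rep_cl:
  assumes "f \<in> V"
  shows "ae_rep (cl f) \<in> V" "AE t in M. ae_rep (cl f) t = f t"
proof -
  note rep = ae_rep_ae_class[OF V_measurable[OF assms]]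
  show "AE t in M. ae_rep (cl f) t = f t" by (rule rep)
  show "ae_rep (cl f) \<in> V"
    by (rule V_ae[OF assms rep(1)]) (use rep(2) in \<open>eventually_elim; simp\<close>)
qed

lemma cl_eqI: "f \<in> V \<Longrightarrow> g \<in> V \<Longrightarrow> (AE t in M. f t = g t) \<Longrightarrow> cl f = cl g"
  by (simp add: ae_class_eq_iff V_measurable)

lemma cl_eq_iff: "f \<in> V \<Longrightarrow> g \<in> V \<Longrightarrow> cl f = cl g \<longleftrightarrow> (AE t in M. f t = g t)"
  by (simp add: ae_class_eq_iff V_measurable)

lemma rep_pts:
  assumes "A \<in> pts X"
  shows "ae_rep A \<in> V" "cl (ae_rep A) = A"
proof -
  obtain f where f: "f \<in> V" "A = cl f" using assms by (auto simp: pts_iff)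
  then show "ae_rep A \<in> V" "cl (ae_rep A) = A"
    using rep_cl[OF f(1)] cl_eqI[OF rep_cl(1)[OF f(1)] f(1)] by simp_all
qed

lemma vadd_cl:
  assumes "f \<in> V" "g \<in> V"
  shows "vadd X (cl f) (cl g) = cl (\<lambda>t. f t + g t)"
proof -
  have "AE t in M. ae_rep (cl f) t + ae_rep (cl g) t = f t + g t"
    using rep_cl(2)[OF assms(1)] rep_cl(2)[OF assms(2)] by eventually_elim simp
  then show ?thesis
    using assms rep_cl by (simp add: function_space_def cl_eq_iff V_add)
qed

lemma vscale_cl:
  assumes "f \<in> V"
  shows "vscale X c (cl f) = cl (\<lambda>t. c * f t)"
proof -
  have "AE t in M. c * ae_rep (cl f) t = c * f t"
    using rep_cl(2)[OF assms(1)] by eventually_elim simp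
  then show ?thesis
    using assms rep_cl by (simp add: function_space_def cl_eq_iff V_scale)
qed

lemma vnorm_cl: "f \<in> V \<Longrightarrow> vnorm X (cl f) = N f"
  using N_ae[of "ae_rep (cl f)" f] rep_cl[of f] by (simp add: function_space_def)

lemma vzero_eq: "vzero X = cl (\<lambda>_. 0)"
  by (simp add: function_space_def)

lemma vdist_cl:
  assumes "f \<in> V" "g \<in> V"
  shows "vdist X (cl f) (cl g) = N (\<lambda>t. f t - g t)"
  using assms V_scale[of g "-1"] V_diff[of f g]
  by (simp add: vdist_def vscale_cl vadd_cl vnorm_cl)

lemma vdist_rep:
  assumes "A \<in> pts X" "B \<in> pts X"
  shows "vdist X A B = N (\<lambda>t. ae_rep A t - ae_rep B t)"
  using vdist_cl[of "ae_rep A" "ae_rep B"] rep_pts assms by simp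

sublocale carrier_normed_space X
proof (unfold_locales, goal_cases)
  case 1 then show ?case using V_zero by (simp add: vzero_eq cl_pts)
next
  case 2 then show ?case by (auto simp: pts_iff vadd_cl intro: V_add)
next
  case 3 then show ?case by (auto simp: pts_iff vscale_cl intro: V_scale)
next
  case 4 then show ?case by (auto simp: pts_iff vadd_cl V_add add.assoc)
next
  case 5 then show ?case by (auto simp: pts_iff vadd_cl V_add add.commute)
next
  case 6 then show ?case by (auto simp: pts_iff vadd_cl vzero_eq V_zero)
next
  case 7 then show ?case by (auto simp: pts_iff vscale_cl vzero_eq V_zero)
next
  case 8 then show ?case by (auto simp: pts_iff vscale_cl)
next
  case 9 then show ?case by (auto simp: pts_iff vscale_cl V_scale mult.assoc)
next
  case 10 then show ?case by (auto simp: pts_iff vscale_cl vadd_cl V_scale V_add distrib_left)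
next
  case 11 then show ?case by (auto simp: pts_iff vscale_cl vadd_cl V_scale V_add distrib_right)
next
  case 12 then show ?case by (auto simp: pts_iff vscale_cl vnorm_cl V_scale N_scale)
next
  case 13 then show ?case by (auto simp: pts_iff vadd_cl vnorm_cl V_add N_triangle)
next
  case (14 A)
  then obtain f where f: "f \<in> V" "A = cl f" by (auto simp: pts_iff)
  then show ?case
    using 14(2) cl_eqI[OF f(1) V_zero N_eq_zero[OF f(1)]] by (simp add: vnorm_cl vzero_eq)
qed

text \<open>A bounded linear functional on the functions induces one on the classes, since it does not
  distinguish functions at distance 0.\<close>

lemma functional_on_classes:
  assumes add: "\<And>f g. f \<in> V \<Longrightarrow> g \<in> V \<Longrightarrow> F (\<lambda>t. f t + g t) = F f + F g"
    and scale: "\<And>c f. f \<in> V \<Longrightarrow> F (\<lambda>t. c * f t) = c * F f"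
    and bound: "\<And>f. f \<in> V \<Longrightarrow> \<bar>F f\<bar> \<le> K * N f"
  shows "(\<lambda>A. F (ae_rep A)) \<in> dual_space X" "\<And>f. f \<in> V \<Longrightarrow> F (ae_rep (cl f)) = F f"
proof -
  have ae: "F f = F g" if f: "f \<in> V" and g: "g \<in> V" and "AE t in M. f t = g t" for f g
  proof -
    have "AE t in M. f t - g t = 0" using that(3) by eventually_elim simp
    then have "N (\<lambda>t. f t - g t) = N (\<lambda>_. 0)"
      using f g by (intro N_ae V_diff V_zero) auto
    also have "\<dots> = 0" using norm_zero by (simp add: vzero_eq vnorm_cl V_zero)
    finally have "F (\<lambda>t. f t - g t) = 0"
      using bound[OF V_diff[OF f g]] by simp
    moreover have "F f = F (\<lambda>t. f t - g t) + F g"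
      using add[OF V_diff[OF f g] g] by simp
    ultimately show ?thesis by simp
  qed
  show rep: "F (ae_rep (cl f)) = F f" if "f \<in> V" for f
    using ae[OF rep_cl(1)[OF that] that rep_cl(2)[OF that]] .
  show "(\<lambda>A. F (ae_rep A)) \<in> dual_space X"
    unfolding dual_space_def
    using bound by (auto simp: pts_iff vadd_cl vscale_cl vnorm_cl rep V_add V_scale add scale intro!: exI[of _ K])
qed

end


section \<open>The Luxemburg norm\<close>

lemma esssup_on_le_iff:
  assumes "E \<in> sets M" "f \<in> borel_measurable M"
  shows "esssup_on M E f \<le> c \<longleftrightarrow> (AE t in M. t \<in> E \<longrightarrow> f t \<le> c)"
proof -
  have E: "E \<inter> space M \<in> sets M" using assms by auto
  have f: "f \<in> borel_measurable (restrict_space M E)"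
    using assms(2) by (rule measurable_restrict_space1)
  show ?thesis
  proof
    assume *: "esssup_on M E f \<le> c"
    have "AE t in M. t \<in> E \<longrightarrow> f t \<le> esssup_on M E f"
      using esssup_AE[of f "restrict_space M E"] unfolding esssup_on_def AE_restrict_space_iff[OF E] .
    then show "AE t in M. t \<in> E \<longrightarrow> f t \<le> c"
      by eventually_elim (use * in auto)
  next
    assume "AE t in M. t \<in> E \<longrightarrow> f t \<le> c"
    then show "esssup_on M E f \<le> c"
      unfolding esssup_on_def by (intro esssup_I[OF f]) (simp add: AE_restrict_space_iff[OF E])
  qed
qed

lemma AE_le_esssup_on:
  assumes "E \<in> sets M" "f \<in> borel_measurable M"
  shows "AE t in M. t \<in> E \<longrightarrow> f t \<le> esssup_on M E f"
  using esssup_on_le_iff[OF assms, of "esssup_on M E f"] by simp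

lemma abs_powr_convex:
  fixes x y :: real
  assumes q: "1 \<le> q" and ab: "0 \<le> a" "0 \<le> b" "a + b = 1"
  shows "\<bar>a * x + b * y\<bar> powr q \<le> a * \<bar>x\<bar> powr q + b * \<bar>y\<bar> powr q"
proof -
  have small: "c powr q \<le> c" if "0 \<le> c" "c \<le> 1" for c :: real
    using powr_mono'[of 1 q c] q that by (cases "c = 0") auto
  have nonneg: "(a * u + b * v) powr q \<le> a * u powr q + b * v powr q" if "0 \<le> u" "0 \<le> v" for u v
  proof (cases "u = 0 \<or> v = 0")
    case True
    have "(a * u) powr q \<le> a * u powr q" "(b * v) powr q \<le> b * v powr q"
      using small[of a] small[of b] ab that by (auto simp: powr_mult intro!: mult_right_mono)
    then show ?thesis using True by auto
  next
    case False
    then have "u \<in> {0<..}" "v \<in> {0<..}" using that by auto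
    then show ?thesis
      using powr_convex[OF q] ab unfolding convex_on_def by auto
  qed
  have "\<bar>a * x + b * y\<bar> \<le> a * \<bar>x\<bar> + b * \<bar>y\<bar>"
    using ab abs_triangle_ineq[of "a * x" "b * y"] by (simp add: abs_mult)
  then have "\<bar>a * x + b * y\<bar> powr q \<le> (a * \<bar>x\<bar> + b * \<bar>y\<bar>) powr q"
    using q by (intro powr_mono2) auto
  also have "\<dots> \<le> a * \<bar>x\<bar> powr q + b * \<bar>y\<bar> powr q" by (rule nonneg) auto
  finally show ?thesis .
qed

locale variable_exponent = sigma_finite_measure M for M :: "'a measure" +
  fixes p :: "'a \<Rightarrow> ennreal"
  assumes p_measurable [measurable]: "p \<in> borel_measurable M"
    and p_ge_1: "\<And>t. t \<in> space M \<Longrightarrow> 1 \<le> p t"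
begin

abbreviation \<Omega>f where "\<Omega>f \<equiv> finite_part M p"
abbreviation \<Omega>i where "\<Omega>i \<equiv> infinite_part M p"
abbreviation \<rho> where "\<rho> \<equiv> modular M p"
abbreviation V where "V \<equiv> var_Lp_functions M p"
abbreviation L where "L \<equiv> luxemburg_norm M p"

definition q :: "'a \<Rightarrow> real" where "q t = enn2real (p t)"

lemma q_measurable [measurable]: "q \<in> borel_measurable M"
  unfolding q_def by measurable

lemma parts_sets [measurable]: "\<Omega>f \<in> sets M" "\<Omega>i \<in> sets M"
  unfolding finite_part_def infinite_part_def by measurable

lemma q_ge_1: "t \<in> \<Omega>f \<Longrightarrow> 1 \<le> q t"
  using p_ge_1[of t] enn2real_mono[of 1 "p t"] by (auto simp: q_def finite_part_def less_top)

definition \<rho>f :: "('a \<Rightarrow> real) \<Rightarrow> ennreal" where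
  "\<rho>f g = (\<integral>\<^sup>+t\<in>\<Omega>f. ennreal (\<bar>g t\<bar> powr q t) \<partial>M)"

definition \<rho>i :: "('a \<Rightarrow> real) \<Rightarrow> ennreal" where
  "\<rho>i g = esssup_on M \<Omega>i (\<lambda>t. ennreal \<bar>g t\<bar>)"

lemma modular_eq: "\<rho> g = \<rho>f g + \<rho>i g"
  by (simp add: modular_def \<rho>f_def \<rho>i_def q_def)

lemma \<rho>i_le_iff:
  assumes [measurable]: "g \<in> borel_measurable M"
  shows "\<rho>i g \<le> c \<longleftrightarrow> (AE t in M. t \<in> \<Omega>i \<longrightarrow> ennreal \<bar>g t\<bar> \<le> c)"
  unfolding \<rho>i_def by (rule esssup_on_le_iff) measurable

lemma AE_le_\<rho>i:
  assumes "g \<in> borel_measurable M"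
  shows "AE t in M. t \<in> \<Omega>i \<longrightarrow> ennreal \<bar>g t\<bar> \<le> \<rho>i g"
  using \<rho>i_le_iff[OF assms, of "\<rho>i g"] by simp

lemma modular_mono:
  assumes [measurable]: "f \<in> borel_measurable M" "g \<in> borel_measurable M"
    and le: "AE t in M. \<bar>f t\<bar> \<le> \<bar>g t\<bar>"
  shows "\<rho> f \<le> \<rho> g"
proof -
  have "\<rho>f f \<le> \<rho>f g"
    unfolding \<rho>f_def
    by (rule nn_integral_mono_AE) (use le in eventually_elim,
        auto simp: indicator_def intro!: ennreal_leI powr_mono2 order_trans[OF zero_le_one q_ge_1])
  moreover have "\<rho>i f \<le> \<rho>i g"
    unfolding \<rho>i_le_iff[OF assms(1)] using AE_le_\<rho>i[OF assms(2)] le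
    by eventually_elim (auto intro: order_trans[OF ennreal_leI])
  ultimately show ?thesis unfolding modular_eq by (rule add_mono)
qed

lemma modular_cong:
  assumes "f \<in> borel_measurable M" "g \<in> borel_measurable M" "AE t in M. \<bar>f t\<bar> = \<bar>g t\<bar>"
  shows "\<rho> f = \<rho> g"
  using assms by (intro antisym modular_mono) (auto elim: AE_mp)

lemma modular_convex:
  assumes [measurable]: "f \<in> borel_measurable M" "g \<in> borel_measurable M"
    and ab: "0 \<le> a" "0 \<le> b" "a + b = 1"
  shows "\<rho> (\<lambda>t. a * f t + b * g t) \<le> ennreal a * \<rho> f + ennreal b * \<rho> g"
proof -
  have "\<rho>f (\<lambda>t. a * f t + b * g t)
      \<le> (\<integral>\<^sup>+t. ennreal a * (ennreal (\<bar>f t\<bar> powr q t) * indicator \<Omega>f t)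
            + ennreal b * (ennreal (\<bar>g t\<bar> powr q t) * indicator \<Omega>f t) \<partial>M)"
    unfolding \<rho>f_def
  proof (rule nn_integral_mono)
    fix t
    show "ennreal (\<bar>a * f t + b * g t\<bar> powr q t) * indicator \<Omega>f t
      \<le> ennreal a * (ennreal (\<bar>f t\<bar> powr q t) * indicator \<Omega>f t)
        + ennreal b * (ennreal (\<bar>g t\<bar> powr q t) * indicator \<Omega>f t)"
      using abs_powr_convex[OF q_ge_1 ab, of t "f t" "g t"] ab
      by (cases "t \<in> \<Omega>f") (auto simp: ennreal_mult'[symmetric] ennreal_plus[symmetric] simp del: ennreal_plus)
  qed
  also have "\<dots> = ennreal a * \<rho>f f + ennreal b * \<rho>f g"
    unfolding \<rho>f_def by (simp add: nn_integral_add nn_integral_cmult)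
  finally have 1: "\<rho>f (\<lambda>t. a * f t + b * g t) \<le> ennreal a * \<rho>f f + ennreal b * \<rho>f g" .
  have 2: "\<rho>i (\<lambda>t. a * f t + b * g t) \<le> ennreal a * \<rho>i f + ennreal b * \<rho>i g"
  proof (subst \<rho>i_le_iff)
    show "AE t in M. t \<in> \<Omega>i \<longrightarrow> ennreal \<bar>a * f t + b * g t\<bar> \<le> ennreal a * \<rho>i f + ennreal b * \<rho>i g"
      using AE_le_\<rho>i[OF assms(1)] AE_le_\<rho>i[OF assms(2)]
    proof eventually_elim
      case (elim t)
      show ?case
      proof
        assume t: "t \<in> \<Omega>i"
        have "\<bar>a * f t + b * g t\<bar> \<le> a * \<bar>f t\<bar> + b * \<bar>g t\<bar>"
          using ab abs_triangle_ineq[of "a * f t" "b * g t"] by (simp add: abs_mult)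
        then have "ennreal \<bar>a * f t + b * g t\<bar> \<le> ennreal a * ennreal \<bar>f t\<bar> + ennreal b * ennreal \<bar>g t\<bar>"
          using ab by (simp add: ennreal_mult'[symmetric] ennreal_plus[symmetric] ennreal_leI del: ennreal_plus)
        also have "\<dots> \<le> ennreal a * \<rho>i f + ennreal b * \<rho>i g"
          using elim t by (intro add_mono mult_left_mono) auto
        finally show "ennreal \<bar>a * f t + b * g t\<bar> \<le> ennreal a * \<rho>i f + ennreal b * \<rho>i g" .
      qed
    qed
  qed measurable
  have "\<rho> (\<lambda>t. a * f t + b * g t)
      \<le> (ennreal a * \<rho>f f + ennreal b * \<rho>f g) + (ennreal a * \<rho>i f + ennreal b * \<rho>i g)"
    unfolding modular_eq using 1 2 by (rule add_mono)
  also have "\<dots> = ennreal a * \<rho> f + ennreal b * \<rho> g"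
    unfolding modular_eq by (simp add: distrib_left ac_simps)
  finally show ?thesis .
qed

lemma modular_zero [simp]: "\<rho> (\<lambda>_. 0) = 0"
proof -
  have "\<rho>f (\<lambda>_. 0) = 0" by (simp add: \<rho>f_def)
  moreover have "\<rho>i (\<lambda>_. 0) \<le> 0" by (subst \<rho>i_le_iff) auto
  ultimately show ?thesis by (simp add: modular_eq)
qed

lemma modular_scale_le:
  assumes "f \<in> borel_measurable M" "0 \<le> a" "a \<le> 1"
  shows "\<rho> (\<lambda>t. a * f t) \<le> ennreal a * \<rho> f"
  using modular_convex[of f "\<lambda>_. 0" a "1 - a"] assms by simp

text \<open>
  This is the triangle inequality for the Luxemburg norm: the left-hand function is the convex
  combination of \<open>f / \<alpha>\<close> and \<open>g / \<beta>\<close> with weights proportional to \<open>\<alpha>\<close> and \<open>\<beta>\<close>.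
\<close>

lemma modular_add_le_1:
  assumes f: "f \<in> borel_measurable M" and g: "g \<in> borel_measurable M"
    and \<alpha>: "0 < \<alpha>" "\<rho> (\<lambda>t. f t / \<alpha>) \<le> 1" and \<beta>: "0 < \<beta>" "\<rho> (\<lambda>t. g t / \<beta>) \<le> 1"
  shows "\<rho> (\<lambda>t. (f t + g t) / (\<alpha> + \<beta>)) \<le> 1"
proof -
  define a b where "a = \<alpha> / (\<alpha> + \<beta>)" and "b = \<beta> / (\<alpha> + \<beta>)"
  have ab: "0 \<le> a" "0 \<le> b" "a + b = 1"
    using \<alpha>(1) \<beta>(1) unfolding a_def b_def by (simp_all add: add_divide_distrib[symmetric])
  have "(f t + g t) / (\<alpha> + \<beta>) = a * (f t / \<alpha>) + b * (g t / \<beta>)" for t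
    using \<alpha>(1) \<beta>(1) unfolding a_def b_def by (simp add: add_divide_distrib)
  then have "\<rho> (\<lambda>t. (f t + g t) / (\<alpha> + \<beta>)) = \<rho> (\<lambda>t. a * (f t / \<alpha>) + b * (g t / \<beta>))"
    by simp
  also have "\<dots> \<le> ennreal a * \<rho> (\<lambda>t. f t / \<alpha>) + ennreal b * \<rho> (\<lambda>t. g t / \<beta>)"
    by (intro modular_convex ab borel_measurable_divide f g borel_measurable_const)
  also have "\<dots> \<le> ennreal a * 1 + ennreal b * 1"
    by (intro add_mono mult_left_mono \<alpha> \<beta>) simp_all
  also have "\<dots> = ennreal (a + b)" using ab(1,2) by simp
  finally show ?thesis by (simp add: ab)
qed

lemma V_borel [measurable_dest]: "f \<in> V \<Longrightarrow> f \<in> borel_measurable M"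
  by (simp add: var_Lp_functions_def)

text \<open>
  By convexity a finite modular becomes at most 1 after dividing the function by that modular.
\<close>

lemma V_iff: "f \<in> V \<longleftrightarrow> f \<in> borel_measurable M \<and> (\<exists>\<alpha>>0. \<rho> (\<lambda>t. f t / \<alpha>) \<le> 1)"
proof
  assume "f \<in> V"
  then obtain l where [measurable]: "f \<in> borel_measurable M" and l: "l > 0" "\<rho> (\<lambda>t. f t / l) < \<infinity>"
    by (auto simp: var_Lp_functions_def)
  define m where "m = max 1 (enn2real (\<rho> (\<lambda>t. f t / l)))"
  have le: "\<rho> (\<lambda>t. f t / l) \<le> ennreal m"
  proof -
    have "\<rho> (\<lambda>t. f t / l) = ennreal (enn2real (\<rho> (\<lambda>t. f t / l)))" using l(2) by simp
    also have "\<dots> \<le> ennreal m" by (rule ennreal_leI) (simp add: m_def)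
    finally show ?thesis .
  qed
  have m: "m \<ge> 1" by (simp add: m_def)
  have "\<rho> (\<lambda>t. f t / (m * l)) = \<rho> (\<lambda>t. (1 / m) * (f t / l))" by (simp add: mult.commute)
  also have "\<dots> \<le> ennreal (1 / m) * \<rho> (\<lambda>t. f t / l)"
    using m by (intro modular_scale_le) auto
  also have "\<dots> \<le> ennreal (1 / m) * ennreal m" using le by (rule mult_left_mono) simp
  also have "\<dots> = 1" using m by (simp add: ennreal_mult'[symmetric])
  finally show "f \<in> borel_measurable M \<and> (\<exists>\<alpha>>0. \<rho> (\<lambda>t. f t / \<alpha>) \<le> 1)"
    using m l by (auto intro!: exI[of _ "m * l"])
next
  assume "f \<in> borel_measurable M \<and> (\<exists>\<alpha>>0. \<rho> (\<lambda>t. f t / \<alpha>) \<le> 1)"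
  then obtain \<alpha> where "f \<in> borel_measurable M" "\<alpha> > 0" "\<rho> (\<lambda>t. f t / \<alpha>) \<le> 1" by blast
  moreover from this have "\<rho> (\<lambda>t. f t / \<alpha>) < \<infinity>" by (simp add: le_less_trans[of _ 1])
  ultimately show "f \<in> V" by (auto simp: var_Lp_functions_def)
qed

lemma L_le: "0 < \<alpha> \<Longrightarrow> \<rho> (\<lambda>t. f t / \<alpha>) \<le> 1 \<Longrightarrow> L f \<le> \<alpha>"
  unfolding luxemburg_norm_def by (intro cInf_lower) (auto intro!: bdd_belowI[of _ 0])

lemma modular_le_1:
  assumes f: "f \<in> V" and less: "L f < \<alpha>"
  shows "0 < \<alpha>" "\<rho> (\<lambda>t. f t / \<alpha>) \<le> 1"
proof -
  have [measurable]: "f \<in> borel_measurable M" using f by (rule V_borel)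
  have "{\<alpha>. \<alpha> > 0 \<and> \<rho> (\<lambda>t. f t / \<alpha>) \<le> 1} \<noteq> {}" using f by (auto simp: V_iff)
  then obtain \<beta> where \<beta>: "\<beta> > 0" "\<rho> (\<lambda>t. f t / \<beta>) \<le> 1" "\<beta> < \<alpha>"
    using cInf_lessD[of "{\<alpha>. \<alpha> > 0 \<and> \<rho> (\<lambda>t. f t / \<alpha>) \<le> 1}" \<alpha>] less
    unfolding luxemburg_norm_def by auto
  then show "0 < \<alpha>" by simp
  have "\<rho> (\<lambda>t. f t / \<alpha>) \<le> \<rho> (\<lambda>t. f t / \<beta>)"
    by (rule modular_mono) (use \<beta> in \<open>auto intro!: divide_left_mono\<close>)
  then show "\<rho> (\<lambda>t. f t / \<alpha>) \<le> 1" using \<beta> by simp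
qed

lemma L_nonneg: "f \<in> V \<Longrightarrow> 0 \<le> L f"
  using modular_le_1(1)[of f 0] by (cases "L f < 0") auto

lemma L_scale_le:
  assumes f: "f \<in> V" and c: "c \<noteq> 0"
  shows "(\<lambda>t. c * f t) \<in> V" "L (\<lambda>t. c * f t) \<le> \<bar>c\<bar> * L f"
proof -
  have [measurable]: "f \<in> borel_measurable M" using f by (rule V_borel)
  have *: "\<rho> (\<lambda>t. c * f t / (\<bar>c\<bar> * \<alpha>)) \<le> 1" if "L f < \<alpha>" for \<alpha>
  proof -
    have "\<rho> (\<lambda>t. c * f t / (\<bar>c\<bar> * \<alpha>)) = \<rho> (\<lambda>t. f t / \<alpha>)"
      using c by (intro modular_cong) (auto simp: abs_mult)
    then show ?thesis using modular_le_1[OF f that] by simp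
  qed
  have pos: "0 < \<bar>c\<bar> * \<alpha>" if "L f < \<alpha>" for \<alpha> using c modular_le_1(1)[OF f that] by simp
  have "L f < L f + 1" by simp
  then show "(\<lambda>t. c * f t) \<in> V" using *[of "L f + 1"] pos[of "L f + 1"]
    unfolding V_iff by (intro conjI exI[of _ "\<bar>c\<bar> * (L f + 1)"]) auto
  have "L (\<lambda>t. c * f t) / \<bar>c\<bar> \<le> \<alpha>" if "L f < \<alpha>" for \<alpha>
    using L_le[OF pos *, OF that that] c by (simp add: field_simps)
  then have "L (\<lambda>t. c * f t) / \<bar>c\<bar> \<le> L f" by (rule dense_ge)
  then show "L (\<lambda>t. c * f t) \<le> \<bar>c\<bar> * L f" using c by (simp add: field_simps)
qed

sublocale normed_function_space M V L
proof (unfold_locales, goal_cases)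
  case (1 f) then show ?case by (rule V_borel)
next
  case 2
  have "(\<lambda>_. 0) \<in> V" by (auto simp: V_iff intro!: exI[of _ 1])
  then show ?case by auto
next
  case (3 f g)
  then have [measurable]: "f \<in> borel_measurable M" "g \<in> borel_measurable M" by (auto simp: V_borel)
  obtain \<alpha> \<beta> where \<alpha>: "\<alpha> > 0" "\<rho> (\<lambda>t. f t / \<alpha>) \<le> 1" and \<beta>: "\<beta> > 0" "\<rho> (\<lambda>t. g t / \<beta>) \<le> 1"
    using 3 by (auto simp: V_iff)
  have "\<rho> (\<lambda>t. (f t + g t) / (\<alpha> + \<beta>)) \<le> 1"
    using \<alpha> \<beta> by (intro modular_add_le_1) auto
  then show ?case using \<alpha> \<beta> by (auto simp: V_iff intro!: exI[of _ "\<alpha> + \<beta>"])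
next
  case (4 f c)
  then show ?case
    using L_scale_le(1)[OF 4, of c] by (cases "c = 0") (auto simp: V_iff intro!: exI[of _ 1])
next
  case (5 f g)
  then have [measurable]: "f \<in> borel_measurable M" "g \<in> borel_measurable M" by (auto simp: V_borel)
  have "\<rho> (\<lambda>t. g t / \<alpha>) = \<rho> (\<lambda>t. f t / \<alpha>)" for \<alpha>
    by (rule modular_cong) (measurable, use 5(3) in \<open>eventually_elim; simp\<close>)
  then show ?case using 5 by (simp add: V_iff)
next
  case (6 f g)
  then have [measurable]: "f \<in> borel_measurable M" "g \<in> borel_measurable M" by (auto simp: V_borel)
  have "\<rho> (\<lambda>t. g t / \<alpha>) = \<rho> (\<lambda>t. f t / \<alpha>)" for \<alpha>
    by (rule modular_cong) (measurable, use 6(3) in \<open>eventually_elim; simp\<close>)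
  then show ?case by (simp add: luxemburg_norm_def)
next
  case (7 f c)
  show ?case
  proof (cases "c = 0")
    case True
    have "L (\<lambda>_. 0) \<le> 0" by (rule dense_ge) (auto intro: L_le)
    moreover have "(\<lambda>_. 0) \<in> V" by (auto simp: V_iff intro!: exI[of _ 1])
    ultimately show ?thesis using True L_nonneg[of "\<lambda>_. 0"] by simp
  next
    case False
    have "L f = L (\<lambda>t. (1 / c) * (c * f t))" using False by simp
    also have "\<dots> \<le> \<bar>1 / c\<bar> * L (\<lambda>t. c * f t)"
      using False by (intro L_scale_le L_scale_le(1)[OF 7]) auto
    finally have "\<bar>c\<bar> * L f \<le> L (\<lambda>t. c * f t)" using False by (simp add: field_simps)
    then show ?thesis using L_scale_le(2)[OF 7 False] by simp
  qed
next
  case (8 f g)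
  then have [measurable]: "f \<in> borel_measurable M" "g \<in> borel_measurable M" by (auto simp: V_borel)
  have *: "L (\<lambda>t. f t + g t) \<le> \<alpha> + \<beta>" if "L f < \<alpha>" "L g < \<beta>" for \<alpha> \<beta>
  proof -
    note \<alpha> = modular_le_1[OF 8(1) that(1)] and \<beta> = modular_le_1[OF 8(2) that(2)]
    have "\<rho> (\<lambda>t. (f t + g t) / (\<alpha> + \<beta>)) \<le> 1"
      using \<alpha> \<beta> by (intro modular_add_le_1) auto
    then show ?thesis using \<alpha> \<beta> by (intro L_le) auto
  qed
  have "L (\<lambda>t. f t + g t) - L g \<le> \<alpha>" if \<alpha>: "L f < \<alpha>" for \<alpha>
  proof -
    have "L (\<lambda>t. f t + g t) - \<alpha> \<le> L g"
      by (rule dense_ge) (use *[OF \<alpha>] in \<open>auto simp: algebra_simps\<close>)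
    then show ?thesis by simp
  qed
  then have "L (\<lambda>t. f t + g t) - L g \<le> L f" by (rule dense_ge)
  then show ?case by simp
next
  case (9 f)
  then have [measurable]: "f \<in> borel_measurable M" by (auto simp: V_borel)
  have "\<rho> f \<le> ennreal \<alpha>" if "0 < \<alpha>" "\<alpha> \<le> 1" for \<alpha>
  proof -
    have "\<rho> f = \<rho> (\<lambda>t. \<alpha> * (f t / \<alpha>))" using that by simp
    also have "\<dots> \<le> ennreal \<alpha> * \<rho> (\<lambda>t. f t / \<alpha>)" using that by (intro modular_scale_le) auto
    also have "\<dots> \<le> ennreal \<alpha> * 1"
      using modular_le_1(2)[OF 9(1), of \<alpha>] 9(2) that by (intro mult_left_mono) auto
    finally show ?thesis by simp
  qed
  then have small: "\<rho> f \<le> ennreal (min \<alpha> 1)" if "\<alpha> > 0" for \<alpha> using that by simp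
  have "\<rho> f \<le> 0"
  proof (rule ennreal_le_epsilon)
    fix e :: real assume "0 < e"
    show "\<rho> f \<le> 0 + ennreal e"
      using order_trans[OF small[OF \<open>0 < e\<close>] ennreal_leI[of "min e 1" e]] by simp
  qed
  then have 0: "\<rho>f f = 0" "\<rho>i f = 0" by (auto simp: modular_eq)
  have "AE t in M. ennreal (\<bar>f t\<bar> powr q t) * indicator \<Omega>f t = 0"
    using 0(1) unfolding \<rho>f_def by (subst (asm) nn_integral_0_iff_AE) auto
  moreover have "AE t in M. t \<in> \<Omega>i \<longrightarrow> ennreal \<bar>f t\<bar> \<le> 0"
    using AE_le_\<rho>i[of f] 0(2) by simp
  moreover have "AE t in M. t \<in> space M" by simp
  ultimately show ?case
  proof eventually_elim
    case (elim t)
    show ?case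
    proof (cases "t \<in> \<Omega>f")
      case True
      then have "\<bar>f t\<bar> powr q t = 0" using elim(1) by (simp add: ennreal_eq_0_iff)
      then show ?thesis by simp
    next
      case False
      then have "t \<in> \<Omega>i" using elim(3) by (auto simp: finite_part_def infinite_part_def not_less top_unique)
      then show ?thesis using elim(2) by (simp add: ennreal_eq_0_iff)
    qed
  qed
qed

lemma var_Lp_eq: "var_Lp M p = X"
  by (simp add: var_Lp_def)

end

section \<open>Uniform convexity in the directions living where the exponent exceeds 1\<close>

lemma powr_midpoint_strict:
  fixes u v q :: real
  assumes "1 < q" "0 \<le> u" "u < v"
  shows "((u + v) / 2) powr q < (u powr q + v powr q) / 2"
proof -
  define s where "s = (u + v) / 2"
  have s: "u < s" "s < v" "v - s = s - u" using assms by (auto simp: s_def field_simps)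
  have cont: "continuous_on {a..b} (\<lambda>t. t powr q)" if "0 \<le> a" for a b :: real
    using that assms by (intro continuous_on_powr') (auto intro!: continuous_intros)
  have der: "((\<lambda>t. t powr q) has_real_derivative q * t powr (q - 1)) (at t)" if "0 < t" for t
    using that by (rule has_real_derivative_powr)
  have mvt: "\<exists>z. a < z \<and> z < b \<and> b powr q - a powr q = (b - a) * (q * z powr (q - 1))"
    if ab: "0 \<le> a" "a < b" for a b :: real
  proof -
    obtain l z where z: "a < z" "z < b" "((\<lambda>t. t powr q) has_real_derivative l) (at z)"
        "b powr q - a powr q = (b - a) * l"
    proof -
      have "(\<lambda>t. t powr q) differentiable (at t)" if "a < t" for t
        using der[of t] that ab(1) unfolding real_differentiable_def by (intro exI) simp
      then show ?thesis using MVT[OF ab(2) cont[OF ab(1)]] that by blast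
    qed
    moreover have "l = q * z powr (q - 1)"
      using DERIV_unique[OF z(3) der] z(1) ab(1) by simp
    ultimately show ?thesis by blast
  qed
  obtain z1 where z1: "u < z1" "z1 < s" "s powr q - u powr q = (s - u) * (q * z1 powr (q - 1))"
    using mvt[of u s] assms s by auto
  obtain z2 where z2: "s < z2" "z2 < v" "v powr q - s powr q = (v - s) * (q * z2 powr (q - 1))"
    using mvt[of s v] assms s by auto
  have "z1 powr (q - 1) < z2 powr (q - 1)"
    using z1 z2 assms by (intro powr_less_mono2) auto
  then have "s powr q - u powr q < v powr q - s powr q"
    unfolding z1(3) z2(3) s(3) using s assms by simp
  then show ?thesis by (simp add: s_def)
qed

lemma abs_powr_midpoint_strict:
  fixes a b q :: real
  assumes q: "1 < q" and ab: "a \<noteq> b"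
  shows "\<bar>(a + b) / 2\<bar> powr q < (\<bar>a\<bar> powr q + \<bar>b\<bar> powr q) / 2"
proof (cases "\<bar>a\<bar> = \<bar>b\<bar>")
  case True
  then have "b = - a" "a \<noteq> 0" using ab by (auto simp: abs_if split: if_splits)
  then show ?thesis by simp
next
  case False
  have "\<bar>(a + b) / 2\<bar> powr q \<le> ((\<bar>a\<bar> + \<bar>b\<bar>) / 2) powr q"
    using q by (intro powr_mono2) auto
  also have "\<dots> < (\<bar>a\<bar> powr q + \<bar>b\<bar> powr q) / 2"
    using powr_midpoint_strict[OF q, of "\<bar>a\<bar>" "\<bar>b\<bar>"] powr_midpoint_strict[OF q, of "\<bar>b\<bar>" "\<bar>a\<bar>"] False
    by (cases "\<bar>a\<bar> < \<bar>b\<bar>") (auto simp: add.commute)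
  finally show ?thesis .
qed

text \<open>Strict convexity is uniform on a compact set of values and exponents.\<close>

lemma uniform_midpoint_gap:
  fixes K \<eta> q0 P :: real
  assumes "1 < q0" "0 < \<eta>"
  shows "\<exists>\<delta>>0. \<forall>a b q. \<bar>a\<bar> \<le> K \<longrightarrow> \<bar>b\<bar> \<le> K \<longrightarrow> \<eta> \<le> \<bar>a - b\<bar> \<longrightarrow> q0 \<le> q \<longrightarrow> q \<le> P \<longrightarrow>
           \<bar>(a + b) / 2\<bar> powr q + \<delta> \<le> (\<bar>a\<bar> powr q + \<bar>b\<bar> powr q) / 2"
proof -
  define S where "S = ({-K..K} \<times> {-K..K} \<times> {q0..P}) \<inter> {z. \<eta> \<le> \<bar>fst z - fst (snd z)\<bar>}"
  define f where "f = (\<lambda>z::real \<times> real \<times> real. (\<bar>fst z\<bar> powr snd (snd z) + \<bar>fst (snd z)\<bar> powr snd (snd z)) / 2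
       - \<bar>(fst z + fst (snd z)) / 2\<bar> powr snd (snd z))"
  have "compact S"
    unfolding S_def by (intro compact_Int_closed compact_Times compact_Icc closed_Collect_le continuous_intros)
  moreover have "continuous_on S f"
    unfolding f_def using assms(1)
    by (intro continuous_on_diff continuous_on_divide continuous_on_add continuous_on_powr' continuous_intros)
       (auto simp: S_def)
  moreover have pos: "0 < f z" if "z \<in> S" for z
    using abs_powr_midpoint_strict[of "snd (snd z)" "fst z" "fst (snd z)"] that assms
    by (auto simp: S_def f_def)
  ultimately have "\<exists>\<delta>>0. \<forall>z\<in>S. \<delta> \<le> f z"
    using continuous_attains_inf[of S f] zero_less_one by (cases "S = {}") blast+
  then obtain \<delta> where \<delta>: "\<delta> > 0" "\<And>z. z \<in> S \<Longrightarrow> \<delta> \<le> f z" by blast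
  show ?thesis
  proof (intro exI[of _ \<delta>] conjI allI impI)
    fix a b q :: real
    assume "\<bar>a\<bar> \<le> K" "\<bar>b\<bar> \<le> K" "\<eta> \<le> \<bar>a - b\<bar>" "q0 \<le> q" "q \<le> P"
    then have "(a, b, q) \<in> S" by (auto simp: S_def)
    from \<delta>(2)[OF this] show "\<bar>(a + b) / 2\<bar> powr q + \<delta> \<le> (\<bar>a\<bar> powr q + \<bar>b\<bar> powr q) / 2"
      by (simp only: f_def fst_conv snd_conv le_diff_eq add.commute)
  qed (rule \<delta>)
qed

lemma (in sigma_finite_measure) finite_positive_subset:
  assumes A: "A \<in> sets M" "emeasure M A \<noteq> 0"
  obtains B where "B \<in> sets M" "B \<subseteq> A" "0 < emeasure M B" "emeasure M B < \<infinity>"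
proof (cases "emeasure M A = \<infinity>")
  case True
  then obtain Z where "Z \<in> sets M" "Z \<subseteq> A" "emeasure M Z < \<infinity>" "emeasure M Z > ennreal 1"
    using approx_PInf_emeasure_with_finite[OF A(1), of 1] by metis
  then show ?thesis using that[of Z] by (metis ennreal_1 order.strict_trans zero_less_one)
next
  case False
  then show ?thesis using that[of A] A by (auto simp: less_top zero_less_iff_neq_zero)
qed

context variable_exponent
begin

text \<open>
  Where the exponent is bounded away from 1 the midpoint inequality has a uniform gap as long as the
  values stay bounded. By Markov's inequality a function of modular at most 1 is bounded by \<open>K\<close> off
  a set of measure \<open>1 / K\<close>, so two such functions that differ by \<open>w\<close> keep a fixed
  amount of the gap.
\<close>

lemma modular_midpoint_gap:
  assumes bound: "AE t in M. t \<in> \<Omega>f \<longrightarrow> q t \<le> P"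
    and w [measurable]: "w \<in> borel_measurable M"
    and w_ne: "\<not> (AE t in M. t \<in> \<Omega>f \<and> 1 < q t \<longrightarrow> w t = 0)"
  shows "\<exists>\<delta>>0. \<forall>f\<in>borel_measurable M. \<forall>g\<in>borel_measurable M. \<rho> f \<le> 1 \<longrightarrow> \<rho> g \<le> 1 \<longrightarrow>
       (\<forall>t. \<bar>w t\<bar> \<le> \<bar>f t - g t\<bar>) \<longrightarrow> \<rho> (\<lambda>t. (f t + g t) / 2) + ennreal \<delta> \<le> 1"
proof -
  \<comment> \<open>The exponent keeps a distance from 1 and \<open>w\<close> keeps a distance from 0.\<close>
  define D where "D n = {t \<in> space M. t \<in> \<Omega>f \<and> 1 + 1 / real (Suc n) \<le> q t \<and> 1 / real (Suc n) \<le> \<bar>w t\<bar>}" for n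
  have D_sets [measurable]: "D n \<in> sets M" for n unfolding D_def by measurable
  have "\<exists>n. emeasure M (D n) \<noteq> 0"
  proof (rule ccontr)
    assume "\<nexists>n. emeasure M (D n) \<noteq> 0"
    then have "AE t in M. \<forall>n. t \<notin> D n"
      by (subst AE_all_countable) (auto intro!: AE_not_in simp: null_sets_def)
    moreover have "AE t in M. t \<in> space M" by simp
    ultimately have "AE t in M. t \<in> \<Omega>f \<and> 1 < q t \<longrightarrow> w t = 0"
    proof eventually_elim
      case (elim t)
      show ?case
      proof (rule impI, rule ccontr)
        assume t: "t \<in> \<Omega>f \<and> 1 < q t" and "w t \<noteq> 0"
        then have "0 < min (q t - 1) \<bar>w t\<bar>" by auto
        then obtain n where "inverse (real (Suc n)) < min (q t - 1) \<bar>w t\<bar>"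
          using reals_Archimedean by blast
        then have "t \<in> D n" using t elim unfolding D_def inverse_eq_divide min_less_iff_conj by (intro CollectI conjI) linarith+
        then show False using elim by blast
      qed
    qed
    then show False using w_ne by simp
  qed
  then obtain n where n: "emeasure M (D n) \<noteq> 0" by blast
  define q0 \<eta> where "q0 = 1 + 1 / real (Suc n)" and "\<eta> = 1 / real (Suc n)"
  have pos: "1 < q0" "0 < \<eta>" by (auto simp: q0_def \<eta>_def)
  obtain E where E [measurable]: "E \<in> sets M" and ED: "E \<subseteq> D n"
      and E_pos: "0 < emeasure M E" "emeasure M E < \<infinity>"
    using finite_positive_subset[OF D_sets n] .
  define m where "m = measure M E"
  have m_eq: "emeasure M E = ennreal m"
    unfolding m_def by (rule emeasure_eq_ennreal_measure) (use E_pos in simp)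
  moreover have "0 < m" using E_pos(1) unfolding m_eq by simp
  ultimately have m: "emeasure M E = ennreal m" "0 < m" by auto
  \<comment> \<open>With this bound the exceptional sets of two functions leave at least half of \<open>E\<close>.\<close>
  define K where "K = max 1 (4 / m)"
  have K: "1 \<le> K" "4 / m \<le> K" by (auto simp: K_def)
  obtain \<delta> where \<delta>: "0 < \<delta>" "\<And>a b q. \<bar>a\<bar> \<le> K \<Longrightarrow> \<bar>b\<bar> \<le> K \<Longrightarrow> \<eta> \<le> \<bar>a - b\<bar> \<Longrightarrow> q0 \<le> q \<Longrightarrow> q \<le> P \<Longrightarrow>
           \<bar>(a + b) / 2\<bar> powr q + \<delta> \<le> (\<bar>a\<bar> powr q + \<bar>b\<bar> powr q) / 2"
    using uniform_midpoint_gap[OF pos] by metis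
  have markov: "emeasure M {t \<in> E. K < \<bar>f t\<bar>} \<le> ennreal (m / 4)"
    if f [measurable]: "f \<in> borel_measurable M" and "\<rho> f \<le> 1" for f
  proof -
    have "ennreal K * emeasure M {t \<in> E. K < \<bar>f t\<bar>} = (\<integral>\<^sup>+t. ennreal K * indicator {t \<in> E. K < \<bar>f t\<bar>} t \<partial>M)"
      by (simp add: nn_integral_cmult_indicator)
    also have "\<dots> \<le> \<rho>f f"
      unfolding \<rho>f_def
    proof (rule nn_integral_mono)
      fix t
      show "ennreal K * indicator {t \<in> E. K < \<bar>f t\<bar>} t \<le> ennreal (\<bar>f t\<bar> powr q t) * indicator \<Omega>f t"
      proof (cases "t \<in> E \<and> K < \<bar>f t\<bar>")
        case True
        then have t: "t \<in> \<Omega>f" using ED by (auto simp: D_def)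
        have "K \<le> \<bar>f t\<bar> powr 1" using True K by simp
        also have "\<dots> \<le> \<bar>f t\<bar> powr q t"
          using True K q_ge_1[OF t] by (intro powr_mono) auto
        finally show ?thesis using True t by (simp add: ennreal_leI)
      qed auto
    qed
    also have "\<dots> \<le> \<rho> f" by (simp add: modular_eq)
    also have "\<dots> \<le> 1" by (rule that(2))
    finally have *: "ennreal K * emeasure M {t \<in> E. K < \<bar>f t\<bar>} \<le> 1" .
    have "emeasure M {t \<in> E. K < \<bar>f t\<bar>} \<le> emeasure M E" by (intro emeasure_mono) auto
    then have "emeasure M {t \<in> E. K < \<bar>f t\<bar>} = ennreal (measure M {t \<in> E. K < \<bar>f t\<bar>})"
      using E_pos by (intro emeasure_eq_ennreal_measure) (auto simp: top_unique)
    with * have "K * measure M {t \<in> E. K < \<bar>f t\<bar>} \<le> 1"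
      using K by (simp add: ennreal_mult'[symmetric])
    then have "measure M {t \<in> E. K < \<bar>f t\<bar>} \<le> 1 / K" using K by (simp add: field_simps)
    also have "1 / K \<le> m / 4" using K m by (simp add: field_simps)
    finally show ?thesis
      using \<open>emeasure M {t \<in> E. K < \<bar>f t\<bar>} = _\<close> by (simp add: ennreal_leI)
  qed
  show ?thesis
  proof (intro exI[of _ "\<delta> * (m / 2)"] conjI ballI impI)
    show "0 < \<delta> * (m / 2)" using \<delta> m by simp
  next
    fix f g
    assume f [measurable]: "f \<in> borel_measurable M" and g [measurable]: "g \<in> borel_measurable M"
      and \<rho>f1: "\<rho> f \<le> 1" and \<rho>g1: "\<rho> g \<le> 1" and fg: "\<forall>t. \<bar>w t\<bar> \<le> \<bar>f t - g t\<bar>"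
    define H where "H = {t \<in> E. \<bar>f t\<bar> \<le> K \<and> \<bar>g t\<bar> \<le> K}"
    have H [measurable]: "H \<in> sets M"
    proof -
      have "H = E \<inter> {t \<in> space M. \<bar>f t\<bar> \<le> K \<and> \<bar>g t\<bar> \<le> K}"
        using sets.sets_into_space[OF E] by (auto simp: H_def)
      then show ?thesis by simp
    qed
    have sub [measurable]: "{t \<in> E. K < \<bar>h t\<bar>} \<in> sets M" if [measurable]: "h \<in> borel_measurable M" for h
    proof -
      have "{t \<in> E. K < \<bar>h t\<bar>} = E \<inter> {t \<in> space M. K < \<bar>h t\<bar>}"
        using sets.sets_into_space[OF E] by auto
      then show ?thesis by simp
    qed
    have "E = H \<union> ({t \<in> E. K < \<bar>f t\<bar>} \<union> {t \<in> E. K < \<bar>g t\<bar>})" by (auto simp: H_def)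
    then have "emeasure M E \<le> emeasure M H + (emeasure M {t \<in> E. K < \<bar>f t\<bar>} + emeasure M {t \<in> E. K < \<bar>g t\<bar>})"
    proof -
      assume E_eq: "E = H \<union> ({t \<in> E. K < \<bar>f t\<bar>} \<union> {t \<in> E. K < \<bar>g t\<bar>})"
      have "emeasure M E \<le> emeasure M H + emeasure M ({t \<in> E. K < \<bar>f t\<bar>} \<union> {t \<in> E. K < \<bar>g t\<bar>})"
        by (subst E_eq, rule emeasure_subadditive[OF H sets.Un[OF sub[OF f] sub[OF g]]])
      also have "\<dots> \<le> emeasure M H + (emeasure M {t \<in> E. K < \<bar>f t\<bar>} + emeasure M {t \<in> E. K < \<bar>g t\<bar>})"
        by (rule add_left_mono, rule emeasure_subadditive[OF sub[OF f] sub[OF g]])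
      finally show ?thesis .
    qed
    also have "\<dots> \<le> emeasure M H + (ennreal (m / 4) + ennreal (m / 4))"
      using markov[OF f \<rho>f1] markov[OF g \<rho>g1] by (intro add_mono) auto
    finally have "ennreal m \<le> emeasure M H + ennreal (m / 2)"
      using m by (simp add: ennreal_plus[symmetric] del: ennreal_plus)
    moreover have "emeasure M H \<le> emeasure M E" by (intro emeasure_mono) (auto simp: H_def)
    then have H_eq: "emeasure M H = ennreal (measure M H)"
      using E_pos by (intro emeasure_eq_ennreal_measure) (auto simp: top_unique)
    ultimately have "m \<le> measure M H + m / 2"
      using m by (simp add: ennreal_plus[symmetric] del: ennreal_plus)
    then have Hm: "ennreal (m / 2) \<le> emeasure M H" unfolding H_eq by (simp add: ennreal_leI)
    let ?h = "\<lambda>t. (f t + g t) / 2"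
    let ?\<phi> = "\<lambda>h t. ennreal (\<bar>h t\<bar> powr q t) * indicator \<Omega>f t"
    have "\<rho>f ?h + ennreal \<delta> * emeasure M H = (\<integral>\<^sup>+t. ?\<phi> ?h t + ennreal \<delta> * indicator H t \<partial>M)"
      unfolding \<rho>f_def by (simp add: nn_integral_add nn_integral_cmult_indicator)
    also have "\<dots> \<le> (\<integral>\<^sup>+t. ennreal (1/2) * ?\<phi> f t + ennreal (1/2) * ?\<phi> g t \<partial>M)"
    proof (rule nn_integral_mono_AE)
      show "AE t in M. ?\<phi> ?h t + ennreal \<delta> * indicator H t \<le> ennreal (1/2) * ?\<phi> f t + ennreal (1/2) * ?\<phi> g t"
        using bound
      proof eventually_elim
        case (elim t)
        show ?case
        proof (cases "t \<in> \<Omega>f")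
          case True
          have "\<bar>?h t\<bar> powr q t + \<delta> * indicator H t \<le> (\<bar>f t\<bar> powr q t + \<bar>g t\<bar> powr q t) / 2"
          proof (cases "t \<in> H")
            case True
            then have "\<bar>f t\<bar> \<le> K" "\<bar>g t\<bar> \<le> K" "t \<in> D n" using ED by (auto simp: H_def)
            moreover have "\<eta> \<le> \<bar>f t - g t\<bar>" "q0 \<le> q t" "q t \<le> P"
              using \<open>t \<in> D n\<close> fg[rule_format, of t] elim by (auto simp: D_def \<eta>_def q0_def)
            ultimately show ?thesis using \<delta>(2)[of "f t" "g t" "q t"] True by simp
          next
            case False
            then show ?thesis
              using abs_powr_convex[OF q_ge_1[OF \<open>t \<in> \<Omega>f\<close>], of "1/2" "1/2" "f t" "g t"]
              by (simp add: add_divide_distrib)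
          qed
          then have "ennreal (\<bar>?h t\<bar> powr q t + \<delta> * indicator H t)
              \<le> ennreal (1/2 * \<bar>f t\<bar> powr q t + 1/2 * \<bar>g t\<bar> powr q t)"
            by (intro ennreal_leI) (simp add: add_divide_distrib)
          also have "\<dots> = ennreal (1/2) * ennreal (\<bar>f t\<bar> powr q t) + ennreal (1/2) * ennreal (\<bar>g t\<bar> powr q t)"
            by (subst ennreal_plus, simp, simp) (simp only: ennreal_mult' zero_le_divide_1_iff zero_le_numeral)
          also have "ennreal (\<bar>?h t\<bar> powr q t + \<delta> * indicator H t)
              = ennreal (\<bar>?h t\<bar> powr q t) + ennreal \<delta> * indicator H t"
            using \<delta>(1) by (subst ennreal_plus) (auto simp: indicator_def)
          finally show ?thesis using True by simp
        next
          case False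
          moreover have "t \<notin> H" using False ED by (auto simp: H_def D_def)
          ultimately show ?thesis by simp
        qed
      qed
    qed
    also have "\<dots> = ennreal (1/2) * \<rho>f f + ennreal (1/2) * \<rho>f g"
      unfolding \<rho>f_def by (simp add: nn_integral_add nn_integral_cmult del: ennreal_half)
    finally have 1: "\<rho>f ?h + ennreal \<delta> * emeasure M H \<le> ennreal (1/2) * \<rho>f f + ennreal (1/2) * \<rho>f g" .
    have 2: "\<rho>i ?h \<le> ennreal (1/2) * \<rho>i f + ennreal (1/2) * \<rho>i g"
    proof (subst \<rho>i_le_iff)
      show "AE t in M. t \<in> \<Omega>i \<longrightarrow> ennreal \<bar>?h t\<bar> \<le> ennreal (1/2) * \<rho>i f + ennreal (1/2) * \<rho>i g"
        using AE_le_\<rho>i[OF f] AE_le_\<rho>i[OF g]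
      proof eventually_elim
        case (elim t)
        show ?case
        proof
          assume t: "t \<in> \<Omega>i"
          have "ennreal \<bar>?h t\<bar> \<le> ennreal (1/2 * \<bar>f t\<bar> + 1/2 * \<bar>g t\<bar>)"
            by (intro ennreal_leI) simp
          also have "\<dots> = ennreal (1/2) * ennreal \<bar>f t\<bar> + ennreal (1/2) * ennreal \<bar>g t\<bar>"
            by (subst ennreal_plus, simp, simp) (simp only: ennreal_mult' zero_le_divide_1_iff zero_le_numeral)
          also have "\<dots> \<le> ennreal (1/2) * \<rho>i f + ennreal (1/2) * \<rho>i g"
            using elim t by (intro add_mono mult_left_mono) auto
          finally show "ennreal \<bar>?h t\<bar> \<le> ennreal (1/2) * \<rho>i f + ennreal (1/2) * \<rho>i g" .
        qed
      qed
    qed measurable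
    have "ennreal (\<delta> * (m / 2)) \<le> ennreal \<delta> * emeasure M H"
      using mult_left_mono[OF Hm, of "ennreal \<delta>"] ennreal_mult'[of \<delta> "m / 2"] \<delta>(1) by simp
    then have "(\<rho>f ?h + ennreal (\<delta> * (m / 2))) + \<rho>i ?h \<le> (\<rho>f ?h + ennreal \<delta> * emeasure M H) + \<rho>i ?h"
      by (intro add_right_mono add_left_mono)
    then have "\<rho> ?h + ennreal (\<delta> * (m / 2)) \<le> (\<rho>f ?h + ennreal \<delta> * emeasure M H) + \<rho>i ?h"
      unfolding modular_eq by (simp only: ac_simps)
    also have "\<dots> \<le> (ennreal (1/2) * \<rho>f f + ennreal (1/2) * \<rho>f g) + (ennreal (1/2) * \<rho>i f + ennreal (1/2) * \<rho>i g)"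
      using 1 2 by (rule add_mono)
    also have "\<dots> = ennreal (1/2) * \<rho> f + ennreal (1/2) * \<rho> g"
      unfolding modular_eq by (simp add: distrib_left ac_simps del: ennreal_half)
    also have "\<dots> \<le> ennreal (1/2) * 1 + ennreal (1/2) * 1"
      using \<rho>f1 \<rho>g1 by (intro add_mono mult_left_mono) auto
    also have "\<dots> = ennreal (1/2 + 1/2)" by (subst ennreal_plus) simp_all
    finally show "\<rho> ?h + ennreal (\<delta> * (m / 2)) \<le> 1" by simp
  qed
qed

text \<open>
  A bound for the exponent limits how fast the modular decays under contractions. This turns a gap
  in the modular into a gap in the norm.
\<close>

lemma modular_scale_ge:
  assumes bound: "AE t in M. t \<in> \<Omega>f \<longrightarrow> q t \<le> P" and P: "1 \<le> P"
    and f [measurable]: "f \<in> borel_measurable M" and c: "0 < c" "c \<le> 1"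
  shows "ennreal (c powr P) * \<rho> f \<le> \<rho> (\<lambda>t. c * f t)"
proof -
  have "ennreal (c powr P) * \<rho>f f = (\<integral>\<^sup>+t. ennreal (c powr P) * (ennreal (\<bar>f t\<bar> powr q t) * indicator \<Omega>f t) \<partial>M)"
    unfolding \<rho>f_def by (simp add: nn_integral_cmult)
  also have "\<dots> \<le> \<rho>f (\<lambda>t. c * f t)"
    unfolding \<rho>f_def
  proof (rule nn_integral_mono_AE)
    show "AE t in M. ennreal (c powr P) * (ennreal (\<bar>f t\<bar> powr q t) * indicator \<Omega>f t)
        \<le> ennreal (\<bar>c * f t\<bar> powr q t) * indicator \<Omega>f t"
      using bound
    proof eventually_elim
      case (elim t)
      show ?case
      proof (cases "t \<in> \<Omega>f")
        case True
        have "c powr P * \<bar>f t\<bar> powr q t \<le> c powr q t * \<bar>f t\<bar> powr q t"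
          using elim True c by (intro mult_right_mono powr_mono') auto
        then show ?thesis
          using True c by (simp add: abs_mult powr_mult ennreal_mult'[symmetric] ennreal_leI)
      qed simp
    qed
  qed
  finally have 1: "ennreal (c powr P) * \<rho>f f \<le> \<rho>f (\<lambda>t. c * f t)" .
  have "\<rho>i f \<le> ennreal (1 / c) * \<rho>i (\<lambda>t. c * f t)"
  proof (subst \<rho>i_le_iff)
    show "AE t in M. t \<in> \<Omega>i \<longrightarrow> ennreal \<bar>f t\<bar> \<le> ennreal (1 / c) * \<rho>i (\<lambda>t. c * f t)"
      using AE_le_\<rho>i[of "\<lambda>t. c * f t", OF borel_measurable_times[OF borel_measurable_const f]]
    proof eventually_elim
      case (elim t)
      show ?case
      proof
        assume "t \<in> \<Omega>i"
        then have "ennreal (1 / c) * ennreal \<bar>c * f t\<bar> \<le> ennreal (1 / c) * \<rho>i (\<lambda>t. c * f t)"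
          using elim by (intro mult_left_mono) auto
        then show "ennreal \<bar>f t\<bar> \<le> ennreal (1 / c) * \<rho>i (\<lambda>t. c * f t)"
          using c by (simp add: ennreal_mult'[symmetric] abs_mult)
      qed
    qed
  qed measurable
  then have "ennreal c * \<rho>i f \<le> ennreal c * (ennreal (1 / c) * \<rho>i (\<lambda>t. c * f t))"
    by (rule mult_left_mono) simp
  also have "\<dots> = \<rho>i (\<lambda>t. c * f t)"
    using c by (simp add: mult.assoc[symmetric] ennreal_mult'[symmetric])
  finally have "ennreal c * \<rho>i f \<le> \<rho>i (\<lambda>t. c * f t)" .
  moreover have "c powr P \<le> c powr 1" using c P by (intro powr_mono') auto
  then have "ennreal (c powr P) * \<rho>i f \<le> ennreal c * \<rho>i f"
    using c by (intro mult_right_mono ennreal_leI) auto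
  ultimately have 2: "ennreal (c powr P) * \<rho>i f \<le> \<rho>i (\<lambda>t. c * f t)" by simp
  show ?thesis unfolding modular_eq distrib_left using 1 2 by (rule add_mono)
qed

text \<open>
  If a point \<open>u\<close> is at almost maximal distance from the midpoint of \<open>x\<close> and \<open>y\<close> although its
  distances from \<open>x\<close> and \<open>y\<close> are not larger, then almost nothing of the gap is left; hence the
  midpoint of \<open>x\<close> and \<open>y\<close> can be diametral only if \<open>x\<close> and \<open>y\<close> agree where \<open>1 < p < \<infinity>\<close>.
\<close>

lemma diametral_midpoint_imp_agree:
  assumes bound: "AE t in M. t \<in> \<Omega>f \<longrightarrow> q t \<le> P"
    and x: "x \<in> V" and y: "y \<in> V" and U: "U \<subseteq> V" and d: "0 < d"
    and le: "\<And>u. u \<in> U \<Longrightarrow> L (\<lambda>t. x t - u t) \<le> d" "\<And>u. u \<in> U \<Longrightarrow> L (\<lambda>t. y t - u t) \<le> d"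
    and far: "\<And>r. r < d \<Longrightarrow> \<exists>u\<in>U. L (\<lambda>t. (x t + y t) / 2 - u t) > r"
  shows "AE t in M. t \<in> \<Omega>f \<and> 1 < q t \<longrightarrow> x t = y t"
proof (rule ccontr)
  have [measurable]: "x \<in> borel_measurable M" "y \<in> borel_measurable M"
    using x y by (auto simp: V_borel)
  define w where "w = (\<lambda>t. (x t - y t) / (2 * d))"
  assume "\<not> ?thesis"
  moreover have "w t = 0 \<longleftrightarrow> x t = y t" for t using d by (simp add: w_def)
  ultimately have w_ne: "\<not> (AE t in M. t \<in> \<Omega>f \<and> 1 < q t \<longrightarrow> w t = 0)" by simp
  have w: "w \<in> borel_measurable M" unfolding w_def by measurable
  obtain \<delta> where \<delta>: "0 < \<delta>"
    "\<forall>f\<in>borel_measurable M. \<forall>g\<in>borel_measurable M. \<rho> f \<le> 1 \<longrightarrow> \<rho> g \<le> 1 \<longrightarrow>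
       (\<forall>t. \<bar>w t\<bar> \<le> \<bar>f t - g t\<bar>) \<longrightarrow> \<rho> (\<lambda>t. (f t + g t) / 2) + ennreal \<delta> \<le> 1"
    using modular_midpoint_gap[OF bound w w_ne] by blast
  define P' where "P' = max 1 P"
  have P': "1 \<le> P'" by (simp add: P'_def)
  have bound': "AE t in M. t \<in> \<Omega>f \<longrightarrow> q t \<le> P'"
    using bound by eventually_elim (auto simp: P'_def)
  \<comment> \<open>The contraction factor \<open>c\<close> costs less of the modular than the gap \<open>\<delta>\<close> gains.\<close>
  define b where "b = max (1/2) (1 - \<delta> / 2)"
  define c where "c = b powr (1 / P')"
  have b: "0 < b" "b < 1" "1 < b + \<delta>" using \<delta>(1) by (auto simp: b_def max_def)
  have c: "0 < c" "c < 1" "c powr P' = b"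
    using b P' powr_less_mono2[of "1 / P'" b 1] by (auto simp: c_def powr_powr)
  \<comment> \<open>Chosen such that enlarging \<open>d\<close> by the factor \<open>1 + \<epsilon>\<close> and contracting by \<open>c\<close> yields
    \<open>d * (1 - \<epsilon>)\<close>.\<close>
  define \<epsilon> where "\<epsilon> = (1 - c) / (1 + c)"
  have \<epsilon>: "0 < \<epsilon>" "\<epsilon> \<le> 1" "1 - \<epsilon> = c * (1 + \<epsilon>)" using c by (auto simp: \<epsilon>_def field_simps)
  define d' where "d' = d * (1 + \<epsilon>)"
  have d': "d < d'" "d' \<le> 2 * d" "0 < d'" "d * (1 - \<epsilon>) = c * d'" "d * (1 - \<epsilon>) < d"
  proof -
    show "d < d'" using \<epsilon>(1) d by (simp add: d'_def)
    then show "0 < d'" using d by simp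
    show "d' \<le> 2 * d" using \<epsilon>(2) d mult_left_mono[of "1 + \<epsilon>" 2 d] by (simp add: d'_def mult.commute)
    show "d * (1 - \<epsilon>) = c * d'" unfolding \<epsilon>(3) d'_def by (simp only: mult_ac)
    show "d * (1 - \<epsilon>) < d" using \<epsilon>(1) d by (simp add: right_diff_distrib)
  qed
  obtain u where u: "u \<in> U" "c * d' < L (\<lambda>t. (x t + y t) / 2 - u t)"
    using far[of "d * (1 - \<epsilon>)"] d' by auto
  have [measurable]: "u \<in> borel_measurable M" using u U by (auto simp: V_borel)
  define f g where "f = (\<lambda>t. (x t - u t) / d')" and "g = (\<lambda>t. (y t - u t) / d')"
  have [measurable]: "f \<in> borel_measurable M" "g \<in> borel_measurable M"
    unfolding f_def g_def by measurable
  have uV: "u \<in> V" using u U by auto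
  have "\<rho> f \<le> 1" unfolding f_def
    by (rule modular_le_1) (use le(1)[OF u(1)] d' V_diff[OF x uV] in auto)
  moreover have "\<rho> g \<le> 1" unfolding g_def
    by (rule modular_le_1) (use le(2)[OF u(1)] d' V_diff[OF y uV] in auto)
  moreover have "\<bar>w t\<bar> \<le> \<bar>f t - g t\<bar>" for t
  proof -
    have "f t - g t = (x t - y t) / d'" unfolding f_def g_def by (simp add: diff_divide_distrib)
    moreover have "\<bar>x t - y t\<bar> / (2 * d) \<le> \<bar>x t - y t\<bar> / d'"
      using d' d by (intro divide_left_mono) auto
    ultimately show ?thesis using d d' by (simp add: w_def abs_divide)
  qed
  ultimately have small: "\<rho> (\<lambda>t. (f t + g t) / 2) + ennreal \<delta> \<le> 1"
    by (intro \<delta>(2)[rule_format]) auto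
  have mid: "(f t + g t) / 2 = ((x t + y t) / 2 - u t) / d'" for t
    using d' by (simp add: f_def g_def field_simps)
  have "\<not> \<rho> (\<lambda>t. ((x t + y t) / 2 - u t) / (c * d')) \<le> 1"
    using L_le[of "c * d'" "\<lambda>t. (x t + y t) / 2 - u t"] u(2) c d' by auto
  then have "1 \<le> \<rho> (\<lambda>t. ((x t + y t) / 2 - u t) / (c * d'))" by simp
  then have "ennreal (c powr P') * 1 \<le> ennreal (c powr P') * \<rho> (\<lambda>t. ((x t + y t) / 2 - u t) / (c * d'))"
    by (rule mult_left_mono) simp
  also have "\<dots> \<le> \<rho> (\<lambda>t. c * (((x t + y t) / 2 - u t) / (c * d')))"
    using c P' by (intro modular_scale_ge[OF bound']) auto
  also have "\<dots> = \<rho> (\<lambda>t. (f t + g t) / 2)"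
    using c unfolding mid by simp
  finally have "ennreal b + ennreal \<delta> \<le> 1"
    using order_trans[OF add_right_mono small] c(3) by (simp only: mult_1_right)
  then have "b + \<delta> \<le> 1"
    using b \<delta>(1) by (simp add: ennreal_plus[symmetric] del: ennreal_plus)
  then show False using b by simp
qed

end

section \<open>Atoms\<close>

context sigma_finite_measure
begin

lemma atom_finite:
  assumes "is_atom M A" shows "emeasure M A < \<infinity>"
proof -
  have A: "A \<in> sets M" "emeasure M A \<noteq> 0" using assms by (auto simp: is_atom_def)
  obtain B where B: "B \<in> sets M" "B \<subseteq> A" "0 < emeasure M B" "emeasure M B < \<infinity>"
    using finite_positive_subset[OF A] .
  then show ?thesis using assms by (auto simp: is_atom_def)
qed

lemma atom_dichotomy:
  assumes A: "is_atom M A" and P [measurable]: "Measurable.pred M P"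
  shows "(AE t in M. t \<in> A \<longrightarrow> P t) \<or> (AE t in M. t \<in> A \<longrightarrow> \<not> P t)"
proof -
  have [measurable]: "A \<in> sets M" using A by (simp add: is_atom_def)
  let ?B = "{t \<in> space M. t \<in> A \<and> P t}"
  have B: "?B \<in> sets M" "?B \<subseteq> A" by auto
  have "emeasure M ?B = 0 \<or> emeasure M ?B = emeasure M A"
    using A B unfolding is_atom_def by blast
  then show ?thesis
  proof
    assume "emeasure M ?B = 0"
    then have "AE t in M. t \<notin> ?B" using B(1) by (intro AE_not_in) (simp add: null_sets_def)
    moreover have "AE t in M. t \<in> space M" by simp
    ultimately show ?thesis by (intro disjI2, eventually_elim) auto
  next
    assume eq: "emeasure M ?B = emeasure M A"
    have "emeasure M (A - ?B) = emeasure M A - emeasure M ?B"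
      using atom_finite[OF A] eq by (intro emeasure_Diff B) auto
    then have "emeasure M (A - ?B) = 0" using eq atom_finite[OF A] by (simp add: ennreal_minus_eq_0)
    then have "AE t in M. t \<notin> A - ?B" by (intro AE_not_in) (simp add: null_sets_def)
    moreover have "AE t in M. t \<in> space M" by simp
    ultimately show ?thesis by (intro disjI1, eventually_elim) auto
  qed
qed

lemma AE_atom_nontrivial:
  assumes A: "is_atom M A" and "AE t in M. t \<in> A \<longrightarrow> P"
  shows P
proof (rule ccontr)
  assume "\<not> P"
  then have "AE t in M. t \<notin> A" using assms(2) by simp
  then have "emeasure M A = 0"
    using A AE_iff_null_sets[of A M] by (auto simp: is_atom_def dest: null_setsD1)
  then show False using A by (simp add: is_atom_def)
qed

text \<open>Each sublevel set of a measurable function is null or full in an atom; the jump occurs at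
  the value that the function takes almost everywhere.\<close>

lemma measurable_const_on_atom:
  fixes f :: "'a \<Rightarrow> real"
  assumes A: "is_atom M A" and f [measurable]: "f \<in> borel_measurable M"
  shows "\<exists>c. AE t in M. t \<in> A \<longrightarrow> f t = c"
proof -
  define S where "S = {r. AE t in M. t \<in> A \<longrightarrow> f t \<le> r}"
  have not_S: "AE t in M. t \<in> A \<longrightarrow> f t > r" if "r \<notin> S" for r
    using atom_dichotomy[OF A, of "\<lambda>t. f t \<le> r"] that by (auto simp: S_def not_le)
  have "S \<noteq> {}"
  proof
    assume "S = {}"
    then have "AE t in M. \<forall>n::nat. t \<in> A \<longrightarrow> f t > real n"
      using not_S by (subst AE_all_countable) auto
    then have "AE t in M. t \<in> A \<longrightarrow> False"
      by eventually_elim (metis not_less reals_Archimedean2 less_imp_le)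
    then show False by (rule AE_atom_nontrivial[OF A])
  qed
  have "\<exists>n::nat. - real n \<notin> S"
  proof (rule ccontr)
    assume "\<nexists>n::nat. - real n \<notin> S"
    then have "AE t in M. \<forall>n::nat. t \<in> A \<longrightarrow> f t \<le> - real n"
      by (subst AE_all_countable) (auto simp: S_def)
    then have "AE t in M. t \<in> A \<longrightarrow> False"
      by eventually_elim (metis minus_le_iff minus_minus not_less reals_Archimedean2)
    then show False by (rule AE_atom_nontrivial[OF A])
  qed
  then obtain n0 :: nat where n0: "- real n0 \<notin> S" by blast
  have up: "r' \<in> S" if "r \<in> S" "r \<le> r'" for r r'
  proof -
    have "AE t in M. t \<in> A \<longrightarrow> f t \<le> r" using that by (simp add: S_def)
    then have "AE t in M. t \<in> A \<longrightarrow> f t \<le> r'" by eventually_elim (use that in auto)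
    then show ?thesis by (simp add: S_def)
  qed
  have bdd: "bdd_below S"
    using n0 up by (intro bdd_belowI[of _ "- real n0"]) (metis linear)
  define c where "c = Inf S"
  have hi: "c + 1 / real (Suc n) \<in> S" for n
  proof -
    have "Inf S < c + 1 / real (Suc n)" by (simp add: c_def)
    then obtain r where "r \<in> S" "r < c + 1 / real (Suc n)"
      using cInf_lessD[OF \<open>S \<noteq> {}\<close>] by blast
    then show ?thesis using up by auto
  qed
  have lo: "c - 1 / real (Suc n) \<notin> S" for n
  proof
    assume "c - 1 / real (Suc n) \<in> S"
    then have "c \<le> c - 1 / real (Suc n)" unfolding c_def by (intro cInf_lower bdd) simp
    then show False by simp
  qed
  have "AE t in M. \<forall>n. t \<in> A \<longrightarrow> f t \<le> c + 1 / real (Suc n)"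
    using hi by (subst AE_all_countable) (auto simp: S_def)
  moreover have "AE t in M. \<forall>n. t \<in> A \<longrightarrow> f t > c - 1 / real (Suc n)"
    using not_S[OF lo] by (subst AE_all_countable) auto
  ultimately have "AE t in M. t \<in> A \<longrightarrow> f t = c"
  proof eventually_elim
    case (elim t)
    show ?case
    proof (rule impI, rule ccontr)
      assume t: "t \<in> A" and "f t \<noteq> c"
      then obtain n where "inverse (real (Suc n)) < \<bar>f t - c\<bar>"
        using reals_Archimedean[of "\<bar>f t - c\<bar>"] by auto
      then show False
        using elim(1)[rule_format, OF t, of n] elim(2)[rule_format, OF t, of n]
        by (simp add: inverse_eq_divide abs_if split: if_splits)
    qed
  qed
  then show ?thesis by blast
qed

text \<open>
  Exhaustion with respect to an equivalent finite measure: a countable union of atoms of maximal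
  measure leaves no atom, since this could be added to the union.
\<close>

lemma atomless_complement:
  assumes E: "E \<in> sets M"
  obtains \<A> where "countable \<A>" "\<And>A. A \<in> \<A> \<Longrightarrow> is_atom M A" "\<And>A. A \<in> \<A> \<Longrightarrow> A \<subseteq> E"
    "atomless M (E - \<Union>\<A>)"
proof -
  obtain h where h [measurable]: "h \<in> borel_measurable M" and fin: "integral\<^sup>N M h \<noteq> \<infinity>"
      and pos: "\<And>t. t \<in> space M \<Longrightarrow> 0 < h t"
    using Ex_finite_integrable_function by blast
  define N where "N = density M h"
  have sets_N [simp]: "sets N = sets M" by (simp add: N_def)
  define \<C> where "\<C> = {\<A>. countable \<A> \<and> (\<forall>A\<in>\<A>. is_atom M A \<and> A \<subseteq> E)}"
  have \<C>_sets: "\<Union>\<A> \<in> sets M" if "\<A> \<in> \<C>" for \<A>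
    using that by (intro sets.countable_Union) (auto simp: \<C>_def is_atom_def)
  have "{} \<in> \<C>" by (simp add: \<C>_def)
  then obtain F :: "nat \<Rightarrow> ennreal" where F: "range F \<subseteq> (\<lambda>\<A>. emeasure N (\<Union>\<A>)) ` \<C>"
      "(SUP \<A>\<in>\<C>. emeasure N (\<Union>\<A>)) = (SUP n. F n)"
    using ennreal_SUP_countable_SUP[of \<C> "\<lambda>\<A>. emeasure N (\<Union>\<A>)"] by blast
  then have "\<forall>n. \<exists>\<A>\<in>\<C>. F n = emeasure N (\<Union>\<A>)" by auto
  then obtain \<A>s where \<A>s: "\<And>n. \<A>s n \<in> \<C>" "\<And>n. F n = emeasure N (\<Union>(\<A>s n))" by metis
  define \<A> where "\<A> = (\<Union>n. \<A>s n)"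
  have \<A>: "\<A> \<in> \<C>" using \<A>s(1) by (auto simp: \<A>_def \<C>_def)
  have max: "emeasure N (\<Union>\<B>) \<le> emeasure N (\<Union>\<A>)" if "\<B> \<in> \<C>" for \<B>
  proof -
    have "emeasure N (\<Union>\<B>) \<le> (SUP n. F n)" using that unfolding F(2)[symmetric] by (intro SUP_upper)
    also have "\<dots> \<le> emeasure N (\<Union>\<A>)"
      using \<C>_sets[OF \<A>] by (intro SUP_least) (auto simp: \<A>s(2) \<A>_def intro!: emeasure_mono)
    finally show ?thesis .
  qed
  have "atomless M (E - \<Union>\<A>)"
    unfolding atomless_def
  proof (intro conjI allI impI)
    show "E - \<Union>\<A> \<in> sets M" using E \<C>_sets[OF \<A>] by auto
    fix A assume A: "is_atom M A"
    show "\<not> A \<subseteq> E - \<Union>\<A>"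
    proof
      assume sub: "A \<subseteq> E - \<Union>\<A>"
      have A_sets: "A \<in> sets M" "emeasure M A \<noteq> 0" using A by (auto simp: is_atom_def)
      have "insert A \<A> \<in> \<C>" using \<A> A sub by (auto simp: \<C>_def)
      from max[OF this] have "emeasure N (A \<union> \<Union>\<A>) \<le> emeasure N (\<Union>\<A>)" by simp
      moreover have "emeasure N (A \<union> \<Union>\<A>) = emeasure N A + emeasure N (\<Union>\<A>)"
        using sub A_sets \<C>_sets[OF \<A>] by (intro plus_emeasure[symmetric]) auto
      moreover have "emeasure N (\<Union>\<A>) \<noteq> top"
      proof -
        have "emeasure N (\<Union>\<A>) \<le> emeasure N (space M)"
          using sets.sets_into_space[OF \<C>_sets[OF \<A>]] by (intro emeasure_mono) auto
        also have "\<dots> = integral\<^sup>N M h"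
          by (simp add: N_def emeasure_density cong: nn_integral_cong)
        finally show ?thesis using fin by (auto simp: top_unique)
      qed
      ultimately have "emeasure N A = 0"
        using ennreal_add_left_cancel_le[of "emeasure N (\<Union>\<A>)" "emeasure N A" 0]
        by (simp add: add.commute)
      then have "AE t in M. h t * indicator A t = 0"
        using A_sets by (simp add: N_def emeasure_density nn_integral_0_iff_AE)
      moreover have "AE t in M. t \<in> space M" by simp
      ultimately have "AE t in M. t \<in> A \<longrightarrow> False"
        by eventually_elim (auto simp: indicator_def dest: pos)
      then show False using AE_atom_nontrivial[OF A] by blast
    qed
  qed
  then show thesis using that[of \<A>] \<A> by (auto simp: \<C>_def)
qed

text \<open>
  One atom of each class suffices: an atom disjoint from all of these would differ from the
  representative of its own class by a non-null set.
\<close>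

lemma finitely_many_atoms_complement:
  assumes E: "E \<in> sets M" and fin: "finitely_many_atoms M E"
  obtains \<A> where "finite \<A>" "\<And>A. A \<in> \<A> \<Longrightarrow> is_atom M A" "\<And>A. A \<in> \<A> \<Longrightarrow> A \<subseteq> E"
    "atomless M (E - \<Union>\<A>)"
proof -
  let ?Q = "{A. is_atom M A \<and> A \<subseteq> E} // null_eq M"
  have refl: "(A, A) \<in> null_eq M" if "is_atom M A" for A
    using that by (auto simp: null_eq_def is_atom_def)
  have "\<forall>c\<in>?Q. \<exists>A. is_atom M A \<and> A \<subseteq> E \<and> c = null_eq M `` {A}"
    by (auto simp: quotient_def)
  then obtain r where r: "\<And>c. c \<in> ?Q \<Longrightarrow> is_atom M (r c) \<and> r c \<subseteq> E \<and> c = null_eq M `` {r c}"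
    by metis
  define \<A> where "\<A> = r ` ?Q"
  have fin\<A>: "finite \<A>" using fin by (simp add: \<A>_def finitely_many_atoms_def)
  have \<A>: "is_atom M A \<and> A \<subseteq> E" if "A \<in> \<A>" for A
    using that r by (auto simp: \<A>_def)
  have U_sets: "\<Union>\<A> \<in> sets M"
    using fin\<A> \<A> by (intro sets.finite_Union) (auto simp: is_atom_def)
  have "atomless M (E - \<Union>\<A>)"
    unfolding atomless_def
  proof (intro conjI allI impI)
    show "E - \<Union>\<A> \<in> sets M" using E U_sets by auto
    fix A assume A: "is_atom M A"
    show "\<not> A \<subseteq> E - \<Union>\<A>"
    proof
      assume sub: "A \<subseteq> E - \<Union>\<A>"
      let ?c = "null_eq M `` {A}"
      have c: "?c \<in> ?Q" using A sub by (auto intro!: quotientI)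
      then have "A \<in> null_eq M `` {r ?c}" using r[OF c] refl[OF A] by auto
      then have "sym_diff (r ?c) A \<in> null_sets M" by (auto simp: null_eq_def)
      moreover have "A \<inter> r ?c = {}" using sub c by (auto simp: \<A>_def)
      then have "A \<subseteq> sym_diff (r ?c) A" by auto
      ultimately have "A \<in> null_sets M"
        using A null_sets_subset by (auto simp: is_atom_def)
      then show False using A by (auto simp: is_atom_def)
    qed
  qed
  then show thesis using that[of \<A>] fin\<A> \<A> by blast
qed

end

section \<open>Directions carried by the exponents one and infinity\<close>

text \<open>
  A weak cluster point need not be the limit of a subsequence, but countably many functionals can be
  made to converge to their values at it.
\<close>

lemma (in carrier_normed_space) weak_cluster_subsequence:
  fixes x :: "nat \<Rightarrow> 'v" and \<phi> :: "nat \<Rightarrow> 'v \<Rightarrow> real"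
  assumes C: "compactin (weak_topology X) C" and x: "\<And>n. x n \<in> C"
    and \<phi>: "\<And>i. \<phi> i \<in> dual_space X"
  obtains u r where "u \<in> C" "strict_mono r" "\<And>i. (\<lambda>k. \<phi> i (x (r k))) \<longlonglongrightarrow> \<phi> i u"
proof -
  obtain u where u: "u \<in> C" "\<forall>U. openin (weak_topology X) U \<longrightarrow> u \<in> U \<longrightarrow> (\<exists>\<^sub>\<infinity>n. x n \<in> U)"
    using weakly_compact_cluster_point[of C x] C x by metis
  have uX: "u \<in> pts X" using u(1) compactin_subset_topspace[OF C] by auto
  define W where "W k i = {y \<in> pts X. \<phi> i y \<in> ball (\<phi> i u) (1 / real (Suc k))}" for k i
  define U where "U k = (\<Inter>i\<in>{..k}. W k i)" for k
  have "openin (weak_topology X) (U k)" for k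
    unfolding U_def W_def
    by (rule openin_INT2) (simp_all only: finite_atMost open_ball openin_weak_functional[OF \<phi>], auto)
  moreover have "u \<in> U k" for k using uX by (auto simp: U_def W_def)
  ultimately have inf: "\<exists>\<^sub>\<infinity>n. x n \<in> U k" for k using u(2) by blast
  then have ex: "\<exists>n>m. x n \<in> U k" for k m unfolding INFM_nat by blast
  have "\<exists>r. \<forall>k. x (r k) \<in> U k \<and> r k < r (Suc k)"
    by (rule dependent_nat_choice) (use ex in blast)+
  then obtain r where r: "\<And>k. x (r k) \<in> U k" "\<And>k. r k < r (Suc k)" by blast
  show thesis
  proof (rule that[OF u(1)])
    show "strict_mono r" using r(2) by (simp add: strict_mono_Suc_iff)
    fix i
    show "(\<lambda>k. \<phi> i (x (r k))) \<longlonglongrightarrow> \<phi> i u"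
    proof (rule metric_LIMSEQ_I)
      fix e :: real assume "0 < e"
      then obtain N where N: "inverse (real (Suc N)) < e" using reals_Archimedean by blast
      show "\<exists>no. \<forall>k\<ge>no. dist (\<phi> i (x (r k))) (\<phi> i u) < e"
      proof (intro exI[of _ "max N i"] allI impI)
        fix k assume k: "max N i \<le> k"
        then have "x (r k) \<in> W k i" using r(1)[of k] by (auto simp: U_def)
        then have "dist (\<phi> i (x (r k))) (\<phi> i u) < 1 / real (Suc k)"
          by (auto simp: W_def metric_space_class.dist_commute)
        also have "\<dots> \<le> inverse (real (Suc N))"
          using k by (simp add: inverse_eq_divide frac_le)
        finally show "dist (\<phi> i (x (r k))) (\<phi> i u) < e" using N by simp
      qed
    qed
  qed
qed

context variable_exponent
begin

definition \<Omega>1 where "\<Omega>1 = {t \<in> space M. p t = 1}"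

lemma \<Omega>1_sets [measurable]: "\<Omega>1 \<in> sets M"
  unfolding \<Omega>1_def by measurable

lemma \<Omega>1_iff: "t \<in> \<Omega>1 \<longleftrightarrow> t \<in> \<Omega>f \<and> q t = 1"
proof -
  have "p t = 1" if "p t < top" "enn2real (p t) = 1"
    using that ennreal_enn2real[of "p t"] by simp
  then show ?thesis by (auto simp: \<Omega>1_def finite_part_def q_def)
qed

lemma \<Omega>1_not_\<Omega>i: "t \<in> \<Omega>1 \<Longrightarrow> t \<notin> \<Omega>i"
  by (auto simp: \<Omega>1_def infinite_part_def)

text \<open>
  The contributions of the exponents 1 and \<open>\<infinity>\<close> to the norm.
\<close>

definition n1 :: "('a \<Rightarrow> real) \<Rightarrow> real" where
  "n1 f = (\<integral>t. indicator \<Omega>1 t * \<bar>f t\<bar> \<partial>M)"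

definition ni :: "('a \<Rightarrow> real) \<Rightarrow> real" where
  "ni f = enn2real (\<rho>i f)"

lemma nn_integral_\<Omega>1_le:
  assumes f: "f \<in> V"
  shows "(\<integral>\<^sup>+t. ennreal (indicator \<Omega>1 t * \<bar>f t\<bar>) \<partial>M) \<le> ennreal (L f)"
proof (rule ennreal_le_epsilon)
  have [measurable]: "f \<in> borel_measurable M" using f by (rule V_borel)
  fix e :: real assume "0 < e"
  define \<alpha> where "\<alpha> = L f + e"
  have \<alpha>: "0 < \<alpha>" "\<rho> (\<lambda>t. f t / \<alpha>) \<le> 1" using modular_le_1[OF f, of \<alpha>] \<open>0 < e\<close> by (auto simp: \<alpha>_def)
  have "(\<integral>\<^sup>+t. ennreal (indicator \<Omega>1 t * \<bar>f t\<bar>) \<partial>M)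
      = (\<integral>\<^sup>+t. ennreal \<alpha> * ennreal (indicator \<Omega>1 t * \<bar>f t / \<alpha>\<bar>) \<partial>M)"
    using \<alpha>(1) by (intro nn_integral_cong) (simp add: ennreal_mult'[symmetric] abs_divide)
  also have "\<dots> = ennreal \<alpha> * (\<integral>\<^sup>+t. ennreal (indicator \<Omega>1 t * \<bar>f t / \<alpha>\<bar>) \<partial>M)"
    by (intro nn_integral_cmult) measurable
  also have "(\<integral>\<^sup>+t. ennreal (indicator \<Omega>1 t * \<bar>f t / \<alpha>\<bar>) \<partial>M) \<le> \<rho>f (\<lambda>t. f t / \<alpha>)"
    unfolding \<rho>f_def by (intro nn_integral_mono) (auto simp: indicator_def \<Omega>1_iff)
  also have "\<dots> \<le> \<rho> (\<lambda>t. f t / \<alpha>)" by (simp add: modular_eq)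
  also have "\<dots> \<le> 1" by (rule \<alpha>)
  finally show "(\<integral>\<^sup>+t. ennreal (indicator \<Omega>1 t * \<bar>f t\<bar>) \<partial>M) \<le> ennreal (L f) + ennreal e"
    using \<open>0 < e\<close> L_nonneg[OF f] by (simp add: \<alpha>_def mult_left_mono)
qed

lemma integrable_\<Omega>1:
  assumes f: "f \<in> V"
  shows "integrable M (\<lambda>t. indicator \<Omega>1 t * f t)" "n1 f \<le> L f" "0 \<le> n1 f"
proof -
  have [measurable]: "f \<in> borel_measurable M" using f by (rule V_borel)
  have eq: "(\<integral>\<^sup>+t. ennreal (norm (indicator \<Omega>1 t * f t)) \<partial>M) = (\<integral>\<^sup>+t. ennreal (indicator \<Omega>1 t * \<bar>f t\<bar>) \<partial>M)"
    by (intro nn_integral_cong) (simp add: abs_mult indicator_def)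
  show int: "integrable M (\<lambda>t. indicator \<Omega>1 t * f t)"
    unfolding integrable_iff_bounded eq using nn_integral_\<Omega>1_le[OF f]
    by (auto intro: le_less_trans)
  show 0: "0 \<le> n1 f" unfolding n1_def by (intro integral_nonneg_AE) auto
  have "ennreal (n1 f) = (\<integral>\<^sup>+t. ennreal (indicator \<Omega>1 t * \<bar>f t\<bar>) \<partial>M)"
    unfolding n1_def
    by (intro nn_integral_eq_integral[symmetric])
       (use integrable_abs[OF int] in \<open>auto simp: abs_mult\<close>)
  also have "\<dots> \<le> ennreal (L f)" by (rule nn_integral_\<Omega>1_le[OF f])
  finally show "n1 f \<le> L f" using L_nonneg[OF f] by simp
qed

lemma integrable_\<Omega>1_abs: "f \<in> V \<Longrightarrow> integrable M (\<lambda>t. indicator \<Omega>1 t * \<bar>f t\<bar>)"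
  using integrable_abs[OF integrable_\<Omega>1(1)] by (simp add: abs_mult)

lemma AE_le_ni:
  assumes f: "f \<in> V"
  shows "AE t in M. t \<in> \<Omega>i \<longrightarrow> \<bar>f t\<bar> \<le> ni f" "\<rho>i f = ennreal (ni f)" "ni f \<le> L f"
proof -
  have [measurable]: "f \<in> borel_measurable M" using f by (rule V_borel)
  have le: "\<rho>i f \<le> ennreal \<alpha>" if "L f < \<alpha>" for \<alpha>
  proof (subst \<rho>i_le_iff)
    note \<alpha> = modular_le_1[OF f that]
    have "\<rho>i (\<lambda>t. f t / \<alpha>) \<le> \<rho> (\<lambda>t. f t / \<alpha>)" by (simp add: modular_eq)
    then have "\<rho>i (\<lambda>t. f t / \<alpha>) \<le> 1" using \<alpha>(2) by simp
    then have "AE t in M. t \<in> \<Omega>i \<longrightarrow> ennreal \<bar>f t / \<alpha>\<bar> \<le> 1" by (subst (asm) \<rho>i_le_iff) auto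
    then show "AE t in M. t \<in> \<Omega>i \<longrightarrow> ennreal \<bar>f t\<bar> \<le> ennreal \<alpha>"
      by eventually_elim (use \<alpha>(1) in \<open>auto simp: ennreal_le_1 intro!: ennreal_leI\<close>)
  qed measurable
  have "\<rho>i f \<le> ennreal (L f + 1)" by (rule le) simp
  then have fin: "\<rho>i f < top" by (simp add: le_less_trans)
  then show eq: "\<rho>i f = ennreal (ni f)" by (simp add: ni_def)
  have ni0: "0 \<le> ni f" by (simp add: ni_def)
  show "AE t in M. t \<in> \<Omega>i \<longrightarrow> \<bar>f t\<bar> \<le> ni f"
    using AE_le_\<rho>i[of f] unfolding eq by (simp add: ni0)
  show "ni f \<le> L f"
  proof (rule dense_ge)
    fix \<alpha> assume "L f < \<alpha>"
    then show "ni f \<le> \<alpha>" using le[of \<alpha>] modular_le_1(1)[OF f, of \<alpha>] unfolding eq by simp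
  qed
qed

lemma ni_le:
  assumes f: "f \<in> V" and "AE t in M. t \<in> \<Omega>i \<longrightarrow> \<bar>f t\<bar> \<le> c" and "0 \<le> c"
  shows "ni f \<le> c"
proof -
  have "\<rho>i f \<le> ennreal c"
    by (subst \<rho>i_le_iff) (use assms V_borel[OF f] in \<open>auto simp: ennreal_leI elim: AE_mp\<close>)
  then show ?thesis using AE_le_ni(2)[OF f] assms(3) by simp
qed

lemma ni_nonneg: "0 \<le> ni f" by (simp add: ni_def)

lemma ni_add_le:
  assumes f: "f \<in> V" and g: "g \<in> V"
  shows "ni (\<lambda>t. f t + g t) \<le> ni f + ni g"
proof (rule ni_le[OF V_add[OF f g]])
  show "AE t in M. t \<in> \<Omega>i \<longrightarrow> \<bar>f t + g t\<bar> \<le> ni f + ni g"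
    using AE_le_ni(1)[OF f] AE_le_ni(1)[OF g] by eventually_elim auto
qed (simp add: ni_nonneg)

lemma n1_add_le:
  assumes f: "f \<in> V" and g: "g \<in> V"
  shows "n1 (\<lambda>t. f t + g t) \<le> n1 f + n1 g"
proof -
  have "n1 (\<lambda>t. f t + g t) \<le> (\<integral>t. indicator \<Omega>1 t * \<bar>f t\<bar> + indicator \<Omega>1 t * \<bar>g t\<bar> \<partial>M)"
    unfolding n1_def using integrable_\<Omega>1_abs[OF f] integrable_\<Omega>1_abs[OF g] integrable_\<Omega>1_abs[OF V_add[OF f g]]
    by (intro integral_mono) (auto simp: indicator_def)
  also have "\<dots> = n1 f + n1 g"
    unfolding n1_def using integrable_\<Omega>1_abs[OF f] integrable_\<Omega>1_abs[OF g] by simp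
  finally show ?thesis .
qed

text \<open>On functions living where the exponent is 1 or \<open>\<infinity>\<close> the modular is homogeneous, so that
  it is the norm: the space of these functions is the sum of an \<open>L\<^sup>1\<close> and an \<open>L\<^sup>\<infinity>\<close> space.\<close>

lemma L_eq_n1_add_ni:
  assumes f: "f \<in> V" and supp: "AE t in M. t \<in> \<Omega>f \<and> 1 < q t \<longrightarrow> f t = 0"
  shows "L f = n1 f + ni f"
proof -
  have [measurable]: "f \<in> borel_measurable M" using f by (rule V_borel)
  have \<rho>: "\<rho> (\<lambda>t. f t / \<alpha>) = ennreal ((n1 f + ni f) / \<alpha>)" if \<alpha>: "0 < \<alpha>" for \<alpha>
  proof -
    have "\<rho>f (\<lambda>t. f t / \<alpha>) = (\<integral>\<^sup>+t. ennreal (indicator \<Omega>1 t * \<bar>f t / \<alpha>\<bar>) \<partial>M)"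
      unfolding \<rho>f_def
    proof (rule nn_integral_cong_AE)
      show "AE t in M. ennreal (\<bar>f t / \<alpha>\<bar> powr q t) * indicator \<Omega>f t = ennreal (indicator \<Omega>1 t * \<bar>f t / \<alpha>\<bar>)"
        using supp
      proof eventually_elim
        case (elim t)
        show ?case
        proof (cases "t \<in> \<Omega>f")
          case True
          then show ?thesis using elim q_ge_1[OF True] by (cases "q t = 1") (auto simp: \<Omega>1_iff)
        qed (auto simp: \<Omega>1_iff)
      qed
    qed
    also have "\<dots> = ennreal (\<integral>t. indicator \<Omega>1 t * \<bar>f t / \<alpha>\<bar> \<partial>M)"
      using integrable_divide_zero[OF integrable_\<Omega>1_abs[OF f], of \<alpha>] \<alpha>
      by (intro nn_integral_eq_integral) (auto simp: abs_divide)
    also have "\<dots> = ennreal (n1 f / \<alpha>)" using \<alpha> by (simp add: n1_def abs_divide)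
    finally have 1: "\<rho>f (\<lambda>t. f t / \<alpha>) = ennreal (n1 f / \<alpha>)" .
    have g: "(\<lambda>t. f t / \<alpha>) \<in> V" using V_scale[OF f, of "1 / \<alpha>"] by simp
    have "ni (\<lambda>t. f t / \<alpha>) \<le> ni f / \<alpha>"
    proof (rule ni_le[OF g])
      show "AE t in M. t \<in> \<Omega>i \<longrightarrow> \<bar>f t / \<alpha>\<bar> \<le> ni f / \<alpha>"
        using AE_le_ni(1)[OF f] by eventually_elim (use \<alpha> in \<open>auto simp: abs_divide divide_right_mono\<close>)
    qed (use \<alpha> ni_nonneg in auto)
    moreover have "ni f \<le> \<alpha> * ni (\<lambda>t. f t / \<alpha>)"
    proof (rule ni_le[OF f])
      show "AE t in M. t \<in> \<Omega>i \<longrightarrow> \<bar>f t\<bar> \<le> \<alpha> * ni (\<lambda>t. f t / \<alpha>)"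
        using AE_le_ni(1)[OF g] by eventually_elim (use \<alpha> in \<open>auto simp: abs_divide field_simps\<close>)
    qed (use \<alpha> ni_nonneg in auto)
    ultimately have "ni (\<lambda>t. f t / \<alpha>) = ni f / \<alpha>" using \<alpha> by (simp add: field_simps)
    then have 2: "\<rho>i (\<lambda>t. f t / \<alpha>) = ennreal (ni f / \<alpha>)" using AE_le_ni(2)[OF g] by simp
    show ?thesis
      unfolding modular_eq 1 2 using integrable_\<Omega>1(3)[OF f] ni_nonneg[of f] \<alpha>
      by (simp add: add_divide_distrib ennreal_plus[symmetric] del: ennreal_plus)
  qed
  have 0: "0 \<le> n1 f + ni f" using integrable_\<Omega>1(3)[OF f] ni_nonneg[of f] by simp
  show ?thesis
  proof (rule antisym)
    show "L f \<le> n1 f + ni f"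
    proof (rule dense_ge)
      fix \<alpha> assume \<alpha>: "n1 f + ni f < \<alpha>"
      then have "0 < \<alpha>" using 0 by simp
      then show "L f \<le> \<alpha>" using \<alpha> 0 by (intro L_le) (auto simp: \<rho> ennreal_le_1)
    qed
    show "n1 f + ni f \<le> L f"
    proof (rule dense_ge)
      fix \<alpha> assume \<alpha>: "L f < \<alpha>"
      note * = modular_le_1[OF f \<alpha>]
      then show "n1 f + ni f \<le> \<alpha>" using 0 by (simp add: \<rho> ennreal_le_1 field_simps)
    qed
  qed
qed

subsection \<open>Evaluation at an atom\<close>

definition atom_value :: "'a set \<Rightarrow> ('a \<Rightarrow> real) \<Rightarrow> real" where
  "atom_value A f = (SOME c. AE t in M. t \<in> A \<longrightarrow> f t = c)"

lemma AE_atom_value: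
  assumes "is_atom M A" "f \<in> borel_measurable M"
  shows "AE t in M. t \<in> A \<longrightarrow> f t = atom_value A f"
  unfolding atom_value_def using measurable_const_on_atom[OF assms] by (rule someI_ex)

lemma atom_value_eqI:
  assumes A: "is_atom M A" and f: "f \<in> borel_measurable M" and c: "AE t in M. t \<in> A \<longrightarrow> f t = c"
  shows "atom_value A f = c"
proof (rule AE_atom_nontrivial[OF A])
  show "AE t in M. t \<in> A \<longrightarrow> atom_value A f = c"
    using AE_atom_value[OF A f] c by eventually_elim auto
qed

text \<open>
  The value on an atom is bounded by the mean of the absolute value if the exponent is 1 there, and
  by the essential supremum if it is \<open>\<infinity>\<close>.
\<close>

lemma atom_value_functional:
  assumes A: "is_atom M A" and sub: "A \<subseteq> \<Omega>1 \<or> A \<subseteq> \<Omega>i"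
  shows "(\<lambda>x. atom_value A (ae_rep x)) \<in> dual_space X"
    and "\<And>f. f \<in> V \<Longrightarrow> atom_value A (ae_rep (cl f)) = atom_value A f"
proof -
  have A_sets [measurable]: "A \<in> sets M" using A by (simp add: is_atom_def)
  have m: "0 < measure M A"
    using A atom_finite[OF A] by (simp add: is_atom_def measure_def enn2real_positive_iff)
  have bound: "\<bar>atom_value A f\<bar> \<le> max 1 (1 / measure M A) * L f" if f: "f \<in> V" for f
    using sub
  proof
    assume "A \<subseteq> \<Omega>i"
    have "AE t in M. t \<in> A \<longrightarrow> \<bar>atom_value A f\<bar> \<le> L f"
      using AE_atom_value[OF A V_borel[OF f]] AE_le_ni(1)[OF f]
      by eventually_elim (use \<open>A \<subseteq> \<Omega>i\<close> AE_le_ni(3)[OF f] in auto)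
    then have "\<bar>atom_value A f\<bar> \<le> L f" by (rule AE_atom_nontrivial[OF A])
    also have "\<dots> = 1 * L f" by simp
    also have "\<dots> \<le> max 1 (1 / measure M A) * L f"
      using L_nonneg[OF f] by (intro mult_right_mono) auto
    finally show ?thesis .
  next
    assume "A \<subseteq> \<Omega>1"
    have "measure M A * \<bar>atom_value A f\<bar> = (\<integral>t. indicator A t * \<bar>atom_value A f\<bar> \<partial>M)"
      using atom_finite[OF A] sets.sets_into_space[OF A_sets] by (simp add: Int_absorb1)
    also have "\<dots> \<le> n1 f"
      unfolding n1_def
    proof (rule integral_mono_AE)
      show "integrable M (\<lambda>t. indicator A t * \<bar>atom_value A f\<bar>)"
        using atom_finite[OF A] by (intro integrable_mult_left integrable_real_indicator) auto
      show "AE t in M. indicator A t * \<bar>atom_value A f\<bar> \<le> indicator \<Omega>1 t * \<bar>f t\<bar>"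
        using AE_atom_value[OF A V_borel[OF f]]
        by eventually_elim (use \<open>A \<subseteq> \<Omega>1\<close> in \<open>auto simp: indicator_def\<close>)
    qed (rule integrable_\<Omega>1_abs[OF f])
    also have "\<dots> \<le> L f" by (rule integrable_\<Omega>1[OF f])
    finally have "\<bar>atom_value A f\<bar> \<le> 1 / measure M A * L f" using m by (simp add: field_simps)
    also have "\<dots> \<le> max 1 (1 / measure M A) * L f"
      using L_nonneg[OF f] by (intro mult_right_mono) auto
    finally show ?thesis .
  qed
  have add: "atom_value A (\<lambda>t. f t + g t) = atom_value A f + atom_value A g" if "f \<in> V" "g \<in> V" for f g
  proof (rule atom_value_eqI[OF A])
    show "(\<lambda>t. f t + g t) \<in> borel_measurable M" using V_borel that by auto
    show "AE t in M. t \<in> A \<longrightarrow> f t + g t = atom_value A f + atom_value A g"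
      using AE_atom_value[OF A V_borel[OF that(1)]] AE_atom_value[OF A V_borel[OF that(2)]]
      by eventually_elim auto
  qed
  have scale: "atom_value A (\<lambda>t. c * f t) = c * atom_value A f" if "f \<in> V" for c f
  proof (rule atom_value_eqI[OF A])
    show "(\<lambda>t. c * f t) \<in> borel_measurable M" using V_borel that by auto
    show "AE t in M. t \<in> A \<longrightarrow> c * f t = c * atom_value A f"
      using AE_atom_value[OF A V_borel[OF that(1)]] by eventually_elim auto
  qed
  show "(\<lambda>x. atom_value A (ae_rep x)) \<in> dual_space X"
    and "\<And>f. f \<in> V \<Longrightarrow> atom_value A (ae_rep (cl f)) = atom_value A f"
    by (rule functional_on_classes[OF add scale bound]; assumption)+
qed

end

section \<open>Weak normal structure\<close>

context variable_exponent
begin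

lemma V_sum: "finite I \<Longrightarrow> (\<And>i. i \<in> I \<Longrightarrow> f i \<in> V) \<Longrightarrow> (\<lambda>t. \<Sum>i\<in>I. f i t) \<in> V"
  by (induction I rule: finite_induct) (auto intro: V_add V_zero)

lemma L_zero: "L (\<lambda>_. 0) = 0"
  using N_scale[OF V_zero, of 0] by simp

lemma L_sum:
  assumes "finite I" "\<And>i. i \<in> I \<Longrightarrow> f i \<in> V"
  shows "L (\<lambda>t. \<Sum>i\<in>I. f i t) \<le> (\<Sum>i\<in>I. L (f i))"
  using assms
proof (induction I rule: finite_induct)
  case (insert i I)
  then show ?case
    using N_triangle[of "f i" "\<lambda>t. \<Sum>i\<in>I. f i t"] V_sum[of I f] by fastforce
qed (simp add: L_zero)

lemma V_mid: "f \<in> V \<Longrightarrow> g \<in> V \<Longrightarrow> (\<lambda>t. (f t + g t) / 2) \<in> V"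
  using V_scale[OF V_add, of f g "1/2"] by (simp add: mult.commute)

lemma L_minus_commute: "f \<in> V \<Longrightarrow> g \<in> V \<Longrightarrow> L (\<lambda>t. f t - g t) = L (\<lambda>t. g t - f t)"
  using N_scale[OF V_diff, of g f "-1"] by simp

lemma ni_minus: "ni (\<lambda>t. - f t) = ni f"
  by (simp add: ni_def \<rho>i_def)

text \<open>
  The part of the norm coming from the exponent 1 splits along a sequence converging almost
  everywhere: by dominated convergence the distance to \<open>z\<close> exceeds the distance to the limit
  \<open>u\<close> asymptotically by the norm of \<open>u - z\<close>.
\<close>

lemma norm_splits_along_convergent:
  assumes Y: "\<And>k. Y k \<in> V" and u: "u \<in> V" and z: "z \<in> V"
    and suppY: "\<And>k. AE t in M. t \<in> \<Omega>f \<and> 1 < q t \<longrightarrow> Y k t = u t"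
    and suppz: "AE t in M. t \<in> \<Omega>f \<and> 1 < q t \<longrightarrow> z t = u t"
    and conv: "AE t in M. t \<in> \<Omega>1 \<longrightarrow> (\<lambda>k. Y k t) \<longlonglongrightarrow> u t"
    and ni0: "(\<lambda>k. ni (\<lambda>t. Y k t - u t)) \<longlonglongrightarrow> 0"
  shows "(\<lambda>k. L (\<lambda>t. Y k t - z t) - L (\<lambda>t. Y k t - u t)) \<longlonglongrightarrow> L (\<lambda>t. u t - z t)"
proof -
  have [measurable]: "u \<in> borel_measurable M" "z \<in> borel_measurable M" "\<And>k. Y k \<in> borel_measurable M"
    using Y u z by (auto simp: V_borel)
  note int = integrable_\<Omega>1_abs[OF V_diff[OF Y z]] integrable_\<Omega>1_abs[OF V_diff[OF Y u]]
      integrable_\<Omega>1_abs[OF V_diff[OF u z]]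
  have "(\<lambda>k. \<integral>t. indicator \<Omega>1 t * \<bar>Y k t - z t\<bar> - indicator \<Omega>1 t * \<bar>Y k t - u t\<bar> \<partial>M)
      \<longlonglongrightarrow> (\<integral>t. indicator \<Omega>1 t * \<bar>u t - z t\<bar> \<partial>M)"
  proof (rule integral_dominated_convergence[where w = "\<lambda>t. indicator \<Omega>1 t * \<bar>u t - z t\<bar>"])
    show "AE t in M. (\<lambda>k. indicator \<Omega>1 t * \<bar>Y k t - z t\<bar> - indicator \<Omega>1 t * \<bar>Y k t - u t\<bar>)
        \<longlonglongrightarrow> indicator \<Omega>1 t * \<bar>u t - z t\<bar>"
      using conv
    proof eventually_elim
      case (elim t)
      show ?case
      proof (cases "t \<in> \<Omega>1")
        case True
        then have "(\<lambda>k. Y k t) \<longlonglongrightarrow> u t" using elim by blast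
        then have "(\<lambda>k. \<bar>Y k t - z t\<bar> - \<bar>Y k t - u t\<bar>) \<longlonglongrightarrow> \<bar>u t - z t\<bar> - \<bar>u t - u t\<bar>"
          by (intro tendsto_intros)
        then show ?thesis using True by simp
      qed simp
    qed
    show "AE t in M. norm (indicator \<Omega>1 t * \<bar>Y k t - z t\<bar> - indicator \<Omega>1 t * \<bar>Y k t - u t\<bar>)
        \<le> indicator \<Omega>1 t * \<bar>u t - z t\<bar>" for k
      by (rule AE_I2) (auto simp: indicator_def)
    show "integrable M (\<lambda>t. indicator \<Omega>1 t * \<bar>u t - z t\<bar>)" by (rule int)
  qed measurable
  then have n1: "(\<lambda>k. n1 (\<lambda>t. Y k t - z t) - n1 (\<lambda>t. Y k t - u t)) \<longlonglongrightarrow> n1 (\<lambda>t. u t - z t)"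
    using int by (simp add: n1_def)
  have ni: "(\<lambda>k. ni (\<lambda>t. Y k t - z t)) \<longlonglongrightarrow> ni (\<lambda>t. u t - z t)"
  proof (rule LIMSEQ_I)
    fix e :: real assume "0 < e"
    then obtain N where N: "\<And>k. k \<ge> N \<Longrightarrow> norm (ni (\<lambda>t. Y k t - u t) - 0) < e"
      using LIMSEQ_D[OF ni0] by blast
    have "norm (ni (\<lambda>t. Y k t - z t) - ni (\<lambda>t. u t - z t)) < e" if "k \<ge> N" for k
    proof -
      have "ni (\<lambda>t. (Y k t - u t) + (u t - z t)) \<le> ni (\<lambda>t. Y k t - u t) + ni (\<lambda>t. u t - z t)"
        by (intro ni_add_le V_diff Y u z)
      moreover have "ni (\<lambda>t. (u t - Y k t) + (Y k t - z t)) \<le> ni (\<lambda>t. u t - Y k t) + ni (\<lambda>t. Y k t - z t)"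
        by (intro ni_add_le V_diff Y u z)
      moreover have "ni (\<lambda>t. u t - Y k t) = ni (\<lambda>t. Y k t - u t)"
        using ni_minus[of "\<lambda>t. Y k t - u t"] by simp
      ultimately show ?thesis using N[OF that] ni_nonneg[of "\<lambda>t. Y k t - u t"] by (simp add: abs_if)
    qed
    then show "\<exists>N. \<forall>k\<ge>N. norm (ni (\<lambda>t. Y k t - z t) - ni (\<lambda>t. u t - z t)) < e" by blast
  qed
  have supp_z: "AE t in M. t \<in> \<Omega>f \<and> 1 < q t \<longrightarrow> Y k t - z t = 0" for k
    using suppY[of k] suppz by eventually_elim auto
  have supp_u: "AE t in M. t \<in> \<Omega>f \<and> 1 < q t \<longrightarrow> Y k t - u t = 0" for k
    using suppY[of k] by eventually_elim auto
  have supp_uz: "AE t in M. t \<in> \<Omega>f \<and> 1 < q t \<longrightarrow> u t - z t = 0"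
    using suppz by eventually_elim auto
  have "(\<lambda>k. (n1 (\<lambda>t. Y k t - z t) - n1 (\<lambda>t. Y k t - u t)) + (ni (\<lambda>t. Y k t - z t) - ni (\<lambda>t. Y k t - u t)))
      \<longlonglongrightarrow> n1 (\<lambda>t. u t - z t) + (ni (\<lambda>t. u t - z t) - 0)"
    by (intro tendsto_add tendsto_diff n1 ni ni0)
  then show ?thesis
    by (simp add: L_eq_n1_add_ni[OF V_diff[OF Y z] supp_z] L_eq_n1_add_ni[OF V_diff[OF Y u] supp_u]
        L_eq_n1_add_ni[OF V_diff[OF u z] supp_uz] algebra_simps)
qed

text \<open>
  If all distances from the points \<open>Y j\<close> and from their midpoints tend to \<open>d\<close>, the splitting
  forces all of these points to have distance \<open>d / 2\<close> from the limit \<open>u\<close>. Hence the triangle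
  inequality is an equality for the differences \<open>Y j - u\<close>, which therefore have a common sign
  where \<open>p = 1\<close>. Integration against this sign is a functional that detects \<open>d / 2\<close>.
\<close>

lemma diametral_limit_functional:
  assumes Y: "\<And>k. Y k \<in> V" and u: "u \<in> V"
    and suppY: "\<And>k. AE t in M. t \<in> \<Omega>f \<and> 1 < q t \<longrightarrow> Y k t = u t"
    and conv: "AE t in M. t \<in> \<Omega>1 \<longrightarrow> (\<lambda>k. Y k t) \<longlonglongrightarrow> u t"
    and ni0: "(\<lambda>k. ni (\<lambda>t. Y k t - u t)) \<longlonglongrightarrow> 0"
    and far: "\<And>j. (\<lambda>k. L (\<lambda>t. Y k t - Y j t)) \<longlonglongrightarrow> d"
      "\<And>j l. j \<noteq> l \<Longrightarrow> (\<lambda>k. L (\<lambda>t. Y k t - (Y j t + Y l t) / 2)) \<longlonglongrightarrow> d"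
  shows "\<exists>F. (\<forall>f\<in>V. \<forall>g\<in>V. F (\<lambda>t. f t + g t) = F f + F g) \<and> (\<forall>c. \<forall>f\<in>V. F (\<lambda>t. c * f t) = c * F f) \<and>
    (\<forall>f\<in>V. \<bar>F f\<bar> \<le> L f) \<and> (\<lambda>k. F (Y k)) \<longlonglongrightarrow> F u + d / 2"
proof -
  have [measurable]: "u \<in> borel_measurable M" "\<And>k. Y k \<in> borel_measurable M"
    using Y u by (auto simp: V_borel)
  define w where "w k = (\<lambda>t. Y k t - u t)" for k
  have w: "w k \<in> V" for k unfolding w_def by (intro V_diff Y u)
  have [measurable]: "w k \<in> borel_measurable M" for k by (rule V_borel[OF w])
  have lim: "(\<lambda>k. L (w k)) \<longlonglongrightarrow> d - L (\<lambda>t. u t - z t)"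
    if z: "z \<in> V" "AE t in M. t \<in> \<Omega>f \<and> 1 < q t \<longrightarrow> z t = u t"
      and "(\<lambda>k. L (\<lambda>t. Y k t - z t)) \<longlonglongrightarrow> d" for z
    using tendsto_diff[OF that(3) norm_splits_along_convergent[OF Y u z(1) suppY z(2) conv ni0]]
    by (simp add: w_def)
  have Lw: "L (\<lambda>t. u t - Y j t) = L (w j)" for j
    unfolding w_def by (rule L_minus_commute[OF u Y])
  have lim_j: "(\<lambda>k. L (w k)) \<longlonglongrightarrow> d - L (w j)" for j
    using lim[OF Y suppY far(1)] unfolding Lw .
  have eq: "L (w j) = L (w 0)" for j
    using LIMSEQ_unique[OF lim_j[of j] lim_j[of 0]] by simp
  then have "(\<lambda>k. L (w k)) = (\<lambda>_. L (w 0))" by (intro ext)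
  then have "(\<lambda>k. L (w k)) \<longlonglongrightarrow> L (w 0)" by (simp only: tendsto_const)
  from LIMSEQ_unique[OF this lim_j[of 0]] have c: "L (w j) = d / 2" for j
    using eq[of j] by simp
  have supp: "AE t in M. t \<in> \<Omega>f \<and> 1 < q t \<longrightarrow> w j t = 0" for j
    using suppY[of j] by eventually_elim (simp add: w_def)
  have n1_add: "n1 (\<lambda>t. w j t + w l t) = n1 (w j) + n1 (w l)" if "j \<noteq> l" for j l
  proof -
    have "AE t in M. t \<in> \<Omega>f \<and> 1 < q t \<longrightarrow> (Y j t + Y l t) / 2 = u t"
      using suppY[of j] suppY[of l] by eventually_elim auto
    from LIMSEQ_unique[OF lim[OF V_mid[OF Y Y] this far(2)[OF that]] lim_j[of 0]]
    have "L (\<lambda>t. u t - (Y j t + Y l t) / 2) = d / 2" using c by simp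
    moreover have "L (\<lambda>t. w j t + w l t) = 2 * L (\<lambda>t. u t - (Y j t + Y l t) / 2)"
    proof -
      have "(\<lambda>t. w j t + w l t) = (\<lambda>t. (-2) * (u t - (Y j t + Y l t) / 2))"
        by (simp add: fun_eq_iff w_def field_simps)
      then show ?thesis using N_scale[OF V_diff[OF u V_mid[OF Y Y]], of "-2" j l] by simp
    qed
    ultimately have "L (\<lambda>t. w j t + w l t) = L (w j) + L (w l)" using c[of j] c[of l] by linarith
    moreover have "AE t in M. t \<in> \<Omega>f \<and> 1 < q t \<longrightarrow> w j t + w l t = 0"
      using supp[of j] supp[of l] by eventually_elim auto
    ultimately have "n1 (\<lambda>t. w j t + w l t) + ni (\<lambda>t. w j t + w l t)
        = (n1 (w j) + ni (w j)) + (n1 (w l) + ni (w l))"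
      using L_eq_n1_add_ni[OF V_add[OF w w]] L_eq_n1_add_ni[OF w supp] by simp
    then show ?thesis
      using n1_add_le[OF w w, of j l] ni_add_le[OF w w, of j l] by linarith
  qed
  have same_sign: "AE t in M. t \<in> \<Omega>1 \<longrightarrow> \<bar>w j t + w l t\<bar> = \<bar>w j t\<bar> + \<bar>w l t\<bar>" for j l
  proof (cases "j = l")
    case False
    let ?h = "\<lambda>t. indicator \<Omega>1 t * \<bar>w j t\<bar> + indicator \<Omega>1 t * \<bar>w l t\<bar> - indicator \<Omega>1 t * \<bar>w j t + w l t\<bar>"
    note int = integrable_\<Omega>1_abs[OF w, of j] integrable_\<Omega>1_abs[OF w, of l]
        integrable_\<Omega>1_abs[OF V_add[OF w w], of j l]
    have "(\<integral>t. ?h t \<partial>M) = 0"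
      using n1_add[OF False] int by (simp add: n1_def)
    moreover have "integrable M ?h" using int by auto
    moreover have "AE t in M. 0 \<le> ?h t" by (rule AE_I2) (auto simp: indicator_def)
    ultimately have "AE t in M. ?h t = 0" using integral_nonneg_eq_0_iff_AE by blast
    then show ?thesis by eventually_elim (auto simp: indicator_def)
  qed auto
  define \<sigma> :: "'a \<Rightarrow> real" where "\<sigma> t = (if \<exists>j. 0 < w j t then 1 else -1)" for t
  have [measurable]: "\<sigma> \<in> borel_measurable M" unfolding \<sigma>_def by measurable
  have "AE t in M. \<forall>j. \<forall>l. t \<in> \<Omega>1 \<longrightarrow> \<bar>w j t + w l t\<bar> = \<bar>w j t\<bar> + \<bar>w l t\<bar>"
    unfolding AE_all_countable using same_sign by blast
  then have sign: "AE t in M. t \<in> \<Omega>1 \<longrightarrow> (\<forall>j. \<sigma> t * w j t = \<bar>w j t\<bar>)"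
  proof eventually_elim
    case (elim t)
    show ?case
    proof (intro impI allI)
      fix j assume t: "t \<in> \<Omega>1"
      show "\<sigma> t * w j t = \<bar>w j t\<bar>"
      proof (cases "\<exists>i. 0 < w i t")
        case True
        then obtain i where i: "0 < w i t" by blast
        have "0 \<le> w j t" using elim[rule_format, OF t, of i j] i by (auto simp: abs_if split: if_splits)
        then show ?thesis using True by (simp add: \<sigma>_def)
      next
        case False
        then have "w j t \<le> 0" by (meson not_le)
        then show ?thesis using False by (simp add: \<sigma>_def)
      qed
    qed
  qed
  define F where "F f = (\<integral>t. \<sigma> t * (indicator \<Omega>1 t * f t) \<partial>M)" for f
  have int: "integrable M (\<lambda>t. \<sigma> t * (indicator \<Omega>1 t * f t))" if "f \<in> V" for f
    by (rule Bochner_Integration.integrable_bound[OF integrable_\<Omega>1(1)[OF that]])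
       (use V_borel[OF that] in \<open>auto simp: \<sigma>_def abs_mult\<close>)
  have F_add: "F (\<lambda>t. f t + g t) = F f + F g" if "f \<in> V" "g \<in> V" for f g
    unfolding F_def using int[OF that(1)] int[OF that(2)]
    by (subst Bochner_Integration.integral_add[symmetric]) (auto simp: algebra_simps)
  have F_scale: "F (\<lambda>t. c * f t) = c * F f" for c f
    unfolding F_def by (subst integral_mult_right_zero[symmetric]) (simp add: mult_ac)
  have F_bound: "\<bar>F f\<bar> \<le> L f" if "f \<in> V" for f
  proof -
    have "\<bar>F f\<bar> \<le> (\<integral>t. \<bar>\<sigma> t * (indicator \<Omega>1 t * f t)\<bar> \<partial>M)"
      unfolding F_def by (rule integral_abs_bound)
    also have "\<dots> = n1 f"
      unfolding n1_def by (rule Bochner_Integration.integral_cong) (auto simp: \<sigma>_def abs_mult)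
    also have "\<dots> \<le> L f" by (rule integrable_\<Omega>1[OF that])
    finally show ?thesis .
  qed
  have F_w: "F (w k) = n1 (w k)" for k
    unfolding F_def n1_def
    by (rule integral_cong_AE) (measurable, use sign in eventually_elim, auto simp: indicator_def)
  have "F (Y k) = F u + (L (w k) - ni (w k))" for k
  proof -
    have "F (Y k) = F (\<lambda>t. w k t + u t)" by (simp add: w_def)
    also have "\<dots> = F (w k) + F u" by (rule F_add[OF w u])
    also have "\<dots> = F u + (L (w k) - ni (w k))"
      using L_eq_n1_add_ni[OF w supp, of k] by (simp add: F_w)
    finally show ?thesis .
  qed
  moreover have "(\<lambda>k. F u + (L (w k) - ni (w k))) \<longlonglongrightarrow> F u + (d / 2 - 0)"
    unfolding c using ni0 unfolding w_def by (intro tendsto_intros)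
  ultimately have "(\<lambda>k. F (Y k)) \<longlonglongrightarrow> F u + d / 2" by simp
  then show ?thesis using F_add F_scale F_bound by blast
qed

text \<open>
  In a diametral set, choosing each point far from the arithmetic mean of the previous ones makes
  it far from every midpoint of two previous ones.
\<close>

lemma diametral_sequence:
  assumes C: "convex_in X C" and ne: "C \<noteq> {}"
    and le: "\<And>x y. x \<in> C \<Longrightarrow> y \<in> C \<Longrightarrow> vdist X x y \<le> d"
    and far: "\<And>x r. x \<in> C \<Longrightarrow> r < d \<Longrightarrow> \<exists>y\<in>C. r < vdist X x y"
  obtains a where "\<And>n. a n \<in> C"
    "\<And>j. (\<lambda>n. L (\<lambda>t. ae_rep (a n) t - ae_rep (a j) t)) \<longlonglongrightarrow> d"
    "\<And>j l. j \<noteq> l \<Longrightarrow> (\<lambda>n. L (\<lambda>t. ae_rep (a n) t - (ae_rep (a j) t + ae_rep (a l) t) / 2)) \<longlonglongrightarrow> d"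
proof -
  have CX: "C \<subseteq> pts X" using C by (simp add: convex_in_def)
  \<comment> \<open>The recursion runs over pairs of a point and the mean of the points up to it; only these two are
    needed to choose the next pair. The error \<open>1 / (n + 1)\<^sup>2\<close> is multiplied by \<open>n + 1\<close> later.\<close>
  define P where "P n z \<longleftrightarrow> fst z \<in> C \<and> snd z \<in> C \<and> (n = 0 \<longrightarrow> snd z = fst z)"
    for n :: nat and z :: "('a \<Rightarrow> real) set \<times> ('a \<Rightarrow> real) set"
  define Q where "Q n z z' \<longleftrightarrow> d - 1 / real (Suc n)^2 < vdist X (snd z) (fst z') \<and>
      snd z' = vadd X (vscale X (1 - 1 / real (n + 2)) (snd z)) (vscale X (1 / real (n + 2)) (fst z'))"
    for n :: nat and z z' :: "('a \<Rightarrow> real) set \<times> ('a \<Rightarrow> real) set"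
  have "\<exists>f. \<forall>n. P n (f n) \<and> Q n (f n) (f (Suc n))"
  proof (rule dependent_nat_choice)
    obtain x where "x \<in> C" using ne by blast
    then show "\<exists>z. P 0 z" by (auto simp: P_def)
  next
    fix z n assume z: "P n z"
    then obtain y where y: "y \<in> C" "d - 1 / real (Suc n)^2 < vdist X (snd z) y"
      using far[of "snd z" "d - 1 / real (Suc n)^2"] by (auto simp: P_def)
    let ?m = "vadd X (vscale X (1 - 1 / real (n + 2)) (snd z)) (vscale X (1 / real (n + 2)) y)"
    have "1 / real (n + 2) \<in> {0..1}" by simp
    then have "?m \<in> C" using C y z unfolding convex_in_def P_def by blast
    then show "\<exists>z'. P (Suc n) z' \<and> Q n z z'"
      using y by (intro exI[of _ "(y, ?m)"]) (auto simp: P_def Q_def)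
  qed
  then obtain f where f: "\<And>n. P n (f n)" "\<And>n. Q n (f n) (f (Suc n))" by blast
  define a where "a n = fst (f n)" for n
  define x where "x n = ae_rep (a n)" for n
  have aC: "a n \<in> C" for n using f(1) by (auto simp: P_def a_def)
  have xV: "x n \<in> V" and cl_x: "cl (x n) = a n" for n
    using rep_pts[of "a n"] aC CX by (auto simp: x_def)
  have dist_le: "L (\<lambda>t. x i t - x j t) \<le> d" for i j
    using le[OF aC aC, of i j] vdist_cl[OF xV xV, of i j] by (simp add: cl_x)
  define avg where "avg n = (\<lambda>t. (\<Sum>k\<le>n. x k t) / real (Suc n))" for n
  have avgV: "avg n \<in> V" for n
    using V_scale[OF V_sum[of "{..n}" x], of "1 / real (Suc n)"] xV by (simp add: avg_def)
  have snd_f: "snd (f n) = cl (avg n)" for n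
  proof (induction n)
    case 0
    then show ?case using f(1)[of 0] cl_x[of 0] by (simp add: P_def a_def avg_def)
  next
    case (Suc n)
    have "snd (f (Suc n)) = vadd X (vscale X (1 - 1 / real (n + 2)) (cl (avg n)))
        (vscale X (1 / real (n + 2)) (cl (x (Suc n))))"
      using f(2)[of n] Suc cl_x[of "Suc n"] by (simp add: Q_def a_def)
    also have "\<dots> = cl (\<lambda>t. (1 - 1 / real (n + 2)) * avg n t + 1 / real (n + 2) * x (Suc n) t)"
      by (simp only: vscale_cl vadd_cl avgV xV V_scale)
    also have "(\<lambda>t. (1 - 1 / real (n + 2)) * avg n t + 1 / real (n + 2) * x (Suc n) t) = avg (Suc n)"
    proof
      fix t
      have "1 - 1 / real (n + 2) = real (Suc n) / real (n + 2)" by (simp add: field_simps)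
      then have "(1 - 1 / real (n + 2)) * (s / real (Suc n)) + 1 / real (n + 2) * y = (s + y) / real (n + 2)"
        for s y :: real
        by (simp only: add_divide_distrib times_divide_times_eq mult.commute[of _ s]
            mult_divide_mult_cancel_right) simp
      from this[of "\<Sum>k\<le>n. x k t" "x (Suc n) t"]
      show "(1 - 1 / real (n + 2)) * avg n t + 1 / real (n + 2) * x (Suc n) t = avg (Suc n) t"
        by (simp add: avg_def)
    qed
    finally show ?case .
  qed
  have avg_far: "d - 1 / real (Suc n)^2 < L (\<lambda>t. avg n t - x (Suc n) t)" for n
    using f(2)[of n] vdist_cl[OF avgV xV, of n "Suc n"] by (simp add: Q_def snd_f cl_x flip: a_def)
  define mid where "mid j l = (\<lambda>t. (x j t + x l t) / 2)" for j l
  have midV: "mid j l \<in> V" for j l unfolding mid_def by (rule V_mid[OF xV xV])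
  have mid_triangle: "2 * L (\<lambda>t. mid j l t - x n t) \<le> L (\<lambda>t. x j t - x n t) + L (\<lambda>t. x l t - x n t)" for j l n
  proof -
    have "2 * L (\<lambda>t. mid j l t - x n t) = L (\<lambda>t. (x j t - x n t) + (x l t - x n t))"
    proof -
      have "(\<lambda>t. (x j t - x n t) + (x l t - x n t)) = (\<lambda>t. 2 * (mid j l t - x n t))"
        by (simp add: fun_eq_iff mid_def field_simps)
      then show ?thesis using N_scale[OF V_diff[OF midV xV], of 2 j l n] by simp
    qed
    also have "\<dots> \<le> L (\<lambda>t. x j t - x n t) + L (\<lambda>t. x l t - x n t)"
      by (intro N_triangle V_diff xV)
    finally show ?thesis .
  qed
  have mid_far: "d - 1 / real (Suc n) \<le> L (\<lambda>t. mid j l t - x (Suc n) t)"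
    if jl: "j \<noteq> l" "j \<le> n" "l \<le> n" for j l n
  proof -
    let ?e = "\<lambda>k t. x k t - x (Suc n) t"
    let ?R = "{..n} - {j, l}"
    have card: "card ?R = n - 1" using jl by (simp add: card_Diff_subset)
    have n1: "1 \<le> n" using jl by linarith
    have "real (Suc n) * L (\<lambda>t. avg n t - x (Suc n) t) = L (\<lambda>t. \<Sum>k\<le>n. ?e k t)"
    proof -
      have "(\<lambda>t. \<Sum>k\<le>n. ?e k t) = (\<lambda>t. real (Suc n) * (avg n t - x (Suc n) t))"
        by (simp only: fun_eq_iff avg_def sum_subtractf right_diff_distrib) simp
      then show ?thesis using N_scale[OF V_diff[OF avgV xV], of "real (Suc n)" n "Suc n"] by simp
    qed
    also have "(\<lambda>t. \<Sum>k\<le>n. ?e k t) = (\<lambda>t. 2 * (mid j l t - x (Suc n) t) + (\<Sum>k\<in>?R. ?e k t))"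
    proof
      fix t
      have "(\<Sum>k\<le>n. ?e k t) = (\<Sum>k\<in>{j, l}. ?e k t) + (\<Sum>k\<in>?R. ?e k t)"
        using jl by (subst sum.subset_diff[of "{j, l}" "{..n}"]) auto
      then show "(\<Sum>k\<le>n. ?e k t) = 2 * (mid j l t - x (Suc n) t) + (\<Sum>k\<in>?R. ?e k t)"
        using jl by (simp add: mid_def)
    qed
    also have "L \<dots> \<le> L (\<lambda>t. 2 * (mid j l t - x (Suc n) t)) + L (\<lambda>t. \<Sum>k\<in>?R. ?e k t)"
      by (intro N_triangle V_scale V_sum V_diff midV xV) simp
    also have "L (\<lambda>t. 2 * (mid j l t - x (Suc n) t)) = 2 * L (\<lambda>t. mid j l t - x (Suc n) t)"
      using N_scale[OF V_diff[OF midV xV], of 2] by simp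
    also have "L (\<lambda>t. \<Sum>k\<in>?R. ?e k t) \<le> (\<Sum>k\<in>?R. L (?e k))"
      by (intro L_sum V_diff xV) simp
    also have "\<dots> \<le> (\<Sum>k\<in>?R. d)" by (intro sum_mono dist_le)
    also have "\<dots> = (real n - 1) * d" using n1 by (simp add: card of_nat_diff)
    finally have "real (Suc n) * L (\<lambda>t. avg n t - x (Suc n) t)
        \<le> 2 * L (\<lambda>t. mid j l t - x (Suc n) t) + (real n - 1) * d" by simp
    moreover have "real (Suc n) * (d - 1 / real (Suc n)^2) \<le> real (Suc n) * L (\<lambda>t. avg n t - x (Suc n) t)"
      using avg_far[of n] by (intro mult_left_mono) auto
    moreover have "real (Suc n) * (d - 1 / real (Suc n)^2) = real (Suc n) * d - 1 / real (Suc n)"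
      by (simp add: power2_eq_square right_diff_distrib del: of_nat_Suc)
    moreover have "real (Suc n) * d = (real n - 1) * d + 2 * d" by (simp add: algebra_simps)
    ultimately have "2 * d - 1 / real (Suc n) \<le> 2 * L (\<lambda>t. mid j l t - x (Suc n) t)" by linarith
    moreover have "0 \<le> 1 / real (Suc n)" by simp
    ultimately show ?thesis by linarith
  qed
  have lim0: "(\<lambda>n. d - 1 / real (Suc n)) \<longlonglongrightarrow> d"
    using tendsto_diff[OF tendsto_const[of d] LIMSEQ_inverse_real_of_nat] by (simp add: inverse_eq_divide)
  have lim0': "(\<lambda>n. d - 2 * (1 / real (Suc n))) \<longlonglongrightarrow> d"
    using tendsto_diff[OF tendsto_const[of d] tendsto_mult_right_zero[OF LIMSEQ_inverse_real_of_nat, of 2]]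
    by (simp add: inverse_eq_divide)
  have mid_lim: "(\<lambda>n. L (\<lambda>t. x n t - mid j l t)) \<longlonglongrightarrow> d" if jl: "j \<noteq> l" for j l
  proof -
    have "(\<lambda>n. L (\<lambda>t. mid j l t - x (Suc n) t)) \<longlonglongrightarrow> d"
    proof (rule tendsto_sandwich[OF _ _ lim0 tendsto_const])
      show "\<forall>\<^sub>F n in sequentially. d - 1 / real (Suc n) \<le> L (\<lambda>t. mid j l t - x (Suc n) t)"
        using eventually_ge_at_top[of "max j l"] by eventually_elim (rule mid_far[OF jl], auto)
      show "\<forall>\<^sub>F n in sequentially. L (\<lambda>t. mid j l t - x (Suc n) t) \<le> d"
      proof (rule always_eventually, rule allI)
        fix n show "L (\<lambda>t. mid j l t - x (Suc n) t) \<le> d"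
          using mid_triangle[of j l "Suc n"] dist_le[of j "Suc n"] dist_le[of l "Suc n"] by linarith
      qed
    qed
    then have "(\<lambda>n. L (\<lambda>t. mid j l t - x n t)) \<longlonglongrightarrow> d" by (rule LIMSEQ_imp_Suc)
    then show ?thesis using L_minus_commute[OF midV xV] by simp
  qed
  have pt_lim: "(\<lambda>n. L (\<lambda>t. x n t - x j t)) \<longlonglongrightarrow> d" for j
  proof -
    have "(\<lambda>n. L (\<lambda>t. x j t - x (Suc n) t)) \<longlonglongrightarrow> d"
    proof (rule tendsto_sandwich[OF _ _ lim0' tendsto_const])
      show "\<forall>\<^sub>F n in sequentially. d - 2 * (1 / real (Suc n)) \<le> L (\<lambda>t. x j t - x (Suc n) t)"
        using eventually_ge_at_top[of "Suc j"]
      proof eventually_elim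
        case (elim n)
        have "d - 1 / real (Suc n) \<le> L (\<lambda>t. mid j (Suc j) t - x (Suc n) t)"
          using elim by (intro mid_far) auto
        then show ?case
          using mid_triangle[of j "Suc j" "Suc n"] dist_le[of "Suc j" "Suc n"] by linarith
      qed
    qed (use dist_le in simp)
    then have "(\<lambda>n. L (\<lambda>t. x j t - x n t)) \<longlonglongrightarrow> d" by (rule LIMSEQ_imp_Suc)
    then show ?thesis using L_minus_commute[OF xV xV] by simp
  qed
  show thesis
    by (rule that[of a, OF aC]) (use pt_lim mid_lim in \<open>simp_all add: x_def mid_def\<close>)
qed

text \<open>
  If all points of the set were diametral, a diametral sequence could be chosen that converges on all
  atoms. The functional detecting \<open>d / 2\<close> would then converge along the sequence to a limit other than
  its value at the weak cluster point.
\<close>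

theorem weak_normal_structure_if_atomic:
  assumes bound: "esssup_on M \<Omega>f p < \<infinity>"
    and fin: "finitely_many_atoms M \<Omega>i"
    and null: "\<And>E. E \<subseteq> {t \<in> space M. p t = 1 \<or> p t = \<infinity>} \<Longrightarrow> atomless M E \<Longrightarrow> E \<in> null_sets M"
  shows "weak_normal_structure X"
  unfolding weak_normal_structure_def
proof (intro allI impI, rule ccontr, elim conjE)
  fix C
  assume conv: "convex_in X C" and comp: "compactin (weak_topology X) C" and pos: "0 < diam X C"
    and no: "\<not> (\<exists>x\<in>C. radius_from X x C < diam X C)"
  have CX: "C \<subseteq> pts X" using conv by (simp add: convex_in_def)
  define P where "P = enn2real (esssup_on M \<Omega>f p)"
  have P: "AE t in M. t \<in> \<Omega>f \<longrightarrow> q t \<le> P"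
    using AE_le_esssup_on[OF parts_sets(1) p_measurable]
    by eventually_elim (use bound in \<open>auto simp: P_def q_def intro: enn2real_mono\<close>)
  obtain B where B: "\<And>x. x \<in> C \<Longrightarrow> vnorm X x \<le> B"
    using weakly_compact_bounded[OF comp] by blast
  have "vdist X x y \<le> 2 * B" if "x \<in> C" "y \<in> C" for x y
    using dist_le_norm_add[of x y] B[OF that(1)] B[OF that(2)] that CX by force
  then have "diam X C \<le> ennreal (2 * B)" by (rule diam_le)
  then have fin_diam: "diam X C < top" using le_less_trans ennreal_less_top by blast
  define d where "d = enn2real (diam X C)"
  have diam: "diam X C = ennreal d" and d: "0 < d"
    using fin_diam pos by (simp_all add: d_def enn2real_positive_iff)
  have le: "vdist X x y \<le> d" if "x \<in> C" "y \<in> C" for x y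
    using dist_le_diam[OF that] d by (simp add: diam)
  have far: "\<exists>y\<in>C. r < vdist X x y" if "x \<in> C" "r < d" for x r
  proof -
    have "ennreal (max 0 r) < ennreal d" using that d by (simp add: ennreal_less_iff)
    also have "\<dots> \<le> radius_from X x C" using no that(1) diam by (simp add: not_less)
    finally obtain y where "y \<in> C" "ennreal (max 0 r) < ennreal (vdist X x y)"
      unfolding radius_from_def less_SUP_iff by blast
    then have "max 0 r < vdist X x y" by (subst (asm) ennreal_less_iff) auto
    then show ?thesis using \<open>y \<in> C\<close> by auto
  qed
  have ne: "C \<noteq> {}" using pos by (auto simp: diam_def)
  have repV: "ae_rep x \<in> V" and cl_rep: "cl (ae_rep x) = x" if "x \<in> C" for x
    using rep_pts that CX by auto
  have agree: "AE t in M. t \<in> \<Omega>f \<and> 1 < q t \<longrightarrow> ae_rep x t = ae_rep y t" if x: "x \<in> C" and y: "y \<in> C" for x y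
  proof (rule diametral_midpoint_imp_agree[OF P repV[OF x] repV[OF y] _ d])
    show "ae_rep ` C \<subseteq> V" using repV by auto
    show "L (\<lambda>t. ae_rep x t - u t) \<le> d" "L (\<lambda>t. ae_rep y t - u t) \<le> d" if uC: "u \<in> ae_rep ` C" for u
    proof -
      obtain v where v: "v \<in> C" "u = ae_rep v" using uC by blast
      have "vdist X x v = L (\<lambda>t. ae_rep x t - u t)" "vdist X y v = L (\<lambda>t. ae_rep y t - u t)"
        using vdist_rep[of x v] vdist_rep[of y v] x y v CX by (simp_all add: subset_iff)
      then show "L (\<lambda>t. ae_rep x t - u t) \<le> d" "L (\<lambda>t. ae_rep y t - u t) \<le> d"
        using le[OF x v(1)] le[OF y v(1)] by simp_all
    qed
    fix r assume r: "r < d"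
    let ?m = "vadd X (vscale X (1 - 1/2) x) (vscale X (1/2) y)"
    have "1/2 \<in> {0..1::real}" by simp
    then have mC: "?m \<in> C" using conv x y unfolding convex_in_def by blast
    have "?m = vadd X (vscale X (1 - 1/2) (cl (ae_rep x))) (vscale X (1/2) (cl (ae_rep y)))"
      using cl_rep x y by simp
    also have "\<dots> = cl (\<lambda>t. (1 - 1/2) * ae_rep x t + 1/2 * ae_rep y t)"
      by (simp only: vscale_cl vadd_cl repV x y V_scale)
    also have "(\<lambda>t. (1 - 1/2) * ae_rep x t + 1/2 * ae_rep y t) = (\<lambda>t. (ae_rep x t + ae_rep y t) / 2)"
      by (simp add: fun_eq_iff field_simps)
    finally have m: "?m = cl (\<lambda>t. (ae_rep x t + ae_rep y t) / 2)" .
    obtain v where v: "v \<in> C" "r < vdist X ?m v" using far[OF mC r] by blast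
    then have "r < L (\<lambda>t. (ae_rep x t + ae_rep y t) / 2 - ae_rep v t)"
      using vdist_cl[OF V_mid[OF repV[OF x] repV[OF y]] repV[OF v(1)]] cl_rep[OF v(1)]
      unfolding m by simp
    then show "\<exists>u\<in>ae_rep ` C. r < L (\<lambda>t. (ae_rep x t + ae_rep y t) / 2 - u t)"
      using v(1) by blast
  qed
  obtain a where a: "\<And>n. a n \<in> C"
    "\<And>j. (\<lambda>n. L (\<lambda>t. ae_rep (a n) t - ae_rep (a j) t)) \<longlonglongrightarrow> d"
    "\<And>j l. j \<noteq> l \<Longrightarrow> (\<lambda>n. L (\<lambda>t. ae_rep (a n) t - (ae_rep (a j) t + ae_rep (a l) t) / 2)) \<longlonglongrightarrow> d"
    using diametral_sequence[OF conv ne le far] by blast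
  obtain \<A>1 where \<A>1: "countable \<A>1" "\<And>A. A \<in> \<A>1 \<Longrightarrow> is_atom M A" "\<And>A. A \<in> \<A>1 \<Longrightarrow> A \<subseteq> \<Omega>1"
      "atomless M (\<Omega>1 - \<Union>\<A>1)"
    using atomless_complement[OF \<Omega>1_sets] by blast
  obtain \<A>i where \<A>i: "finite \<A>i" "\<And>A. A \<in> \<A>i \<Longrightarrow> is_atom M A" "\<And>A. A \<in> \<A>i \<Longrightarrow> A \<subseteq> \<Omega>i"
      "atomless M (\<Omega>i - \<Union>\<A>i)"
    using finitely_many_atoms_complement[OF parts_sets(2) fin] by blast
  have "\<Omega>1 - \<Union>\<A>1 \<in> null_sets M"
    by (rule null[OF _ \<A>1(4)]) (auto simp: \<Omega>1_def)
  then have cover1: "AE t in M. t \<in> \<Omega>1 \<longrightarrow> t \<in> \<Union>\<A>1" by (auto dest: AE_not_in elim: AE_mp)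
  have "\<Omega>i - \<Union>\<A>i \<in> null_sets M"
    by (rule null[OF _ \<A>i(4)]) (auto simp: infinite_part_def)
  then have coveri: "AE t in M. t \<in> \<Omega>i \<longrightarrow> t \<in> \<Union>\<A>i" by (auto dest: AE_not_in elim: AE_mp)
  define \<T> where "\<T> = \<A>1 \<union> \<A>i"
  have \<T>: "countable \<T>" "\<And>A. A \<in> \<T> \<Longrightarrow> is_atom M A" "\<And>A. A \<in> \<T> \<Longrightarrow> A \<subseteq> \<Omega>1 \<or> A \<subseteq> \<Omega>i"
  proof -
    show "countable \<T>" unfolding \<T>_def by (intro countable_Un \<A>1(1) countable_finite \<A>i(1))
    show "is_atom M A" if "A \<in> \<T>" for A
      using that \<A>1(2)[of A] \<A>i(2)[of A] unfolding \<T>_def by blast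
    show "A \<subseteq> \<Omega>1 \<or> A \<subseteq> \<Omega>i" if "A \<in> \<T>" for A
      using that \<A>1(3)[of A] \<A>i(3)[of A] unfolding \<T>_def by blast
  qed
  define \<phi> where "\<phi> i = (if \<T> = {} then (\<lambda>_. 0) else (\<lambda>x. atom_value (from_nat_into \<T> i) (ae_rep x)))" for i
  have \<phi>: "\<phi> i \<in> dual_space X" for i
    using atom_value_functional(1) \<T>(2,3) from_nat_into[of \<T> i] by (auto simp: \<phi>_def)
  have \<phi>_T: "\<exists>i. \<phi> i = (\<lambda>x. atom_value A (ae_rep x))" if "A \<in> \<T>" for A
    using from_nat_into_surj[OF \<T>(1) that] that by (auto simp: \<phi>_def)
  obtain u r where u: "u \<in> C" and r: "strict_mono r"
      and \<phi>_lim: "\<And>i. (\<lambda>k. \<phi> i (a (r k))) \<longlonglongrightarrow> \<phi> i u"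
    by (rule weak_cluster_subsequence[of C a \<phi>, OF comp a(1) \<phi>]) blast
  define Y where "Y k = ae_rep (a (r k))" for k
  define U where "U = ae_rep u"
  have YV: "Y k \<in> V" for k unfolding Y_def by (rule repV[OF a(1)])
  have UV: "U \<in> V" unfolding U_def by (rule repV[OF u])
  have T_lim: "(\<lambda>k. atom_value A (Y k)) \<longlonglongrightarrow> atom_value A U" if AT: "A \<in> \<T>" for A
  proof -
    obtain i where i: "\<phi> i = (\<lambda>x. atom_value A (ae_rep x))" using \<phi>_T[OF AT] by blast
    show ?thesis using \<phi>_lim[of i] unfolding i Y_def U_def .
  qed
  have AE_value: "AE t in M. \<forall>A\<in>\<T>. t \<in> A \<longrightarrow> f t = atom_value A f" if "f \<in> V" for f
    using AE_atom_value[OF \<T>(2) V_borel[OF that]] by (subst AE_ball_countable[OF \<T>(1)]) auto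
  have "AE t in M. \<forall>k. \<forall>A\<in>\<T>. t \<in> A \<longrightarrow> Y k t = atom_value A (Y k)"
    unfolding AE_all_countable using AE_value[OF YV] by blast
  then have "AE t in M. t \<in> \<Omega>1 \<longrightarrow> (\<lambda>k. Y k t) \<longlonglongrightarrow> U t"
    using AE_value[OF UV] cover1
  proof eventually_elim
    case (elim t)
    show ?case
    proof
      assume "t \<in> \<Omega>1"
      then obtain A where A: "A \<in> \<T>" "t \<in> A" using elim(3) by (auto simp: \<T>_def)
      then show "(\<lambda>k. Y k t) \<longlonglongrightarrow> U t" using T_lim[OF A(1)] elim by simp
    qed
  qed
  moreover have "(\<lambda>k. ni (\<lambda>t. Y k t - U t)) \<longlonglongrightarrow> 0"
  proof (rule tendsto_sandwich[OF _ _ tendsto_const])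
    show "\<forall>\<^sub>F k in sequentially. 0 \<le> ni (\<lambda>t. Y k t - U t)" by (simp add: ni_nonneg)
    show "\<forall>\<^sub>F k in sequentially. ni (\<lambda>t. Y k t - U t) \<le> (\<Sum>A\<in>\<A>i. \<bar>atom_value A (Y k) - atom_value A U\<bar>)"
    proof (rule always_eventually, rule allI)
      fix k
      show "ni (\<lambda>t. Y k t - U t) \<le> (\<Sum>A\<in>\<A>i. \<bar>atom_value A (Y k) - atom_value A U\<bar>)"
      proof (rule ni_le[OF V_diff[OF YV UV]])
        show "AE t in M. t \<in> \<Omega>i \<longrightarrow> \<bar>Y k t - U t\<bar> \<le> (\<Sum>A\<in>\<A>i. \<bar>atom_value A (Y k) - atom_value A U\<bar>)"
          using AE_value[OF UV] AE_value[OF YV, of k] coveri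
        proof eventually_elim
          case (elim t)
          show ?case
          proof
            assume "t \<in> \<Omega>i"
            then obtain A where A: "A \<in> \<A>i" "t \<in> A" using elim(3) by auto
            then have "A \<in> \<T>" by (simp add: \<T>_def)
            then have "U t = atom_value A U" "Y k t = atom_value A (Y k)" using elim(1,2) A(2) by blast+
            then have "\<bar>Y k t - U t\<bar> = \<bar>atom_value A (Y k) - atom_value A U\<bar>" by simp
            also have "\<dots> \<le> (\<Sum>A\<in>\<A>i. \<bar>atom_value A (Y k) - atom_value A U\<bar>)"
              using \<A>i(1) A by (intro member_le_sum) auto
            finally show "\<bar>Y k t - U t\<bar> \<le> (\<Sum>A\<in>\<A>i. \<bar>atom_value A (Y k) - atom_value A U\<bar>)" .
          qed
        qed
      qed (simp add: sum_nonneg)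
    qed
    have "(\<lambda>k. \<Sum>A\<in>\<A>i. \<bar>atom_value A (Y k) - atom_value A U\<bar>) \<longlonglongrightarrow> (\<Sum>A\<in>\<A>i. \<bar>atom_value A U - atom_value A U\<bar>)"
      by (intro tendsto_intros T_lim) (simp add: \<T>_def)
    then show "(\<lambda>k. \<Sum>A\<in>\<A>i. \<bar>atom_value A (Y k) - atom_value A U\<bar>) \<longlonglongrightarrow> 0" by simp
  qed
  moreover have "(\<lambda>k. L (\<lambda>t. Y k t - Y j t)) \<longlonglongrightarrow> d" for j
    using LIMSEQ_subseq_LIMSEQ[OF a(2)[of "r j"] r] by (simp add: Y_def comp_def)
  moreover have "(\<lambda>k. L (\<lambda>t. Y k t - (Y j t + Y l t) / 2)) \<longlonglongrightarrow> d" if "j \<noteq> l" for j l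
  proof -
    have "r j \<noteq> r l" using strict_mono_eq[OF r] that by simp
    from LIMSEQ_subseq_LIMSEQ[OF a(3)[OF this] r] show ?thesis by (simp add: Y_def comp_def)
  qed
  moreover have "AE t in M. t \<in> \<Omega>f \<and> 1 < q t \<longrightarrow> Y k t = U t" for k
    unfolding Y_def U_def by (rule agree[OF a(1) u])
  ultimately obtain F where F': "\<forall>f\<in>V. \<forall>g\<in>V. F (\<lambda>t. f t + g t) = F f + F g"
      "\<forall>c. \<forall>f\<in>V. F (\<lambda>t. c * f t) = c * F f" "\<forall>f\<in>V. \<bar>F f\<bar> \<le> L f"
      and F_lim: "(\<lambda>k. F (Y k)) \<longlonglongrightarrow> F U + d / 2"
    using diametral_limit_functional[of Y U d, OF YV UV] by blast
  have F: "\<And>f g. f \<in> V \<Longrightarrow> g \<in> V \<Longrightarrow> F (\<lambda>t. f t + g t) = F f + F g"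
      "\<And>c f. f \<in> V \<Longrightarrow> F (\<lambda>t. c * f t) = c * F f" "\<And>f. f \<in> V \<Longrightarrow> \<bar>F f\<bar> \<le> 1 * L f"
    using F' by auto
  \<comment> \<open>A weak cluster point of the subsequence is determined by its values on the atoms, so it is
    \<open>u\<close> again, although \<open>F\<close> was not among the functionals used to find \<open>u\<close>.\<close>
  define \<phi>' where "\<phi>' i = (case i of 0 \<Rightarrow> (\<lambda>x. F (ae_rep x)) | Suc i \<Rightarrow> \<phi> i)" for i
  have \<phi>': "\<phi>' i \<in> dual_space X" for i
  proof -
    have "(\<lambda>x. F (ae_rep x)) \<in> dual_space X"
      by (rule functional_on_classes(1)[of F 1]) (use F in auto)
    then show ?thesis using \<phi> by (cases i) (simp_all add: \<phi>'_def)
  qed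
  obtain v s where v: "v \<in> C" and s: "strict_mono s"
      and \<phi>'_lim: "\<And>i. (\<lambda>k. \<phi>' i (a (r (s k)))) \<longlonglongrightarrow> \<phi>' i v"
    by (rule weak_cluster_subsequence[of C "\<lambda>k. a (r k)" \<phi>', OF comp a(1) \<phi>']) blast
  have "\<phi> i v = \<phi> i u" for i
    using LIMSEQ_unique[OF \<phi>'_lim[of "Suc i"]] LIMSEQ_subseq_LIMSEQ[OF \<phi>_lim[of i] s]
    by (simp add: \<phi>'_def comp_def)
  then have val: "atom_value A (ae_rep v) = atom_value A (ae_rep u)" if "A \<in> \<T>" for A
    using \<phi>_T[OF that] by (metis (mono_tags, lifting))
  have "AE t in M. t \<in> space M" by simp
  then have "AE t in M. ae_rep v t = ae_rep u t"
    using agree[OF v u] AE_value[OF repV[OF u]] AE_value[OF repV[OF v]] cover1 coveri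
  proof eventually_elim
    case (elim t)
    have "t \<in> \<Omega>f \<or> t \<in> \<Omega>i"
      using elim(1) by (cases "p t = top") (auto simp: finite_part_def infinite_part_def less_top)
    moreover have "t \<in> \<Omega>f \<Longrightarrow> q t = 1 \<or> 1 < q t" using q_ge_1[of t] by auto
    ultimately consider "t \<in> \<Omega>f" "1 < q t" | "t \<in> \<Omega>1" | "t \<in> \<Omega>i"
      using \<Omega>1_iff[of t] by blast
    then show ?case
    proof cases
      case 1
      then show ?thesis using elim(2) by blast
    next
      case 2
      then obtain A where "A \<in> \<T>" "t \<in> A" using elim(5) by (auto simp: \<T>_def)
      then show ?thesis using elim(3,4) val by simp
    next
      case 3
      then obtain A where "A \<in> \<T>" "t \<in> A" using elim(6) by (auto simp: \<T>_def)
      then show ?thesis using elim(3,4) val by simp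
    qed
  qed
  then have "v = u" using cl_eqI[OF repV[OF v] repV[OF u]] cl_rep u v by simp
  then have "(\<lambda>k. F (Y (s k))) \<longlonglongrightarrow> F U"
    using \<phi>'_lim[of 0] by (simp add: \<phi>'_def Y_def U_def)
  moreover have "(\<lambda>k. F (Y (s k))) \<longlonglongrightarrow> F U + d / 2"
    using LIMSEQ_subseq_LIMSEQ[OF F_lim s] by (simp add: comp_def)
  ultimately have "F U = F U + d / 2" by (rule LIMSEQ_unique)
  then show False using d by simp
qed

end

section \<open>Order intervals in L1 are weakly compact\<close>

lemma normed_function_space_L1:
  "normed_function_space M {f. integrable M f} (\<lambda>f. \<integral>t. \<bar>f t\<bar> \<partial>M)"
proof (unfold_locales, goal_cases)
  case (1 f) then show ?case by auto
next
  case 2 show ?case by (auto intro!: exI[of _ "\<lambda>_. 0"])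
next
  case (3 f g) then show ?case by auto
next
  case (4 f c) then show ?case by auto
next
  case (5 f g)
  then have "integrable M g \<longleftrightarrow> integrable M f"
    by (intro integrable_cong_AE) (auto elim: AE_mp)
  then show ?case using 5 by simp
next
  case (6 f g)
  then have "f \<in> borel_measurable M" "g \<in> borel_measurable M" by auto
  then show ?case
    by (intro integral_cong_AE) (use 6(3) in \<open>auto elim: AE_mp\<close>)
next
  case (7 f c) then show ?case by (simp add: abs_mult)
next
  case (8 f g)
  then have "(\<integral>t. \<bar>f t + g t\<bar> \<partial>M) \<le> (\<integral>t. \<bar>f t\<bar> + \<bar>g t\<bar> \<partial>M)"
    by (intro integral_mono) (auto intro: integrable_abs)
  also have "\<dots> = (\<integral>t. \<bar>f t\<bar> \<partial>M) + (\<integral>t. \<bar>g t\<bar> \<partial>M)"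
    using 8 by (intro Bochner_Integration.integral_add) (auto intro: integrable_abs)
  finally show ?case .
next
  case (9 f)
  then have "AE t in M. \<bar>f t\<bar> = 0"
    using integral_nonneg_eq_0_iff_AE[of M "\<lambda>t. \<bar>f t\<bar>"] integrable_abs[of M f] by auto
  then show ?case by eventually_elim simp
qed

text \<open>Domination by the measure makes a finitely additive set function continuous at the empty set,
  and then the Radon-Nikodym theorem applies.\<close>

lemma (in finite_measure) dominated_additive_density:
  fixes \<nu> :: "'a set \<Rightarrow> real"
  assumes add: "\<And>A B. A \<in> sets M \<Longrightarrow> B \<in> sets M \<Longrightarrow> A \<inter> B = {} \<Longrightarrow> \<nu> (A \<union> B) = \<nu> A + \<nu> B"
    and nonneg: "\<And>A. A \<in> sets M \<Longrightarrow> 0 \<le> \<nu> A"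
    and le: "\<And>A. A \<in> sets M \<Longrightarrow> \<nu> A \<le> c * measure M A"
    and c: "0 \<le> c"
  shows "\<exists>g\<in>borel_measurable M. (\<forall>t. 0 \<le> g t \<and> g t \<le> c) \<and>
           (\<forall>A\<in>sets M. \<nu> A = (\<integral>t. indicator A t * g t \<partial>M))"
proof -
  define N where "N = measure_of (space M) (sets M) (\<lambda>A. ennreal (\<nu> A))"
  have sets_N [simp]: "sets N = sets M" by (simp add: N_def sets.space_closed)
  have empty: "\<nu> {} = 0" using add[of "{}" "{}"] by simp
  have ca: "countably_additive (sets M) (\<lambda>A. ennreal (\<nu> A))"
  proof (rule sets.empty_continuous_imp_countably_additive)
    show "positive (sets M) (\<lambda>A. ennreal (\<nu> A))" by (simp add: positive_def empty)
    show "Measure_Space.additive (sets M) (\<lambda>A. ennreal (\<nu> A))"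
      unfolding Measure_Space.additive_def using add nonneg by (simp add: ennreal_plus)
    show "\<forall>A\<in>sets M. ennreal (\<nu> A) \<noteq> \<infinity>" by simp
    fix A :: "nat \<Rightarrow> 'a set"
    assume A: "range A \<subseteq> sets M" "decseq A" "(\<Inter>i. A i) = {}"
    have "(\<lambda>i. c * measure M (A i)) \<longlonglongrightarrow> c * measure M (\<Inter>i. A i)"
      by (intro tendsto_intros finite_Lim_measure_decseq A)
    then have "(\<lambda>i. c * measure M (A i)) \<longlonglongrightarrow> 0" using A(3) by simp
    then have "(\<lambda>i. \<nu> (A i)) \<longlonglongrightarrow> 0"
      by (rule tendsto_sandwich[OF _ _ tendsto_const, rotated 2])
         (use A(1) nonneg le in auto)
    then have "(\<lambda>i. ennreal (\<nu> (A i))) \<longlonglongrightarrow> ennreal 0" by (rule tendsto_ennrealI)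
    then show "(\<lambda>i. ennreal (\<nu> (A i))) \<longlonglongrightarrow> 0" by simp
  qed
  have em_N: "emeasure N A = ennreal (\<nu> A)" if "A \<in> sets M" for A
    unfolding N_def by (rule emeasure_measure_of_sigma)
      (use that ca empty sets.sigma_algebra_axioms in \<open>auto simp: positive_def\<close>)
  have "absolutely_continuous M N"
    unfolding absolutely_continuous_def
  proof
    fix A assume A: "A \<in> null_sets M"
    then have "A \<in> sets M" "measure M A = 0" by (auto simp: measure_def)
    then show "A \<in> null_sets N" using le[of A] nonneg[of A] by (auto simp: null_sets_def em_N)
  qed
  then obtain f where f [measurable]: "f \<in> borel_measurable M" and N: "density M f = N"
    using Radon_Nikodym[of N] sets_N by blast
  have int_f: "(\<integral>\<^sup>+t. f t * indicator A t \<partial>M) = ennreal (\<nu> A)" if "A \<in> sets M" for A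
    using em_N[OF that] that unfolding N[symmetric] by (simp add: emeasure_density)
  have "AE t in M. f t \<le> ennreal (c + 1 / real (Suc n))" for n
  proof -
    define b where "b = c + 1 / real (Suc n)"
    have "0 < 1 / real (Suc n)" by simp
    then have b: "c < b" "0 < b" using c unfolding b_def by linarith+
    define A where "A = {t \<in> space M. f t > ennreal b}"
    have A [measurable]: "A \<in> sets M" unfolding A_def by measurable
    have "ennreal b * emeasure M A = (\<integral>\<^sup>+t. ennreal b * indicator A t \<partial>M)"
      by (simp add: nn_integral_cmult_indicator)
    also have "\<dots> \<le> (\<integral>\<^sup>+t. f t * indicator A t \<partial>M)"
      by (intro nn_integral_mono) (auto simp: A_def indicator_def)
    also have "\<dots> = ennreal (\<nu> A)" by (rule int_f[OF A])
    also have "\<dots> \<le> ennreal (c * measure M A)" by (intro ennreal_leI le A)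
    finally have "b * measure M A \<le> c * measure M A"
      using b c by (simp add: emeasure_eq_measure ennreal_mult'[symmetric])
    then have "measure M A = 0" using b measure_nonneg[of M A] by (simp add: mult_le_cancel_right)
    then have "A \<in> null_sets M" by (simp add: null_sets_def emeasure_eq_measure)
    then have "AE t in M. t \<notin> A" by (rule AE_not_in)
    moreover have "AE t in M. t \<in> space M" by simp
    ultimately show ?thesis by eventually_elim (auto simp: A_def b_def)
  qed
  then have "AE t in M. \<forall>n. f t \<le> ennreal (c + 1 / real (Suc n))"
    by (simp add: AE_all_countable)
  then have f_le: "AE t in M. f t \<le> ennreal c"
  proof eventually_elim
    case (elim t)
    show ?case
    proof (rule ennreal_le_epsilon)
      fix e :: real assume "0 < e"
      then obtain n where "inverse (real (Suc n)) < e" using reals_Archimedean by blast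
      then have "ennreal (c + 1 / real (Suc n)) \<le> ennreal (c + e)"
        by (intro ennreal_leI) (simp add: inverse_eq_divide)
      then show "f t \<le> ennreal c + ennreal e"
        using elim[rule_format, of n] c \<open>0 < e\<close> by (simp add: ennreal_plus order_trans)
    qed
  qed
  define g where "g t = min c (enn2real (f t))" for t
  have [measurable]: "g \<in> borel_measurable M" unfolding g_def by measurable
  have g: "0 \<le> g t" "g t \<le> c" for t using c by (auto simp: g_def)
  have fg: "AE t in M. f t = ennreal (g t)"
    using f_le
  proof eventually_elim
    case (elim t)
    then have "f t < top" by (rule le_less_trans) simp
    then have "f t = ennreal (enn2real (f t))" by simp
    moreover from this have "enn2real (f t) \<le> c" using elim c by (metis ennreal_le_iff)
    ultimately show ?case by (simp add: g_def min_absorb2)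
  qed
  have "\<nu> A = (\<integral>t. indicator A t * g t \<partial>M)" if A [measurable]: "A \<in> sets M" for A
  proof -
    have "ennreal (\<nu> A) = (\<integral>\<^sup>+t. ennreal (indicator A t * g t) \<partial>M)"
      unfolding int_f[OF A, symmetric]
      by (rule nn_integral_cong_AE, use fg in eventually_elim) (auto simp: indicator_def)
    also have "\<dots> = ennreal (\<integral>t. indicator A t * g t \<partial>M)"
      by (rule nn_integral_eq_integral)
         (auto intro!: integrable_const_bound[where B = c] simp: indicator_def g c)
    finally show ?thesis using nonneg[OF A] g by (subst (asm) ennreal_inj) auto
  qed
  then show ?thesis using g by (intro bexI[of _ g]) auto
qed

locale finite_measure_L1 = finite_measure M for M :: "'a measure"
begin

sublocale normed_function_space M "{f. integrable M f}" "\<lambda>f. \<integral>t. \<bar>f t\<bar> \<partial>M"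
  by (rule normed_function_space_L1)

lemma integrable_bounded:
  "f \<in> borel_measurable M \<Longrightarrow> (\<And>t. \<bar>f t\<bar> \<le> B) \<Longrightarrow> integrable M (f :: 'a \<Rightarrow> real)"
  by (rule integrable_const_bound[where B = B]) auto

lemma integrable_mult_bounded:
  fixes f g :: "'a \<Rightarrow> real"
  assumes f: "integrable M f" and g: "g \<in> borel_measurable M" "\<And>t. \<bar>g t\<bar> \<le> B"
  shows "integrable M (\<lambda>t. f t * g t)"
proof (rule Bochner_Integration.integrable_bound)
  show "integrable M (\<lambda>t. B * f t)" using f by simp
  have B: "0 \<le> B" using g(2)[of undefined] by linarith
  show "AE t in M. norm (f t * g t) \<le> norm (B * f t)"
  proof (rule AE_I2)
    fix t
    have "\<bar>f t\<bar> * \<bar>g t\<bar> \<le> \<bar>f t\<bar> * B" by (intro mult_left_mono g(2)) simp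
    then show "norm (f t * g t) \<le> norm (B * f t)" using B by (simp add: abs_mult mult.commute)
  qed
qed (use f g in auto)

text \<open>
  On indicators, adding the norm bound times the measure turns a functional into a nonnegative set
  function dominated by the measure. Its density represents the functional on simple functions,
  hence everywhere.
\<close>

lemma dual_L1:
  assumes \<phi>: "\<phi> \<in> dual_space X"
  shows "\<exists>g B. g \<in> borel_measurable M \<and> (\<forall>t. \<bar>g t\<bar> \<le> B) \<and>
           (\<forall>f. integrable M f \<longrightarrow> \<phi> (cl f) = (\<integral>t. f t * g t \<partial>M))"
proof -
  obtain K where K: "\<And>x. x \<in> pts X \<Longrightarrow> \<bar>\<phi> x\<bar> \<le> K * vnorm X x"
    using \<phi> unfolding dual_space_def by blast
  define \<kappa> where "\<kappa> = \<bar>K\<bar>"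
  have \<kappa>: "\<bar>\<phi> (cl f)\<bar> \<le> \<kappa> * (\<integral>t. \<bar>f t\<bar> \<partial>M)" if "integrable M f" for f
  proof -
    have "\<bar>\<phi> (cl f)\<bar> \<le> K * (\<integral>t. \<bar>f t\<bar> \<partial>M)"
      using K[of "cl f"] that vnorm_cl[of f] by simp
    also have "\<dots> \<le> \<kappa> * (\<integral>t. \<bar>f t\<bar> \<partial>M)"
      by (rule mult_right_mono) (auto simp: \<kappa>_def)
    finally show ?thesis .
  qed
  have \<kappa>0: "0 \<le> \<kappa>" by (simp add: \<kappa>_def)
  have \<phi>_add: "\<phi> (cl (\<lambda>t. f t + h t)) = \<phi> (cl f) + \<phi> (cl h)" if "integrable M f" "integrable M h" for f h
  proof -
    have "cl f \<in> pts X" "cl h \<in> pts X" using that by simp_all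
    then have "\<phi> (vadd X (cl f) (cl h)) = \<phi> (cl f) + \<phi> (cl h)"
      using \<phi> unfolding dual_space_def by blast
    then show ?thesis using vadd_cl[of f h] that by simp
  qed
  have \<phi>_scale: "\<phi> (cl (\<lambda>t. c * f t)) = c * \<phi> (cl f)" if "integrable M f" for c f
  proof -
    have "cl f \<in> pts X" using that by simp
    then have "\<phi> (vscale X c (cl f)) = c * \<phi> (cl f)"
      using \<phi> unfolding dual_space_def by blast
    then show ?thesis using vscale_cl[of f c] that by simp
  qed
  define \<nu> where "\<nu> A = \<phi> (cl (indicator A)) + \<kappa> * measure M A" for A
  have ind: "integrable M (indicator A :: 'a \<Rightarrow> real)" if "A \<in> sets M" for A
    using that by (intro integrable_real_indicator) (auto simp: emeasure_eq_measure)
  have \<nu>_bounds: "0 \<le> \<nu> A \<and> \<nu> A \<le> 2 * \<kappa> * measure M A" if "A \<in> sets M" for A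
    using \<kappa>[OF ind[OF that]] that by (auto simp: \<nu>_def abs_le_iff Int_absorb2 sets.sets_into_space)
  have "\<exists>g\<in>borel_measurable M. (\<forall>t. 0 \<le> g t \<and> g t \<le> 2 * \<kappa>) \<and>
           (\<forall>A\<in>sets M. \<nu> A = (\<integral>t. indicator A t * g t \<partial>M))"
  proof (rule dominated_additive_density)
    fix A B assume AB: "A \<in> sets M" "B \<in> sets M" "A \<inter> B = {}"
    have "indicator (A \<union> B) = (\<lambda>t. indicator A t + indicator B t :: real)"
      using AB by (auto simp: indicator_def fun_eq_iff)
    then show "\<nu> (A \<union> B) = \<nu> A + \<nu> B"
      using \<phi>_add[OF ind ind, of A B] AB finite_measure_Union[of A B] by (simp add: \<nu>_def algebra_simps)
  qed (use \<nu>_bounds \<kappa>0 in auto)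
  then obtain g where g [measurable]: "g \<in> borel_measurable M" and g_bd: "\<And>t. 0 \<le> g t \<and> g t \<le> 2 * \<kappa>"
      and \<nu>_g: "\<And>A. A \<in> sets M \<Longrightarrow> \<nu> A = (\<integral>t. indicator A t * g t \<partial>M)" by blast
  define h where "h t = g t - \<kappa>" for t
  have h [measurable]: "h \<in> borel_measurable M" unfolding h_def by measurable
  have h_bd: "\<bar>h t\<bar> \<le> \<kappa>" for t using g_bd[of t] by (auto simp: h_def abs_le_iff)
  have "\<phi> (cl f) = (\<integral>t. f t * h t \<partial>M)" if "integrable M f" for f
    using that
  proof (induction rule: integrable_induct)
    case (base A c)
    have "\<phi> (cl (indicator A)) = (\<integral>t. indicator A t * g t \<partial>M) - \<kappa> * measure M A"
      using \<nu>_g[OF base(1)] by (simp add: \<nu>_def)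
    also have "\<dots> = (\<integral>t. indicator A t * g t - indicator A t * \<kappa> \<partial>M)"
      using base(1) integrable_mult_bounded[OF ind[OF base(1)] g, of "2 * \<kappa>"] g_bd ind[OF base(1)]
      by (subst Bochner_Integration.integral_diff)
         (auto simp: abs_le_iff Int_absorb2 sets.sets_into_space intro: order_trans)
    also have "\<dots> = (\<integral>t. indicator A t * h t \<partial>M)" by (simp add: h_def right_diff_distrib)
    finally have *: "\<phi> (cl (indicator A)) = (\<integral>t. indicator A t * h t \<partial>M)" .
    have "\<phi> (cl (\<lambda>t. c * indicator A t)) = c * (\<integral>t. indicator A t * h t \<partial>M)"
      using \<phi>_scale[OF ind[OF base(1)]] * by simp
    also have "\<dots> = (\<integral>t. c * (indicator A t * h t) \<partial>M)" by simp
    finally show ?case by (simp add: mult_ac)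
  next
    case (add f f')
    note int = integrable_mult_bounded[OF add.hyps(1) h h_bd] integrable_mult_bounded[OF add.hyps(2) h h_bd]
    have "(\<integral>t. (f t + f' t) * h t \<partial>M) = (\<integral>t. f t * h t \<partial>M) + (\<integral>t. f' t * h t \<partial>M)"
      using int by (simp add: distrib_right)
    then show ?case using add.IH \<phi>_add[OF add.hyps] by simp
  next
    case (lim f s)
    have [measurable]: "f \<in> borel_measurable M" "\<And>i. s i \<in> borel_measurable M" using lim.hyps by auto
    have "(\<lambda>i. \<integral>t. s i t * h t \<partial>M) \<longlonglongrightarrow> (\<integral>t. f t * h t \<partial>M)"
    proof (rule integral_dominated_convergence[where w = "\<lambda>t. 2 * \<kappa> * \<bar>f t\<bar>"])
      show "integrable M (\<lambda>t. 2 * \<kappa> * \<bar>f t\<bar>)" using lim.hyps by (intro integrable_mult_right integrable_abs)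
      show "AE t in M. (\<lambda>i. s i t * h t) \<longlonglongrightarrow> f t * h t"
        by (rule AE_I2) (intro tendsto_intros lim.hyps)
      show "AE t in M. norm (s i t * h t) \<le> 2 * \<kappa> * \<bar>f t\<bar>" for i
      proof (rule AE_I2)
        fix t assume "t \<in> space M"
        then have "\<bar>s i t\<bar> * \<bar>h t\<bar> \<le> (2 * \<bar>f t\<bar>) * \<kappa>"
          using lim.hyps(3)[of t i] h_bd[of t] by (intro mult_mono) auto
        then show "norm (s i t * h t) \<le> 2 * \<kappa> * \<bar>f t\<bar>" by (simp add: abs_mult mult_ac)
      qed
    qed measurable
    moreover have "(\<lambda>i. \<phi> (cl (s i))) \<longlonglongrightarrow> \<phi> (cl f)"
    proof -
      have "(\<lambda>i. \<integral>t. \<bar>s i t - f t\<bar> \<partial>M) \<longlonglongrightarrow> (\<integral>t. 0 \<partial>M)"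
      proof (rule integral_dominated_convergence[where w = "\<lambda>t. 3 * \<bar>f t\<bar>"])
        show "integrable M (\<lambda>t. 3 * \<bar>f t\<bar>)" using lim.hyps by (intro integrable_mult_right integrable_abs)
        show "AE t in M. (\<lambda>i. \<bar>s i t - f t\<bar>) \<longlonglongrightarrow> 0"
        proof (rule AE_I2)
          fix t assume "t \<in> space M"
          then have "(\<lambda>i. s i t) \<longlonglongrightarrow> f t" by (rule lim.hyps(2))
          from tendsto_rabs[OF tendsto_diff[OF this tendsto_const[of "f t"]]]
          show "(\<lambda>i. \<bar>s i t - f t\<bar>) \<longlonglongrightarrow> 0" by simp
        qed
        show "AE t in M. norm \<bar>s i t - f t\<bar> \<le> 3 * \<bar>f t\<bar>" for i
        proof (rule AE_I2)
          fix t assume "t \<in> space M"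
          then have "\<bar>s i t\<bar> \<le> 2 * \<bar>f t\<bar>" using lim.hyps(3)[of t i] by simp
          then show "norm \<bar>s i t - f t\<bar> \<le> 3 * \<bar>f t\<bar>" using abs_triangle_ineq4[of "s i t" "f t"] by simp
        qed
      qed measurable
      then have lim0: "(\<lambda>i. \<kappa> * (\<integral>t. \<bar>s i t - f t\<bar> \<partial>M)) \<longlonglongrightarrow> 0"
        using tendsto_mult_right_zero by fastforce
      have "norm (\<phi> (cl (s i)) - \<phi> (cl f)) \<le> \<kappa> * (\<integral>t. \<bar>s i t - f t\<bar> \<partial>M)" for i
      proof -
        have d: "integrable M (\<lambda>t. s i t - f t)" using lim.hyps by auto
        have "\<phi> (cl (s i)) = \<phi> (cl (\<lambda>t. s i t - f t)) + \<phi> (cl f)"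
          using \<phi>_add[OF d lim.hyps(4)] by simp
        then show ?thesis using \<kappa>[OF d] by simp
      qed
      then show ?thesis
        by (intro LIM_zero_cancel[OF Lim_null_comparison[OF _ lim0]] always_eventually allI)
    qed
    ultimately show ?case using lim.IH LIMSEQ_unique by simp
  qed
  then show ?thesis using h h_bd by blast
qed

text \<open>
  The densities between 0 and \<open>c\<close> correspond to the additive set functions dominated by
  \<open>c\<close> times the measure, a closed subset of a product of compact intervals. The correspondence
  is continuous because a functional is integration against a bounded function, which is uniformly
  close to simple ones.
\<close>

theorem weakly_compact_order_interval:
  assumes c: "0 \<le> c"
  shows "compactin (weak_topology X)
    (cl ` {f. integrable M f \<and> (AE t in M. 0 \<le> f t \<and> f t \<le> c) \<and> (\<integral>t. f t \<partial>M) = a})"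
proof -
  define T where "T = product_topology (\<lambda>_. euclideanreal) (sets M)"
  define Z0 where "Z0 = PiE (sets M) (\<lambda>A. {0..c * measure M A})"
  define R where "R = {(A, B). A \<in> sets M \<and> B \<in> sets M \<and> A \<inter> B = {}}"
  define Z where "Z = Z0 \<inter> ({\<nu>\<in>topspace T. \<nu> (space M) \<in> {a}} \<inter>
      (\<Inter>(A, B)\<in>R. {\<nu>\<in>topspace T. \<nu> (A \<union> B) - \<nu> A - \<nu> B \<in> {0}}))"
  have proj: "continuous_map T euclideanreal (\<lambda>\<nu>. \<nu> A)" if "A \<in> sets M" for A
    unfolding T_def using that continuous_map_product_projection[of A "sets M" "\<lambda>_. euclideanreal"] by simp
  have "compactin T Z0"
    unfolding T_def Z0_def by (simp add: compactin_PiE)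
  moreover have "closedin T ({\<nu>\<in>topspace T. \<nu> (space M) \<in> {a}} \<inter>
      (\<Inter>(A, B)\<in>R. {\<nu>\<in>topspace T. \<nu> (A \<union> B) - \<nu> A - \<nu> B \<in> {0}}))"
  proof (intro closedin_Int closedin_INT)
    show "closedin T {\<nu>\<in>topspace T. \<nu> (space M) \<in> {a}}"
      by (rule closedin_continuous_map_preimage[OF proj]) auto
    show "R \<noteq> {}" by (auto simp: R_def)
    fix x assume "x \<in> R"
    then obtain A B where x: "x = (A, B)" "A \<in> sets M" "B \<in> sets M" by (auto simp: R_def)
    have "continuous_map T euclideanreal (\<lambda>\<nu>. \<nu> (A \<union> B) - \<nu> A - \<nu> B)"
      by (intro continuous_map_diff proj) (use x in auto)
    from closedin_continuous_map_preimage[OF this, of "{0}"]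
    show "closedin T (case x of (A, B) \<Rightarrow> {\<nu>\<in>topspace T. \<nu> (A \<union> B) - \<nu> A - \<nu> B \<in> {0}})"
      by (simp add: x)
  qed
  ultimately have Z_compact: "compactin T Z" unfolding Z_def by (rule compact_Int_closedin)
  have ZT: "Z \<subseteq> topspace T" using Z_compact by (rule compactin_subset_topspace)
  have ZD: "\<And>A. A \<in> sets M \<Longrightarrow> 0 \<le> \<nu> A \<and> \<nu> A \<le> c * measure M A" "\<nu> (space M) = a"
      "\<And>A B. A \<in> sets M \<Longrightarrow> B \<in> sets M \<Longrightarrow> A \<inter> B = {} \<Longrightarrow> \<nu> (A \<union> B) = \<nu> A + \<nu> B" if "\<nu> \<in> Z" for \<nu>
  proof -
    show "0 \<le> \<nu> A \<and> \<nu> A \<le> c * measure M A" if "A \<in> sets M" for A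
      using that \<open>\<nu> \<in> Z\<close> by (auto simp: Z_def Z0_def PiE_iff)
    show "\<nu> (space M) = a" using \<open>\<nu> \<in> Z\<close> by (simp add: Z_def)
    show "\<nu> (A \<union> B) = \<nu> A + \<nu> B" if "A \<in> sets M" "B \<in> sets M" "A \<inter> B = {}" for A B
    proof -
      have "(A, B) \<in> R" using that by (simp add: R_def)
      then have "\<nu> (A \<union> B) - \<nu> A - \<nu> B \<in> {0}" using \<open>\<nu> \<in> Z\<close> by (auto simp: Z_def)
      then show ?thesis by simp
    qed
  qed
  have "\<forall>\<nu>\<in>Z. \<exists>g\<in>borel_measurable M. (\<forall>t. 0 \<le> g t \<and> g t \<le> c) \<and>
           (\<forall>A\<in>sets M. \<nu> A = (\<integral>t. indicator A t * g t \<partial>M))"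
  proof
    fix \<nu> assume \<nu>: "\<nu> \<in> Z"
    show "\<exists>g\<in>borel_measurable M. (\<forall>t. 0 \<le> g t \<and> g t \<le> c) \<and>
           (\<forall>A\<in>sets M. \<nu> A = (\<integral>t. indicator A t * g t \<partial>M))"
      by (rule dominated_additive_density) (use ZD[OF \<nu>] c in auto)
  qed
  then obtain D where D: "\<And>\<nu>. \<nu> \<in> Z \<Longrightarrow> D \<nu> \<in> borel_measurable M"
      "\<And>\<nu> t. \<nu> \<in> Z \<Longrightarrow> 0 \<le> D \<nu> t \<and> D \<nu> t \<le> c"
      "\<And>\<nu> A. \<nu> \<in> Z \<Longrightarrow> A \<in> sets M \<Longrightarrow> \<nu> A = (\<integral>t. indicator A t * D \<nu> t \<partial>M)" by metis
  have D_int: "integrable M (D \<nu>)" if "\<nu> \<in> Z" for \<nu>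
    by (rule integrable_bounded[where B = c]) (use D that c in auto)
  have D_mass: "(\<integral>t. D \<nu> t \<partial>M) = a" if "\<nu> \<in> Z" for \<nu>
  proof -
    have "a = (\<integral>t. indicator (space M) t * D \<nu> t \<partial>M)"
      using D(3)[OF that sets.top] ZD(2)[OF that] by simp
    also have "\<dots> = (\<integral>t. D \<nu> t \<partial>M)" by (rule Bochner_Integration.integral_cong) auto
    finally show ?thesis by simp
  qed
  have cont: "continuous_map (subtopology T Z) euclideanreal (\<lambda>\<nu>. \<phi> (cl (D \<nu>)))"
    if \<phi>: "\<phi> \<in> dual_space X" for \<phi>
  proof -
    obtain g B where g [measurable]: "g \<in> borel_measurable M" and g_bd: "\<And>t. \<bar>g t\<bar> \<le> B"
        and rep: "\<And>f. integrable M f \<Longrightarrow> \<phi> (cl f) = (\<integral>t. f t * g t \<partial>M)"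
      using dual_L1[OF \<phi>] by blast
    have approx: "\<exists>h. continuous_map (subtopology T Z) euclideanreal h \<and>
        (\<forall>\<nu>\<in>Z. \<bar>h \<nu> - \<phi> (cl (D \<nu>))\<bar> \<le> e * a)" if e: "0 < e" for e
    proof -
      obtain n :: nat where n: "B / e + 1 < real n" using reals_Archimedean2 by blast
      define I where "I = {- int n..int n}"
      define E where "E i = {t \<in> space M. \<lfloor>g t / e\<rfloor> = i}" for i
      have E [measurable]: "E i \<in> sets M" for i unfolding E_def by measurable
      define s where "s t = (\<Sum>i\<in>I. e * of_int i * indicator (E i) t)" for t
      have s: "s t = e * of_int \<lfloor>g t / e\<rfloor>" if "t \<in> space M" for t
      proof -
        have "\<bar>g t / e\<bar> \<le> B / e" using g_bd[of t] e by (simp add: divide_right_mono)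
        then have "\<bar>g t / e\<bar> < real n - 1" using n by linarith
        then have "\<lfloor>g t / e\<rfloor> \<in> I" unfolding I_def by (auto; linarith)
        then have "s t = (\<Sum>i\<in>I. if i = \<lfloor>g t / e\<rfloor> then e * of_int i else 0)"
          unfolding s_def using that by (intro sum.cong) (auto simp: E_def indicator_def)
        also have "\<dots> = e * of_int \<lfloor>g t / e\<rfloor>" using \<open>\<lfloor>g t / e\<rfloor> \<in> I\<close> by (simp add: I_def)
        finally show ?thesis .
      qed
      have s_g: "\<bar>s t - g t\<bar> \<le> e" if "t \<in> space M" for t
      proof -
        have "of_int \<lfloor>g t / e\<rfloor> \<le> g t / e" "g t / e < of_int \<lfloor>g t / e\<rfloor> + 1" by linarith+
        then have "e * of_int \<lfloor>g t / e\<rfloor> \<le> e * (g t / e)" "e * (g t / e) < e * (of_int \<lfloor>g t / e\<rfloor> + 1)"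
          using e by (simp_all only: mult_le_cancel_left_pos mult_less_cancel_left_pos)
        then have "e * of_int \<lfloor>g t / e\<rfloor> \<le> g t" "g t < e * of_int \<lfloor>g t / e\<rfloor> + e"
          using e by (simp_all add: distrib_left)
        then show ?thesis unfolding s[OF that] by (simp add: abs_le_iff)
      qed
      define h where "h \<nu> = (\<Sum>i\<in>I. e * of_int i * \<nu> (E i))" for \<nu> :: "'a set \<Rightarrow> real"
      have "continuous_map T euclideanreal h"
        unfolding h_def by (intro continuous_map_sum continuous_map_real_mult proj E) (auto simp: I_def)
      then have "continuous_map (subtopology T Z) euclideanreal h"
        by (rule continuous_map_from_subtopology)
      moreover have "\<bar>h \<nu> - \<phi> (cl (D \<nu>))\<bar> \<le> e * a" if \<nu>: "\<nu> \<in> Z" for \<nu>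
      proof -
        have [measurable]: "D \<nu> \<in> borel_measurable M" by (rule D(1)[OF \<nu>])
        have iE: "integrable M (\<lambda>t. indicator (E i) t * D \<nu> t)" for i
          by (rule integrable_bounded[where B = c]) (use D(2)[OF \<nu>] c in \<open>auto simp: indicator_def\<close>)
        have "h \<nu> = (\<Sum>i\<in>I. e * of_int i * (\<integral>t. indicator (E i) t * D \<nu> t \<partial>M))"
          unfolding h_def using D(3)[OF \<nu> E] by simp
        also have "\<dots> = (\<integral>t. (\<Sum>i\<in>I. e * of_int i * (indicator (E i) t * D \<nu> t)) \<partial>M)"
          using iE by (subst Bochner_Integration.integral_sum) auto
        also have "\<dots> = (\<integral>t. D \<nu> t * s t \<partial>M)"
          by (simp add: s_def sum_distrib_left mult_ac)
        finally have h_eq: "h \<nu> = (\<integral>t. D \<nu> t * s t \<partial>M)" .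
        have int_s: "integrable M (\<lambda>t. D \<nu> t * s t)"
        proof -
          have "integrable M (\<lambda>t. \<Sum>i\<in>I. e * of_int i * (indicator (E i) t * D \<nu> t))" using iE by auto
          then show ?thesis by (simp add: s_def sum_distrib_left mult_ac)
        qed
        note int_g = integrable_mult_bounded[OF D_int[OF \<nu>] g g_bd]
        have "h \<nu> - \<phi> (cl (D \<nu>)) = (\<integral>t. D \<nu> t * s t - D \<nu> t * g t \<partial>M)"
          unfolding h_eq rep[OF D_int[OF \<nu>]] using int_s int_g by simp
        also have "\<bar>\<dots>\<bar> \<le> (\<integral>t. \<bar>D \<nu> t * s t - D \<nu> t * g t\<bar> \<partial>M)" by (rule integral_abs_bound)
        also have "\<dots> \<le> (\<integral>t. e * D \<nu> t \<partial>M)"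
        proof (rule integral_mono)
          show "integrable M (\<lambda>t. \<bar>D \<nu> t * s t - D \<nu> t * g t\<bar>)" using int_s int_g by auto
          show "integrable M (\<lambda>t. e * D \<nu> t)" using D_int[OF \<nu>] by auto
          fix t assume "t \<in> space M"
          then have "D \<nu> t * \<bar>s t - g t\<bar> \<le> D \<nu> t * e"
            using s_g D(2)[OF \<nu>] by (intro mult_left_mono) auto
          then show "\<bar>D \<nu> t * s t - D \<nu> t * g t\<bar> \<le> e * D \<nu> t"
          proof -
            have "D \<nu> t * s t - D \<nu> t * g t = D \<nu> t * (s t - g t)" by (simp add: right_diff_distrib)
            then show ?thesis
              using D(2)[OF \<nu>, of t] \<open>D \<nu> t * \<bar>s t - g t\<bar> \<le> D \<nu> t * e\<close>
              by (simp add: abs_mult mult.commute)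
          qed
        qed
        also have "\<dots> = e * a" using D_mass[OF \<nu>] by simp
        finally show ?thesis .
      qed
      ultimately show ?thesis by blast
    qed
    show ?thesis
    proof (cases "Z = {}")
      case True then show ?thesis by simp
    next
      case False
      then have a: "0 \<le> a" using D_mass D(2) by (metis all_not_in_conv integral_nonneg_AE AE_I2)
      have "\<forall>k. \<exists>h. continuous_map (subtopology T Z) euclideanreal h \<and>
          (\<forall>\<nu>\<in>Z. \<bar>h \<nu> - \<phi> (cl (D \<nu>))\<bar> \<le> 1 / real (Suc k) * a)"
        by (intro allI approx) simp
      then obtain h where h: "\<And>k. continuous_map (subtopology T Z) euclideanreal (h k)"
          "\<And>k \<nu>. \<nu> \<in> Z \<Longrightarrow> \<bar>h k \<nu> - \<phi> (cl (D \<nu>))\<bar> \<le> 1 / real (Suc k) * a" by metis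
      have "continuous_map (subtopology T Z) (Met_TC.mtopology :: real topology) (\<lambda>\<nu>. \<phi> (cl (D \<nu>)))"
      proof (rule Met_TC.continuous_map_uniform_limit[where F = sequentially and f = h])
        show "\<forall>\<^sub>F k in sequentially. continuous_map (subtopology T Z) Met_TC.mtopology (h k)"
          using h(1) by simp
        fix \<epsilon> :: real assume "0 < \<epsilon>"
        then have "\<forall>\<^sub>F k in sequentially. 1 / real (Suc k) * a < \<epsilon>"
          using order_tendstoD(2)[OF tendsto_mult_left_zero[OF LIMSEQ_inverse_real_of_nat, of a]]
          by (simp add: inverse_eq_divide)
        then show "\<forall>\<^sub>F k in sequentially. \<forall>\<nu>\<in>topspace (subtopology T Z).
            \<phi> (cl (D \<nu>)) \<in> UNIV \<and> dist (h k \<nu>) (\<phi> (cl (D \<nu>))) < \<epsilon>"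
        proof eventually_elim
          case (elim k)
          show ?case
          proof
            fix \<nu> assume "\<nu> \<in> topspace (subtopology T Z)"
            then show "\<phi> (cl (D \<nu>)) \<in> UNIV \<and> dist (h k \<nu>) (\<phi> (cl (D \<nu>))) < \<epsilon>"
              using h(2)[of \<nu> k] elim by (simp add: dist_real_def)
          qed
        qed
      qed simp
      then show ?thesis by simp
    qed
  qed
  have D_pts: "cl (D \<nu>) \<in> pts X" if "\<nu> \<in> Z" for \<nu> using D_int[OF that] by simp
  have "continuous_map (subtopology T Z) (weak_topology X) (\<lambda>\<nu>. cl (D \<nu>))"
    unfolding weak_topology_def
  proof (rule continuous_on_generated_topo)
    fix W assume "W \<in> {{x \<in> pts X. f x \<in> U} | f U. f \<in> dual_space X \<and> open U}"
    then obtain \<phi> U where W: "W = {x \<in> pts X. \<phi> x \<in> U}" and \<phi>: "\<phi> \<in> dual_space X" and U: "open U" by blast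
    have "openin (subtopology T Z) {\<nu> \<in> topspace (subtopology T Z). \<phi> (cl (D \<nu>)) \<in> U}"
      by (rule openin_continuous_map_preimage[OF cont[OF \<phi>]]) (use U in simp)
    moreover have "{\<nu> \<in> topspace (subtopology T Z). \<phi> (cl (D \<nu>)) \<in> U}
        = (\<lambda>\<nu>. cl (D \<nu>)) -` W \<inter> topspace (subtopology T Z)"
      unfolding W using D_pts by auto
    ultimately show "openin (subtopology T Z) ((\<lambda>\<nu>. cl (D \<nu>)) -` W \<inter> topspace (subtopology T Z))" by simp
  next
    show "(\<lambda>\<nu>. cl (D \<nu>)) ` topspace (subtopology T Z) \<subseteq> \<Union> {{x \<in> pts X. f x \<in> U} | f U. f \<in> dual_space X \<and> open U}"
      using D_pts topspace_weak unfolding weak_topology_def topology_generated_by_topspace by auto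
  qed
  moreover have "compactin (subtopology T Z) Z" using Z_compact by (simp add: compactin_subtopology)
  ultimately have "compactin (weak_topology X) ((\<lambda>\<nu>. cl (D \<nu>)) ` Z)" by (rule image_compactin[rotated])
  also have "(\<lambda>\<nu>. cl (D \<nu>)) ` Z = cl ` {f. integrable M f \<and> (AE t in M. 0 \<le> f t \<and> f t \<le> c) \<and> (\<integral>t. f t \<partial>M) = a}"
  proof (intro equalityI subsetI)
    fix x assume "x \<in> (\<lambda>\<nu>. cl (D \<nu>)) ` Z"
    then show "x \<in> cl ` {f. integrable M f \<and> (AE t in M. 0 \<le> f t \<and> f t \<le> c) \<and> (\<integral>t. f t \<partial>M) = a}"
      using D_int D_mass D(2) by (auto intro!: imageI)
  next
    fix x assume "x \<in> cl ` {f. integrable M f \<and> (AE t in M. 0 \<le> f t \<and> f t \<le> c) \<and> (\<integral>t. f t \<partial>M) = a}"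
    then obtain f where f: "integrable M f" "AE t in M. 0 \<le> f t \<and> f t \<le> c" "(\<integral>t. f t \<partial>M) = a"
      and x: "x = cl f" by blast
    have iA: "integrable M (\<lambda>t. indicator A t * f t)" if "A \<in> sets M" for A
      using integrable_mult_bounded[OF f(1), of "indicator A" 1] that by (simp add: mult.commute indicator_def)
    define \<nu> where "\<nu> = (\<lambda>A\<in>sets M. \<integral>t. indicator A t * f t \<partial>M)"
    have "0 \<le> \<nu> A \<and> \<nu> A \<le> c * measure M A" if A: "A \<in> sets M" for A
    proof
      show "0 \<le> \<nu> A"
        unfolding \<nu>_def using A f(2) by (auto intro!: integral_nonneg_AE elim!: AE_mp)
      have "(\<integral>t. indicator A t * f t \<partial>M) \<le> (\<integral>t. indicator A t * c \<partial>M)"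
      proof (rule integral_mono_AE[OF iA[OF A]])
        show "integrable M (\<lambda>t. indicator A t * c)"
          by (rule integrable_bounded[where B = c]) (use A c in \<open>auto simp: indicator_def\<close>)
        show "AE t in M. indicator A t * f t \<le> indicator A t * c"
          using f(2) by eventually_elim (simp add: indicator_def)
      qed
      then show "\<nu> A \<le> c * measure M A"
        using A by (simp add: \<nu>_def Int_absorb2 sets.sets_into_space mult.commute)
    qed
    moreover have "\<nu> (space M) = a"
      unfolding \<nu>_def using f(3) by (simp cong: Bochner_Integration.integral_cong)
    moreover have "\<nu> (A \<union> B) - \<nu> A - \<nu> B = 0" if "(A, B) \<in> R" for A B
    proof -
      have AB: "A \<in> sets M" "B \<in> sets M" "A \<inter> B = {}" using that by (auto simp: R_def)
      have "(\<lambda>t. indicator (A \<union> B) t * f t) = (\<lambda>t. indicator A t * f t + indicator B t * f t)"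
        using AB by (auto simp: indicator_def fun_eq_iff)
      then show ?thesis using AB iA by (simp add: \<nu>_def)
    qed
    moreover have "\<nu> \<in> topspace T" by (simp add: T_def \<nu>_def)
    ultimately have \<nu>: "\<nu> \<in> Z"
      by (auto simp: Z_def Z0_def PiE_iff \<nu>_def[THEN fun_cong] extensional_def T_def)
    have [measurable]: "f \<in> borel_measurable M" "D \<nu> \<in> borel_measurable M" using f D(1)[OF \<nu>] by auto
    have "AE t in M. f t = D \<nu> t"
    proof (rule density_unique_real[OF f(1) D_int[OF \<nu>]])
      fix A assume A: "A \<in> sets M"
      then show "(\<integral>t\<in>A. f t \<partial>M) = (\<integral>t\<in>A. D \<nu> t \<partial>M)"
        using D(3)[OF \<nu> A] by (simp add: \<nu>_def set_lebesgue_integral_def)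
    qed
    then have "x = cl (D \<nu>)" unfolding x using f(1) D_int[OF \<nu>] by (intro cl_eqI) auto
    then show "x \<in> (\<lambda>\<nu>. cl (D \<nu>)) ` Z" using \<nu> by blast
  qed
  finally show ?thesis .
qed

end

section \<open>Alspach's fixed point free isometry\<close>

abbreviation \<Lambda> :: "real measure" where "\<Lambda> \<equiv> lebesgue_on {0..1}"

lemma unit_sets [simp, intro]: "{0..1::real} \<in> sets lebesgue" by simp

lemma finite_measure_unit: "finite_measure \<Lambda>"
  by (rule finite_measure_lebesgue_on) simp

interpretation L1: finite_measure_L1 \<Lambda>
  by (simp add: finite_measure_L1_def finite_measure_unit)

lemma L1_01_eq: "L1_01 = L1.X"
  by (simp add: L1_01_def)

lemma measure_unit [simp]: "measure \<Lambda> {0..1} = 1"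
  by (simp add: measure_restrict_space)

text \<open>
  The graphs of two functions on the unit interval, compressed to the left and to the right half.
  The value at \<open>1/2\<close> belongs to the left half, which makes no difference up to null sets.
\<close>

definition glue :: "(real \<Rightarrow> 'b) \<Rightarrow> (real \<Rightarrow> 'b) \<Rightarrow> real \<Rightarrow> 'b" where
  "glue a b t = (if t \<le> 1/2 then a (2 * t) else b (2 * t - 1))"

lemma glue_compose: "h (glue a b t) = glue (\<lambda>t. h (a t)) (\<lambda>t. h (b t)) t"
  by (simp add: glue_def)

lemma measurable_affine_lebesgue:
  assumes "f \<in> borel_measurable lebesgue" "c \<noteq> 0"
  shows "(\<lambda>t. f (b + c * t)) \<in> borel_measurable (lebesgue :: real measure)"
proof -
  have "(\<lambda>t::real. b + c * t) \<in> lebesgue \<rightarrow>\<^sub>M lebesgue"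
    using lebesgue_affine_measurable[of "\<lambda>_. c" b] assms(2) by simp
  then show ?thesis using assms(1) by (rule measurable_compose)
qed

lemma nn_integral_glue:
  fixes a b :: "real \<Rightarrow> ennreal"
  assumes a: "a \<in> borel_measurable \<Lambda>" and b: "b \<in> borel_measurable \<Lambda>"
  shows "glue a b \<in> borel_measurable \<Lambda>"
    and "2 * (\<integral>\<^sup>+t. glue a b t \<partial>\<Lambda>) = (\<integral>\<^sup>+t. a t \<partial>\<Lambda>) + (\<integral>\<^sup>+t. b t \<partial>\<Lambda>)"
proof -
  let ?I = "indicator {0..1::real} :: real \<Rightarrow> ennreal"
  have a' [measurable]: "(\<lambda>t. a t * ?I t) \<in> borel_measurable lebesgue"
    using a by (subst (asm) borel_measurable_restrict_space_iff_ennreal) auto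
  have b' [measurable]: "(\<lambda>t. b t * ?I t) \<in> borel_measurable lebesgue"
    using b by (subst (asm) borel_measurable_restrict_space_iff_ennreal) auto
  have a2 [measurable]: "(\<lambda>t. a (0 + 2 * t) * ?I (0 + 2 * t)) \<in> borel_measurable lebesgue"
    by (rule measurable_affine_lebesgue[OF a']) simp
  have b2 [measurable]: "(\<lambda>t. b (-1 + 2 * t) * ?I (-1 + 2 * t)) \<in> borel_measurable lebesgue"
    by (rule measurable_affine_lebesgue[OF b']) simp
  have half [measurable]: "{1/2::real} \<in> sets lebesgue" by simp
  let ?s = "\<lambda>t. a (0 + 2 * t) * ?I (0 + 2 * t) + b (-1 + 2 * t) * ?I (-1 + 2 * t) * indicator (- {1/2}) t"
  have eq: "glue a b t * ?I t = ?s t" for t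
    by (auto simp: glue_def indicator_def)
  have "?s \<in> borel_measurable lebesgue" by measurable
  then show "glue a b \<in> borel_measurable \<Lambda>"
    by (subst borel_measurable_restrict_space_iff_ennreal) (auto simp: eq)
  have a_int: "(\<integral>\<^sup>+t. a t \<partial>\<Lambda>) = (\<integral>\<^sup>+t. a t * ?I t \<partial>lebesgue)" for a :: "real \<Rightarrow> ennreal"
    by (rule nn_integral_restrict_space) simp
  have "(\<integral>\<^sup>+t. glue a b t \<partial>\<Lambda>) = (\<integral>\<^sup>+t. ?s t \<partial>lebesgue)" by (simp add: a_int eq)
  also have "\<dots> = (\<integral>\<^sup>+t. a (0 + 2 * t) * ?I (0 + 2 * t) \<partial>lebesgue)
      + (\<integral>\<^sup>+t. b (-1 + 2 * t) * ?I (-1 + 2 * t) * indicator (- {1/2}) t \<partial>lebesgue)"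
    by (rule nn_integral_add) measurable
  also have "(\<integral>\<^sup>+t. b (-1 + 2 * t) * ?I (-1 + 2 * t) * indicator (- {1/2}) t \<partial>lebesgue)
      = (\<integral>\<^sup>+t. b (-1 + 2 * t) * ?I (-1 + 2 * t) \<partial>lebesgue)"
  proof (rule nn_integral_cong_AE)
    have "AE t in lebesgue. t \<noteq> (1/2 :: real)"
      by (rule AE_completion) (rule AE_lborel_singleton)
    then show "AE t in lebesgue. b (-1 + 2 * t) * ?I (-1 + 2 * t) * indicator (- {1/2}) t = b (-1 + 2 * t) * ?I (-1 + 2 * t)"
      by eventually_elim simp
  qed
  finally have "2 * (\<integral>\<^sup>+t. glue a b t \<partial>\<Lambda>)
      = 2 * (\<integral>\<^sup>+t. a (0 + 2 * t) * ?I (0 + 2 * t) \<partial>lebesgue)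
      + 2 * (\<integral>\<^sup>+t. b (-1 + 2 * t) * ?I (-1 + 2 * t) \<partial>lebesgue)"
    by (simp only: distrib_left)
  also have "2 * (\<integral>\<^sup>+t. a (0 + 2 * t) * ?I (0 + 2 * t) \<partial>lebesgue) = (\<integral>\<^sup>+t. a t \<partial>\<Lambda>)"
    unfolding a_int using nn_integral_real_affine_lebesgue[OF a', of 2 0] by simp
  also have "2 * (\<integral>\<^sup>+t. b (-1 + 2 * t) * ?I (-1 + 2 * t) \<partial>lebesgue) = (\<integral>\<^sup>+t. b t \<partial>\<Lambda>)"
    unfolding a_int using nn_integral_real_affine_lebesgue[OF b', of 2 "-1"] by simp
  finally show "2 * (\<integral>\<^sup>+t. glue a b t \<partial>\<Lambda>) = (\<integral>\<^sup>+t. a t \<partial>\<Lambda>) + (\<integral>\<^sup>+t. b t \<partial>\<Lambda>)" .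
qed

lemma glue_measurable [measurable]:
  fixes a b :: "real \<Rightarrow> real"
  assumes [measurable]: "a \<in> borel_measurable \<Lambda>" "b \<in> borel_measurable \<Lambda>"
  shows "glue a b \<in> borel_measurable \<Lambda>"
proof -
  have pm: "h = (\<lambda>t. enn2real (ennreal (h t)) - enn2real (ennreal (- h t)))" for h :: "real \<Rightarrow> real"
  proof
    fix t show "h t = enn2real (ennreal (h t)) - enn2real (ennreal (- h t))"
      by (cases "0 \<le> h t") (auto simp: ennreal_neg)
  qed
  have [measurable]: "glue (\<lambda>t. ennreal (a t)) (\<lambda>t. ennreal (b t)) \<in> borel_measurable \<Lambda>"
    "glue (\<lambda>t. ennreal (- a t)) (\<lambda>t. ennreal (- b t)) \<in> borel_measurable \<Lambda>"
    by (rule nn_integral_glue; measurable)+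
  show ?thesis
    by (subst pm, subst glue_compose[of ennreal], subst glue_compose[of "\<lambda>x. ennreal (- x)"]) measurable
qed

lemma integral_glue:
  fixes a b :: "real \<Rightarrow> real"
  assumes a: "integrable \<Lambda> a" and b: "integrable \<Lambda> b"
    and nonneg: "AE t in \<Lambda>. 0 \<le> a t" "AE t in \<Lambda>. 0 \<le> b t" "AE t in \<Lambda>. 0 \<le> glue a b t"
  shows "integrable \<Lambda> (glue a b)"
    and "(\<integral>t. glue a b t \<partial>\<Lambda>) = ((\<integral>t. a t \<partial>\<Lambda>) + (\<integral>t. b t \<partial>\<Lambda>)) / 2"
proof -
  have [measurable]: "a \<in> borel_measurable \<Lambda>" "b \<in> borel_measurable \<Lambda>" using a b by auto
  have "2 * (\<integral>\<^sup>+t. ennreal (glue a b t) \<partial>\<Lambda>) = (\<integral>\<^sup>+t. ennreal (a t) \<partial>\<Lambda>) + (\<integral>\<^sup>+t. ennreal (b t) \<partial>\<Lambda>)"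
    using nn_integral_glue(2)[of "\<lambda>t. ennreal (a t)" "\<lambda>t. ennreal (b t)"] by (simp add: glue_compose)
  also have "\<dots> = ennreal ((\<integral>t. a t \<partial>\<Lambda>) + (\<integral>t. b t \<partial>\<Lambda>))"
    using nn_integral_eq_integral[OF a nonneg(1)] nn_integral_eq_integral[OF b nonneg(2)]
      integral_nonneg_AE[OF nonneg(1)] integral_nonneg_AE[OF nonneg(2)] by (simp add: ennreal_plus)
  finally have *: "2 * (\<integral>\<^sup>+t. ennreal (glue a b t) \<partial>\<Lambda>) = ennreal ((\<integral>t. a t \<partial>\<Lambda>) + (\<integral>t. b t \<partial>\<Lambda>))" .
  then have fin: "(\<integral>\<^sup>+t. ennreal (glue a b t) \<partial>\<Lambda>) < \<infinity>"
    by (metis ennreal_mult_eq_top_iff ennreal_neq_top infinity_ennreal_def less_top zero_neq_numeral)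
  show int: "integrable \<Lambda> (glue a b)"
    by (rule integrableI_nonneg[OF _ nonneg(3) fin]) measurable
  have "2 * ennreal (\<integral>t. glue a b t \<partial>\<Lambda>) = ennreal ((\<integral>t. a t \<partial>\<Lambda>) + (\<integral>t. b t \<partial>\<Lambda>))"
    using * nn_integral_eq_integral[OF int nonneg(3)] by simp
  then have "2 * (\<integral>t. glue a b t \<partial>\<Lambda>) = (\<integral>t. a t \<partial>\<Lambda>) + (\<integral>t. b t \<partial>\<Lambda>)"
    using integral_nonneg_AE[OF nonneg(1)] integral_nonneg_AE[OF nonneg(2)] integral_nonneg_AE[OF nonneg(3)]
    by (metis add_nonneg_nonneg ennreal_inj ennreal_mult' ennreal_numeral mult_nonneg_nonneg zero_le_numeral)
  then show "(\<integral>t. glue a b t \<partial>\<Lambda>) = ((\<integral>t. a t \<partial>\<Lambda>) + (\<integral>t. b t \<partial>\<Lambda>)) / 2" by simp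
qed

lemma measure_glue:
  fixes a b :: "real \<Rightarrow> real"
  assumes [measurable]: "a \<in> borel_measurable \<Lambda>" "b \<in> borel_measurable \<Lambda>" "S \<in> sets borel"
  shows "measure \<Lambda> {t \<in> space \<Lambda>. glue a b t \<in> S}
    = (measure \<Lambda> {t \<in> space \<Lambda>. a t \<in> S} + measure \<Lambda> {t \<in> space \<Lambda>. b t \<in> S}) / 2"
proof -
  have ind: "(\<integral>t. indicator S (h t) \<partial>\<Lambda>) = measure \<Lambda> {t \<in> space \<Lambda>. h t \<in> S}"
    if [measurable]: "h \<in> borel_measurable \<Lambda>" for h :: "real \<Rightarrow> real"
  proof -
    have "(\<integral>t. indicator S (h t) \<partial>\<Lambda>) = (\<integral>t. indicator {t \<in> space \<Lambda>. h t \<in> S} t \<partial>\<Lambda>)"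
      by (rule Bochner_Integration.integral_cong) (auto simp: indicator_def)
    also have "\<dots> = measure \<Lambda> ({t \<in> space \<Lambda>. h t \<in> S} \<inter> space \<Lambda>)" by (rule Bochner_Integration.integral_indicator)
    also have "{t \<in> space \<Lambda>. h t \<in> S} \<inter> space \<Lambda> = {t \<in> space \<Lambda>. h t \<in> S}" by blast
    finally show ?thesis .
  qed
  have int: "integrable \<Lambda> (\<lambda>t. indicator S (h t) :: real)"
    if [measurable]: "h \<in> borel_measurable \<Lambda>" for h :: "real \<Rightarrow> real"
    by (rule L1.integrable_bounded[where B = 1]) (auto simp: indicator_def)
  have "(\<integral>t. glue (\<lambda>t. indicator S (a t) :: real) (\<lambda>t. indicator S (b t)) t \<partial>\<Lambda>)
      = ((\<integral>t. indicator S (a t) \<partial>\<Lambda>) + (\<integral>t. indicator S (b t) \<partial>\<Lambda>)) / 2"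
    by (rule integral_glue(2)) (auto intro: int simp: glue_def)
  then show ?thesis by (simp add: ind flip: glue_compose)
qed

text \<open>
  A baker's transformation of the region below the graph: its height is doubled, and what lies above
  level 2 is put beside the rest.
\<close>

definition alspach :: "(real \<Rightarrow> real) \<Rightarrow> real \<Rightarrow> real" where
  "alspach f = glue (\<lambda>t. min (2 * f t) 2) (\<lambda>t. max (2 * f t - 2) 0)"

lemma alspach_measurable [measurable]:
  "f \<in> borel_measurable \<Lambda> \<Longrightarrow> alspach f \<in> borel_measurable \<Lambda>"
  unfolding alspach_def
  by (intro glue_measurable borel_measurable_min borel_measurable_max borel_measurable_diff
      borel_measurable_times borel_measurable_const)

lemma AE_glue:
  fixes a b :: "real \<Rightarrow> real"
  assumes [measurable]: "a \<in> borel_measurable \<Lambda>" "b \<in> borel_measurable \<Lambda>" "S \<in> sets borel"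
    and a: "AE t in \<Lambda>. a t \<in> S" and b: "AE t in \<Lambda>. b t \<in> S"
  shows "AE t in \<Lambda>. glue a b t \<in> S"
proof -
  have null: "measure \<Lambda> {t \<in> space \<Lambda>. h t \<in> - S} = 0 \<longleftrightarrow> (AE t in \<Lambda>. h t \<in> S)"
    if [measurable]: "h \<in> borel_measurable \<Lambda>" for h :: "real \<Rightarrow> real"
  proof -
    have sets: "{t \<in> space \<Lambda>. h t \<in> - S} \<in> sets \<Lambda>" by measurable
    have "(AE t in \<Lambda>. h t \<in> S) \<longleftrightarrow> emeasure \<Lambda> {t \<in> space \<Lambda>. h t \<in> - S} = 0"
      by (rule AE_iff_measurable[OF sets]) blast
    then show ?thesis unfolding L1.emeasure_eq_measure by simp
  qed
  show ?thesis
    using measure_glue[of a b "- S"] null[of a] null[of b] null[of "glue a b"] a b by simp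
qed

text \<open>
  Cutting two numbers at the same level splits their difference into parts of equal sign, so that the
  absolute values add up.
\<close>

lemma alspach_isometry:
  assumes f: "integrable \<Lambda> f" and g: "integrable \<Lambda> g"
  shows "(\<integral>t. \<bar>alspach f t - alspach g t\<bar> \<partial>\<Lambda>) = (\<integral>t. \<bar>f t - g t\<bar> \<partial>\<Lambda>)"
proof -
  let ?a = "\<lambda>t. \<bar>min (2 * f t) 2 - min (2 * g t) 2\<bar>"
  let ?b = "\<lambda>t. \<bar>max (2 * f t - 2) 0 - max (2 * g t - 2) 0\<bar>"
  have [measurable]: "f \<in> borel_measurable \<Lambda>" "g \<in> borel_measurable \<Lambda>" using f g by auto
  have int: "integrable \<Lambda> ?a" "integrable \<Lambda> ?b" using f g by (auto intro!: integrable_abs)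
  have "(\<integral>t. \<bar>alspach f t - alspach g t\<bar> \<partial>\<Lambda>) = (\<integral>t. glue ?a ?b t \<partial>\<Lambda>)"
    by (rule Bochner_Integration.integral_cong) (auto simp: alspach_def glue_def)
  also have "\<dots> = ((\<integral>t. ?a t \<partial>\<Lambda>) + (\<integral>t. ?b t \<partial>\<Lambda>)) / 2"
    by (rule integral_glue(2)) (use int in \<open>auto simp: glue_def\<close>)
  also have "\<dots> = (\<integral>t. ?a t + ?b t \<partial>\<Lambda>) / 2" using int by simp
  also have "(\<integral>t. ?a t + ?b t \<partial>\<Lambda>) = (\<integral>t. 2 * \<bar>f t - g t\<bar> \<partial>\<Lambda>)"
    by (rule Bochner_Integration.integral_cong) (auto simp: min_def max_def abs_if)
  finally show ?thesis by simp
qed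

definition alspach_domain :: "(real \<Rightarrow> real) set" where
  "alspach_domain = {f. integrable \<Lambda> f \<and> (AE t in \<Lambda>. 0 \<le> f t \<and> f t \<le> 2) \<and> (\<integral>t. f t \<partial>\<Lambda>) = 1}"

lemma alspach_domain_invariant:
  assumes "f \<in> alspach_domain"
  shows "alspach f \<in> alspach_domain"
proof -
  have f: "integrable \<Lambda> f" and bd: "AE t in \<Lambda>. 0 \<le> f t \<and> f t \<le> 2" and mass: "(\<integral>t. f t \<partial>\<Lambda>) = 1"
    using assms by (auto simp: alspach_domain_def)
  have [measurable]: "f \<in> borel_measurable \<Lambda>" using f by auto
  let ?a = "\<lambda>t. min (2 * f t) 2" and ?b = "\<lambda>t. max (2 * f t - 2) 0"
  have a: "AE t in \<Lambda>. ?a t \<in> {0..2}" and b: "AE t in \<Lambda>. ?b t \<in> {0..2}"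
    using bd by (eventually_elim, auto)+
  have "AE t in \<Lambda>. alspach f t \<in> {0..2}"
    unfolding alspach_def by (rule AE_glue[OF _ _ _ a b]) measurable
  then have bd': "AE t in \<Lambda>. 0 \<le> alspach f t \<and> alspach f t \<le> 2" by simp
  have int: "integrable \<Lambda> ?a" "integrable \<Lambda> ?b" using f by auto
  have nonneg: "AE t in \<Lambda>. 0 \<le> ?a t" "AE t in \<Lambda>. 0 \<le> ?b t" "AE t in \<Lambda>. 0 \<le> glue ?a ?b t"
    using a b bd' by (auto simp: alspach_def)
  have "(\<integral>t. alspach f t \<partial>\<Lambda>) = ((\<integral>t. ?a t \<partial>\<Lambda>) + (\<integral>t. ?b t \<partial>\<Lambda>)) / 2"
    unfolding alspach_def by (rule integral_glue(2)[OF int nonneg])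
  also have "\<dots> = (\<integral>t. ?a t + ?b t \<partial>\<Lambda>) / 2" using int by simp
  also have "(\<integral>t. ?a t + ?b t \<partial>\<Lambda>) = (\<integral>t. 2 * f t \<partial>\<Lambda>)"
    by (rule Bochner_Integration.integral_cong) (auto simp: min_def max_def)
  also have "\<dots> = 2" using mass by simp
  finally have "(\<integral>t. alspach f t \<partial>\<Lambda>) = 1" by simp
  moreover have "integrable \<Lambda> (alspach f)" unfolding alspach_def by (rule integral_glue(1)[OF int nonneg])
  ultimately show ?thesis using bd' by (simp add: alspach_domain_def)
qed

text \<open>
  Ergodicity of the doubling map, in the form needed here: if the indicator of \<open>A\<close> is reproduced
  on both halves, then the deviation of the measure of \<open>A\<close> in \<open>[0, x]\<close> from its expected value
  \<open>x\<close> times the measure of \<open>A\<close> is halved when passing to the halves, hence it vanishes.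
\<close>

lemma doubling_invariant_trivial:
  assumes A [measurable]: "A \<in> sets \<Lambda>"
    and inv: "AE t in \<Lambda>. (indicator A t :: real) = glue (indicator A) (indicator A) t"
  shows "measure \<Lambda> A = (measure \<Lambda> A)\<^sup>2"
proof -
  define \<mu> where "\<mu> = measure \<Lambda> A"
  define i :: "real \<Rightarrow> real" where "i = indicator A"
  have [measurable]: "i \<in> borel_measurable \<Lambda>" unfolding i_def by measurable
  have inv': "AE t in \<Lambda>. i t = glue i i t"
    using inv by eventually_elim (auto simp: i_def glue_def indicator_def split: if_splits)
  have A_unit: "A \<subseteq> {0..1}" using sets.sets_into_space[OF A] by simp
  have id [measurable]: "(\<lambda>t::real. t) \<in> borel_measurable \<Lambda>"
    using id_borel_measurable_lebesgue_on[of "{0..1::real}"] by (simp add: id_def)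
  have [measurable]: "(\<lambda>t. indicator {0..x} t :: real) \<in> borel_measurable \<Lambda>" for x :: real
    by (rule measurable_compose[OF id]) measurable
  define F where "F x = (\<integral>t. i t * indicator {0..x} t \<partial>\<Lambda>)" for x
  have int: "integrable \<Lambda> (\<lambda>t. i t * indicator {0..x} t)" for x
    by (rule L1.integrable_bounded[where B = 1]) (auto simp: i_def indicator_def)
  have int_i: "integrable \<Lambda> i"
    by (rule L1.integrable_bounded[where B = 1]) (auto simp: i_def indicator_def)
  have F1: "(\<integral>t. i t \<partial>\<Lambda>) = \<mu>"
    using A_unit by (simp add: i_def \<mu>_def Int_absorb2)
  have F_left: "F (x / 2) = F x / 2" if x: "0 \<le> x" "x \<le> 1" for x
  proof -
    have "F (x / 2) = (\<integral>t. glue (\<lambda>t. i t * indicator {0..x} t) (\<lambda>_. 0) t \<partial>\<Lambda>)"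
      unfolding F_def
    proof (rule integral_cong_AE)
      show "AE t in \<Lambda>. i t * indicator {0..x / 2} t = glue (\<lambda>t. i t * indicator {0..x} t) (\<lambda>_. 0) t"
        using inv' by eventually_elim (use x in \<open>auto simp: glue_def indicator_def\<close>)
    qed measurable
    also have "\<dots> = (F x + 0) / 2"
      unfolding F_def using int by (subst integral_glue(2)) (auto simp: glue_def i_def)
    finally show ?thesis by simp
  qed
  have F_right: "F (1/2 + x / 2) = (\<mu> + F x) / 2" if x: "0 \<le> x" "x \<le> 1" for x
  proof -
    have "F (1/2 + x / 2) = (\<integral>t. glue i (\<lambda>t. i t * indicator {0..x} t) t \<partial>\<Lambda>)"
      unfolding F_def
    proof (rule integral_cong_AE)
      have "AE t in \<Lambda>. t \<in> space \<Lambda>" by (rule AE_space)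
      then show "AE t in \<Lambda>. i t * indicator {0..1/2 + x / 2} t = glue i (\<lambda>t. i t * indicator {0..x} t) t"
        using inv' by eventually_elim (use x in \<open>auto simp: glue_def indicator_def\<close>)
    qed measurable
    also have "\<dots> = (\<mu> + F x) / 2"
      unfolding F_def F1[symmetric] using int int_i by (subst integral_glue(2)) (auto simp: glue_def i_def)
    finally show ?thesis .
  qed
  define G where "G x = F x - \<mu> * x" for x
  have F_bd: "0 \<le> F x \<and> F x \<le> \<mu>" for x
  proof
    show "0 \<le> F x" unfolding F_def by (rule integral_nonneg_AE) (auto simp: i_def)
    show "F x \<le> \<mu>"
      unfolding F_def F1[symmetric] using int int_i by (intro integral_mono) (auto simp: i_def indicator_def)
  qed
  have G_half: "\<exists>y\<in>{0..1}. G x = G y / 2" if x: "x \<in> {0..1}" for x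
  proof (cases "x \<le> 1/2")
    case True
    then show ?thesis using F_left[of "2 * x"] x
      by (intro bexI[of _ "2 * x"]) (auto simp: G_def)
  next
    case False
    then have "F x = (\<mu> + F (2 * x - 1)) / 2" using F_right[of "2 * x - 1"] x by (simp add: diff_divide_distrib)
    then show ?thesis using False x
      by (intro bexI[of _ "2 * x - 1"]) (auto simp: G_def field_simps)
  qed
  have "\<bar>G x\<bar> \<le> 2 * \<mu> / 2 ^ n" if "x \<in> {0..1}" for n x
    using that
  proof (induction n arbitrary: x)
    case 0
    have "0 \<le> \<mu> * x" "\<mu> * x \<le> \<mu>" using 0 by (simp_all add: \<mu>_def mult_left_le)
    then show ?case using F_bd[of x] by (auto simp: G_def abs_le_iff)
  next
    case (Suc n)
    obtain y where "y \<in> {0..1}" "G x = G y / 2" using G_half[OF Suc.prems] by blast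
    then show ?case using Suc.IH[of y] by simp
  qed
  then have G0: "G x = 0" if x: "x \<in> {0..1}" for x
  proof -
    have "(\<lambda>n. 2 * \<mu> / 2 ^ n) \<longlonglongrightarrow> 0" by (rule LIMSEQ_divide_realpow_zero) simp
    then have "\<bar>G x\<bar> \<le> 0"
      by (rule LIMSEQ_le_const) (use \<open>\<And>n x. x \<in> {0..1} \<Longrightarrow> \<bar>G x\<bar> \<le> 2 * \<mu> / 2 ^ n\<close>[OF x] in auto)
    then show ?thesis by simp
  qed
  have F_eq: "F x = \<mu> * x" if "x \<in> {0..1}" for x using G0[OF that] by (simp add: G_def)
  \<comment> \<open>Two finite Borel measures that agree on the half-lines.\<close>
  define N1 where "N1 = distr (density \<Lambda> (indicator A)) borel (\<lambda>t. t)"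
  define N2 where "N2 = distr (density \<Lambda> (\<lambda>_. ennreal \<mu>)) borel (\<lambda>t. t)"
  have B_sets: "B \<inter> {0..1} \<in> sets \<Lambda>" if "B \<in> sets borel" for B :: "real set"
    using measurable_sets[OF id that] by (simp add: vimage_def Int_def)
  have N1: "emeasure N1 B = ennreal (measure \<Lambda> (A \<inter> B))" if B: "B \<in> sets borel" for B
  proof -
    have "A \<inter> B = A \<inter> (B \<inter> {0..1})" using A_unit by auto
    then have AB: "A \<inter> B \<in> sets \<Lambda>" using B_sets[OF B] A by auto
    have "emeasure N1 B = emeasure (density \<Lambda> (indicator A)) (B \<inter> {0..1})"
      unfolding N1_def using B by (subst emeasure_distr) (auto simp: vimage_def Int_def)
    also have "\<dots> = (\<integral>\<^sup>+t. indicator A t * indicator (B \<inter> {0..1}) t \<partial>\<Lambda>)"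
      using B_sets[OF B] by (subst emeasure_density) auto
    also have "\<dots> = (\<integral>\<^sup>+t. indicator (A \<inter> B) t \<partial>\<Lambda>)"
      by (rule nn_integral_cong) (auto simp: indicator_def)
    also have "\<dots> = emeasure \<Lambda> (A \<inter> B)" using AB by simp
    finally show ?thesis by (simp add: L1.emeasure_eq_measure)
  qed
  have N2: "emeasure N2 B = ennreal (\<mu> * measure \<Lambda> (B \<inter> {0..1}))" if B: "B \<in> sets borel" for B
  proof -
    have "emeasure N2 B = emeasure (density \<Lambda> (\<lambda>_. ennreal \<mu>)) (B \<inter> {0..1})"
      unfolding N2_def using B by (subst emeasure_distr) (auto simp: vimage_def Int_def)
    also have "\<dots> = ennreal \<mu> * emeasure \<Lambda> (B \<inter> {0..1})"
      using B_sets[OF B] by (subst emeasure_density) (auto simp: nn_integral_cmult_indicator)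
    finally show ?thesis by (simp add: L1.emeasure_eq_measure ennreal_mult' \<mu>_def)
  qed
  have F_measure: "F x = measure \<Lambda> (A \<inter> {0..x})" for x
  proof -
    have "A \<inter> {0..x} = A \<inter> ({0..x} \<inter> {0..1})" using A_unit by auto
    then have "A \<inter> {0..x} \<in> sets \<Lambda>" using B_sets[of "{0..x}"] A by auto
    moreover have "F x = (\<integral>t. indicator (A \<inter> {0..x}) t \<partial>\<Lambda>)"
      unfolding F_def i_def by (rule Bochner_Integration.integral_cong) (auto simp: indicator_def)
    ultimately show ?thesis using A_unit by (simp add: Int_absorb2 le_infI1)
  qed
  have "N1 = N2"
  proof (rule measure_eqI_lessThan)
    show "sets N1 = sets borel" "sets N2 = sets borel" by (simp_all add: N1_def N2_def)
    show "emeasure N1 {x<..} < \<infinity>" for x by (subst N1) auto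
    fix x :: real
    consider "x < 0" | "0 \<le> x" "x \<le> 1" | "1 < x" by linarith
    then have "measure \<Lambda> (A \<inter> {x<..}) = \<mu> * measure \<Lambda> ({x<..} \<inter> {0..1})"
    proof cases
      case 1
      then have "A \<inter> {x<..} = A" "{x<..} \<inter> {0..1} = {0..1}" using A_unit by auto
      then show ?thesis by (simp add: \<mu>_def)
    next
      case 2
      have "A \<inter> {x<..} = A - A \<inter> {0..x}" using A_unit by auto
      moreover have "A \<inter> {0..x} \<in> sets \<Lambda>"
      proof -
        have "A \<inter> {0..x} = A \<inter> ({0..x} \<inter> {0..1})" using A_unit by auto
        then show ?thesis using B_sets[of "{0..x}"] A by auto
      qed
      ultimately have "measure \<Lambda> (A \<inter> {x<..}) = \<mu> - F x"
        unfolding \<mu>_def F_measure using A by (simp add: L1.finite_measure_Diff)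
      moreover have "{x<..} \<inter> {0..1} = {x<..1}" using 2 by auto
      moreover have "measure \<Lambda> {x<..1} = 1 - x"
        by (subst measure_restrict_space) (use 2 in auto)
      ultimately show ?thesis using F_eq[of x] 2 by (simp add: right_diff_distrib)
    next
      case 3
      then have "A \<inter> {x<..} = {}" "{x<..} \<inter> {0..1} = {}" using A_unit by auto
      then show ?thesis by simp
    qed
    then show "emeasure N1 {x<..} = emeasure N2 {x<..}" by (simp add: N1 N2)
  qed
  obtain B C where BC: "A = B \<union> C" "B \<in> sets borel" "C \<in> null_sets lebesgue"
  proof -
    have "A \<in> sets lebesgue" using A by (simp add: sets_restrict_space_iff)
    then obtain S N N' where "A = S \<union> N" "S \<in> sets lborel" "N' \<in> null_sets lborel" "N \<subseteq> N'"
      by (auto elim: sets_completionE)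
    moreover from this have "N \<in> null_sets lebesgue"
      by (meson null_sets_completionI null_sets_completion_subset)
    ultimately show ?thesis using that[of S N] by simp
  qed
  have C: "C \<in> null_sets \<Lambda>"
    using BC A_unit by (subst null_sets_restrict_space) auto
  have B_unit: "B \<subseteq> {0..1}" using BC A_unit by auto
  have BL: "B \<in> sets \<Lambda>" using B_sets[OF BC(2)] B_unit by (simp add: Int_absorb2)
  have mB: "measure \<Lambda> B = \<mu>"
    unfolding \<mu>_def BC(1) using BL C by (simp add: measure_Un_null_set)
  have "ennreal (measure \<Lambda> (A \<inter> B)) = ennreal (\<mu> * measure \<Lambda> (B \<inter> {0..1}))"
    using N1[OF BC(2)] N2[OF BC(2)] \<open>N1 = N2\<close> by simp
  moreover have "A \<inter> B = B" using BC by auto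
  ultimately have "ennreal \<mu> = ennreal (\<mu> * \<mu>)" using mB B_unit by (simp add: Int_absorb2)
  then show ?thesis by (simp add: \<mu>_def power2_eq_square)
qed

text \<open>
  For a fixed point, the measure of \<open>{f \<ge> r}\<close> is the mean of those of \<open>{f \<ge> r/2}\<close> and
  \<open>{f \<ge> 1 + r/2}\<close>. At \<open>r = 2\<close> this shows that the values in \<open>[1, 2)\<close> are omitted, and by induction
  at \<open>r = 2 ^ - n\<close> that only the values 0 and 2 are taken. The set where the value is 2 then has
  measure \<open>1/2\<close> and is invariant under the doubling map.
\<close>

lemma alspach_no_fixed_point:
  assumes dom: "f \<in> alspach_domain" and fixed: "AE t in \<Lambda>. alspach f t = f t"
  shows False
proof -
  have f: "integrable \<Lambda> f" and bd: "AE t in \<Lambda>. 0 \<le> f t \<and> f t \<le> 2" and mass: "(\<integral>t. f t \<partial>\<Lambda>) = 1"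
    using dom by (auto simp: alspach_domain_def)
  have f_meas [measurable]: "f \<in> borel_measurable \<Lambda>" using f by auto
  define m where "m r = measure \<Lambda> {t \<in> space \<Lambda>. r \<le> f t}" for r
  have step: "m r = (m (r / 2) + m (1 + r / 2)) / 2" if r: "0 < r" "r \<le> 2" for r
  proof -
    have "m r = measure \<Lambda> {t \<in> space \<Lambda>. alspach f t \<in> {r..}}"
      unfolding m_def
    proof (rule L1.finite_measure_eq_AE)
      show "AE t in \<Lambda>. t \<in> {t \<in> space \<Lambda>. r \<le> f t} \<longleftrightarrow> t \<in> {t \<in> space \<Lambda>. alspach f t \<in> {r..}}"
        using fixed by eventually_elim auto
    qed measurable
    also have "\<dots> = (measure \<Lambda> {t \<in> space \<Lambda>. min (2 * f t) 2 \<in> {r..}} + measure \<Lambda> {t \<in> space \<Lambda>. max (2 * f t - 2) 0 \<in> {r..}}) / 2"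
      unfolding alspach_def by (rule measure_glue) measurable
    also have "{t \<in> space \<Lambda>. min (2 * f t) 2 \<in> {r..}} = {t \<in> space \<Lambda>. r / 2 \<le> f t}" using r by auto
    also have "{t \<in> space \<Lambda>. max (2 * f t - 2) 0 \<in> {r..}} = {t \<in> space \<Lambda>. 1 + r / 2 \<le> f t}" using r by auto
    finally show ?thesis by (simp add: m_def)
  qed
  have mono: "m s \<le> m r" if "r \<le> s" for r s
    unfolding m_def
  proof (rule L1.finite_measure_mono)
    show "{t \<in> space \<Lambda>. s \<le> f t} \<subseteq> {t \<in> space \<Lambda>. r \<le> f t}" using that by auto
  qed measurable
  have m12: "m 1 = m 2" using step[of 2] by simp
  have m_dyadic: "m (1 / 2 ^ n) = m 1" for n
  proof (induction n)
    case (Suc n)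
    have "1 / 2 ^ n \<le> (1::real)" by simp
    moreover have "0 \<le> 1 / (2::real) ^ n" by simp
    moreover have "1 + e / 2 \<le> 2 \<and> 1 \<le> 1 + e / 2" if "0 \<le> e" "e \<le> 1" for e :: real using that by simp
    ultimately have b: "1 + 1 / 2 ^ n / 2 \<le> (2::real)" and b': "(1::real) \<le> 1 + 1 / 2 ^ n / 2" by blast+
    have "m 2 \<le> m (1 + 1 / 2 ^ n / 2)" "m (1 + 1 / 2 ^ n / 2) \<le> m 1"
      by (rule mono[OF b], rule mono[OF b'])
    then have "m (1 + 1 / 2 ^ n / 2) = m 1" using m12 by simp
    moreover have "m (1 / 2 ^ n) = (m (1 / 2 ^ n / 2) + m (1 + 1 / 2 ^ n / 2)) / 2"
      by (rule step) (simp, use \<open>1 / 2 ^ n \<le> (1::real)\<close> in linarith)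
    ultimately show ?case using Suc by (simp add: mult.commute)
  qed simp
  have AE_values: "AE t in \<Lambda>. f t = 0 \<or> f t = 2"
  proof -
    have "AE t in \<Lambda>. \<not> (1 / 2 ^ n \<le> f t \<and> f t < 2)" for n
    proof -
      have "m (1 / 2 ^ n) - m 2 = measure \<Lambda> ({t \<in> space \<Lambda>. 1 / 2 ^ n \<le> f t} - {t \<in> space \<Lambda>. 2 \<le> f t})"
      proof -
        have le1: "1 / 2 ^ n \<le> (1::real)" by simp
        have "{t \<in> space \<Lambda>. 2 \<le> f t} \<subseteq> {t \<in> space \<Lambda>. 1 / 2 ^ n \<le> f t}"
        proof
          fix t assume "t \<in> {t \<in> space \<Lambda>. 2 \<le> f t}"
          moreover from this have "1 / 2 ^ n \<le> f t" using le1 by (simp only: mem_Collect_eq) linarith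
          ultimately show "t \<in> {t \<in> space \<Lambda>. 1 / 2 ^ n \<le> f t}" by simp
        qed
        moreover have "{t \<in> space \<Lambda>. r \<le> f t} \<in> sets \<Lambda>" for r by measurable
        ultimately show ?thesis unfolding m_def by (intro L1.finite_measure_Diff[symmetric])
      qed
      also have "{t \<in> space \<Lambda>. 1 / 2 ^ n \<le> f t} - {t \<in> space \<Lambda>. 2 \<le> f t} = {t \<in> space \<Lambda>. 1 / 2 ^ n \<le> f t \<and> f t < 2}"
        by auto
      finally have "emeasure \<Lambda> {t \<in> space \<Lambda>. 1 / 2 ^ n \<le> f t \<and> f t < 2} = 0"
        unfolding L1.emeasure_eq_measure using m_dyadic m12 by simp
      moreover have "{t \<in> space \<Lambda>. 1 / 2 ^ n \<le> f t \<and> f t < 2} \<in> sets \<Lambda>" by measurable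
      ultimately show ?thesis by (subst AE_iff_measurable) (assumption | blast)+
    qed
    then have "AE t in \<Lambda>. \<forall>n. \<not> (1 / 2 ^ n \<le> f t \<and> f t < 2)" unfolding AE_all_countable by blast
    then show ?thesis
      using bd
    proof eventually_elim
      case (elim t)
      show ?case
      proof (rule ccontr)
        assume "\<not> (f t = 0 \<or> f t = 2)"
        then have "0 < f t" "f t < 2" using elim by auto
        then obtain n where "(1/2) ^ n < f t" using real_arch_pow_inv[of "f t" "1/2"] by auto
        then show False using elim \<open>f t < 2\<close> by (auto simp: power_one_over dest!: spec[of _ n])
      qed
    qed
  qed
  define A where "A = {t \<in> space \<Lambda>. 1 \<le> f t}"
  have A [measurable]: "A \<in> sets \<Lambda>" unfolding A_def by measurable
  have "(\<integral>t. f t \<partial>\<Lambda>) = (\<integral>t. 2 * indicator A t \<partial>\<Lambda>)"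
  proof (rule integral_cong_AE)
    show "AE t in \<Lambda>. f t = 2 * indicator A t"
      using AE_values AE_space by eventually_elim (auto simp: A_def)
  qed measurable
  also have "\<dots> = 2 * measure \<Lambda> (A \<inter> space \<Lambda>)" by (simp del: space_lebesgue_on)
  also have "A \<inter> space \<Lambda> = A" by (auto simp: A_def)
  finally have mA: "measure \<Lambda> A = 1 / 2" using mass by simp
  \<comment> \<open>This detects the values of \<open>f\<close> in \<open>[1/2, 3/2)\<close>, which are omitted. For every other value \<open>y\<close>,
    both \<open>min (2 * y) 2 \<ge> 1\<close> and \<open>max (2 * y - 2) 0 \<ge> 1\<close> are equivalent to \<open>y \<ge> 1\<close>.\<close>
  let ?g = "\<lambda>t. indicator {1/2..<1} (f t) + indicator {1..<3/2} (f t) :: real"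
  have g_meas: "?g \<in> borel_measurable \<Lambda>" by measurable
  have g_AE: "AE t in \<Lambda>. ?g t \<in> {0}" using AE_values by eventually_elim auto
  have "AE t in \<Lambda>. glue ?g ?g t \<in> {0}"
    by (rule AE_glue[OF g_meas g_meas _ g_AE g_AE]) simp
  then have "AE t in \<Lambda>. (indicator A t :: real) = glue (indicator A) (indicator A) t"
    using fixed AE_space AE_values
  proof eventually_elim
    case (elim t)
    define s where "s = (if t \<le> 1/2 then 2 * t else 2 * t - 1)"
    have s: "s \<in> space \<Lambda>" using elim(3) by (auto simp: s_def)
    have g: "glue a a t = a s" for a :: "real \<Rightarrow> real" by (simp add: glue_def s_def)
    have "?g s = 0" using elim(1) g[of ?g] by simp
    then have "\<not> (1/2 \<le> f s \<and> f s < 1) \<and> \<not> (1 \<le> f s \<and> f s < 3/2)"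
      by (auto simp: indicator_def split: if_splits)
    moreover have "f t = (if t \<le> 1/2 then min (2 * f s) 2 else max (2 * f s - 2) 0)"
      using elim(2) by (auto simp: alspach_def glue_def s_def split: if_splits)
    ultimately have "1 \<le> f t \<longleftrightarrow> 1 \<le> f s" by (auto split: if_splits)
    then have "t \<in> A \<longleftrightarrow> s \<in> A" using s elim(3) by (simp add: A_def)
    then show ?case using g[of "indicator A"] by (auto simp: indicator_def)
  qed
  then have "measure \<Lambda> A = (measure \<Lambda> A)\<^sup>2" by (rule doubling_invariant_trivial[OF A])
  then show False using mA by (simp add: power2_eq_square)
qed

lemma alspach_domain_ae:
  assumes f: "f \<in> alspach_domain" and g [measurable]: "g \<in> borel_measurable \<Lambda>" and ae: "AE t in \<Lambda>. g t = f t"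
  shows "g \<in> alspach_domain"
proof -
  have [measurable]: "f \<in> borel_measurable \<Lambda>" using f by (auto simp: alspach_domain_def)
  have "integrable \<Lambda> g \<longleftrightarrow> integrable \<Lambda> f" by (rule integrable_cong_AE) (use ae in measurable)
  moreover have "(\<integral>t. g t \<partial>\<Lambda>) = (\<integral>t. f t \<partial>\<Lambda>)" by (rule integral_cong_AE) (use ae in measurable)
  moreover have "AE t in \<Lambda>. 0 \<le> f t \<and> f t \<le> 2" using f by (simp add: alspach_domain_def)
  then have "AE t in \<Lambda>. 0 \<le> g t \<and> g t \<le> 2" using ae by eventually_elim simp
  ultimately show ?thesis using f by (simp add: alspach_domain_def)
qed

context carrier_normed_space
begin

text \<open>
  A functional composed with the embedding is a functional again.
\<close>

lemma isometric_embedding_weakly_continuous: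
  assumes "linear_between Y X J" and iso: "\<forall>y\<in>pts Y. vnorm X (J y) = vnorm Y y"
    and top: "topspace (weak_topology Y) = pts Y"
  shows "continuous_map (weak_topology Y) (weak_topology X) J"
proof -
  have J: "\<And>y. y \<in> pts Y \<Longrightarrow> J y \<in> pts X"
    "\<And>y z. y \<in> pts Y \<Longrightarrow> z \<in> pts Y \<Longrightarrow> J (vadd Y y z) = vadd X (J y) (J z)"
    "\<And>c y. y \<in> pts Y \<Longrightarrow> J (vscale Y c y) = vscale X c (J y)"
    using assms(1) by (auto simp: linear_between_def)
  have "continuous_map (weak_topology Y) (topology_generated_by {{x \<in> pts X. f x \<in> U} | f U. f \<in> dual_space X \<and> open U}) J"
  proof (rule continuous_on_generated_topo)
    fix W assume "W \<in> {{x \<in> pts X. f x \<in> U} | f U. f \<in> dual_space X \<and> open U}"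
    then obtain \<phi> U where W: "W = {x \<in> pts X. \<phi> x \<in> U}" and \<phi>: "\<phi> \<in> dual_space X" and U: "open U" by blast
    have "(\<lambda>y. \<phi> (J y)) \<in> dual_space Y"
    proof -
      obtain B where lin: "\<forall>x\<in>pts X. \<forall>y\<in>pts X. \<phi> (x \<oplus> y) = \<phi> x + \<phi> y" "\<forall>c. \<forall>x\<in>pts X. \<phi> (c \<cdot> x) = c * \<phi> x"
        and B: "\<forall>x\<in>pts X. \<bar>\<phi> x\<bar> \<le> B * vnorm X x"
        using \<phi> unfolding dual_space_def by blast
      have "\<bar>\<phi> (J y)\<bar> \<le> B * vnorm Y y" if "y \<in> pts Y" for y
        using B J(1)[OF that] iso that by force
      then show ?thesis using lin J unfolding dual_space_def by auto
    qed
    then have "openin (weak_topology Y) {y \<in> pts Y. \<phi> (J y) \<in> U}"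
      unfolding weak_topology_def using U by (intro topology_generated_by_Basis) auto
    also have "{y \<in> pts Y. \<phi> (J y) \<in> U} = J -` W \<inter> topspace (weak_topology Y)"
      unfolding W top using J(1) by auto
    finally show "openin (weak_topology Y) (J -` W \<inter> topspace (weak_topology Y))" .
  next
    have "\<Union> {{x \<in> pts X. f x \<in> U} | f U. f \<in> dual_space X \<and> open U} = pts X"
      using topspace_weak unfolding weak_topology_def topology_generated_by_topspace .
    then show "J ` topspace (weak_topology Y) \<subseteq> \<Union> {{x \<in> pts X. f x \<in> U} | f U. f \<in> dual_space X \<and> open U}"
      using J(1) top by auto
  qed
  then show ?thesis by (simp add: weak_topology_def)
qed

text \<open>
  The embedding carries Alspach's set and map into \<open>X\<close>.
\<close>

theorem contains_L1_imp_not_weak_FPP: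
  assumes "contains_isometric_copy X L1_01"
  shows "\<not> weak_FPP X"
proof
  assume fpp: "weak_FPP X"
  obtain J where lin: "linear_between L1.X X J" and iso: "\<forall>y\<in>pts L1.X. vnorm X (J y) = vnorm L1.X y"
    using assms by (auto simp: contains_isometric_copy_def L1_01_eq)
  have J: "\<And>y. y \<in> pts L1.X \<Longrightarrow> J y \<in> pts X"
    "\<And>y z. y \<in> pts L1.X \<Longrightarrow> z \<in> pts L1.X \<Longrightarrow> J (vadd L1.X y z) = vadd X (J y) (J z)"
    "\<And>c y. y \<in> pts L1.X \<Longrightarrow> J (vscale L1.X c y) = vscale X c (J y)"
    using lin by (auto simp: linear_between_def)
  have J_dist: "vdist X (J y) (J z) = vdist L1.X y z" if "y \<in> pts L1.X" "z \<in> pts L1.X" for y z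
    using that iso unfolding vdist_def by (metis J(2,3) L1.add_pts L1.scale_pts)
  have J_inj: "y = z" if "y \<in> pts L1.X" "z \<in> pts L1.X" "J y = J z" for y z
    using J_dist[OF that(1,2)] that J(1)[OF that(2)] by (intro L1.vdist_eq_zero) auto
  define K where "K = L1.cl ` alspach_domain"
  have dom_int: "integrable \<Lambda> f" if "f \<in> alspach_domain" for f using that by (simp add: alspach_domain_def)
  have KY: "K \<subseteq> pts L1.X" using dom_int by (auto simp: K_def)
  have rep_K: "ae_rep y \<in> alspach_domain" "L1.cl (ae_rep y) = y" if y: "y \<in> K" for y
  proof -
    obtain f where f: "f \<in> alspach_domain" "y = L1.cl f" using y by (auto simp: K_def)
    have fV: "f \<in> {f. integrable \<Lambda> f}" using dom_int[OF f(1)] by simp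
    show "ae_rep y \<in> alspach_domain"
      unfolding f(2) using L1.rep_cl[OF fV] by (intro alspach_domain_ae[OF f(1)]) auto
    show "L1.cl (ae_rep y) = y" using L1.rep_pts(2)[of y] y KY by blast
  qed
  have K_compact: "compactin (weak_topology L1.X) K"
    using L1.weakly_compact_order_interval[of 2 1] by (simp add: K_def alspach_domain_def)
  define C where "C = J ` K"
  define A where "A y = L1.cl (alspach (ae_rep y))" for y
  have A_K: "A y \<in> K" if "y \<in> K" for y
    using alspach_domain_invariant[OF rep_K(1)[OF that]] by (auto simp: A_def K_def)
  have A_dist: "vdist L1.X (A y) (A z) = vdist L1.X y z" if "y \<in> K" "z \<in> K" for y z
  proof -
    note y = rep_K[OF that(1)] and z = rep_K[OF that(2)]
    note int = dom_int[OF y(1)] dom_int[OF z(1)]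
      dom_int[OF alspach_domain_invariant[OF y(1)]] dom_int[OF alspach_domain_invariant[OF z(1)]]
    have "vdist L1.X (A y) (A z) = (\<integral>t. \<bar>alspach (ae_rep y) t - alspach (ae_rep z) t\<bar> \<partial>\<Lambda>)"
      unfolding A_def by (rule L1.vdist_cl) (use int in auto)
    also have "\<dots> = (\<integral>t. \<bar>ae_rep y t - ae_rep z t\<bar> \<partial>\<Lambda>)" by (rule alspach_isometry[OF int(1,2)])
    also have "\<dots> = vdist L1.X (L1.cl (ae_rep y)) (L1.cl (ae_rep z))"
      by (rule L1.vdist_cl[symmetric]) (use int in auto)
    finally show ?thesis unfolding y(2) z(2) .
  qed
  define T where "T c = J (A (inv_into K J c))" for c
  have inj: "inj_on J K" using J_inj KY by (intro inj_onI) blast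
  have T_J: "T (J y) = J (A y)" if "y \<in> K" for y
    using that inj by (simp add: T_def)
  have "\<exists>x\<in>C. T x = x"
  proof (rule fpp[unfolded weak_FPP_def, rule_format], intro conjI)
    have "(\<lambda>_. 1) \<in> alspach_domain"
      using L1.integrable_bounded[of "\<lambda>_. 1" 1] by (simp add: alspach_domain_def)
    then show "C \<noteq> {}" by (auto simp: C_def K_def)
    show "compactin (weak_topology X) C"
      unfolding C_def
      by (rule image_compactin[OF K_compact isometric_embedding_weakly_continuous[OF lin iso L1.topspace_weak]])
    show "convex_in X C"
      unfolding convex_in_def
    proof (intro conjI ballI)
      show "C \<subseteq> pts X" using J(1) KY by (auto simp: C_def)
      fix x z t assume "x \<in> C" "z \<in> C" and t: "t \<in> {0..1::real}"
      then obtain f g where f: "f \<in> alspach_domain" "x = J (L1.cl f)" and g: "g \<in> alspach_domain" "z = J (L1.cl g)"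
        by (auto simp: C_def K_def)
      let ?h = "\<lambda>s. (1 - t) * f s + t * g s"
      have ptsf: "L1.cl f \<in> pts L1.X" "L1.cl g \<in> pts L1.X" using dom_int f(1) g(1) by auto
      have "vadd X (vscale X (1 - t) x) (vscale X t z)
          = J (vadd L1.X (vscale L1.X (1 - t) (L1.cl f)) (vscale L1.X t (L1.cl g)))"
        unfolding f(2) g(2) using ptsf by (simp add: J)
      also have "vadd L1.X (vscale L1.X (1 - t) (L1.cl f)) (vscale L1.X t (L1.cl g)) = L1.cl ?h"
        using dom_int[OF f(1)] dom_int[OF g(1)] by (simp add: L1.vscale_cl L1.vadd_cl)
      finally have eq: "vadd X (vscale X (1 - t) x) (vscale X t z) = J (L1.cl ?h)" .
      have "AE s in \<Lambda>. 0 \<le> f s \<and> f s \<le> 2" "AE s in \<Lambda>. 0 \<le> g s \<and> g s \<le> 2"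
        using f(1) g(1) by (simp_all add: alspach_domain_def)
      then have "AE s in \<Lambda>. 0 \<le> ?h s \<and> ?h s \<le> 2"
      proof eventually_elim
        case (elim s)
        have "(1 - t) * f s \<le> (1 - t) * 2" "t * g s \<le> t * 2"
          using t elim mult_left_mono[of "f s" 2 "1 - t"] mult_left_mono[of "g s" 2 t] by auto
        moreover have "0 \<le> (1 - t) * f s" "0 \<le> t * g s" using t elim by auto
        moreover have "(1 - t) * 2 + t * 2 = 2" by (simp add: left_diff_distrib)
        ultimately show ?case using add_mono[of "(1 - t) * f s" "(1 - t) * 2" "t * g s" "t * 2"] by simp
      qed
      moreover have "(\<integral>s. ?h s \<partial>\<Lambda>) = 1"
        using f(1) g(1) by (simp add: alspach_domain_def)
      ultimately have "?h \<in> alspach_domain"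
        using dom_int[OF f(1)] dom_int[OF g(1)] by (simp add: alspach_domain_def)
      then show "vadd X (vscale X (1 - t) x) (vscale X t z) \<in> C" unfolding eq C_def K_def by blast
    qed
    show "T ` C \<subseteq> C" using T_J A_K by (auto simp: C_def)
    show "nonexpansive_on X C T"
      unfolding nonexpansive_on_def C_def
    proof (intro ballI, elim imageE)
      fix x z y y' assume y: "x = J y" "y \<in> K" and y': "z = J y'" "y' \<in> K"
      have "vdist X (T x) (T z) = vdist L1.X (A y) (A y')"
        unfolding y(1) y'(1) T_J[OF y(2)] T_J[OF y'(2)] using A_K y(2) y'(2) KY by (intro J_dist) auto
      also have "\<dots> = vdist L1.X y y'" by (rule A_dist[OF y(2) y'(2)])
      also have "\<dots> = vdist X x z" unfolding y(1) y'(1) using y(2) y'(2) KY by (intro J_dist[symmetric]) auto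
      finally show "vdist X (T x) (T z) \<le> vdist X x z" by simp
    qed
  qed
  then obtain y where y: "y \<in> K" "J (A y) = J y" using T_J by (auto simp: C_def)
  then have "A y = y" using J_inj A_K KY by blast
  then have "L1.cl (alspach (ae_rep y)) = L1.cl (ae_rep y)" using rep_K(2)[OF y(1)] by (simp add: A_def)
  then have "AE t in \<Lambda>. alspach (ae_rep y) t = ae_rep y t"
    using dom_int rep_K(1)[OF y(1)] alspach_domain_invariant by (subst (asm) L1.cl_eq_iff) auto
  then show False using alspach_no_fixed_point rep_K(1)[OF y(1)] by blast
qed

end

section \<open>Uniformly distributed functions on atomless spaces\<close>

locale atomless_finite_measure = finite_measure M for M :: "'a measure" +
  assumes splits: "A \<in> sets M \<Longrightarrow> 0 < measure M A \<Longrightarrow>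
      \<exists>B\<in>sets M. B \<subseteq> A \<and> 0 < measure M B \<and> measure M B < measure M A"
begin

text \<open>
  Of two complementary parts of a set one has at most half of its measure.
\<close>

lemma small_positive_subset:
  assumes A: "A \<in> sets M" "0 < measure M A" and e: "0 < e"
  shows "\<exists>B\<in>sets M. B \<subseteq> A \<and> 0 < measure M B \<and> measure M B < e"
proof -
  have "\<exists>B\<in>sets M. B \<subseteq> A \<and> 0 < measure M B \<and> measure M B \<le> measure M A / 2 ^ n" for n
  proof (induction n)
    case 0
    show ?case using A by auto
  next
    case (Suc n)
    then obtain B where B: "B \<in> sets M" "B \<subseteq> A" "0 < measure M B" "measure M B \<le> measure M A / 2 ^ n" by blast
    obtain C where C: "C \<in> sets M" "C \<subseteq> B" "0 < measure M C" "measure M C < measure M B"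
      using splits[OF B(1,3)] by blast
    have D: "measure M (B - C) = measure M B - measure M C" using finite_measure_Diff[OF B(1) C(1,2)] .
    show ?case
    proof (cases "measure M C \<le> measure M B / 2")
      case True
      then show ?thesis using B C by (intro bexI[of _ C]) auto
    next
      case False
      then show ?thesis using B C D by (intro bexI[of _ "B - C"]) auto
    qed
  qed
  moreover have "(\<lambda>n. measure M A / 2 ^ n) \<longlonglongrightarrow> 0" by (rule LIMSEQ_divide_realpow_zero) simp
  then obtain n where "measure M A / 2 ^ n < e"
    using order_tendstoD(2)[OF _ e] by (force dest: eventually_happens'[OF sequentially_bot])
  ultimately show ?thesis by (meson le_less_trans)
qed

text \<open>
  Sierpinski's theorem: enlarge a set greedily, keeping its measure below \<open>r\<close> and taking each time
  almost the best enlargement; a set of small measure could still be added to the union if that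
  fell short of \<open>r\<close>.
\<close>

lemma subset_of_given_measure:
  assumes A: "A \<in> sets M" and r: "0 \<le> r" "r \<le> measure M A"
  shows "\<exists>B\<in>sets M. B \<subseteq> A \<and> measure M B = r"
proof -
  define adm where "adm = {B \<in> sets M. B \<subseteq> A \<and> measure M B \<le> r}"
  have best: "\<exists>D\<in>adm. C \<subseteq> D \<and> (\<forall>D'\<in>adm. C \<subseteq> D' \<longrightarrow> measure M D' \<le> measure M D + e)"
    if C: "C \<in> adm" and e: "0 < e" for C e
  proof -
    define S where "S = measure M ` {D \<in> adm. C \<subseteq> D}"
    have S: "S \<noteq> {}" "bdd_above S" using C by (auto simp: S_def adm_def intro!: bdd_aboveI[of _ r])
    obtain D where D: "D \<in> adm" "C \<subseteq> D" "Sup S - e < measure M D"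
      using less_cSupD[OF S(1), of "Sup S - e"] e by (auto simp: S_def)
    have "measure M D' \<le> measure M D + e" if "D' \<in> adm" "C \<subseteq> D'" for D'
    proof -
      have "measure M D' \<le> Sup S" using that S(2) by (intro cSup_upper) (auto simp: S_def)
      then show ?thesis using D(3) by simp
    qed
    then show ?thesis using D by blast
  qed
  have "\<exists>C. \<forall>n::nat. C n \<in> adm \<and> (C n \<subseteq> C (Suc n) \<and>
      (\<forall>D'\<in>adm. C n \<subseteq> D' \<longrightarrow> measure M D' \<le> measure M (C (Suc n)) + 1 / real (Suc n)))"
  proof (rule dependent_nat_choice)
    show "\<exists>x. x \<in> adm" using r by (intro exI[of _ "{}"]) (simp add: adm_def)
  next
    fix C and n :: nat assume "C \<in> adm"
    then show "\<exists>y. y \<in> adm \<and> C \<subseteq> y \<and> (\<forall>D'\<in>adm. C \<subseteq> D' \<longrightarrow> measure M D' \<le> measure M y + 1 / real (Suc n))"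
      using best[of C "1 / real (Suc n)"] by auto
  qed
  then obtain C where C: "\<And>n. C n \<in> adm" "\<And>n. C n \<subseteq> C (Suc n)"
      "\<And>n D'. D' \<in> adm \<Longrightarrow> C n \<subseteq> D' \<Longrightarrow> measure M D' \<le> measure M (C (Suc n)) + 1 / real (Suc n)"
    by blast
  define U where "U = (\<Union>n. C n)"
  have U: "U \<in> sets M" "U \<subseteq> A" using C(1) by (auto simp: U_def adm_def)
  have "(\<lambda>n. measure M (C n)) \<longlonglongrightarrow> measure M U"
    unfolding U_def using C(1,2) by (intro finite_Lim_measure_incseq incseq_SucI) (auto simp: adm_def)
  then have Ur: "measure M U \<le> r" by (rule LIMSEQ_le_const2) (use C(1) in \<open>auto simp: adm_def\<close>)
  have "measure M U = r"
  proof (rule ccontr)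
    assume "measure M U \<noteq> r"
    then have less: "measure M U < r" using Ur by simp
    then have "0 < measure M (A - U)" using finite_measure_Diff[OF A U] r by simp
    then obtain B where B: "B \<in> sets M" "B \<subseteq> A - U" "0 < measure M B" "measure M B < r - measure M U"
      using small_positive_subset[of "A - U" "r - measure M U"] A U less by auto
    have UB: "measure M (U \<union> B) = measure M U + measure M B"
      using B U by (intro finite_measure_Union) auto
    have adm: "U \<union> B \<in> adm" using B U UB by (auto simp: adm_def)
    have "measure M B \<le> 1 / real (Suc n)" for n
    proof -
      have "measure M (U \<union> B) \<le> measure M (C (Suc n)) + 1 / real (Suc n)"
        by (rule C(3)[OF adm]) (auto simp: U_def)
      also have "measure M (C (Suc n)) \<le> measure M U"
        using U by (intro finite_measure_mono) (auto simp: U_def)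
      finally show ?thesis using UB by simp
    qed
    moreover obtain n where "inverse (real (Suc n)) < measure M B" using reals_Archimedean[OF B(3)] by blast
    ultimately show False by (metis inverse_eq_divide not_le)
  qed
  then show ?thesis using U by blast
qed

lemma intermediate_set:
  assumes "A \<in> sets M" "B \<in> sets M" "A \<subseteq> B"
  shows "\<exists>C\<in>sets M. A \<subseteq> C \<and> C \<subseteq> B \<and> measure M C = (measure M A + measure M B) / 2"
proof -
  have le: "measure M A \<le> measure M B" using assms by (intro finite_measure_mono) auto
  have diff: "measure M (B - A) = measure M B - measure M A" using assms by (intro finite_measure_Diff) auto
  obtain D where D: "D \<in> sets M" "D \<subseteq> B - A" "measure M D = (measure M B - measure M A) / 2"
    using subset_of_given_measure[of "B - A" "(measure M B - measure M A) / 2"] assms le diff by auto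
  have "measure M (A \<union> D) = measure M A + measure M D"
    using assms D by (intro finite_measure_Union) auto
  then show ?thesis using assms D by (intro bexI[of _ "A \<union> D"]) (auto simp: field_simps)
qed

definition mid_set :: "'a set \<Rightarrow> 'a set \<Rightarrow> 'a set" where
  "mid_set A B = (SOME C. C \<in> sets M \<and> A \<subseteq> C \<and> C \<subseteq> B \<and> measure M C = (measure M A + measure M B) / 2)"

lemma mid_set:
  assumes "A \<in> sets M" "B \<in> sets M" "A \<subseteq> B"
  shows "mid_set A B \<in> sets M \<and> A \<subseteq> mid_set A B \<and> mid_set A B \<subseteq> B \<and>
    measure M (mid_set A B) = (measure M A + measure M B) / 2"
proof -
  let ?P = "\<lambda>C. C \<in> sets M \<and> A \<subseteq> C \<and> C \<subseteq> B \<and> measure M C = (measure M A + measure M B) / 2"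
  have "\<exists>C. ?P C" using intermediate_set[OF assms] by blast
  then have "?P (SOME C. ?P C)" by (rule someI_ex)
  then show ?thesis by (simp only: mid_set_def)
qed

text \<open>\<open>dyadic n k\<close> is an increasing family of sets of measure \<open>k / 2 ^ n\<close> times that of the
  space, so that a point can be mapped to the dyadic parameter at which it enters the family.\<close>

fun dyadic :: "nat \<Rightarrow> nat \<Rightarrow> 'a set" where
  "dyadic 0 k = (if k = 0 then {} else space M)"
| "dyadic (Suc n) k = (if even k then dyadic n (k div 2)
      else mid_set (dyadic n (k div 2)) (dyadic n (Suc (k div 2))))"

lemma dyadic_step:
  "dyadic n k \<in> sets M \<and> dyadic n k \<subseteq> dyadic n (Suc k)"
proof (induction n arbitrary: k)
  case 0
  show ?case by (cases "k = 0") simp_all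
next
  case (Suc n)
  note mid = mid_set[of "dyadic n (k div 2)" "dyadic n (Suc (k div 2))"]
  show ?case
  proof (cases "even k")
    case True
    then show ?thesis using Suc[of "k div 2"] Suc[of "Suc (k div 2)"] mid by simp
  next
    case False
    then have "Suc k div 2 = Suc (k div 2)" by presburger
    then show ?thesis using Suc[of "k div 2"] Suc[of "Suc (k div 2)"] mid False by simp
  qed
qed

lemma dyadic_sets [measurable]: "dyadic n k \<in> sets M"
  by (rule conjunct1[OF dyadic_step])

lemma dyadic_mono: "k \<le> l \<Longrightarrow> dyadic n k \<subseteq> dyadic n l"
  by (rule lift_Suc_mono_le[of "dyadic n"]) (rule conjunct2[OF dyadic_step])

lemma measure_dyadic: "k \<le> 2 ^ n \<Longrightarrow> measure M (dyadic n k) = real k / 2 ^ n * measure M (space M)"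
proof (induction n arbitrary: k)
  case 0
  then have "k = 0 \<or> k = 1" by auto
  then show ?case by (elim disjE) simp_all
next
  case (Suc n)
  show ?case
  proof (cases "even k")
    case True
    then obtain j where j: "k = 2 * j" by (elim evenE)
    then have "j \<le> 2 ^ n" using Suc.prems by simp
    then show ?thesis unfolding j using Suc.IH[of j] by simp
  next
    case False
    then obtain j where j: "k = 2 * j + 1" by (elim oddE)
    then have "j \<le> 2 ^ n" "Suc j \<le> 2 ^ n" using Suc.prems by auto
    moreover have "k div 2 = j" using j by simp
    moreover have "measure M (mid_set (dyadic n j) (dyadic n (Suc j)))
        = (measure M (dyadic n j) + measure M (dyadic n (Suc j))) / 2"
      using mid_set[of "dyadic n j" "dyadic n (Suc j)"] dyadic_step[of n j] dyadic_sets by simp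
    moreover have "dyadic (Suc n) k = mid_set (dyadic n (k div 2)) (dyadic n (Suc (k div 2)))"
      using False by simp
    ultimately have "measure M (dyadic (Suc n) k)
        = (real j / 2 ^ n * measure M (space M) + real (Suc j) / 2 ^ n * measure M (space M)) / 2"
      using Suc.IH[of j] Suc.IH[of "Suc j"] by simp
    also have "\<dots> = real k / 2 ^ Suc n * measure M (space M)"
      unfolding j by (simp add: add_divide_distrib distrib_right)
    finally show ?thesis .
  qed
qed

lemma dyadic_refine: "dyadic (n + i) (2 ^ i * k) = dyadic n k"
  by (induction i) (simp_all add: mult.assoc)

lemma dyadic_mono_real:
  assumes "real k / 2 ^ n \<le> real l / 2 ^ m"
  shows "dyadic n k \<subseteq> dyadic m l"
proof -
  have "real k * 2 ^ m \<le> real l * 2 ^ n" using assms by (simp add: field_simps)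
  then have "real (2 ^ m * k) \<le> real (2 ^ n * l)" by (simp add: mult.commute)
  then have "2 ^ m * k \<le> 2 ^ n * l" by (simp only: of_nat_le_iff)
  then have "dyadic (n + m) (2 ^ m * k) \<subseteq> dyadic (m + n) (2 ^ n * l)"
    unfolding add.commute[of n m] by (rule dyadic_mono)
  then show ?thesis by (simp only: dyadic_refine)
qed

definition entry :: "'a \<Rightarrow> real" where
  "entry x = Inf {real k / 2 ^ n | n k. k \<le> 2 ^ n \<and> x \<in> dyadic n k}"

lemma entry_less_iff:
  assumes x: "x \<in> space M"
  shows "entry x < t \<longleftrightarrow> (\<exists>n k. k \<le> 2 ^ n \<and> real k / 2 ^ n < t \<and> x \<in> dyadic n k)"
proof -
  let ?S = "{real k / 2 ^ n | n k. k \<le> 2 ^ n \<and> x \<in> dyadic n k}"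
  have "x \<in> dyadic 0 1" using x by simp
  then have "real 1 / 2 ^ 0 \<in> ?S" by (intro CollectI exI[of _ 0] exI[of _ 1]) simp
  then have ne: "?S \<noteq> {}" by blast
  have bdd: "bdd_below ?S" by (rule bdd_belowI[of _ 0]) auto
  show ?thesis unfolding entry_def cInf_less_iff[OF ne bdd] by auto
qed

lemma entry_range:
  assumes x: "x \<in> space M"
  shows "0 \<le> entry x" "entry x \<le> 1"
proof -
  show "0 \<le> entry x"
    using entry_less_iff[OF x, of 0] by (auto simp: not_less[symmetric] divide_less_0_iff)
  have "entry x < t" if "1 < t" for t
    unfolding entry_less_iff[OF x] using x that by (intro exI[of _ 0] exI[of _ 1]) simp
  then show "entry x \<le> 1" by (rule dense_ge[OF less_imp_le])
qed

lemma entry_measurable [measurable]: "entry \<in> borel_measurable M"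
proof (rule borel_measurableI_less)
  fix t
  have "{x \<in> space M. entry x < t} = (\<Union>n. \<Union>k\<in>{k. k \<le> 2 ^ n \<and> real k / 2 ^ n < t}. dyadic n k)"
  proof (intro set_eqI iffI)
    fix x assume "x \<in> {x \<in> space M. entry x < t}"
    then show "x \<in> (\<Union>n. \<Union>k\<in>{k. k \<le> 2 ^ n \<and> real k / 2 ^ n < t}. dyadic n k)"
      using entry_less_iff[of x t] by auto
  next
    fix x assume "x \<in> (\<Union>n. \<Union>k\<in>{k. k \<le> 2 ^ n \<and> real k / 2 ^ n < t}. dyadic n k)"
    then obtain n k where "k \<le> 2 ^ n" "real k / 2 ^ n < t" "x \<in> dyadic n k" by blast
    moreover from this have "x \<in> space M" using sets.sets_into_space[OF dyadic_sets] by blast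
    ultimately show "x \<in> {x \<in> space M. entry x < t}" using entry_less_iff[of x t] by blast
  qed
  also have "\<dots> \<in> sets M"
    by (intro sets.countable_UN' countable_Collect dyadic_sets) auto
  finally show "{x \<in> space M. entry x < t} \<in> sets M" .
qed

lemma measure_entry_less:
  assumes t: "0 \<le> t" "t \<le> 1"
  shows "measure M {x \<in> space M. entry x < t} = t * measure M (space M)"
proof -
  let ?m = "measure M (space M)" and ?E = "{x \<in> space M. entry x < t}"
  have E [measurable]: "?E \<in> sets M" by measurable
  have bounds: "(t - 1 / 2 ^ n) * ?m \<le> measure M ?E \<and> measure M ?E \<le> (t + 1 / 2 ^ n) * ?m" for n
  proof
    define k where "k = nat \<lceil>t * 2 ^ n\<rceil>"
    have kr: "real k = of_int \<lceil>t * 2 ^ n\<rceil>" using t by (simp add: k_def)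
    have k: "t * 2 ^ n \<le> real k" "real k < t * 2 ^ n + 1" unfolding kr by linarith+
    have "t * 2 ^ n \<le> 2 ^ n" using t by (simp add: mult_left_le_one_le)
    then have "\<lceil>t * 2 ^ n\<rceil> \<le> 2 ^ n" by (simp add: ceiling_le_iff)
    then have k_le: "k \<le> 2 ^ n" by (simp add: k_def nat_le_iff)
    have "?E \<subseteq> dyadic n k"
    proof
      fix x assume "x \<in> ?E"
      then obtain m l where "real l / 2 ^ m < t" "x \<in> dyadic m l" using entry_less_iff by blast
      moreover have "t \<le> real k / 2 ^ n" using k(1) by (simp add: field_simps)
      ultimately show "x \<in> dyadic n k" using dyadic_mono_real[of l m k n] by auto
    qed
    then have "measure M ?E \<le> measure M (dyadic n k)" by (intro finite_measure_mono) auto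
    also have "\<dots> = real k / 2 ^ n * ?m" by (rule measure_dyadic[OF k_le])
    also have "\<dots> \<le> (t + 1 / 2 ^ n) * ?m"
    proof (rule mult_right_mono)
      show "real k / 2 ^ n \<le> t + 1 / 2 ^ n" using k(2) by (simp add: field_simps)
    qed simp
    finally show "measure M ?E \<le> (t + 1 / 2 ^ n) * ?m" .
    show "(t - 1 / 2 ^ n) * ?m \<le> measure M ?E"
    proof (cases "k = 0")
      case True
      then have "t * 2 ^ n \<le> 0" using k(1) by simp
      then have "t * 2 ^ n \<le> 0 * 2 ^ n" by simp
      then have "t \<le> 0" by (rule mult_right_le_imp_le) simp
      moreover have "0 \<le> 1 / (2::real) ^ n" by simp
      ultimately have "t - 1 / 2 ^ n \<le> 0" by linarith
      then have "(t - 1 / 2 ^ n) * ?m \<le> 0" by (rule mult_nonpos_nonneg) simp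
      then show ?thesis using measure_nonneg[of M ?E] by linarith
    next
      case False
      then have k': "real (k - 1) = real k - 1" by (simp add: of_nat_diff)
      have less: "real (k - 1) / 2 ^ n < t" unfolding k' using k(2) by (simp add: field_simps)
      have "dyadic n (k - 1) \<subseteq> ?E"
      proof
        fix x assume x: "x \<in> dyadic n (k - 1)"
        then have "x \<in> space M" using sets.sets_into_space[OF dyadic_sets] by blast
        moreover have "k - 1 \<le> 2 ^ n" using k_le by simp
        ultimately show "x \<in> ?E" using entry_less_iff[of x t] less x by blast
      qed
      then have "measure M (dyadic n (k - 1)) \<le> measure M ?E" by (intro finite_measure_mono) auto
      moreover have "measure M (dyadic n (k - 1)) = real (k - 1) / 2 ^ n * ?m"
        using k_le by (intro measure_dyadic) auto
      moreover have "(t - 1 / 2 ^ n) * ?m \<le> real (k - 1) / 2 ^ n * ?m"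
      proof (rule mult_right_mono)
        show "t - 1 / 2 ^ n \<le> real (k - 1) / 2 ^ n" unfolding k' using k(1) by (simp add: field_simps)
      qed simp
      ultimately show ?thesis by simp
    qed
  qed
  have lim: "(\<lambda>n. 1 / 2 ^ n :: real) \<longlonglongrightarrow> 0" by (rule LIMSEQ_divide_realpow_zero) simp
  have l1: "(\<lambda>n. (t - 1 / 2 ^ n) * ?m) \<longlonglongrightarrow> (t - 0) * ?m" by (intro tendsto_intros lim)
  have l2: "(\<lambda>n. (t + 1 / 2 ^ n) * ?m) \<longlonglongrightarrow> (t + 0) * ?m" by (intro tendsto_intros lim)
  have "(t - 0) * ?m \<le> measure M ?E" by (rule LIMSEQ_le_const2[OF l1]) (use bounds in auto)
  moreover have "measure M ?E \<le> (t + 0) * ?m" by (rule LIMSEQ_le_const[OF l2]) (use bounds in auto)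
  ultimately show ?thesis by simp
qed

theorem distr_entry:
  "distr M borel entry = density lborel (\<lambda>t. ennreal (measure M (space M)) * indicator {0..1} t)"
proof (rule measure_eqI_lessThan)
  let ?m = "measure M (space M)"
  have dens: "emeasure (density lborel (\<lambda>t. ennreal ?m * indicator {0..1} t)) {x<..}
      = ennreal ?m * emeasure lborel ({0..1} \<inter> {x<..})" for x :: real
  proof -
    have "emeasure (density lborel (\<lambda>t. ennreal ?m * indicator {0..1} t)) {x<..}
        = (\<integral>\<^sup>+t. ennreal ?m * indicator ({0..1} \<inter> {x<..}) t \<partial>lborel)"
      by (subst emeasure_density) (auto intro!: nn_integral_cong simp: indicator_def)
    then show ?thesis by (simp add: nn_integral_cmult_indicator)
  qed
  have em: "emeasure (distr M borel entry) {x<..} = ennreal (measure M {y \<in> space M. x < entry y})" for x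
  proof -
    have "entry -` {x<..} \<inter> space M = {y \<in> space M. x < entry y}" by auto
    then show ?thesis by (subst emeasure_distr) (simp_all add: emeasure_eq_measure)
  qed
  show "emeasure (distr M borel entry) {x<..} < \<infinity>" for x by (simp add: em)
  fix x :: real
  have le: "measure M {y \<in> space M. entry y \<le> x} = x * ?m" if x: "0 \<le> x" "x < 1" for x
  proof (rule antisym)
    have lim: "(\<lambda>n. min 1 (x + 1 / real (Suc n)) * ?m) \<longlonglongrightarrow> min 1 (x + 0) * ?m"
      using LIMSEQ_inverse_real_of_nat by (intro tendsto_intros) (simp add: inverse_eq_divide)
    have "measure M {y \<in> space M. entry y \<le> x} \<le> min 1 (x + 0) * ?m"
    proof (rule LIMSEQ_le_const[OF lim], intro exI[of _ 0] allI impI)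
      fix n :: nat
      let ?t = "min 1 (x + 1 / real (Suc n))"
      have "x < ?t" using x by simp
      then have "{y \<in> space M. entry y \<le> x} \<subseteq> {y \<in> space M. entry y < ?t}"
        using le_less_trans by blast
      then have "measure M {y \<in> space M. entry y \<le> x} \<le> measure M {y \<in> space M. entry y < ?t}"
        by (rule finite_measure_mono) measurable
      also have "\<dots> = ?t * ?m" using x by (intro measure_entry_less) auto
      finally show "measure M {y \<in> space M. entry y \<le> x} \<le> ?t * ?m" .
    qed
    then show "measure M {y \<in> space M. entry y \<le> x} \<le> x * ?m" using x by simp
    have "x * ?m = measure M {y \<in> space M. entry y < x}" using x by (intro measure_entry_less[symmetric]) auto
    also have "\<dots> \<le> measure M {y \<in> space M. entry y \<le> x}" by (intro finite_measure_mono) auto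
    finally show "x * ?m \<le> measure M {y \<in> space M. entry y \<le> x}" .
  qed
  consider "x < 0" | "0 \<le> x" "x < 1" | "1 \<le> x" by linarith
  then show "emeasure (distr M borel entry) {x<..} = emeasure (density lborel (\<lambda>t. ennreal ?m * indicator {0..1} t)) {x<..}"
  proof cases
    case 1
    then have "{y \<in> space M. x < entry y} = space M" "{0..1} \<inter> {x<..} = {0..1::real}"
      using entry_range(1) by force+
    then show ?thesis by (simp add: em dens)
  next
    case 2
    have "{y \<in> space M. x < entry y} = space M - {y \<in> space M. entry y \<le> x}" by auto
    then have "measure M {y \<in> space M. x < entry y} = ?m - x * ?m"
      using le[OF 2] by (simp add: finite_measure_compl)
    moreover have "{0..1} \<inter> {x<..} = {x<..1}" using 2 by auto
    ultimately show ?thesis using 2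
      by (simp add: em dens ennreal_mult'[symmetric] left_diff_distrib mult.commute)
  next
    case 3
    then have e1: "{y \<in> space M. x < entry y} = {}" and e2: "{0..1} \<inter> {x<..} = {}"
      using entry_range(2) by force+
    show ?thesis unfolding em dens e1 e2 by simp
  qed
qed auto

end

section \<open>A countable norming family for L1 of the unit interval\<close>

text \<open>
  The members of \<open>L\<^sup>1[0,1]\<close> are Lebesgue measurable functions, which may become nonmeasurable when
  composed with a measurable function. Borel representatives avoid this.
\<close>

lemma borel_version:
  assumes "f \<in> borel_measurable \<Lambda>"
  shows "\<exists>g\<in>borel_measurable borel. AE t in lborel. t \<in> {0..1} \<longrightarrow> f t = (g t :: real)"
proof -
  have "(\<lambda>t. indicator {0..1} t *\<^sub>R f t) \<in> borel_measurable lebesgue"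
    using assms by (subst (asm) borel_measurable_restrict_space_iff) auto
  then obtain g where g: "g \<in> borel_measurable lborel" "AE t in lborel. indicator {0..1} t *\<^sub>R f t = g t"
    using completion_ex_borel_measurable_real by blast
  have "AE t in lborel. t \<in> {0..1} \<longrightarrow> f t = g t"
    using g(2) by eventually_elim auto
  then show ?thesis using g(1) by auto
qed

definition borel_rep :: "(real \<Rightarrow> real) \<Rightarrow> real \<Rightarrow> real" where
  "borel_rep f = (SOME g. g \<in> borel_measurable borel \<and> (AE t in lborel. t \<in> {0..1} \<longrightarrow> f t = g t))"

lemma borel_rep:
  assumes "f \<in> borel_measurable \<Lambda>"
  shows "borel_rep f \<in> borel_measurable borel" "AE t in lborel. t \<in> {0..1} \<longrightarrow> f t = borel_rep f t"
proof -
  let ?P = "\<lambda>g. g \<in> borel_measurable borel \<and> (AE t in lborel. t \<in> {0..1} \<longrightarrow> f t = g t)"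
  have "\<exists>g. ?P g" using borel_version[OF assms] by blast
  then have "?P (SOME g. ?P g)" by (rule someI_ex)
  then show "borel_rep f \<in> borel_measurable borel" "AE t in lborel. t \<in> {0..1} \<longrightarrow> f t = borel_rep f t"
    by (simp_all add: borel_rep_def)
qed

lemma AE_unit_iff: "(AE t in \<Lambda>. P t) \<longleftrightarrow> (AE t in lebesgue. t \<in> {0..1} \<longrightarrow> P t)"
  by (rule AE_restrict_space_iff) simp

lemma nn_integral_unit_borel_rep:
  assumes f: "f \<in> borel_measurable \<Lambda>"
  shows "(\<integral>\<^sup>+t. ennreal \<bar>f t\<bar> \<partial>\<Lambda>) = (\<integral>\<^sup>+t. ennreal \<bar>borel_rep f t\<bar> * indicator {0..1} t \<partial>lborel)"
proof -
  note [measurable] = borel_rep(1)[OF f]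
  have "(\<integral>\<^sup>+t. ennreal \<bar>f t\<bar> \<partial>\<Lambda>) = (\<integral>\<^sup>+t. ennreal \<bar>f t\<bar> * indicator {0..1} t \<partial>lebesgue)"
    by (rule nn_integral_restrict_space) simp
  also have "\<dots> = (\<integral>\<^sup>+t. ennreal \<bar>borel_rep f t\<bar> * indicator {0..1} t \<partial>lebesgue)"
  proof (rule nn_integral_cong_AE)
    show "AE t in lebesgue. ennreal \<bar>f t\<bar> * indicator {0..1} t = ennreal \<bar>borel_rep f t\<bar> * indicator {0..1} t"
      using AE_completion[OF borel_rep(2)[OF f]] by eventually_elim (auto simp: indicator_def)
  qed
  also have "\<dots> = (\<integral>\<^sup>+t. ennreal \<bar>borel_rep f t\<bar> * indicator {0..1} t \<partial>lborel)"
    by (rule nn_integral_completion)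
  finally show ?thesis .
qed

lemma borel_sets_unit:
  assumes "W \<in> sets borel" shows "W \<inter> {0..1} \<in> sets \<Lambda>"
proof -
  have "W \<in> sets lebesgue" using assms by (metis sets_completionI_sets sets_lborel)
  then show ?thesis by (auto simp: sets_restrict_space)
qed

lemma sign_measurable:
  assumes W: "W \<in> sets borel"
  shows "(\<lambda>t. 2 * indicator W t - 1 :: real) \<in> borel_measurable \<Lambda>"
proof -
  have "(\<lambda>t. 2 * indicator (W \<inter> {0..1}) t - 1 :: real) \<in> borel_measurable \<Lambda>"
    using borel_sets_unit[OF W] by measurable
  also have "?this \<longleftrightarrow> ?thesis"
    by (rule measurable_cong) (auto simp: indicator_def)
  finally show ?thesis .
qed

text \<open>
  The finite measure with density \<open>\<bar>f\<bar>\<close> is regular, so the set \<open>{f > 0}\<close> is approximated in this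
  measure by a finite union of basic open sets. The corresponding sign function almost norms
  \<open>f\<close>, and there are only countably many of them.
\<close>

lemma countable_norming_family:
  obtains W :: "nat \<Rightarrow> real set" where "\<And>k. W k \<in> sets borel"
    "\<And>(f :: real \<Rightarrow> real) e. integrable \<Lambda> f \<Longrightarrow> 0 < e \<Longrightarrow>
       \<exists>k. (\<integral>t. \<bar>f t\<bar> \<partial>\<Lambda>) - e < (\<integral>t. f t * (2 * indicator (W k) t - 1) \<partial>\<Lambda>)"
proof -
  obtain \<B> :: "real set set" where \<B>: "countable \<B>" "topological_basis \<B>"
    using ex_countable_basis by blast
  define \<W> where "\<W> = Union ` {F. finite F \<and> F \<subseteq> \<B>}"
  have \<W>: "countable \<W>" "\<W> \<noteq> {}"
    using countable_Collect_finite_subset[OF \<B>(1)] by (auto simp: \<W>_def)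
  define W where "W = from_nat_into \<W>"
  have W_mem: "W k \<in> \<W>" for k unfolding W_def by (rule from_nat_into[OF \<W>(2)])
  have W_surj: "\<exists>k. W k = S" if "S \<in> \<W>" for S
    unfolding W_def using from_nat_into_surj[OF \<W>(1) that] .
  have \<W>_open: "open S" if "S \<in> \<W>" for S
    using that topological_basis_open[OF \<B>(2)] by (auto simp: \<W>_def)
  show thesis
  proof (rule that[of W])
    show "W k \<in> sets borel" for k using \<W>_open[OF W_mem] by (rule borel_open)
    fix f :: "real \<Rightarrow> real" and e :: real
    assume f: "integrable \<Lambda> f" and e: "0 < e"
    have fm [measurable]: "f \<in> borel_measurable \<Lambda>" using f by auto
    define g where "g = borel_rep f"
    have g [measurable]: "g \<in> borel_measurable borel" and fg: "AE t in lborel. t \<in> {0..1} \<longrightarrow> f t = g t"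
      unfolding g_def by (rule borel_rep[OF fm])+
    have fg': "AE t in \<Lambda>. f t = g t" unfolding AE_unit_iff by (rule AE_completion[OF fg])
    define N where "N = density lborel (\<lambda>t. ennreal \<bar>g t\<bar> * indicator {0..1} t)"
    have sets_N [simp]: "sets N = sets borel" and space_N [simp]: "space N = UNIV" by (simp_all add: N_def)
    have N_eq: "emeasure N S = (\<integral>\<^sup>+t. ennreal (\<bar>f t\<bar> * indicator S t) \<partial>\<Lambda>)" if S [measurable]: "S \<in> sets borel" for S
    proof -
      have SL: "indicator S \<in> borel_measurable lebesgue"
        using S by (intro borel_measurable_indicator) (metis sets_completionI_sets sets_lborel)
      have "emeasure N S = (\<integral>\<^sup>+t. ennreal \<bar>g t\<bar> * indicator {0..1} t * indicator S t \<partial>lborel)"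
        unfolding N_def by (rule emeasure_density) measurable
      also have "\<dots> = (\<integral>\<^sup>+t. ennreal \<bar>g t\<bar> * indicator {0..1} t * indicator S t \<partial>lebesgue)"
        by (rule nn_integral_completion[symmetric])
      also have "\<dots> = (\<integral>\<^sup>+t. ennreal (\<bar>f t\<bar> * indicator S t) * indicator {0..1} t \<partial>lebesgue)"
      proof (rule nn_integral_cong_AE)
        show "AE t in lebesgue. ennreal \<bar>g t\<bar> * indicator {0..1} t * indicator S t
            = ennreal (\<bar>f t\<bar> * indicator S t) * indicator {0..1} t"
          using AE_completion[OF fg] by eventually_elim (auto simp: indicator_def)
      qed
      also have "\<dots> = (\<integral>\<^sup>+t. ennreal (\<bar>f t\<bar> * indicator S t) \<partial>\<Lambda>)"
        by (rule nn_integral_restrict_space[symmetric]) simp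
      finally show ?thesis .
    qed
    have int_S: "integrable \<Lambda> (\<lambda>t. \<bar>f t\<bar> * indicator S t)" if "S \<in> sets borel" for S
    proof -
      have "(\<lambda>t. (1 + (2 * indicator S t - 1)) / 2 :: real) \<in> borel_measurable \<Lambda>"
        by (intro borel_measurable_divide borel_measurable_add borel_measurable_const sign_measurable[OF that])
      then have "integrable \<Lambda> (\<lambda>t. \<bar>f t\<bar> * ((1 + (2 * indicator S t - 1)) / 2))"
        by (rule L1.integrable_mult_bounded[OF integrable_abs[OF f], of _ 1]) (auto simp: indicator_def)
      then show ?thesis by simp
    qed
    have N_real: "emeasure N S = ennreal (\<integral>t. \<bar>f t\<bar> * indicator S t \<partial>\<Lambda>)" if "S \<in> sets borel" for S
      unfolding N_eq[OF that] by (rule nn_integral_eq_integral[OF int_S[OF that]]) auto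
    have fin: "emeasure N (space N) \<noteq> \<infinity>" using N_real[of UNIV] by simp
    interpret N: finite_measure N by (rule finite_measureI[OF fin])
    define B where "B = {t. 0 < g t}"
    have B [measurable]: "B \<in> sets borel" unfolding B_def by measurable
    have BN: "emeasure N B = ennreal (measure N B)" by (rule N.emeasure_eq_measure)
    have "emeasure N B = (SUP K\<in>{K. K \<subseteq> B \<and> compact K}. emeasure N K)"
      by (rule inner_regular) (use fin B in auto)
    moreover have "emeasure N B - ennreal (e / 4) < emeasure N B \<or> emeasure N B = 0"
      unfolding BN using e by (cases "measure N B = 0") (auto simp: ennreal_minus ennreal_less_iff ennreal_minus_if zero_less_measure_iff)
    ultimately have "\<exists>K. K \<subseteq> B \<and> compact K \<and> emeasure N B \<le> emeasure N K + ennreal (e / 4)"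
    proof (elim disjE)
      assume "emeasure N B = (SUP K\<in>{K. K \<subseteq> B \<and> compact K}. emeasure N K)" "emeasure N B - ennreal (e / 4) < emeasure N B"
      then obtain K where "K \<subseteq> B" "compact K" "emeasure N B - ennreal (e / 4) < emeasure N K"
        by (auto simp: less_SUP_iff)
      then show ?thesis by (metis add.commute ennreal_minus_le_iff less_imp_le)
    qed (auto intro!: exI[of _ "{}"])
    then obtain K where K: "K \<subseteq> B" "compact K" "emeasure N B \<le> emeasure N K + ennreal (e / 4)" by blast
    have K_sets: "K \<in> sets borel" using K(2) by (simp add: borel_compact)
    have "emeasure N B = (INF U\<in>{U. B \<subseteq> U \<and> open U}. emeasure N U)"
      by (rule outer_regular) (use fin B in auto)
    moreover have "emeasure N B < emeasure N B + ennreal (e / 4)"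
      unfolding BN using e by (simp add: ennreal_plus[symmetric] ennreal_less_iff del: ennreal_plus)
    ultimately obtain U where U: "B \<subseteq> U" "open U" "emeasure N U < emeasure N B + ennreal (e / 4)"
      by (metis (mono_tags, lifting) INF_less_iff mem_Collect_eq)
    have "\<exists>\<F>\<subseteq>\<B>. U = \<Union>\<F>" using \<B>(2) U(2) unfolding topological_basis_def by blast
    then obtain \<F> where \<F>: "\<F> \<subseteq> \<B>" "U = \<Union>\<F>" by blast
    have "\<And>S. S \<in> \<F> \<Longrightarrow> open S" using \<F>(1) topological_basis_open[OF \<B>(2)] by blast
    then obtain \<G> where \<G>: "\<G> \<subseteq> \<F>" "finite \<G>" "K \<subseteq> \<Union>\<G>"
      using compactE[OF K(2), of \<F>] K(1) U(1) \<F>(2) by (metis subset_trans)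
    have "\<Union>\<G> \<in> \<W>" using \<G> \<F>(1) by (auto simp: \<W>_def)
    then obtain k where k: "W k = \<Union>\<G>" using W_surj by blast
    have Wk [measurable]: "W k \<in> sets borel" using \<W>_open[OF W_mem] by (rule borel_open)
    let ?I = "\<lambda>S. \<integral>t. \<bar>f t\<bar> * indicator S t \<partial>\<Lambda>"
    have I_nonneg: "0 \<le> ?I S" for S by (rule integral_nonneg_AE) auto
    have "ennreal (?I B) \<le> ennreal (?I K + e / 4)" "ennreal (?I U) < ennreal (?I B + e / 4)"
      using K(3) U(3) I_nonneg e U(2) by (simp_all add: N_real B K_sets borel_open)
    then have IK: "?I B \<le> ?I K + e / 4" and IU: "?I U < ?I B + e / 4"
      using I_nonneg e by (simp_all add: ennreal_less_iff del: ennreal_plus)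
    have U_sets: "U \<in> sets borel" using U(2) by (rule borel_open)
    \<comment> \<open>Where the signs of \<open>f\<close> and of \<open>2 * indicator (W k) - 1\<close> differ, the point lies in
      \<open>U - K\<close> or in a null set.\<close>
    have AE_le: "AE t in \<Lambda>. \<bar>f t\<bar> - f t * (2 * indicator (W k) t - 1)
        \<le> 2 * (\<bar>f t\<bar> * indicator U t - \<bar>f t\<bar> * indicator K t)"
      using fg'
    proof eventually_elim
      case (elim t)
      have sub: "K \<subseteq> W k" "W k \<subseteq> U" using \<G> \<F>(2) k by auto
      show ?case
      proof (cases "t \<in> B")
        case True
        then have "0 < f t" "t \<in> U" using elim U(1) by (auto simp: B_def)
        then show ?thesis using sub by (auto simp: indicator_def)
      next
        case False
        then have "f t \<le> 0" "t \<notin> K" using elim K(1) by (auto simp: B_def)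
        then show ?thesis using sub by (auto simp: indicator_def)
      qed
    qed
    have int_s: "integrable \<Lambda> (\<lambda>t. f t * (2 * indicator (W k) t - 1))"
      by (rule L1.integrable_mult_bounded[OF f sign_measurable[OF Wk], where B = 1]) (auto simp: indicator_def)
    have "(\<integral>t. \<bar>f t\<bar> \<partial>\<Lambda>) - (\<integral>t. f t * (2 * indicator (W k) t - 1) \<partial>\<Lambda>)
        = (\<integral>t. \<bar>f t\<bar> - f t * (2 * indicator (W k) t - 1) \<partial>\<Lambda>)"
      using f int_s by (simp add: integrable_abs)
    also have "\<dots> \<le> (\<integral>t. 2 * (\<bar>f t\<bar> * indicator U t - \<bar>f t\<bar> * indicator K t) \<partial>\<Lambda>)"
      by (rule integral_mono_AE[OF _ _ AE_le]) (use f int_s int_S[OF U_sets] int_S[OF K_sets] in auto)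
    also have "\<dots> = 2 * (?I U - ?I K)" using int_S[OF U_sets] int_S[OF K_sets] by simp
    also have "\<dots> < e" using IK IU by simp
    finally show "\<exists>k. (\<integral>t. \<bar>f t\<bar> \<partial>\<Lambda>) - e < (\<integral>t. f t * (2 * indicator (W k) t - 1) \<partial>\<Lambda>)"
      by (intro exI[of _ k]) simp
  qed
qed

section \<open>Copies of L1 inside variable Lebesgue spaces\<close>

context variable_exponent
begin

lemma embedding_by_functions:
  assumes V: "\<And>y. y \<in> pts L1.X \<Longrightarrow> j y \<in> V"
    and add: "\<And>y z. y \<in> pts L1.X \<Longrightarrow> z \<in> pts L1.X \<Longrightarrow> AE t in M. j (vadd L1.X y z) t = j y t + j z t"
    and scale: "\<And>c y. y \<in> pts L1.X \<Longrightarrow> AE t in M. j (vscale L1.X c y) t = c * j y t"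
    and norm: "\<And>y. y \<in> pts L1.X \<Longrightarrow> L (j y) = vnorm L1.X y"
  shows "contains_isometric_copy X L1_01"
  unfolding contains_isometric_copy_def L1_01_eq linear_between_def
proof (intro exI[of _ "\<lambda>y. cl (j y)"] conjI ballI allI)
  fix y assume y: "y \<in> pts L1.X"
  show "cl (j y) \<in> pts X" using V[OF y] by (rule cl_pts)
  show "vnorm X (cl (j y)) = vnorm L1.X y" using vnorm_cl[OF V[OF y]] norm[OF y] by simp
  fix c
  show "cl (j (vscale L1.X c y)) = vscale X c (cl (j y))"
    unfolding vscale_cl[OF V[OF y]] by (rule cl_eqI[OF V V_scale scale]) (use y V in auto)
next
  fix y z assume y: "y \<in> pts L1.X" and z: "z \<in> pts L1.X"
  show "cl (j (vadd L1.X y z)) = vadd X (cl (j y)) (cl (j z))"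
    unfolding vadd_cl[OF V[OF y] V[OF z]] by (rule cl_eqI[OF V V_add add]) (use y z V in auto)
qed

lemma L1_rep:
  assumes "y \<in> pts L1.X"
  shows "integrable \<Lambda> (ae_rep y)" "vnorm L1.X y = (\<integral>t. \<bar>ae_rep y t\<bar> \<partial>\<Lambda>)"
  using L1.rep_pts[OF assms] L1.vnorm_cl[of "ae_rep y"] by auto

lemma L1_rep_add:
  assumes "y \<in> pts L1.X" "z \<in> pts L1.X"
  shows "AE t in \<Lambda>. ae_rep (vadd L1.X y z) t = ae_rep y t + ae_rep z t"
proof -
  have "vadd L1.X y z = L1.cl (\<lambda>t. ae_rep y t + ae_rep z t)"
    using L1.vadd_cl[of "ae_rep y" "ae_rep z"] L1.rep_pts assms by simp
  then show ?thesis using L1.rep_cl(2)[of "\<lambda>t. ae_rep y t + ae_rep z t"] L1_rep[OF assms(1)] L1_rep[OF assms(2)] by simp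
qed

lemma L1_rep_scale:
  assumes "y \<in> pts L1.X"
  shows "AE t in \<Lambda>. ae_rep (vscale L1.X c y) t = c * ae_rep y t"
proof -
  have "vscale L1.X c y = L1.cl (\<lambda>t. c * ae_rep y t)"
    using L1.vscale_cl[of "ae_rep y" c] L1.rep_pts assms by simp
  then show ?thesis using L1.rep_cl(2)[of "\<lambda>t. c * ae_rep y t"] L1_rep[OF assms(1)] by simp
qed

text \<open>
  If the blocks \<open>{\<kappa> = k}\<close> of \<open>e\<close> all have modular more than 1 after any enlargement, although the
  modular of \<open>e\<close> itself is at most 1, then the norm of a combination of the blocks is the supremum
  of the absolute values of its coefficients. So the space contains the bounded sequences, and the
  values of a norming sequence of functionals embed \<open>L\<^sup>1[0,1]\<close> into these.
\<close>

theorem blocks_imp_contains_L1: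
  fixes e :: "'a \<Rightarrow> real" and \<kappa> :: "'a \<Rightarrow> nat"
  assumes e [measurable]: "e \<in> borel_measurable M" and \<kappa> [measurable]: "\<kappa> \<in> measurable M (count_space UNIV)"
    and small: "\<rho> e \<le> 1"
    and large: "\<And>k c. 1 < c \<Longrightarrow> 1 < \<rho> (\<lambda>t. c * (if \<kappa> t = k then e t else 0))"
  shows "contains_isometric_copy X L1_01"
proof -
  obtain W :: "nat \<Rightarrow> real set" where W: "\<And>k. W k \<in> sets borel"
    and norming: "\<And>(f :: real \<Rightarrow> real) \<epsilon>. integrable \<Lambda> f \<Longrightarrow> 0 < \<epsilon> \<Longrightarrow>
       \<exists>k. (\<integral>t. \<bar>f t\<bar> \<partial>\<Lambda>) - \<epsilon> < (\<integral>t. f t * (2 * indicator (W k) t - 1) \<partial>\<Lambda>)"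
    using countable_norming_family by blast
  define F where "F f k = (\<integral>t. f t * (2 * indicator (W k) t - 1) \<partial>\<Lambda>)" for f :: "real \<Rightarrow> real" and k
  have int_F: "integrable \<Lambda> (\<lambda>t. f t * (2 * indicator (W k) t - 1))" if "integrable \<Lambda> f"
    for f :: "real \<Rightarrow> real" and k
  proof (rule L1.integrable_mult_bounded[where B = 1])
    show "(\<lambda>t. 2 * indicator (W k) t - 1 :: real) \<in> borel_measurable \<Lambda>" by (rule sign_measurable[OF W])
  qed (use that in \<open>auto simp: indicator_def\<close>)
  have F_le: "\<bar>F f k\<bar> \<le> (\<integral>t. \<bar>f t\<bar> \<partial>\<Lambda>)" if f: "integrable \<Lambda> f" for f k
  proof -
    have "\<bar>F f k\<bar> \<le> (\<integral>t. \<bar>f t * (2 * indicator (W k) t - 1)\<bar> \<partial>\<Lambda>)" unfolding F_def by (rule integral_abs_bound)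
    also have "\<dots> = (\<integral>t. \<bar>f t\<bar> \<partial>\<Lambda>)"
      by (rule Bochner_Integration.integral_cong) (auto simp: indicator_def abs_mult)
    finally show ?thesis .
  qed
  define j where "j y = (\<lambda>t. F (ae_rep y) (\<kappa> t) * e t)" for y
  have j_meas [measurable]: "j y \<in> borel_measurable M" for y
    unfolding j_def by measurable
  have small': "\<rho> (\<lambda>t. j y t / \<alpha>) \<le> 1" if y: "y \<in> pts L1.X" and \<alpha>: "0 < \<alpha>" "vnorm L1.X y \<le> \<alpha>" for y \<alpha>
  proof -
    have "\<rho> (\<lambda>t. j y t / \<alpha>) \<le> \<rho> e"
    proof (rule modular_mono)
      show "AE t in M. \<bar>j y t / \<alpha>\<bar> \<le> \<bar>e t\<bar>"
      proof (rule AE_I2)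
        fix t
        have "\<bar>F (ae_rep y) (\<kappa> t)\<bar> \<le> \<alpha>" using F_le[OF L1_rep(1)[OF y], of "\<kappa> t"] L1_rep(2)[OF y] \<alpha> by simp
        then have "\<bar>F (ae_rep y) (\<kappa> t)\<bar> * \<bar>e t\<bar> \<le> \<alpha> * \<bar>e t\<bar>" by (rule mult_right_mono) simp
        then show "\<bar>j y t / \<alpha>\<bar> \<le> \<bar>e t\<bar>" using \<alpha>(1) by (simp add: j_def abs_mult field_simps)
      qed
    qed measurable
    then show ?thesis using small by simp
  qed
  have n0: "0 \<le> vnorm L1.X y" if "y \<in> pts L1.X" for y using L1.norm_nonneg[OF that] .
  have jV: "j y \<in> V" if y: "y \<in> pts L1.X" for y
    unfolding V_iff using small'[OF y, of "vnorm L1.X y + 1"] n0[OF y] j_meas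
    by (intro conjI exI[of _ "vnorm L1.X y + 1"]) auto
  show ?thesis
  proof (rule embedding_by_functions[of j])
    show "j y \<in> V" if "y \<in> pts L1.X" for y by (rule jV[OF that])
  next
    fix y z assume y: "y \<in> pts L1.X" and z: "z \<in> pts L1.X"
    note iy = L1_rep(1)[OF y] and iz = L1_rep(1)[OF z] and iyz = L1_rep(1)[OF L1.add_pts[OF y z]]
    have "F (ae_rep (vadd L1.X y z)) k = F (ae_rep y) k + F (ae_rep z) k" for k
    proof -
      have "F (ae_rep (vadd L1.X y z)) k
          = (\<integral>t. ae_rep y t * (2 * indicator (W k) t - 1) + ae_rep z t * (2 * indicator (W k) t - 1) \<partial>\<Lambda>)"
        unfolding F_def
      proof (rule integral_cong_AE)
        show "AE t in \<Lambda>. ae_rep (vadd L1.X y z) t * (2 * indicator (W k) t - 1)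
            = ae_rep y t * (2 * indicator (W k) t - 1) + ae_rep z t * (2 * indicator (W k) t - 1)"
          using L1_rep_add[OF y z] by eventually_elim (simp add: distrib_right)
      qed (use int_F[OF iyz, of k] int_F[OF iy, of k] int_F[OF iz, of k] in auto)
      then show ?thesis unfolding F_def using int_F[OF iy, of k] int_F[OF iz, of k] by simp
    qed
    then show "AE t in M. j (vadd L1.X y z) t = j y t + j z t" by (simp add: j_def distrib_right)
  next
    fix c y assume y: "y \<in> pts L1.X"
    note iy = L1_rep(1)[OF y] and icy = L1_rep(1)[OF L1.scale_pts[OF y, of c]]
    have "F (ae_rep (vscale L1.X c y)) k = c * F (ae_rep y) k" for k
    proof -
      have "F (ae_rep (vscale L1.X c y)) k = (\<integral>t. c * (ae_rep y t * (2 * indicator (W k) t - 1)) \<partial>\<Lambda>)"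
        unfolding F_def
      proof (rule integral_cong_AE)
        show "AE t in \<Lambda>. ae_rep (vscale L1.X c y) t * (2 * indicator (W k) t - 1)
            = c * (ae_rep y t * (2 * indicator (W k) t - 1))"
          using L1_rep_scale[OF y, of c] by eventually_elim simp
      qed (use int_F[OF icy, of k] int_F[OF iy, of k] in auto)
      then show ?thesis unfolding F_def by simp
    qed
    then show "AE t in M. j (vscale L1.X c y) t = c * j y t" by (simp add: j_def)
  next
    fix y assume y: "y \<in> pts L1.X"
    show "L (j y) = vnorm L1.X y"
    proof (rule antisym)
      show "L (j y) \<le> vnorm L1.X y"
        by (rule dense_ge) (use small'[OF y] n0[OF y] in \<open>force intro: L_le\<close>)
      show "vnorm L1.X y \<le> L (j y)"
      proof (rule ccontr)
        assume "\<not> vnorm L1.X y \<le> L (j y)"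
        then obtain \<alpha> where \<alpha>: "L (j y) < \<alpha>" "\<alpha> < vnorm L1.X y" using dense by (auto simp: not_le)
        have \<alpha>0: "0 < \<alpha>" "\<rho> (\<lambda>t. j y t / \<alpha>) \<le> 1" using modular_le_1[OF jV[OF y] \<alpha>(1)] by auto
        obtain k where k: "\<alpha> < F (ae_rep y) k"
          using norming[OF L1_rep(1)[OF y], of "vnorm L1.X y - \<alpha>"] \<alpha>(2) L1_rep(2)[OF y] by (auto simp: F_def)
        define c where "c = F (ae_rep y) k / \<alpha>"
        have "1 < c" using k \<alpha>0 by (simp add: c_def)
        then have "1 < \<rho> (\<lambda>t. c * (if \<kappa> t = k then e t else 0))" by (rule large)
        also have "\<dots> \<le> \<rho> (\<lambda>t. j y t / \<alpha>)"
        proof (rule modular_mono)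
          show "AE t in M. \<bar>c * (if \<kappa> t = k then e t else 0)\<bar> \<le> \<bar>j y t / \<alpha>\<bar>"
            by (rule AE_I2) (auto simp: c_def j_def)
        qed measurable
        finally show False using \<alpha>0(2) by simp
      qed
    qed
  qed
qed

text \<open>
  The indicator of the union has supremum 1 on each of the sets.
\<close>

lemma disjoint_nonnull_imp_contains_L1:
  fixes E :: "nat \<Rightarrow> 'a set"
  assumes E [measurable]: "\<And>k. E k \<in> sets M" and disj: "disjoint_family E"
    and sub: "\<And>k. E k \<subseteq> \<Omega>i" and pos: "\<And>k. emeasure M (E k) \<noteq> 0"
  shows "contains_isometric_copy X L1_01"
proof -
  define \<kappa> where "\<kappa> t = (LEAST k. t \<in> E k)" for t
  define e :: "'a \<Rightarrow> real" where "e = indicator (\<Union>k. E k)"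
  have \<kappa>: "\<kappa> t = k" if "t \<in> E k" for t k
    unfolding \<kappa>_def
  proof (rule Least_equality)
    fix i assume "t \<in> E i"
    then have "i = k" using disj that by (auto simp: disjoint_family_on_def)
    then show "k \<le> i" by simp
  qed (rule that)
  have e_meas [measurable]: "e \<in> borel_measurable M" unfolding e_def by measurable
  have \<kappa>_meas [measurable]: "\<kappa> \<in> measurable M (count_space UNIV)" unfolding \<kappa>_def by measurable
  show ?thesis
  proof (rule blocks_imp_contains_L1[OF e_meas \<kappa>_meas])
    have "e t = 0" if "t \<in> \<Omega>f" for t
      using that sub by (fastforce simp: e_def indicator_def finite_part_def infinite_part_def)
    then have "\<rho>f e = (\<integral>\<^sup>+t. 0 \<partial>M)"
      unfolding \<rho>f_def by (intro nn_integral_cong) (auto simp: indicator_def)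
    moreover have "\<rho>i e \<le> 1"
      unfolding \<rho>i_le_iff[OF e_meas] by (rule AE_I2) (auto simp: e_def indicator_def)
    ultimately show "\<rho> e \<le> 1" by (simp add: modular_eq)
  next
    fix k and c :: real assume c: "1 < c"
    let ?h = "\<lambda>t. c * (if \<kappa> t = k then e t else 0)"
    show "1 < \<rho> ?h"
    proof (rule ccontr)
      assume "\<not> 1 < \<rho> ?h"
      moreover have "\<rho>i ?h \<le> \<rho> ?h" by (simp add: modular_eq)
      ultimately have "\<rho>i ?h \<le> 1" by (simp add: not_less)
      then have "AE t in M. t \<in> \<Omega>i \<longrightarrow> ennreal \<bar>?h t\<bar> \<le> 1" by (subst (asm) \<rho>i_le_iff) measurable
      then have "AE t in M. t \<notin> E k"
      proof eventually_elim
        case (elim t)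
        show ?case
        proof
          assume t: "t \<in> E k"
          then have "?h t = c" using \<kappa>[OF t] by (auto simp: e_def indicator_def)
          then have "ennreal c \<le> 1" using elim t sub c by auto
          then show False using c by (simp add: ennreal_le_1)
        qed
      qed
      then have "E k \<in> null_sets M" using AE_iff_null_sets[OF E] by simp
      then show False using pos[of k] by auto
    qed
  qed
qed

text \<open>
  If the exponent is unbounded, take disjoint sets on which it is at least \<open>n\<^sup>2\<close> and let the \<open>n\<close>-th
  one contribute \<open>2 ^ - (n + 1)\<close> to the modular. Multiplication by \<open>c > 1\<close> multiplies this
  contribution by at least \<open>c ^ (n * n)\<close>, so every block made of infinitely many of these sets
  acquires modular more than 1.
\<close>

lemma unbounded_exponent_imp_contains_L1:
  assumes unb: "\<not> esssup_on M \<Omega>f p < \<infinity>"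
  shows "contains_isometric_copy X L1_01"
proof -
  define G where "G a b = {t \<in> space M. t \<in> \<Omega>f \<and> a \<le> q t \<and> q t < b}" for a b :: real
  have G_sets [measurable]: "G a b \<in> sets M" for a b unfolding G_def by measurable
  have band: "\<exists>b::nat. emeasure M (G a (real b)) \<noteq> 0" for a
  proof (rule ccontr)
    assume "\<nexists>b::nat. emeasure M (G a (real b)) \<noteq> 0"
    then have "AE t in M. \<forall>b::nat. t \<notin> G a (real b)"
      unfolding AE_all_countable by (intro allI AE_not_in) (simp add: null_sets_def)
    moreover have "AE t in M. t \<in> space M" by simp
    ultimately have "AE t in M. t \<in> \<Omega>f \<longrightarrow> p t \<le> ennreal a"
    proof eventually_elim
      case (elim t)
      show ?case
      proof
        assume t: "t \<in> \<Omega>f"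
        obtain b :: nat where "q t < real b" using reals_Archimedean2 by blast
        then have "q t < a" using elim(1)[rule_format, of b] elim(2) t by (auto simp: G_def)
        moreover have "p t = ennreal (q t)" using t by (simp add: q_def finite_part_def)
        ultimately show "p t \<le> ennreal a" by (simp add: ennreal_leI)
      qed
    qed
    then have "esssup_on M \<Omega>f p \<le> ennreal a"
      by (subst esssup_on_le_iff) (auto simp: p_measurable)
    then show False using unb le_less_trans by fastforce
  qed
  have "\<exists>c. \<forall>n. real (n * n) \<le> c n \<and> emeasure M (G (c n) (c (Suc n))) \<noteq> 0"
  proof (rule dependent_nat_choice)
    show "\<exists>x. real (0 * 0) \<le> x" by auto
  next
    fix x and n :: nat
    obtain b :: nat where b: "emeasure M (G x (real b)) \<noteq> 0" using band by blast
    define y where "y = max (real b) (real (Suc n * Suc n))"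
    have "G x (real b) \<subseteq> G x y" by (auto simp: G_def y_def)
    then have "emeasure M (G x (real b)) \<le> emeasure M (G x y)" by (rule emeasure_mono) measurable
    then have "emeasure M (G x y) \<noteq> 0" using b by auto
    then show "\<exists>y. real (Suc n * Suc n) \<le> y \<and> emeasure M (G x y) \<noteq> 0"
      by (intro exI[of _ y]) (simp add: y_def)
  qed
  then obtain c where c: "\<And>n. real (n * n) \<le> c n" "\<And>n. emeasure M (G (c n) (c (Suc n))) \<noteq> 0" by blast
  have "\<forall>n. \<exists>B. B \<in> sets M \<and> B \<subseteq> G (c n) (c (Suc n)) \<and> 0 < emeasure M B \<and> emeasure M B < \<infinity>"
  proof
    fix n
    obtain B where "B \<in> sets M" "B \<subseteq> G (c n) (c (Suc n))" "0 < emeasure M B" "emeasure M B < \<infinity>"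
      using finite_positive_subset[OF G_sets c(2)] .
    then show "\<exists>B. B \<in> sets M \<and> B \<subseteq> G (c n) (c (Suc n)) \<and> 0 < emeasure M B \<and> emeasure M B < \<infinity>" by blast
  qed
  then obtain F where F [measurable]: "\<And>n. F n \<in> sets M" and FG: "\<And>n. F n \<subseteq> G (c n) (c (Suc n))"
      and F_pos: "\<And>n. 0 < emeasure M (F n)" and F_fin: "\<And>n. emeasure M (F n) < \<infinity>" by metis
  have c_Suc: "c n \<le> c (Suc n)" for n
  proof -
    have "G (c n) (c (Suc n)) \<noteq> {}" using c(2)[of n] by auto
    then show ?thesis unfolding G_def by fastforce
  qed
  have c_mono: "c n \<le> c m" if "n \<le> m" for n m using c_Suc that by (rule lift_Suc_mono_le)
  have F_q: "t \<in> \<Omega>f" "c n \<le> q t" "q t < c (Suc n)" if "t \<in> F n" for t n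
    using that FG by (auto simp: G_def)
  have uniq: "n = m" if "t \<in> F n" "t \<in> F m" for t n m
  proof (rule ccontr)
    assume "n \<noteq> m"
    then consider "Suc n \<le> m" | "Suc m \<le> n" by linarith
    then show False
      using F_q[OF that(1)] F_q[OF that(2)] c_mono[of "Suc n" m] c_mono[of "Suc m" n] by cases auto
  qed
  define N where "N t = (LEAST n. t \<in> F n)" for t
  have N: "N t = n" if "t \<in> F n" for t n
    unfolding N_def using that uniq by (intro Least_equality) auto
  have N_meas [measurable]: "N \<in> measurable M (count_space UNIV)" unfolding N_def by measurable
  define m where "m n = measure M (F n)" for n
  have m: "emeasure M (F n) = ennreal (m n)" "0 < m n" for n
  proof -
    show eq: "emeasure M (F n) = ennreal (m n)"
      unfolding m_def by (rule emeasure_eq_ennreal_measure) (use F_fin[of n] in simp)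
    show "0 < m n" using F_pos[of n] unfolding eq by simp
  qed
  define a where "a n = (1/2) ^ Suc n / m n" for n
  have a: "0 < a n" for n using m(2)[of n] by (simp add: a_def)
  define e where "e t = indicator (\<Union>n. F n) t * a (N t) powr (1 / q t)" for t
  have e_meas [measurable]: "e \<in> borel_measurable M" unfolding e_def by measurable
  define \<kappa> where "\<kappa> t = fst (prod_decode (N t))" for t
  have \<kappa>_meas [measurable]: "\<kappa> \<in> measurable M (count_space UNIV)"
    unfolding \<kappa>_def by (rule measurable_compose[OF N_meas]) simp
  have e_F: "0 < e t" "e t powr q t = a n" if "t \<in> F n" for t n
  proof -
    have "0 < q t" using q_ge_1[OF F_q(1)[OF that]] by simp
    moreover have "e t = a n powr (1 / q t)" using that N[OF that] by (auto simp: e_def indicator_def)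
    ultimately show "0 < e t" "e t powr q t = a n" using a[of n] by (simp_all add: powr_powr)
  qed
  have e_out: "e t = 0" if "\<And>n. t \<notin> F n" for t using that by (simp add: e_def)
  show ?thesis
  proof (rule blocks_imp_contains_L1[OF e_meas \<kappa>_meas])
    have "\<rho>f e \<le> (\<integral>\<^sup>+t. (\<Sum>n. ennreal (a n) * indicator (F n) t) \<partial>M)"
      unfolding \<rho>f_def
    proof (rule nn_integral_mono)
      fix t
      show "ennreal (\<bar>e t\<bar> powr q t) * indicator \<Omega>f t \<le> (\<Sum>n. ennreal (a n) * indicator (F n) t)"
      proof (cases "\<exists>n. t \<in> F n")
        case True
        then obtain n where n: "t \<in> F n" by blast
        have "ennreal (\<bar>e t\<bar> powr q t) * indicator \<Omega>f t \<le> (\<Sum>n\<in>{n}. ennreal (a n) * indicator (F n) t)"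
          using n e_F[OF n] F_q(1)[OF n] by (simp add: abs_of_pos)
        also have "\<dots> \<le> (\<Sum>n. ennreal (a n) * indicator (F n) t)"
          by (rule sum_le_suminf) auto
        finally show ?thesis .
      qed (use e_out in simp)
    qed
    also have "\<dots> = (\<Sum>n. ennreal (a n) * emeasure M (F n))"
      by (subst nn_integral_suminf) (simp_all add: nn_integral_cmult_indicator)
    also have "\<dots> = (\<Sum>n. ennreal ((1/2) ^ Suc n))"
    proof (rule suminf_cong)
      fix n
      have "a n * m n = (1/2) ^ Suc n" using m(2)[of n] by (simp add: a_def)
      then show "ennreal (a n) * emeasure M (F n) = ennreal ((1/2) ^ Suc n)"
        using a[of n] unfolding m(1) by (simp add: ennreal_mult'[symmetric] del: power_Suc)
    qed
    also have "\<dots> = 1"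
    proof -
      have "(\<Sum>n. ennreal ((1/2) ^ Suc n)) = ennreal 1"
        by (rule suminf_ennreal_eq) (simp, rule power_half_series)
      then show ?thesis by (simp only: ennreal_1)
    qed
    finally have "\<rho>f e \<le> 1" .
    moreover have "e t = 0" if "t \<in> \<Omega>i" for t
    proof (rule e_out)
      fix n show "t \<notin> F n" using that F_q(1)[of t n] by (auto simp: finite_part_def infinite_part_def)
    qed
    then have "\<rho>i e \<le> 0" unfolding \<rho>i_le_iff[OF e_meas] by simp
    ultimately show "\<rho> e \<le> 1" by (simp add: modular_eq)
  next
    fix k and b :: real assume b: "1 < b"
    let ?h = "\<lambda>t. b * (if \<kappa> t = k then e t else 0)"
    \<comment> \<open>For \<open>n \<ge> j\<close> this gives \<open>b ^ (n * n) > 4 ^ n \<ge> 2 ^ (n + 1)\<close>.\<close>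
    obtain j where j: "4 < b ^ j" using real_arch_pow[OF b] by blast
    define n where "n = prod_encode (k, Suc j)"
    have "Suc j \<le> n" unfolding n_def by (rule le_prod_encode_2)
    then have n: "1 \<le> n" "j \<le> n" by auto
    have "b ^ j \<le> b ^ n" using n(2) b by (intro power_increasing) auto
    then have "4 < b ^ n" using j by linarith
    then have "4 ^ n < (b ^ n) ^ n" using n(1) by (intro power_strict_mono) auto
    then have big: "4 ^ n < b ^ (n * n)" by (simp add: power_mult)
    have two: "(2::real) * 2 ^ n \<le> 4 ^ n"
    proof -
      have "(2::real) ^ 1 \<le> 2 ^ n" using n(1) by (intro power_increasing) auto
      then have "2 * 2 ^ n \<le> 2 ^ n * (2 ^ n :: real)" by (intro mult_right_mono) auto
      also have "\<dots> = 4 ^ n" by (simp flip: power_mult_distrib)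
      finally show ?thesis .
    qed
    have "1 < b ^ (n * n) * (1/2) ^ Suc n"
    proof -
      have "2 * 2 ^ n < b ^ (n * n)" using two big by linarith
      then show ?thesis by (simp add: power_one_over field_simps)
    qed
    also have "b ^ (n * n) * (1/2) ^ Suc n = b ^ (n * n) * a n * m n"
      using m(2)[of n] by (simp add: a_def)
    finally have "1 < ennreal (b ^ (n * n) * a n * m n)" by (simp add: ennreal_less_iff[of 1, simplified])
    also have "\<dots> = ennreal (b ^ (n * n) * a n) * emeasure M (F n)"
      unfolding m(1) using a[of n] b by (intro ennreal_mult') simp
    also have "\<dots> = (\<integral>\<^sup>+t. ennreal (b ^ (n * n) * a n) * indicator (F n) t \<partial>M)"
      by (simp add: nn_integral_cmult_indicator)
    also have "\<dots> \<le> \<rho>f ?h"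
      unfolding \<rho>f_def
    proof (rule nn_integral_mono)
      fix t
      show "ennreal (b ^ (n * n) * a n) * indicator (F n) t \<le> ennreal (\<bar>?h t\<bar> powr q t) * indicator \<Omega>f t"
      proof (cases "t \<in> F n")
        case True
        have "\<kappa> t = k" using N[OF True] by (simp add: \<kappa>_def n_def)
        then have "\<bar>?h t\<bar> powr q t = b powr q t * a n"
          using e_F[OF True] b by (simp add: abs_mult powr_mult)
        moreover have "b powr real (n * n) \<le> b powr q t"
          using F_q(2)[OF True] c(1)[of n] b by (intro powr_mono) auto
        then have "b ^ (n * n) * a n \<le> b powr q t * a n"
          using b a[of n] by (intro mult_right_mono) (auto simp: powr_realpow[symmetric] simp del: of_nat_mult)
        ultimately show ?thesis using True F_q(1)[OF True] by (simp add: ennreal_leI)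
      qed simp
    qed
    also have "\<dots> \<le> \<rho> ?h" by (simp add: modular_eq)
    finally show "1 < \<rho> ?h" .
  qed
qed

lemma atomless_subset:
  assumes "atomless M E" "A \<in> sets M" "A \<subseteq> E"
  shows "atomless M A"
  using assms unfolding atomless_def by blast

lemma atomless_split:
  assumes E: "atomless M E" and A: "A \<in> sets M" "A \<subseteq> E" "0 < emeasure M A" "emeasure M A < \<infinity>"
  obtains B where "B \<in> sets M" "B \<subseteq> A" "0 < emeasure M B" "emeasure M B < emeasure M A"
proof -
  have "\<not> is_atom M A" using E A(2) by (auto simp: atomless_def)
  then obtain B where B: "B \<in> sets M" "B \<subseteq> A" "emeasure M B \<noteq> 0" "emeasure M B \<noteq> emeasure M A"
    using A by (auto simp: is_atom_def)
  moreover have "emeasure M B \<le> emeasure M A" using A(1) B(2) by (intro emeasure_mono)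
  ultimately show ?thesis using that[of B] by (simp add: zero_less_iff_neq_zero)
qed

text \<open>
  On a set of finite measure \<open>m\<close> where the exponent is 1 the modular is the integral, and composition
  with a uniformly distributed function multiplies integrals by \<open>m\<close>.
\<close>

lemma atomless_at_one_imp_contains_L1:
  assumes E: "atomless M E" "E \<subseteq> \<Omega>1" "emeasure M E \<noteq> 0"
  shows "contains_isometric_copy X L1_01"
proof -
  have "E \<in> sets M" using E(1) by (simp add: atomless_def)
  then obtain A where A [measurable]: "A \<in> sets M" and AE: "A \<subseteq> E" and A_pos: "0 < emeasure M A" "emeasure M A < \<infinity>"
    using finite_positive_subset[OF _ E(3)] by metis
  define N where "N = restrict_space M A"
  have space_N: "space N = A" using sets.sets_into_space[OF A] by (auto simp: N_def space_restrict_space)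
  have sets_N: "B \<in> sets N \<longleftrightarrow> B \<in> sets M \<and> B \<subseteq> A" for B
  proof
    assume B: "B \<in> sets N"
    then have "B \<subseteq> space N" by (rule sets.sets_into_space)
    then have "B \<subseteq> A" unfolding space_N .
    then show "B \<in> sets M \<and> B \<subseteq> A" using B A by (simp add: N_def sets_restrict_space_iff)
  qed (use A in \<open>auto simp: N_def sets_restrict_space_iff\<close>)
  have em_N: "emeasure N B = emeasure M B" if "B \<in> sets N" for B
    unfolding N_def using A that[unfolded sets_N] by (intro emeasure_restrict_space) auto
  have fin: "finite_measure N" by (rule finite_measureI) (use em_N[of A] A_pos A in \<open>simp add: space_N sets_N\<close>)
  interpret N: finite_measure N by (rule fin)
  interpret N: atomless_finite_measure N
  proof
    fix B assume B: "B \<in> sets N" "0 < measure N B"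
    then have "0 < emeasure M B" using N.emeasure_eq_measure[of B] unfolding em_N[OF B(1), symmetric] by simp
    moreover have "emeasure M B < \<infinity>" using em_N[OF B(1)] N.emeasure_eq_measure[of B] by (metis ennreal_less_top infinity_ennreal_def)
    ultimately obtain C where C: "C \<in> sets M" "C \<subseteq> B" "0 < emeasure M C" "emeasure M C < emeasure M B"
      using atomless_split[OF E(1), of B] B(1) AE unfolding sets_N by blast
    then have "C \<in> sets N" using B(1) by (auto simp: sets_N)
    then show "\<exists>C\<in>sets N. C \<subseteq> B \<and> 0 < measure N C \<and> measure N C < measure N B"
      using C unfolding em_N[OF B(1), symmetric] em_N[OF \<open>C \<in> sets N\<close>, symmetric]
      by (intro bexI[of _ C]) (auto simp: N.emeasure_eq_measure ennreal_less_iff)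
  qed
  have AE_N: "(AE t in N. R t) \<longleftrightarrow> (AE t in M. t \<in> A \<longrightarrow> R t)" for R
    unfolding N_def using A by (intro AE_restrict_space_iff) auto
  have nn_N: "(\<integral>\<^sup>+t. u t \<partial>N) = (\<integral>\<^sup>+t. u t * indicator A t \<partial>M)" for u
    unfolding N_def using A by (intro nn_integral_restrict_space) auto
  have meas_N: "(\<lambda>t. if t \<in> A then u t else 0) \<in> borel_measurable M" if "u \<in> borel_measurable N"
    for u :: "'a \<Rightarrow> real"
  proof -
    have "(\<lambda>t. u t * indicator A t) \<in> borel_measurable M"
      using that unfolding N_def by (subst (asm) borel_measurable_restrict_space_iff) (auto simp: mult.commute)
    also have "(\<lambda>t. u t * indicator A t) = (\<lambda>t. if t \<in> A then u t else 0)" by (auto simp: indicator_def)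
    finally show ?thesis .
  qed
  define m where "m = measure N (space N)"
  have m: "0 < m"
  proof -
    have "emeasure M A = ennreal m"
      using em_N[of A] A N.emeasure_eq_measure[of A] by (simp add: m_def space_N sets_N)
    then show ?thesis using A_pos(1) by simp
  qed
  define b where "b y = borel_rep (ae_rep y)" for y
  have b_meas: "b y \<in> borel_measurable borel" and b_eq: "AE t in lborel. t \<in> {0..1} \<longrightarrow> ae_rep y t = b y t"
    if "y \<in> pts L1.X" for y
    using borel_rep[of "ae_rep y"] L1_rep(1)[OF that] unfolding b_def by auto
  define j where "j y t = (if t \<in> A then b y (N.entry t) / m else 0)" for y t
  have push: "AE t in M. t \<in> A \<longrightarrow> P (N.entry t)" if "AE s in lborel. s \<in> {0..1} \<longrightarrow> P s" for P
  proof -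
    have "AE s in density lborel (\<lambda>t. ennreal m * indicator {0..1} t). P s"
      using that m by (subst AE_density) (auto simp: indicator_def split: if_splits elim!: AE_mp)
    then have "AE s in distr N borel N.entry. P s" unfolding N.distr_entry m_def .
    then have "AE t in N. P (N.entry t)" by (rule AE_distrD[OF N.entry_measurable])
    then show ?thesis unfolding AE_N .
  qed
  have unit_AE: "AE s in lborel. s \<in> {0..1} \<longrightarrow> Q s" if "AE s in \<Lambda>. Q s" for Q
    using that unfolding AE_unit_iff AE_completion_iff .
  have j_meas: "j y \<in> borel_measurable M" if y: "y \<in> pts L1.X" for y
  proof -
    note [measurable] = b_meas[OF y]
    have "(\<lambda>t. b y (N.entry t) / m) \<in> borel_measurable N" by measurable
    then show ?thesis unfolding j_def[abs_def] by (rule meas_N)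
  qed
  have \<rho>_j: "\<rho> (\<lambda>t. j y t / \<alpha>) = ennreal (vnorm L1.X y / \<alpha>)" if y: "y \<in> pts L1.X" and \<alpha>: "0 < \<alpha>" for y \<alpha>
  proof -
    note [measurable] = b_meas[OF y] j_meas[OF y]
    have "(\<integral>\<^sup>+t. ennreal \<bar>b y (N.entry t)\<bar> \<partial>N) = (\<integral>\<^sup>+s. ennreal \<bar>b y s\<bar> \<partial>distr N borel N.entry)"
      by (subst nn_integral_distr) measurable
    also have "\<dots> = (\<integral>\<^sup>+s. ennreal m * indicator {0..1} s * ennreal \<bar>b y s\<bar> \<partial>lborel)"
      unfolding N.distr_entry m_def by (subst nn_integral_density) auto
    also have "\<dots> = ennreal m * (\<integral>\<^sup>+s. ennreal \<bar>b y s\<bar> * indicator {0..1} s \<partial>lborel)"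
      by (subst nn_integral_cmult[symmetric]) (auto simp: mult_ac)
    also have "(\<integral>\<^sup>+s. ennreal \<bar>b y s\<bar> * indicator {0..1} s \<partial>lborel) = (\<integral>\<^sup>+s. ennreal \<bar>ae_rep y s\<bar> \<partial>\<Lambda>)"
      unfolding b_def using L1_rep(1)[OF y] by (intro nn_integral_unit_borel_rep[symmetric]) auto
    also have "\<dots> = ennreal (vnorm L1.X y)"
      unfolding L1_rep(2)[OF y] using L1_rep(1)[OF y] by (intro nn_integral_eq_integral) (auto intro: integrable_abs)
    finally have int: "(\<integral>\<^sup>+t. ennreal \<bar>b y (N.entry t)\<bar> \<partial>N) = ennreal m * ennreal (vnorm L1.X y)" .
    have "\<rho>f (\<lambda>t. j y t / \<alpha>) = (\<integral>\<^sup>+t. ennreal (\<bar>b y (N.entry t)\<bar> / (m * \<alpha>)) * indicator A t \<partial>M)"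
      unfolding \<rho>f_def
    proof (rule nn_integral_cong)
      fix t
      show "ennreal (\<bar>j y t / \<alpha>\<bar> powr q t) * indicator \<Omega>f t = ennreal (\<bar>b y (N.entry t)\<bar> / (m * \<alpha>)) * indicator A t"
      proof (cases "t \<in> A")
        case True
        then have "t \<in> \<Omega>f" "q t = 1" using AE E(2) \<Omega>1_iff by auto
        then show ?thesis using True m \<alpha> by (simp add: j_def abs_divide)
      qed (simp add: j_def)
    qed
    also have "\<dots> = (\<integral>\<^sup>+t. ennreal (\<bar>b y (N.entry t)\<bar> / (m * \<alpha>)) \<partial>N)"
      by (rule nn_N[symmetric])
    also have "\<dots> = (\<integral>\<^sup>+t. ennreal (1 / (m * \<alpha>)) * ennreal \<bar>b y (N.entry t)\<bar> \<partial>N)"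
      using m \<alpha> by (intro nn_integral_cong) (simp add: ennreal_mult'[symmetric])
    also have "\<dots> = ennreal (1 / (m * \<alpha>)) * (ennreal m * ennreal (vnorm L1.X y))"
      by (subst nn_integral_cmult) (measurable, simp add: int)
    also have "\<dots> = ennreal (vnorm L1.X y / \<alpha>)"
      using m \<alpha> by (simp add: ennreal_mult'[symmetric] field_simps)
    finally have 1: "\<rho>f (\<lambda>t. j y t / \<alpha>) = ennreal (vnorm L1.X y / \<alpha>)" .
    have "j y t = 0" if "t \<in> \<Omega>i" for t
      using that AE E(2) \<Omega>1_not_\<Omega>i by (auto simp: j_def)
    then have "\<rho>i (\<lambda>t. j y t / \<alpha>) \<le> 0" by (subst \<rho>i_le_iff) auto
    then show ?thesis by (simp add: modular_eq 1)
  qed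
  have n0: "0 \<le> vnorm L1.X y" if "y \<in> pts L1.X" for y using L1.norm_nonneg[OF that] .
  have jV: "j y \<in> V" if y: "y \<in> pts L1.X" for y
    unfolding V_iff using j_meas[OF y] \<rho>_j[OF y, of "vnorm L1.X y + 1"] n0[OF y]
    by (intro conjI exI[of _ "vnorm L1.X y + 1"]) (auto simp: ennreal_le_1)
  show ?thesis
  proof (rule embedding_by_functions[of j])
    show "j y \<in> V" if "y \<in> pts L1.X" for y by (rule jV[OF that])
  next
    fix y z assume y: "y \<in> pts L1.X" and z: "z \<in> pts L1.X"
    have "AE s in lborel. s \<in> {0..1} \<longrightarrow> b (vadd L1.X y z) s = b y s + b z s"
      using b_eq[OF y] b_eq[OF z] b_eq[OF L1.add_pts[OF y z]] unit_AE[OF L1_rep_add[OF y z]]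
      by eventually_elim auto
    from push[OF this] show "AE t in M. j (vadd L1.X y z) t = j y t + j z t"
      by eventually_elim (simp add: j_def add_divide_distrib)
  next
    fix c y assume y: "y \<in> pts L1.X"
    have "AE s in lborel. s \<in> {0..1} \<longrightarrow> b (vscale L1.X c y) s = c * b y s"
      using b_eq[OF y] b_eq[OF L1.scale_pts[OF y, of c]] unit_AE[OF L1_rep_scale[OF y, of c]]
      by eventually_elim auto
    from push[OF this] show "AE t in M. j (vscale L1.X c y) t = c * j y t"
      by eventually_elim (simp add: j_def)
  next
    fix y assume y: "y \<in> pts L1.X"
    show "L (j y) = vnorm L1.X y"
    proof (rule antisym)
      show "L (j y) \<le> vnorm L1.X y"
      proof (rule dense_ge)
        fix \<alpha> assume \<alpha>: "vnorm L1.X y < \<alpha>"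
        then have "0 < \<alpha>" using n0[OF y] by simp
        then show "L (j y) \<le> \<alpha>" using \<alpha> by (intro L_le) (auto simp: \<rho>_j[OF y] ennreal_le_1)
      qed
      show "vnorm L1.X y \<le> L (j y)"
      proof (rule dense_ge)
        fix \<alpha> assume "L (j y) < \<alpha>"
        then have "0 < \<alpha>" "\<rho> (\<lambda>t. j y t / \<alpha>) \<le> 1" using modular_le_1[OF jV[OF y]] by auto
        then show "vnorm L1.X y \<le> \<alpha>" by (simp add: \<rho>_j[OF y] ennreal_le_1)
      qed
    qed
  qed
qed

text \<open>
  Repeated splitting gives a decreasing sequence of sets with non-null differences.
\<close>

lemma atomless_at_infinity_imp_contains_L1:
  assumes E: "atomless M E" "E \<subseteq> \<Omega>i" "emeasure M E \<noteq> 0"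
  shows "contains_isometric_copy X L1_01"
proof -
  define P where "P A \<longleftrightarrow> A \<in> sets M \<and> A \<subseteq> E \<and> 0 < emeasure M A \<and> emeasure M A < \<infinity>" for A
  have "\<exists>A. \<forall>n::nat. P (A n) \<and> (A (Suc n) \<subseteq> A n \<and> emeasure M (A (Suc n)) < emeasure M (A n))"
  proof (rule dependent_nat_choice)
    have "E \<in> sets M" using E(1) by (simp add: atomless_def)
    then show "\<exists>A. P A" using finite_positive_subset[OF _ E(3)] unfolding P_def by metis
  next
    fix A assume "P A"
    then obtain B where "B \<in> sets M" "B \<subseteq> A" "0 < emeasure M B" "emeasure M B < emeasure M A"
      using atomless_split[OF E(1)] unfolding P_def by metis
    then show "\<exists>B. P B \<and> B \<subseteq> A \<and> emeasure M B < emeasure M A"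
      using \<open>P A\<close> by (intro exI[of _ B]) (auto simp: P_def)
  qed
  then obtain A where A: "\<And>n. P (A n)" "\<And>n. A (Suc n) \<subseteq> A n"
      "\<And>n. emeasure M (A (Suc n)) < emeasure M (A n)" by blast
  have anti: "A m \<subseteq> A n" if "n \<le> m" for n m using that A(2) by (rule lift_Suc_antimono_le[rotated])
  define D where "D n = A n - A (Suc n)" for n
  show ?thesis
  proof (rule disjoint_nonnull_imp_contains_L1[of D])
    show "D k \<in> sets M" for k using A(1) by (auto simp: D_def P_def)
    show "D k \<subseteq> \<Omega>i" for k using A(1)[of k] E(2) by (auto simp: D_def P_def)
    show "disjoint_family D"
      unfolding disjoint_family_on_def
    proof (intro ballI impI)
      fix n m :: nat assume "n \<noteq> m"
      then consider "Suc n \<le> m" | "Suc m \<le> n" by linarith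
      then show "D n \<inter> D m = {}"
        using anti[of "Suc n" m] anti[of "Suc m" n] by cases (auto simp: D_def)
    qed
    show "emeasure M (D k) \<noteq> 0" for k
    proof -
      have "emeasure M (D k) = emeasure M (A k) - emeasure M (A (Suc k))"
        unfolding D_def using A(1)[of k] A(1)[of "Suc k"] A(2) by (intro emeasure_Diff) (auto simp: P_def)
      moreover have "emeasure M (A k) - emeasure M (A (Suc k)) \<noteq> 0"
      proof
        assume "emeasure M (A k) - emeasure M (A (Suc k)) = 0"
        then have "emeasure M (A k) \<le> emeasure M (A (Suc k))"
          using A(1)[of k] by (auto simp: P_def ennreal_minus_eq_0)
        then show False using A(3)[of k] by simp
      qed
      ultimately show ?thesis by simp
    qed
  qed
qed

lemma equiv_null_eq: "equiv (sets M) (null_eq M)"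
proof (rule equivI)
  show "null_eq M \<subseteq> sets M \<times> sets M" by (auto simp: null_eq_def)
  show "refl_on (sets M) (null_eq M)" by (auto simp: refl_on_def null_eq_def)
  show "sym (null_eq M)" by (auto simp: sym_def null_eq_def Un_commute)
  show "trans (null_eq M)"
  proof (rule transI)
    fix A B C assume "(A, B) \<in> null_eq M" "(B, C) \<in> null_eq M"
    then have *: "A \<in> sets M" "C \<in> sets M" "sym_diff A B \<union> sym_diff B C \<in> null_sets M"
      by (auto simp: null_eq_def)
    have "sym_diff A C \<in> null_sets M"
      by (rule null_sets_subset[OF *(3)]) (use *(1,2) in auto)
    then show "(A, C) \<in> null_eq M" using * by (simp add: null_eq_def)
  qed
qed

text \<open>
  Atoms of different classes intersect in null sets, because a non-null part of an atom is all of it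
  up to a null set. Hence making the atoms disjoint removes only null sets.
\<close>

lemma infinitely_many_atoms_imp_contains_L1:
  assumes inf: "\<not> finitely_many_atoms M \<Omega>i"
  shows "contains_isometric_copy X L1_01"
proof -
  let ?Q = "{A. is_atom M A \<and> A \<subseteq> \<Omega>i} // null_eq M"
  obtain f :: "nat \<Rightarrow> 'a set set" where f: "inj f" "range f \<subseteq> ?Q"
    using inf infinite_countable_subset[of ?Q] by (auto simp: finitely_many_atoms_def)
  have "\<forall>n. \<exists>A. is_atom M A \<and> A \<subseteq> \<Omega>i \<and> f n = null_eq M `` {A}"
  proof
    fix n
    have "f n \<in> ?Q" using f(2) by auto
    then show "\<exists>A. is_atom M A \<and> A \<subseteq> \<Omega>i \<and> f n = null_eq M `` {A}" by (auto simp: quotient_def)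
  qed
  then obtain A where A: "\<And>n. is_atom M (A n)" "\<And>n. A n \<subseteq> \<Omega>i" "\<And>n. f n = null_eq M `` {A n}" by metis
  have A_sets [measurable]: "A n \<in> sets M" for n using A(1) by (simp add: is_atom_def)
  have null: "A i \<inter> A n \<in> null_sets M" if "i \<noteq> n" for i n
  proof (rule ccontr)
    assume "A i \<inter> A n \<notin> null_sets M"
    then have pos: "emeasure M (A i \<inter> A n) \<noteq> 0" by (auto simp: null_sets_def)
    have full: "A k - A i \<inter> A n \<in> null_sets M" if "A i \<inter> A n \<subseteq> A k" for k
    proof -
      have eq: "emeasure M (A i \<inter> A n) = emeasure M (A k)"
        using A(1)[of k] pos that unfolding is_atom_def by (metis A_sets sets.Int)
      have "emeasure M (A k - A i \<inter> A n) = emeasure M (A k) - emeasure M (A i \<inter> A n)"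
        using atom_finite[OF A(1)[of k]] eq that by (intro emeasure_Diff) auto
      then show ?thesis using eq atom_finite[OF A(1)[of k]] by (auto simp: null_sets_def ennreal_minus_eq_0)
    qed
    have "sym_diff (A i) (A n) = (A i - A i \<inter> A n) \<union> (A n - A i \<inter> A n)" by blast
    then have "sym_diff (A i) (A n) \<in> null_sets M" using full[of i] full[of n] by auto
    then have "(A i, A n) \<in> null_eq M" by (simp add: null_eq_def)
    then have "f i = f n" unfolding A(3) by (rule equiv_class_eq[OF equiv_null_eq])
    then show False using f(1) that by (simp add: inj_eq)
  qed
  show ?thesis
  proof (rule disjoint_nonnull_imp_contains_L1[of "disjointed A"])
    show "disjointed A k \<in> sets M" for k using sets.range_disjointed_sets[of A M] A_sets by blast
    show "disjoint_family (disjointed A)" by (rule disjoint_family_disjointed)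
    show "disjointed A k \<subseteq> \<Omega>i" for k using disjointed_subset[of A k] A(2)[of k] by blast
    show "emeasure M (disjointed A k) \<noteq> 0" for k
    proof -
      have "(\<Union>i\<in>{0..<k}. A i \<inter> A k) \<in> null_sets M"
        by (rule null_sets_UN') (auto intro: null)
      moreover have "disjointed A k = A k - (\<Union>i\<in>{0..<k}. A i \<inter> A k)" by (auto simp: disjointed_def)
      ultimately have "emeasure M (disjointed A k) = emeasure M (A k)"
        by (simp add: emeasure_Diff_null_set)
      then show ?thesis using A(1)[of k] by (auto simp: is_atom_def)
    qed
  qed
qed

theorem not_contains_L1_imp_atomic:
  assumes no: "\<not> contains_isometric_copy X L1_01"
  shows "esssup_on M \<Omega>f p < \<infinity>" "finitely_many_atoms M \<Omega>i"
    and "E \<subseteq> {t \<in> space M. p t = 1 \<or> p t = \<infinity>} \<Longrightarrow> atomless M E \<Longrightarrow> E \<in> null_sets M"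
proof -
  show "esssup_on M \<Omega>f p < \<infinity>" using no unbounded_exponent_imp_contains_L1 by blast
  show "finitely_many_atoms M \<Omega>i" using no infinitely_many_atoms_imp_contains_L1 by blast
  assume sub: "E \<subseteq> {t \<in> space M. p t = 1 \<or> p t = \<infinity>}" and E: "atomless M E"
  have E_sets: "E \<in> sets M" using E by (simp add: atomless_def)
  have "atomless M (E \<inter> \<Omega>1)" "atomless M (E \<inter> \<Omega>i)"
    by (rule atomless_subset[OF E]; use E_sets in auto)+
  then have "emeasure M (E \<inter> \<Omega>1) = 0" "emeasure M (E \<inter> \<Omega>i) = 0"
    using no atomless_at_one_imp_contains_L1[of "E \<inter> \<Omega>1"] atomless_at_infinity_imp_contains_L1[of "E \<inter> \<Omega>i"]
    by auto
  then have "(E \<inter> \<Omega>1) \<union> (E \<inter> \<Omega>i) \<in> null_sets M"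
    using E_sets by (intro null_sets.Un) (auto simp: null_sets_def)
  moreover have "E = (E \<inter> \<Omega>1) \<union> (E \<inter> \<Omega>i)" using sub by (auto simp: \<Omega>1_def infinite_part_def)
  ultimately show "E \<in> null_sets M" by simp
qed

end

section \<open>Equivalence of the four conditions\<close>

theorem theorem3p3:
  fixes M :: "'a measure" and p :: "'a \<Rightarrow> ennreal"
  assumes "complete_measure M" and "sigma_finite_measure M"
    and "p \<in> borel_measurable M" and "\<And>t. t \<in> space M \<Longrightarrow> 1 \<le> p t"
  shows "(weak_normal_structure (var_Lp M p) \<longleftrightarrow> weak_FPP (var_Lp M p)) \<and>
    (weak_FPP (var_Lp M p) \<longleftrightarrow> \<not> contains_isometric_copy (var_Lp M p) L1_01) \<and>
    (\<not> contains_isometric_copy (var_Lp M p) L1_01 \<longleftrightarrow>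
      esssup_on M (finite_part M p) p < \<infinity> \<and>
      finitely_many_atoms M (infinite_part M p) \<and>
      (\<forall>E. E \<subseteq> {t \<in> space M. p t = 1 \<or> p t = \<infinity>} \<and> atomless M E \<longrightarrow> E \<in> null_sets M))"
proof -
  interpret variable_exponent M p
    using assms by (simp add: variable_exponent_def variable_exponent_axioms_def)
  have "weak_normal_structure X \<Longrightarrow> weak_FPP X"
    by (rule weak_normal_structure_imp_weak_FPP)
  moreover have "weak_FPP X \<Longrightarrow> \<not> contains_isometric_copy X L1_01"
    using contains_L1_imp_not_weak_FPP by blast
  moreover have "\<not> contains_isometric_copy X L1_01 \<Longrightarrow> esssup_on M \<Omega>f p < \<infinity> \<and>
      finitely_many_atoms M \<Omega>i \<and>
      (\<forall>E. E \<subseteq> {t \<in> space M. p t = 1 \<or> p t = \<infinity>} \<and> atomless M E \<longrightarrow> E \<in> null_sets M)"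
    using not_contains_L1_imp_atomic by blast
  moreover have "esssup_on M \<Omega>f p < \<infinity> \<and> finitely_many_atoms M \<Omega>i \<and>
      (\<forall>E. E \<subseteq> {t \<in> space M. p t = 1 \<or> p t = \<infinity>} \<and> atomless M E \<longrightarrow> E \<in> null_sets M) \<Longrightarrow>
      weak_normal_structure X"
    by (rule weak_normal_structure_if_atomic) blast+
  ultimately show ?thesis unfolding var_Lp_eq by blast
qed

end
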